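(* Let $(a_n)_{n\ge1}$ satisfy $a_n\to\infty$ and $a_n-\log n-(k-1)\log\log n\to-\infty$ as $n\to\infty$, and let $b_n=na_n^{k-1}e^{-a_n}$. Then the sequence $(T_{k,n}/b_n)_{n\ge1}$ satisfies a large deviation principle on $\mathbb{R}$ with rate $b_n$ and rate function $$I_k(x)=\begin{cases}x\log(x/\alpha_k)-x+\alpha_k & \text{if }x\ge0,\\ \infty & \text{if }x<0,\end{cases}\qquad \alpha_k=\frac{e^{-s_0}}{(k-1)!}.$$ Furthermore, $(T^{\mathsf{B}}_{k,n}/b_n)_{n\ge1}$ satisfies the same large deviation principle (same rate $b_n$ and same rate function $I_k$).
   Context: Fix integers $d\ge1$, $k\ge1$ and a real number $s_0$. The unit cube $[0,1]^d$ is equipped with the toroidal metric $\mathsf{dist}(x,y)=\min_{z\in\mathbb{Z}^d}\|x-y+z\|$ ($\|\cdot\|$ Euclidean); $B_r(x)=\{y\in[0,1]^d:\mathsf{dist}(x,y)\le r\}$. $\theta_d$ is the volume of the unit ball of $\mathbb{R}^d$. $\mathcal{P}_n$ is a homogeneous Poisson point process on $[0,1]^d$ with intensity $n$; $\mathcal{B}_n=\{X_1,\dots,X_n\}$ is a binomial point process, with $X_1,X_2,\dots$ i.i.d. uniform on $[0,1]^d$. For a point process $\omega$, $\omega(A)$ denotes the number of its points in $A$. Put $$r_n(s_0)=\Big(\frac{a_n+s_0}{n\theta_d}\Big)^{1/d}$$ (well defined for all large $n$), and $$T_{k,n}=\sum_{X\in\mathcal{P}_n}\mathbf{1}\{\mathcal{P}_n(B_{r_n(s_0)}(X))\le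 k\},\qquad T^{\mathsf{B}}_{k,n}=\sum_{X\in\mathcal{B}_n}\mathbf{1}\{\mathcal{B}_n(B_{r_n(s_0)}(X))\le k\}.$$ The convention $0\log0=0$ is used. A sequence of random elements $(Y_n)$ of a topological space satisfies an LDP with rate $b_n\to\infty$ and rate function $I$ (lower semicontinuous, values in $[0,\infty]$) if for every Borel set $A$: $-\inf_{\mathrm{int}A}I\le\liminf_n b_n^{-1}\log\mathbb{P}(Y_n\in A)\le\limsup_n b_n^{-1}\log\mathbb{P}(Y_n\in A)\le-\inf_{\overline{A}}I$. *)

theory Defs
  imports "HOL-Probability.Probability"
begin

section \<open>The unit cube with the toroidal metric\<close>

definition unit_cube :: "(real ^ 'd) set" where
  "unit_cube = {x. \<forall>i. 0 \<le> x $ i \<and> x $ i \<le> 1}"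

definition torus_dist :: "real ^ 'd \<Rightarrow> real ^ 'd \<Rightarrow> real" where
  "torus_dist x y = (INF z\<in>{z. \<forall>i. z $ i \<in> \<int>}. norm (x - y + z))"

definition torus_ball :: "real \<Rightarrow> real ^ 'd \<Rightarrow> (real ^ 'd) set" where
  "torus_ball r x = {y \<in> unit_cube. torus_dist x y \<le> r}"


section \<open>Finite point processes\<close>

text \<open>
  Finite point configurations are finite multisets, so that points are counted with their
  multiplicity; \<open>num_points\<close> is the number \<open>\<omega>(A)\<close> of points of a configuration in a set.
\<close>

definition num_points :: "'p multiset \<Rightarrow> 'p set \<Rightarrow> nat" where
  "num_points N A = size {#x \<in># N. x \<in> A#}"

text \<open>
  The distribution of the counts is given by the explicit Poisson weights, because
  \<open>poisson_pmf\<close> requires a strictly positive parameter, whereas null sets have parameter \<open>0\<close>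
  (the formula then yields the point mass at \<open>0\<close>, as \<open>0 ^ 0 = 1\<close>).
\<close>

definition poisson_process :: "'w measure \<Rightarrow> real \<Rightarrow> ('w \<Rightarrow> (real ^ 'd) multiset) \<Rightarrow> bool" where
  "poisson_process M \<rho> N \<longleftrightarrow>
     (\<forall>\<omega>\<in>space M. set_mset (N \<omega>) \<subseteq> unit_cube) \<and>
     (\<forall>A\<in>sets borel. A \<subseteq> unit_cube \<longrightarrow>
        (\<lambda>\<omega>. num_points (N \<omega>) A) \<in> M \<rightarrow>\<^sub>M count_space UNIV \<and>
        (\<forall>m. measure M {\<omega>\<in>space M. num_points (N \<omega>) A = m} =
             (\<rho> * measure lborel A) ^ m / fact m * exp (- (\<rho> * measure lborel A)))) \<and>
     (\<forall>m (A :: nat \<Rightarrow> (real ^ 'd) set).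
        (\<forall>i<m. A i \<in> sets borel \<and> A i \<subseteq> unit_cube) \<longrightarrow> disjoint_family_on A {..<m} \<longrightarrow>
        prob_space.indep_vars M (\<lambda>_. count_space UNIV)
          (\<lambda>i \<omega>. num_points (N \<omega>) (A i)) {..<m})"

definition iid_uniform :: "'w measure \<Rightarrow> (nat \<Rightarrow> 'w \<Rightarrow> real ^ 'd) \<Rightarrow> bool" where
  "iid_uniform M X \<longleftrightarrow>
     prob_space.indep_vars M (\<lambda>_. borel) X {1..} \<and>
     (\<forall>i\<ge>1. distr M borel (X i) = uniform_measure lborel unit_cube)"

definition binomial_process :: "(nat \<Rightarrow> 'w \<Rightarrow> real ^ 'd) \<Rightarrow> nat \<Rightarrow> 'w \<Rightarrow> (real ^ 'd) multiset" where
  "binomial_process X n \<omega> = image_mset (\<lambda>i. X i \<omega>) (mset_set {1..n})"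


section \<open>Counting points with few neighbours\<close>

definition crit_radius :: "'d::finite itself \<Rightarrow> (nat \<Rightarrow> real) \<Rightarrow> real \<Rightarrow> nat \<Rightarrow> real" where
  "crit_radius _ a s\<^sub>0 n =
     ((a n + s\<^sub>0) / (real n * measure lborel (ball (0 :: real ^ 'd) 1))) powr (1 / real CARD('d))"

text \<open>A point of the configuration is itself counted among the points of the ball around it.\<close>

definition T_stat :: "nat \<Rightarrow> real \<Rightarrow> (real ^ 'd) multiset \<Rightarrow> real" where
  "T_stat k r N = (\<Sum>x\<in>#N. of_bool (num_points N (torus_ball r x) \<le> k))"


section \<open>Large deviation principles\<close>

definition log_ereal :: "real \<Rightarrow> ereal" where
  "log_ereal p = (if p = 0 then - \<infinity> else ereal (ln p))"

definition lower_semicont :: "('a :: topological_space \<Rightarrow> ereal) \<Rightarrow> bool" where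
  "lower_semicont I \<longleftrightarrow> (\<forall>c. closed {x. I x \<le> c})"

text \<open>Sequences of random elements are indexed by \<open>n \<ge> 1\<close>; the index \<open>0\<close> is ignored.\<close>

definition satisfies_LDP ::
  "'w measure \<Rightarrow> (nat \<Rightarrow> 'w \<Rightarrow> 'a :: topological_space) \<Rightarrow> (nat \<Rightarrow> real) \<Rightarrow> ('a \<Rightarrow> ereal) \<Rightarrow> bool"
where
  "satisfies_LDP M Y b I \<longleftrightarrow>
     (\<forall>n\<ge>1. Y n \<in> borel_measurable M) \<and>
     filterlim b at_top sequentially \<and>
     lower_semicont I \<and> (\<forall>x. 0 \<le> I x) \<and>
     (\<forall>A\<in>sets borel.
        - (INF x\<in>interior A. I x) \<le>
          liminf (\<lambda>n. ereal (1 / b n) * log_ereal (measure M {\<omega>\<in>space M. Y n \<omega> \<in> A})) \<and>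
        limsup (\<lambda>n. ereal (1 / b n) * log_ereal (measure M {\<omega>\<in>space M. Y n \<omega> \<in> A})) \<le>
          - (INF x\<in>closure A. I x))"

definition alpha :: "nat \<Rightarrow> real \<Rightarrow> real" where
  "alpha k s\<^sub>0 = exp (- s\<^sub>0) / fact (k - 1)"

text \<open>At \<open>x = 0\<close> the convention \<open>0 log 0 = 0\<close> is automatic, as the factor \<open>x\<close> vanishes.\<close>

definition rate_fun :: "nat \<Rightarrow> real \<Rightarrow> real \<Rightarrow> ereal" where
  "rate_fun k s\<^sub>0 x =
     (if 0 \<le> x then ereal (x * ln (x / alpha k s\<^sub>0) - x + alpha k s\<^sub>0) else \<infinity>)"

end

theory Submission
  imports Defs "HOL-Real_Asymp.Real_Asymp"
begin

text \<open>
  Call a point isolated if the ball around it contains at most \<open>k\<close> points. At the critical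
  radius isolated points are rare and almost independent, so that their number behaves like
  a Poisson variable of mean \<open>\<alpha> * b n\<close>; the rate function is the one of a Poisson
  law. Precisely, \<open>ln (E (exp (t * T n))) / b n\<close> tends to \<open>\<alpha> * (exp t - 1)\<close> for every
  real \<open>t\<close> (\<open>poisson_log_mgf\<close>, \<open>binomial_log_mgf\<close>), and the large deviation principle
  follows from this by the argument of Gaertner and Ellis: Chernoff's inequality for the
  upper bound, exponential tilting for the lower bound (locale \<open>mgf_limit\<close>).

  For the Poisson process the torus is cut into cells of diameter \<open>\<delta>\<close>, and balls are
  replaced by unions of cells. The statistic becomes a function of independent Poisson
  counts. The cells are grouped into classes of diameter comparable to \<open>r\<close>; a class holds at
  most \<open>k\<close> isolated points, and the contributions of two classes are independent unless the
  classes are adjacent. A class has at most \<open>17 ^ d\<close> adjacent ones. The expectation of a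
  product of such locally dependent factors can be expanded by inserting one factor at a
  time (\<open>local_product.log_estimate\<close>): its logarithm is the sum of the expectations of the
  factors minus one, up to the correlations of adjacent factors. The Palm formula gives the
  first-order term, \<open>\<rho> * PL k (\<rho> * vol)\<close>, and shows that pairs of isolated points
  in adjacent classes are negligible (\<open>E_pr_sum_le\<close>): two such points are either within
  distance \<open>\<epsilon> * r\<close>, which costs a factor of order \<open>\<epsilon> ^ d\<close>, or the second
  ball sticks out of the first by a fixed share of its volume, which has to be almost empty
  as well. The bounds do not depend on \<open>\<delta>\<close>, which tends to zero first.

  The binomial process is compared with a Poisson process of intensity slightly below \<open>n\<close>.
  Given its number \<open>j\<close> of points, the Poisson process is a sample of size \<open>j\<close>, and it is
  coupled with the binomial process as its first \<open>j\<close> points. The remaining points change the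
  statistic by a sum of local terms whose exponential moment is close to one on the scale
  considered. Young's inequality with an exponent \<open>\<theta> < 1\<close> separates this error from
  the main term; finally \<open>\<theta>\<close> tends to one.
\<close>

section \<open>Poisson counts and the Palm formula\<close>

abbreviation E :: "'a pmf \<Rightarrow> ('a \<Rightarrow> real) \<Rightarrow> real" where
  "E p f \<equiv> measure_pmf.expectation p f"

lemma integrable_bounded_pmf:
  fixes f :: "'a \<Rightarrow> real"
  assumes "\<And>x. \<bar>f x\<bar> \<le> B"
  shows "integrable (measure_pmf p) f"
  by (rule measure_pmf.integrable_const_bound[where B=B]) (use assms in auto)

lemma E_mono_bounded:
  assumes "\<And>x. \<bar>f x\<bar> \<le> B" "\<And>x. \<bar>g x\<bar> \<le> B'" "\<And>x. f x \<le> g x"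
  shows "E p f \<le> E p g"
  using assms by (intro integral_mono integrable_bounded_pmf) auto

lemma E_bind_pmf:
  fixes f :: "'a \<Rightarrow> real"
  assumes "\<And>x. \<bar>f x\<bar> \<le> B"
  shows "E (bind_pmf p q) f = E p (\<lambda>x. E (q x) f)"
proof -
  define g where "g = (\<lambda>x. f x + B)"
  have g0: "0 \<le> g x" "\<bar>g x\<bar> \<le> 2 * B" for x using assms[of x] by (auto simp: g_def abs_if split: if_splits)
  have ig: "integrable (measure_pmf r) g" for r by (rule integrable_bounded_pmf) (rule g0)
  have e: "ennreal (E r g) = (\<integral>\<^sup>+x. ennreal (g x) \<partial>measure_pmf r)" for r
    by (rule nn_integral_eq_integral[symmetric]) (auto simp: g0 ig)
  have bq: "\<bar>E r g\<bar> \<le> 2 * B" for r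
  proof -
    have "E r g \<le> 2 * B"
      by (rule measure_pmf.integral_le_const[OF ig]) (use g0 in \<open>auto intro: abs_le_D1\<close>)
    moreover have "0 \<le> E r g" by (rule integral_nonneg_AE) (simp add: g0)
    ultimately show ?thesis by simp
  qed
  have "ennreal (E (bind_pmf p q) g) = (\<integral>\<^sup>+x. ennreal (E (q x) g) \<partial>measure_pmf p)"
    by (simp only: e nn_integral_bind_pmf)
  also have "\<dots> = ennreal (E p (\<lambda>x. E (q x) g))"
    by (intro nn_integral_eq_integral integrable_bounded_pmf[OF bq]) (auto intro!: integral_nonneg_AE simp: g0)
  finally have "E (bind_pmf p q) g = E p (\<lambda>x. E (q x) g)"
    by (subst (asm) ennreal_inj) (auto intro!: integral_nonneg_AE simp: g0)
  moreover have if': "integrable (measure_pmf r) f" for r by (rule integrable_bounded_pmf) (rule assms)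
  have "E r g = E r f + B" for r unfolding g_def by (subst Bochner_Integration.integral_add) (auto simp: if')
  moreover have "integrable (measure_pmf p) (\<lambda>x. E (q x) f)"
  proof -
    have "E (q x) f = E (q x) g - B" for x using \<open>\<And>r. E r g = E r f + B\<close>[of "q x"] by simp
    then show ?thesis using integrable_bounded_pmf[OF bq, of p] by simp
  qed
  ultimately show ?thesis by simp
qed

text \<open>
  Cells of measure zero have parameter zero, which \<open>poisson_pmf\<close> excludes.
\<close>

definition pois :: "real \<Rightarrow> nat pmf" where
  "pois \<mu> = (if \<mu> > 0 then poisson_pmf \<mu> else return_pmf 0)"

lemma pmf_pois: "0 \<le> \<mu> \<Longrightarrow> pmf (pois \<mu>) n = \<mu> ^ n / fact n * exp (- \<mu>)"
  by (cases "\<mu> = 0") (auto simp: pois_def power_0_left)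

lemma pois_add:
  assumes "0 \<le> a" "0 \<le> b"
  shows "map_pmf (\<lambda>(x, y). x + y) (pair_pmf (pois a) (pois b)) = pois (a + b)"
proof (rule pmf_eqI)
  fix n :: nat
  have vim: "(\<lambda>(x, y). x + y) -` {n} = (\<lambda>i. (i, n - i)) ` {..n}"
  proof (intro set_eqI iffI)
    fix z :: "nat \<times> nat" assume "z \<in> (\<lambda>(x, y). x + y) -` {n}"
    then have "z = (fst z, n - fst z)" "fst z \<le> n" by (cases z; simp)+
    then show "z \<in> (\<lambda>i. (i, n - i)) ` {..n}" by blast
  qed auto
  have "pmf (map_pmf (\<lambda>(x, y). x + y) (pair_pmf (pois a) (pois b))) n =
      (\<Sum>z\<in>(\<lambda>i. (i, n - i)) ` {..n}. pmf (pair_pmf (pois a) (pois b)) z)"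
    by (simp add: pmf_map vim measure_measure_pmf_finite)
  also have "\<dots> = (\<Sum>i\<le>n. a ^ i / fact i * exp (- a) * (b ^ (n - i) / fact (n - i) * exp (- b)))"
    by (subst sum.reindex) (auto simp: inj_on_def pmf_pair pmf_pois assms)
  also have "\<dots> = (\<Sum>i\<le>n. of_nat (n choose i) * a ^ i * b ^ (n - i)) / fact n * exp (- (a + b))"
    unfolding sum_divide_distrib sum_distrib_right
  proof (intro sum.cong refl)
    fix i assume "i \<in> {..n}"
    then have c: "of_nat (n choose i) = (fact n / (fact i * fact (n - i)) :: real)"
      by (simp add: binomial_fact)
    have e: "exp (- (a + b)) = exp (- a) * exp (- b)" by (simp add: mult_exp_exp)
    show "a ^ i / fact i * exp (- a) * (b ^ (n - i) / fact (n - i) * exp (- b)) =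
        of_nat (n choose i) * a ^ i * b ^ (n - i) / fact n * exp (- (a + b))"
      unfolding c e by simp
  qed
  also have "\<dots> = pmf (pois (a + b)) n"
    using assms by (simp add: pmf_pois binomial_ring)
  finally show "pmf (map_pmf (\<lambda>(x, y). x + y) (pair_pmf (pois a) (pois b))) n = pmf (pois (a + b)) n" .
qed

lemma palm_pois:
  assumes "0 \<le> \<mu>"
  shows "(\<integral>\<^sup>+n. of_nat n * h n \<partial>pois \<mu>) = ennreal \<mu> * (\<integral>\<^sup>+n. h (Suc n) \<partial>pois \<mu>)"
proof -
  have "(\<integral>\<^sup>+n. of_nat n * h n \<partial>pois \<mu>) = (\<Sum>n. ennreal (pmf (pois \<mu>) n) * (of_nat n * h n))"
    by (simp add: nn_integral_measure_pmf nn_integral_count_space_nat)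
  also have "\<dots> = (\<Sum>n. ennreal (pmf (pois \<mu>) (Suc n)) * (of_nat (Suc n) * h (Suc n)))"
    using suminf_offset[of "\<lambda>n. ennreal (pmf (pois \<mu>) n) * (of_nat n * h n)" 1] by simp
  also have "\<dots> = (\<Sum>n. ennreal \<mu> * (ennreal (pmf (pois \<mu>) n) * h (Suc n)))"
  proof (rule suminf_cong)
    fix n
    have "ennreal (pmf (pois \<mu>) (Suc n)) * of_nat (Suc n) = ennreal (pmf (pois \<mu>) (Suc n) * real (Suc n))"
      by (simp only: ennreal_mult ennreal_of_nat_eq_real_of_nat pmf_nonneg of_nat_0_le_iff)
    also have "pmf (pois \<mu>) (Suc n) * real (Suc n) = \<mu> * pmf (pois \<mu>) n"
      using assms by (simp only: pmf_pois power_Suc fact_Suc) (simp add: divide_simps del: of_nat_Suc)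
    also have "ennreal \<dots> = ennreal \<mu> * ennreal (pmf (pois \<mu>) n)"
      using assms by (simp add: ennreal_mult)
    finally show "ennreal (pmf (pois \<mu>) (Suc n)) * (of_nat (Suc n) * h (Suc n)) =
        ennreal \<mu> * (ennreal (pmf (pois \<mu>) n) * h (Suc n))"
      by (metis mult.assoc)
  qed
  also have "\<dots> = ennreal \<mu> * (\<Sum>n. ennreal (pmf (pois \<mu>) n) * h (Suc n))" by simp
  also have "(\<Sum>n. ennreal (pmf (pois \<mu>) n) * h (Suc n)) = (\<integral>\<^sup>+n. h (Suc n) \<partial>pois \<mu>)"
    by (simp add: nn_integral_measure_pmf nn_integral_count_space_nat)
  finally show ?thesis .
qed

text \<open>
  The shift \<open>n * \<mu> ^ n / fact n = \<mu> * \<mu> ^ (n - 1) / fact (n - 1)\<close> of the Poisson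
  weights, applied to one coordinate of a product law. This is the Palm formula: weighting a
  configuration by its number of points in \<open>q\<close> amounts to adding a point to \<open>q\<close>.
\<close>

lemma palm_Pi_pois:
  assumes "finite Q" "q \<in> Q" "0 \<le> \<mu> q"
  shows "(\<integral>\<^sup>+N. of_nat (N q) * h N \<partial>Pi_pmf Q 0 (\<lambda>q. pois (\<mu> q))) =
    ennreal (\<mu> q) * (\<integral>\<^sup>+N. h (N(q := Suc (N q))) \<partial>Pi_pmf Q 0 (\<lambda>q. pois (\<mu> q)))"
proof -
  define R where "R = Q - {q}"
  have Q: "Q = insert q R" "finite R" "q \<notin> R" using assms by (auto simp: R_def)
  have ins: "Pi_pmf (insert q R) 0 (\<lambda>q. pois (\<mu> q)) =
      bind_pmf (Pi_pmf R 0 (\<lambda>q. pois (\<mu> q))) (\<lambda>f. bind_pmf (pois (\<mu> q)) (\<lambda>y. return_pmf (f(q := y))))"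
    by (subst Pi_pmf_insert'[OF Q(2,3)], subst bind_commute_pmf) (rule refl)
  show ?thesis unfolding Q(1) ins
    by (simp add: palm_pois[OF assms(3)] nn_integral_cmult)
qed

text \<open>
  A substitute for measurability with respect to the coordinates in \<open>A\<close>, suited to product
  laws on functions.
\<close>

definition depends_on :: "(('q \<Rightarrow> nat) \<Rightarrow> 'b) \<Rightarrow> 'q set \<Rightarrow> bool" where
  "depends_on f A \<longleftrightarrow> (\<forall>N N'. (\<forall>x\<in>A. N x = N' x) \<longrightarrow> f N = f N')"

lemma depends_onD: "depends_on f A \<Longrightarrow> (\<And>x. x \<in> A \<Longrightarrow> N x = N' x) \<Longrightarrow> f N = f N'"
  by (auto simp: depends_on_def)

lemma E_Pi_indep:
  fixes f g :: "('q \<Rightarrow> nat) \<Rightarrow> real"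
  assumes fin: "finite Q" and f: "depends_on f A" and g: "depends_on g B" and AB: "A \<inter> B = {}"
    and bf: "\<And>N. \<bar>f N\<bar> \<le> Bf" and bg: "\<And>N. \<bar>g N\<bar> \<le> Bg"
  shows "E (Pi_pmf Q 0 p) (\<lambda>N. f N * g N) = E (Pi_pmf Q 0 p) f * E (Pi_pmf Q 0 p) g"
proof -
  define m where "m = (\<lambda>(N :: 'q \<Rightarrow> nat) N' x. if x \<in> Q \<inter> A then N x else N' x)"
  let ?P = "Pi_pmf (Q \<inter> A) 0 p" and ?R = "Pi_pmf (Q - A) 0 p"
  have split: "Pi_pmf Q 0 p = bind_pmf ?P (\<lambda>N. bind_pmf ?R (\<lambda>N'. return_pmf (m N N')))"
  proof -
    have "Pi_pmf ((Q \<inter> A) \<union> (Q - A)) 0 p =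
        map_pmf (\<lambda>(f, g) x. if x \<in> Q \<inter> A then f x else g x) (pair_pmf ?P ?R)"
      using fin by (intro Pi_pmf_union) auto
    moreover have "(Q \<inter> A) \<union> (Q - A) = Q" by auto
    ultimately show ?thesis
      by (simp add: pair_pmf_def map_bind_pmf m_def)
  qed
  have f': "f (m N N') = f (m N (\<lambda>_. 0))" if "N' \<in> set_pmf ?R" for N N'
  proof (rule depends_onD[OF f])
    fix x assume "x \<in> A"
    have "N' x = 0" if "x \<notin> Q"
      using set_Pi_pmf_subset[of "Q - A" 0 p] \<open>N' \<in> set_pmf ?R\<close> fin that by auto
    then show "m N N' x = m N (\<lambda>_. 0) x" using \<open>x \<in> A\<close> by (auto simp: m_def)
  qed
  have g': "g (m N N') = g N'" for N N'
    using AB by (intro depends_onD[OF g]) (auto simp: m_def)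
  have E1: "E (Pi_pmf Q 0 p) h = E ?P (\<lambda>N. E ?R (\<lambda>N'. h (m N N')))" if "\<And>N. \<bar>h N\<bar> \<le> B" for h B
    unfolding split by (simp add: E_bind_pmf[OF that])
  have Ef: "E (Pi_pmf Q 0 p) f = E ?P (\<lambda>N. f (m N (\<lambda>_. 0)))"
  proof (subst E1[OF bf], intro Bochner_Integration.integral_cong refl)
    fix N
    have "E ?R (\<lambda>N'. f (m N N')) = E ?R (\<lambda>N'. f (m N (\<lambda>_. 0)))"
      by (intro integral_cong_AE) (auto simp: AE_measure_pmf_iff f')
    then show "E ?R (\<lambda>N'. f (m N N')) = f (m N (\<lambda>_. 0))" by simp
  qed
  have Eg: "E (Pi_pmf Q 0 p) g = E ?R g"
    by (subst E1[OF bg]) (simp add: g')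
  have "\<bar>f N * g N\<bar> \<le> Bf * Bg" for N
    unfolding abs_mult using bf[of N] bg[of N] by (intro mult_mono) auto
  then have "E (Pi_pmf Q 0 p) (\<lambda>N. f N * g N) = E ?P (\<lambda>N. E ?R (\<lambda>N'. f (m N N') * g N'))"
    by (subst E1) (auto simp: g')
  also have "\<dots> = E ?P (\<lambda>N. f (m N (\<lambda>_. 0)) * E ?R g)"
  proof (intro Bochner_Integration.integral_cong refl)
    fix N
    have "E ?R (\<lambda>N'. f (m N N') * g N') = E ?R (\<lambda>N'. f (m N (\<lambda>_. 0)) * g N')"
      by (intro integral_cong_AE) (auto simp: AE_measure_pmf_iff f')
    then show "E ?R (\<lambda>N'. f (m N N') * g N') = f (m N (\<lambda>_. 0)) * E ?R g" by simp
  qed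
  also have "\<dots> = E (Pi_pmf Q 0 p) f * E (Pi_pmf Q 0 p) g" by (simp add: Ef Eg)
  finally show ?thesis .
qed

lemma Pi_pois_sum:
  assumes "finite Q" "U \<subseteq> Q" "\<And>q. q \<in> Q \<Longrightarrow> 0 \<le> \<mu> q"
  shows "map_pmf (\<lambda>N. \<Sum>q\<in>U. N q) (Pi_pmf Q 0 (\<lambda>q. pois (\<mu> q))) = pois (\<Sum>q\<in>U. \<mu> q)"
proof -
  have finU: "finite U" using assms finite_subset by auto
  have "map_pmf (\<lambda>N. \<Sum>q\<in>U. N q) (Pi_pmf U 0 (\<lambda>q. pois (\<mu> q))) = pois (\<Sum>q\<in>U. \<mu> q)"
    using finU assms(2)
  proof (induction U)
    case empty
    then show ?case by (simp add: pois_def)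
  next
    case (insert x U)
    have "map_pmf (\<lambda>N. \<Sum>q\<in>insert x U. N q) (Pi_pmf (insert x U) 0 (\<lambda>q. pois (\<mu> q))) =
       map_pmf (\<lambda>(y, f). y + (\<Sum>q\<in>U. f q)) (pair_pmf (pois (\<mu> x)) (Pi_pmf U 0 (\<lambda>q. pois (\<mu> q))))"
      using insert by (simp add: Pi_pmf_insert pmf.map_comp o_def case_prod_unfold)
        (intro map_pmf_cong refl arg_cong2[where f="(+)"] sum.cong, auto)
    also have "\<dots> = map_pmf (\<lambda>(y, z). y + z) (pair_pmf (pois (\<mu> x))
        (map_pmf (\<lambda>f. \<Sum>q\<in>U. f q) (Pi_pmf U 0 (\<lambda>q. pois (\<mu> q)))))"
      by (simp add: pair_map_pmf2 pmf.map_comp o_def case_prod_unfold)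
    also have "\<dots> = pois (\<mu> x + (\<Sum>q\<in>U. \<mu> q))"
      using insert assms by (simp add: pois_add sum_nonneg subset_eq)
    finally show ?case using insert by simp
  qed
  moreover have "Pi_pmf U 0 (\<lambda>q. pois (\<mu> q)) =
      map_pmf (\<lambda>f x. if x \<in> U then f x else 0) (Pi_pmf Q 0 (\<lambda>q. pois (\<mu> q)))"
    by (intro Pi_pmf_subset assms)
  ultimately show ?thesis
    by (simp add: pmf.map_comp o_def)
qed

section \<open>Products of locally dependent factors\<close>

lemma abs_E_le:
  fixes f g :: "'a \<Rightarrow> real"
  assumes "integrable (measure_pmf p) f" "integrable (measure_pmf p) g" "\<And>x. \<bar>f x\<bar> \<le> g x"
  shows "\<bar>E p f\<bar> \<le> E p g"
proof -
  have "\<bar>E p f\<bar> \<le> E p (\<lambda>x. \<bar>f x\<bar>)" by (rule integral_abs_bound)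
  also have "\<dots> \<le> E p g" by (intro integral_mono integrable_abs assms)
  finally show ?thesis .
qed

lemma abs_prod_minus_one_le:
  fixes v :: "'i \<Rightarrow> real"
  assumes "finite S" "1 \<le> C" "\<And>i. i \<in> S \<Longrightarrow> 0 \<le> v i" "\<And>i. i \<in> S \<Longrightarrow> v i \<le> C"
  shows "\<bar>(\<Prod>i\<in>S. v i) - 1\<bar> \<le> C ^ card S * (\<Sum>i\<in>S. \<bar>v i - 1\<bar>)"
  using assms(1,3,4)
proof (induction S)
  case (insert x S)
  let ?P = "\<Prod>i\<in>S. v i" and ?s = "\<Sum>i\<in>S. \<bar>v i - 1\<bar>"
  have IH: "\<bar>?P - 1\<bar> \<le> C ^ card S * ?s" using insert by auto
  have C1: "1 \<le> C ^ card S" using assms(2) by (rule one_le_power)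
  have s0: "0 \<le> ?s" by (simp add: sum_nonneg)
  have "\<bar>v x * ?P - 1\<bar> \<le> \<bar>v x * (?P - 1)\<bar> + \<bar>v x - 1\<bar>"
    using abs_triangle_ineq[of "v x * (?P - 1)" "v x - 1"] by (simp add: algebra_simps)
  also have "\<bar>v x * (?P - 1)\<bar> \<le> C * (C ^ card S * ?s)"
    unfolding abs_mult using insert.prems IH assms(2) by (intro mult_mono) auto
  also have "C * (C ^ card S * ?s) + \<bar>v x - 1\<bar> \<le> C * (C ^ card S * ?s) + C * C ^ card S * \<bar>v x - 1\<bar>"
    using mult_right_mono[of 1 "C * C ^ card S" "\<bar>v x - 1\<bar>"] one_le_power[OF assms(2), of "Suc (card S)"]
    by simp
  finally show ?case using insert.hyps by (simp add: algebra_simps)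
qed simp

lemma prod_le_power:
  fixes v :: "'i \<Rightarrow> real"
  assumes "finite S" "1 \<le> C" "card S \<le> m" "\<And>i. i \<in> S \<Longrightarrow> 0 \<le> v i" "\<And>i. i \<in> S \<Longrightarrow> v i \<le> C"
  shows "(\<Prod>i\<in>S. v i) \<le> C ^ m"
proof -
  have "(\<Prod>i\<in>S. v i) \<le> (\<Prod>i\<in>S. C)" using assms by (intro prod_mono) auto
  also have "\<dots> = C ^ card S" by simp
  also have "\<dots> \<le> C ^ m" using assms by (intro power_increasing) auto
  finally show ?thesis .
qed

text \<open>
  Factors with a local dependence structure: \<open>\<Gamma> i\<close> collects the factors with which
  the \<open>i\<close>-th one may interact. Independence is required for functions of two factors because
  the second-order terms of the expansion involve pairs of interacting factors.
\<close>

locale local_product =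
  fixes p :: "'x pmf" and J :: "'i set" and v :: "'i \<Rightarrow> 'x \<Rightarrow> real" and \<Gamma> :: "'i \<Rightarrow> 'i set"
    and C :: real and D :: nat
  assumes finJ: "finite J" and C1: "1 \<le> C"
    and v_le: "\<And>i x. i \<in> J \<Longrightarrow> v i x \<le> C"
    and v_ge: "\<And>i x. i \<in> J \<Longrightarrow> 1 / C \<le> v i x"
    and card_\<Gamma>: "\<And>i. i \<in> J \<Longrightarrow> card (J \<inter> \<Gamma> i) \<le> D"
    and self_\<Gamma>: "\<And>i. i \<in> J \<Longrightarrow> i \<in> \<Gamma> i"
    and indep: "\<And>i j S h B. i \<in> J \<Longrightarrow> j \<in> J \<Longrightarrow> S \<subseteq> J \<Longrightarrow> S \<inter> (\<Gamma> i \<union> \<Gamma> j) = {} \<Longrightarrow>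
      (\<And>x. \<bar>h (v i x) (v j x)\<bar> \<le> B) \<Longrightarrow>
      E p (\<lambda>x. h (v i x) (v j x) * (\<Prod>l\<in>S. v l x)) =
      E p (\<lambda>x. h (v i x) (v j x)) * E p (\<lambda>x. \<Prod>l\<in>S. v l x)"
begin

definition w :: "'i \<Rightarrow> 'x \<Rightarrow> real" where "w i x = v i x - 1"

definition F :: "'i set \<Rightarrow> real" where "F S = E p (\<lambda>x. \<Prod>l\<in>S. v l x)"

lemma C0: "0 < C" using C1 by simp

lemma v_pos: "i \<in> J \<Longrightarrow> 0 < v i x"
  using v_ge[of i x] C0 by (meson divide_pos_pos less_le_trans zero_less_one)

lemma w_abs: "i \<in> J \<Longrightarrow> \<bar>w i x\<bar> \<le> C"
  using v_pos[of i x] v_le[of i x] C1 by (simp add: w_def abs_if)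

lemma prod_pos': "S \<subseteq> J \<Longrightarrow> 0 < (\<Prod>l\<in>S. v l x)"
  by (intro prod_pos) (auto intro: v_pos)

lemma prod_bound: "S \<subseteq> J \<Longrightarrow> (\<Prod>l\<in>S. v l x) \<le> C ^ card J"
  using finJ by (intro prod_le_power) (auto intro: finite_subset card_mono v_le less_imp_le v_pos C1)

lemma prod_abs_bound: "S \<subseteq> J \<Longrightarrow> \<bar>\<Prod>l\<in>S. v l x\<bar> \<le> C ^ card J"
  using prod_pos'[of S x] prod_bound[of S x] by simp

lemma integrable_times_prod:
  assumes "S \<subseteq> J" "\<And>x. \<bar>f x\<bar> \<le> B"
  shows "integrable p (\<lambda>x. f x * (\<Prod>l\<in>S. v l x))"
proof (rule integrable_bounded_pmf)
  fix x
  show "\<bar>f x * (\<Prod>l\<in>S. v l x)\<bar> \<le> B * C ^ card J"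
    unfolding abs_mult using assms prod_abs_bound[OF assms(1), of x]
    by (intro mult_mono) (auto intro: order_trans[OF abs_ge_zero])
qed

lemma integrable_prod': "S \<subseteq> J \<Longrightarrow> integrable p (\<lambda>x. \<Prod>l\<in>S. v l x)"
  using integrable_times_prod[of S "\<lambda>_. 1" 1] by simp

lemma prod_subset_le:
  assumes "S' \<subseteq> S" "S \<subseteq> J" "card (S - S') \<le> m"
  shows "(\<Prod>l\<in>S'. v l x) \<le> C ^ m * (\<Prod>l\<in>S. v l x)"
proof -
  have fin: "finite S" using finJ assms finite_subset by auto
  have "(\<Prod>l\<in>S - S'. inverse (v l x)) \<le> C ^ m"
  proof (rule prod_le_power)
    fix i assume "i \<in> S - S'"
    then have "i \<in> J" using assms by auto
    then show "inverse (v i x) \<le> C" "0 \<le> inverse (v i x)"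
      using v_ge[of i x] v_pos[of i x] C0 by (auto simp: field_simps)
  qed (use fin assms C1 in auto)
  then have "inverse (\<Prod>l\<in>S - S'. v l x) \<le> C ^ m"
    using prod_inversef[of "\<lambda>l. v l x" "S - S'"] by (simp add: o_def)
  moreover have "0 < (\<Prod>l\<in>S - S'. v l x)" using prod_pos'[of "S - S'" x] assms by auto
  ultimately have 1: "1 \<le> C ^ m * (\<Prod>l\<in>S - S'. v l x)"
    by (simp add: field_simps)
  have "(\<Prod>l\<in>S. v l x) = (\<Prod>l\<in>S - S'. v l x) * (\<Prod>l\<in>S'. v l x)"
    using fin assms by (simp add: prod.subset_diff)
  moreover have "0 \<le> (\<Prod>l\<in>S'. v l x)" using prod_pos'[of S' x] order.trans[OF assms(1,2)] by simp
  from mult_right_mono[OF 1 this] have "(\<Prod>l\<in>S'. v l x) \<le> C ^ m * (\<Prod>l\<in>S - S'. v l x) * (\<Prod>l\<in>S'. v l x)"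
    by simp
  ultimately show ?thesis by (simp only: mult.assoc)
qed

lemma F_pos: "S \<subseteq> J \<Longrightarrow> 0 < F S"
proof -
  assume S: "S \<subseteq> J"
  have "1 \<le> C ^ card S * (\<Prod>l\<in>S. v l x)" for x
    using prod_subset_le[of "{}" S "card S" x] S by simp
  then have "inverse (C ^ card S) \<le> (\<Prod>l\<in>S. v l x)" for x
    using C0 by (simp add: field_simps)
  then have "inverse (C ^ card S) \<le> F S"
    unfolding F_def by (intro measure_pmf.integral_ge_const integrable_prod' S) auto
  then show ?thesis using C0 by (meson inverse_positive_iff_positive less_le_trans zero_less_power)
qed

text \<open>
  The factors interacting with \<open>i\<close> or \<open>j\<close> are at most \<open>2 * D\<close> in number, and each lies
  between \<open>1 / C\<close> and \<open>C\<close>. Deleting them costs \<open>C ^ (2 * D)\<close> and makes the rest independent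
  of the pair; restoring them costs the same factor again.
\<close>

lemma near_factors_cost:
  assumes "i \<in> J" "j \<in> J" "S \<subseteq> J" and h: "\<And>x. 0 \<le> h (v i x) (v j x)" "\<And>x. h (v i x) (v j x) \<le> B"
  shows "E p (\<lambda>x. h (v i x) (v j x) * (\<Prod>l\<in>S. v l x)) \<le> C ^ (4 * D) * E p (\<lambda>x. h (v i x) (v j x)) * F S"
proof -
  let ?u = "\<lambda>x. h (v i x) (v j x)"
  have ub: "\<bar>?u x\<bar> \<le> B" for x using h[of x] by simp
  have finS: "finite S" using finJ assms(3) by (rule finite_subset[rotated])
  define S' where "S' = S - (\<Gamma> i \<union> \<Gamma> j)"
  have S': "S' \<subseteq> S" "S' \<subseteq> J" using assms by (auto simp: S'_def)
  have "S - S' \<subseteq> (J \<inter> \<Gamma> i) \<union> (J \<inter> \<Gamma> j)" using assms by (auto simp: S'_def)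
  then have "card (S - S') \<le> card ((J \<inter> \<Gamma> i) \<union> (J \<inter> \<Gamma> j))" by (intro card_mono) (auto simp: finJ)
  also have "\<dots> \<le> card (J \<inter> \<Gamma> i) + card (J \<inter> \<Gamma> j)" by (rule card_Un_le)
  also have "\<dots> \<le> 2 * D" using card_\<Gamma>[OF assms(1)] card_\<Gamma>[OF assms(2)] by simp
  finally have cd: "card (S - S') \<le> 2 * D" .
  have cS: "(\<Prod>l\<in>S. v l x) \<le> C ^ (2 * D) * (\<Prod>l\<in>S'. v l x)" for x
  proof -
    have "(\<Prod>l\<in>S. v l x) = (\<Prod>l\<in>S - S'. v l x) * (\<Prod>l\<in>S'. v l x)"
      using finS S' by (simp add: prod.subset_diff)
    also have "\<dots> \<le> C ^ (2 * D) * (\<Prod>l\<in>S'. v l x)"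
      using finS assms(3) cd prod_pos'[OF S'(2), of x] C1
      by (intro mult_right_mono prod_le_power) (auto intro: v_le less_imp_le[OF v_pos])
    finally show ?thesis .
  qed
  have "E p (\<lambda>x. ?u x * (\<Prod>l\<in>S. v l x)) \<le> E p (\<lambda>x. C ^ (2 * D) * (?u x * (\<Prod>l\<in>S'. v l x)))"
  proof (intro integral_mono integrable_times_prod[OF assms(3) ub] Bochner_Integration.integrable_mult_right
      integrable_times_prod[OF S'(2) ub])
    fix x
    show "?u x * (\<Prod>l\<in>S. v l x) \<le> C ^ (2 * D) * (?u x * (\<Prod>l\<in>S'. v l x))"
      using mult_left_mono[OF cS h(1)] by (simp add: mult_ac)
  qed
  also have "\<dots> = C ^ (2 * D) * (E p ?u * F S')"
  proof -
    have "S' \<inter> (\<Gamma> i \<union> \<Gamma> j) = {}" by (auto simp: S'_def)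
    from indep[OF assms(1,2) S'(2) this, of h B] ub show ?thesis by (simp add: F_def)
  qed
  also have "\<dots> \<le> C ^ (2 * D) * (E p ?u * (C ^ (2 * D) * F S))"
  proof -
    have "F S' \<le> E p (\<lambda>x. C ^ (2 * D) * (\<Prod>l\<in>S. v l x))"
      unfolding F_def
      by (intro integral_mono integrable_prod' S' assms(3) Bochner_Integration.integrable_mult_right prod_subset_le cd)
    then have "F S' \<le> C ^ (2 * D) * F S" by (simp add: F_def)
    then show ?thesis
      using C0 h(1) by (intro mult_left_mono) (auto simp: integral_nonneg_AE)
  qed
  also have "\<dots> = C ^ (2 * D + 2 * D) * E p ?u * F S"
    unfolding power_add by (simp only: mult_ac)
  finally show ?thesis by simp
qed

lemma F_insert:
  assumes "j \<in> J" "S \<subseteq> J" "j \<notin> S"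
  shows "F (insert j S) = F S + E p (\<lambda>x. w j x * (\<Prod>l\<in>S. v l x))"
proof -
  have "finite S" using finJ assms finite_subset by auto
  then have "F (insert j S) = E p (\<lambda>x. (\<Prod>l\<in>S. v l x) + w j x * (\<Prod>l\<in>S. v l x))"
    unfolding F_def w_def using assms by (intro Bochner_Integration.integral_cong) (auto simp: algebra_simps)
  also have "\<dots> = F S + E p (\<lambda>x. w j x * (\<Prod>l\<in>S. v l x))"
    unfolding F_def
    by (intro Bochner_Integration.integral_add integrable_prod' integrable_times_prod[where B=C] assms w_abs)
  finally show ?thesis .
qed

text \<open>
  Inserting the factor \<open>j\<close> multiplies the expectation by at most \<open>1 + C ^ (4 * D) * E
  \<bar>w j\<bar>\<close>.
\<close>

lemma crude_bound: "S \<subseteq> J \<Longrightarrow> F S \<le> exp (C ^ (4 * D) * (\<Sum>j\<in>S. E p (\<lambda>x. \<bar>w j x\<bar>)))"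
proof -
  assume "S \<subseteq> J"
  then have "finite S" using finJ finite_subset by auto
  then show ?thesis using \<open>S \<subseteq> J\<close>
  proof (induction S)
    case empty
    then show ?case by (simp add: F_def)
  next
    case (insert j S)
    then have j: "j \<in> J" "S \<subseteq> J" "j \<notin> S" by auto
    have "E p (\<lambda>x. w j x * (\<Prod>l\<in>S. v l x)) \<le> E p (\<lambda>x. \<bar>w j x\<bar> * (\<Prod>l\<in>S. v l x))"
      by (intro integral_mono integrable_times_prod[where B=C] j mult_right_mono)
         (use j in \<open>auto intro!: less_imp_le[OF prod_pos'] w_abs\<close>)
    also have "\<dots> \<le> C ^ (4 * D) * E p (\<lambda>x. \<bar>w j x\<bar>) * F S"
      using near_factors_cost[OF j(1,1,2), of "\<lambda>s t. \<bar>s - 1\<bar>" C] w_abs[OF j(1)] by (simp add: w_def)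
    finally have "F (insert j S) \<le> (1 + C ^ (4 * D) * E p (\<lambda>x. \<bar>w j x\<bar>)) * F S"
      unfolding F_insert[OF j] by (simp add: algebra_simps)
    also have "\<dots> \<le> exp (C ^ (4 * D) * E p (\<lambda>x. \<bar>w j x\<bar>)) * exp (C ^ (4 * D) * (\<Sum>j\<in>S. E p (\<lambda>x. \<bar>w j x\<bar>)))"
      using insert j F_pos[OF j(2)] by (intro mult_mono exp_ge_add_one_self) auto
    finally show ?case using insert by (simp add: exp_add[symmetric] distrib_left)
  qed
qed

text \<open>
  The smallness of the single \<open>E \<bar>w i\<bar>\<close> does not make these terms of second order,
  since interacting factors may be strongly correlated; they have to be estimated
  separately.
\<close>

definition pair_err :: "'i \<Rightarrow> real" where
  "pair_err j = (\<Sum>i\<in>J \<inter> \<Gamma> j - {j}. E p (\<lambda>x. \<bar>w j x * w i x\<bar>))"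

text \<open>
  Only the factors near \<open>j\<close> are correlated with \<open>w j\<close>. Once they are deleted, the
  expectation splits. The deletion produces terms that contain \<open>w i\<close> for some \<open>i\<close> near \<open>j\<close>:
  next to \<open>w j\<close> they form the pair errors, and in the expectation without \<open>w j\<close> they
  contribute at most \<open>e\<close> each.
\<close>

lemma step_estimate:
  assumes j: "j \<in> J" "S \<subseteq> J" "j \<notin> S" and e: "\<And>i. i \<in> J \<Longrightarrow> E p (\<lambda>x. \<bar>w i x\<bar>) \<le> e"
  shows "\<bar>F (insert j S) - F S - E p (w j) * F S\<bar> \<le>
     F S * (C ^ (6 * D) * (real D * e * E p (\<lambda>x. \<bar>w j x\<bar>) + pair_err j))"
proof -
  define S0 where "S0 = S \<inter> \<Gamma> j"
  define S' where "S' = S - \<Gamma> j"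
  have S': "S' \<subseteq> J" "S' \<inter> \<Gamma> j = {}" "S' \<subseteq> S" and S0: "S0 \<subseteq> J \<inter> \<Gamma> j - {j}" "S0 \<subseteq> J"
    using j by (auto simp: S0_def S'_def)
  have fin: "finite S" "finite S0" using finJ j S0 finite_subset by (blast intro: finite_subset)+
  have "card S0 \<le> card (J \<inter> \<Gamma> j)" using S0 finJ by (intro card_mono) auto
  then have cS0: "card S0 \<le> D" using card_\<Gamma>[OF j(1)] by simp
  have e0: "0 \<le> e" using order_trans[OF _ e[OF j(1)]] by (simp add: integral_nonneg_AE)
  have splitS: "(\<Prod>l\<in>S. v l x) = (\<Prod>l\<in>S'. v l x) * (\<Prod>l\<in>S0. v l x)" for x
    unfolding S'_def S0_def using fin(1) by (metis mult.commute prod.Int_Diff)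
  have CD: "1 \<le> C ^ m" for m using C1 by (rule one_le_power)
  have diff: "\<bar>(\<Prod>l\<in>S0. v l x) - 1\<bar> \<le> C ^ D * (\<Sum>i\<in>S0. \<bar>w i x\<bar>)" for x
  proof -
    have "\<bar>(\<Prod>l\<in>S0. v l x) - 1\<bar> \<le> C ^ card S0 * (\<Sum>i\<in>S0. \<bar>v i x - 1\<bar>)"
      using fin C1 S0 by (intro abs_prod_minus_one_le) (auto intro: v_le less_imp_le[OF v_pos])
    also have "\<dots> \<le> C ^ D * (\<Sum>i\<in>S0. \<bar>v i x - 1\<bar>)"
      using C1 cS0 by (intro mult_right_mono power_increasing) (auto simp: sum_nonneg)
    finally show ?thesis by (simp add: w_def)
  qed
  have FS': "F S' \<le> C ^ D * F S"
  proof -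
    have "S - S' = S0" by (auto simp: S'_def S0_def)
    then have "(\<Prod>l\<in>S'. v l x) \<le> C ^ D * (\<Prod>l\<in>S. v l x)" for x
      using cS0 S' j by (intro prod_subset_le) auto
    then have "F S' \<le> E p (\<lambda>x. C ^ D * (\<Prod>l\<in>S. v l x))" unfolding F_def
      by (intro integral_mono integrable_prod' S' j Bochner_Integration.integrable_mult_right)
    then show ?thesis by (simp add: F_def)
  qed
  \<comment> \<open>The cost of deleting the factors near \<open>j\<close>. It is used twice: for \<open>u = w j\<close> and for \<open>u = 1\<close>.\<close>
  have main: "\<bar>E p (\<lambda>x. u x * (\<Prod>l\<in>S. v l x)) - E p (\<lambda>x. u x * (\<Prod>l\<in>S'. v l x))\<bar>
      \<le> C ^ D * (\<Sum>i\<in>S0. C ^ (4 * D) * E p (\<lambda>x. \<bar>u x\<bar> * \<bar>w i x\<bar>) * (C ^ D * F S))"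
    if u: "u = (\<lambda>x. h (v j x))" "\<And>x. \<bar>u x\<bar> \<le> B" for u h B
  proof -
    have B0: "0 \<le> B" using u(2)[of undefined] by simp
    have iu: "\<bar>\<bar>u x\<bar> * \<bar>w i x\<bar>\<bar> \<le> B * C" if "i \<in> S0" for i x
      using u(2)[of x] w_abs[of i x] that S0 B0 by (auto simp: abs_mult intro!: mult_mono)
    have int: "integrable p (\<lambda>x. (\<bar>u x\<bar> * \<bar>w i x\<bar>) * (\<Prod>l\<in>S'. v l x))" if "i \<in> S0" for i
      using iu[OF that] by (intro integrable_times_prod[OF S'(1)])
    have "\<bar>E p (\<lambda>x. u x * (\<Prod>l\<in>S. v l x)) - E p (\<lambda>x. u x * (\<Prod>l\<in>S'. v l x))\<bar> =
        \<bar>E p (\<lambda>x. u x * (\<Prod>l\<in>S. v l x) - u x * (\<Prod>l\<in>S'. v l x))\<bar>"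
      by (subst Bochner_Integration.integral_diff
            [OF integrable_times_prod[OF j(2) u(2)] integrable_times_prod[OF S'(1) u(2)]]) (rule refl)
    also have "\<dots> \<le> E p (\<lambda>x. C ^ D * (\<Sum>i\<in>S0. (\<bar>u x\<bar> * \<bar>w i x\<bar>) * (\<Prod>l\<in>S'. v l x)))"
    proof (rule abs_E_le)
      show "integrable p (\<lambda>x. u x * (\<Prod>l\<in>S. v l x) - u x * (\<Prod>l\<in>S'. v l x))"
        by (intro Bochner_Integration.integrable_diff integrable_times_prod[OF j(2) u(2)] integrable_times_prod[OF S'(1) u(2)])
      show "integrable p (\<lambda>x. C ^ D * (\<Sum>i\<in>S0. (\<bar>u x\<bar> * \<bar>w i x\<bar>) * (\<Prod>l\<in>S'. v l x)))"
        by (intro Bochner_Integration.integrable_mult_right Bochner_Integration.integrable_sum int)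
      fix x
      have "\<bar>u x * (\<Prod>l\<in>S. v l x) - u x * (\<Prod>l\<in>S'. v l x)\<bar> =
          \<bar>u x\<bar> * (\<Prod>l\<in>S'. v l x) * \<bar>(\<Prod>l\<in>S0. v l x) - 1\<bar>"
      proof -
        have "u x * (\<Prod>l\<in>S. v l x) - u x * (\<Prod>l\<in>S'. v l x) =
            u x * (\<Prod>l\<in>S'. v l x) * ((\<Prod>l\<in>S0. v l x) - 1)"
          unfolding splitS by (simp only: right_diff_distrib mult.assoc mult_1_right)
        then show ?thesis using prod_pos'[OF S'(1), of x] by (simp add: abs_mult)
      qed
      also have "\<dots> \<le> \<bar>u x\<bar> * (\<Prod>l\<in>S'. v l x) * (C ^ D * (\<Sum>i\<in>S0. \<bar>w i x\<bar>))"
        using prod_pos'[OF S'(1), of x] by (intro mult_left_mono diff) auto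
      finally show "\<bar>u x * (\<Prod>l\<in>S. v l x) - u x * (\<Prod>l\<in>S'. v l x)\<bar> \<le>
          C ^ D * (\<Sum>i\<in>S0. (\<bar>u x\<bar> * \<bar>w i x\<bar>) * (\<Prod>l\<in>S'. v l x))"
        by (simp add: sum_distrib_left sum_distrib_right mult_ac)
    qed
    also have "\<dots> = C ^ D * (\<Sum>i\<in>S0. E p (\<lambda>x. (\<bar>u x\<bar> * \<bar>w i x\<bar>) * (\<Prod>l\<in>S'. v l x)))"
      by (simp add: int)
    also have "\<dots> \<le> C ^ D * (\<Sum>i\<in>S0. C ^ (4 * D) * E p (\<lambda>x. \<bar>u x\<bar> * \<bar>w i x\<bar>) * F S')"
    proof (intro mult_left_mono sum_mono)
      fix i assume i: "i \<in> S0"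
      show "E p (\<lambda>x. (\<bar>u x\<bar> * \<bar>w i x\<bar>) * (\<Prod>l\<in>S'. v l x)) \<le> C ^ (4 * D) * E p (\<lambda>x. \<bar>u x\<bar> * \<bar>w i x\<bar>) * F S'"
        using near_factors_cost[of j i S' "\<lambda>s t. \<bar>h s\<bar> * \<bar>t - 1\<bar>" "B * C"] j S' S0 i iu[OF i]
        by (auto simp: u(1) w_def)
    qed (use C0 in auto)
    also have "\<dots> \<le> C ^ D * (\<Sum>i\<in>S0. C ^ (4 * D) * E p (\<lambda>x. \<bar>u x\<bar> * \<bar>w i x\<bar>) * (C ^ D * F S))"
      using C0 by (intro mult_left_mono sum_mono FS') (auto simp: integral_nonneg_AE)
    finally show ?thesis .
  qed
  have 1: "\<bar>F S - F S'\<bar> \<le> C ^ (6 * D) * (real D * e) * F S"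
  proof -
    have "\<bar>F S - F S'\<bar> \<le> C ^ D * (\<Sum>i\<in>S0. C ^ (4 * D) * E p (\<lambda>x. \<bar>w i x\<bar>) * (C ^ D * F S))"
      using main[of "\<lambda>_. 1" "\<lambda>_. 1" 1] by (simp add: F_def)
    also have "\<dots> \<le> C ^ D * (\<Sum>i\<in>S0. C ^ (4 * D) * e * (C ^ D * F S))"
      using C0 S0 F_pos[OF j(2)] by (intro mult_left_mono sum_mono mult_right_mono e) auto
    also have "\<dots> = C ^ (D + 4 * D + D) * (real (card S0) * e) * F S"
      unfolding power_add by (simp add: mult_ac)
    also have "\<dots> \<le> C ^ (D + 4 * D + D) * (real D * e) * F S"
      using C0 cS0 e0 F_pos[OF j(2)] by (intro mult_right_mono mult_left_mono) auto
    finally show ?thesis by simp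
  qed
  have 2: "\<bar>E p (\<lambda>x. w j x * (\<Prod>l\<in>S. v l x)) - E p (\<lambda>x. w j x * (\<Prod>l\<in>S'. v l x))\<bar> \<le>
     C ^ (6 * D) * pair_err j * F S"
  proof -
    have "\<bar>E p (\<lambda>x. w j x * (\<Prod>l\<in>S. v l x)) - E p (\<lambda>x. w j x * (\<Prod>l\<in>S'. v l x))\<bar> \<le>
      C ^ D * (\<Sum>i\<in>S0. C ^ (4 * D) * E p (\<lambda>x. \<bar>w j x\<bar> * \<bar>w i x\<bar>) * (C ^ D * F S))"
      by (rule main[of _ "\<lambda>s. s - 1" C]) (auto simp: w_def fun_eq_iff intro: w_abs[OF j(1), unfolded w_def])
    also have "\<dots> = C ^ (D + 4 * D + D) * (\<Sum>i\<in>S0. E p (\<lambda>x. \<bar>w j x * w i x\<bar>)) * F S"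
      unfolding power_add by (simp add: mult_ac sum_distrib_left abs_mult)
    also have "\<dots> \<le> C ^ (D + 4 * D + D) * pair_err j * F S"
      unfolding pair_err_def using C0 F_pos[OF j(2)] S0 finJ
      by (intro mult_right_mono mult_left_mono sum_mono2) (auto simp: integral_nonneg_AE)
    finally show ?thesis by simp
  qed
  have 3: "E p (\<lambda>x. w j x * (\<Prod>l\<in>S'. v l x)) = E p (w j) * F S'"
  proof -
    have "w j = (\<lambda>x. v j x - 1)" by (simp add: w_def fun_eq_iff)
    then show ?thesis
      using indep[of j j S' "\<lambda>s t. s - 1" C] j S' w_abs[OF j(1)] by (simp add: F_def)
  qed
  have 4: "\<bar>E p (w j)\<bar> \<le> E p (\<lambda>x. \<bar>w j x\<bar>)" by (rule integral_abs_bound)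
  have "\<bar>F (insert j S) - F S - E p (w j) * F S\<bar> =
     \<bar>(E p (\<lambda>x. w j x * (\<Prod>l\<in>S. v l x)) - E p (\<lambda>x. w j x * (\<Prod>l\<in>S'. v l x))) - E p (w j) * (F S - F S')\<bar>"
    by (simp add: F_insert[OF j] 3 algebra_simps)
  also have "\<dots> \<le> C ^ (6 * D) * pair_err j * F S + \<bar>E p (w j)\<bar> * \<bar>F S - F S'\<bar>"
    using 2 by (simp add: abs_mult[symmetric])
  also have "\<bar>E p (w j)\<bar> * \<bar>F S - F S'\<bar> \<le> E p (\<lambda>x. \<bar>w j x\<bar>) * (C ^ (6 * D) * (real D * e) * F S)"
    by (intro mult_mono 1 4) auto
  finally show ?thesis by (simp add: algebra_simps)
qed

lemma pair_err_nonneg: "0 \<le> pair_err j"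
  by (simp add: pair_err_def sum_nonneg integral_nonneg_AE)

lemma pair_err_le:
  assumes "j \<in> J"
  shows "pair_err j \<le> real D * C * E p (\<lambda>x. \<bar>w j x\<bar>)"
proof -
  have "pair_err j \<le> (\<Sum>i\<in>J \<inter> \<Gamma> j - {j}. E p (\<lambda>x. C * \<bar>w j x\<bar>))"
    unfolding pair_err_def
  proof (intro sum_mono integral_mono)
    fix i x assume i: "i \<in> J \<inter> \<Gamma> j - {j}"
    have *: "\<bar>w j x * w i x\<bar> \<le> C * \<bar>w j x\<bar>" for x
      using mult_right_mono[OF w_abs[of i x], of "\<bar>w j x\<bar>"] i by (simp add: abs_mult mult_ac)
    then show "\<bar>w j x * w i x\<bar> \<le> C * \<bar>w j x\<bar>" .
    have **: "C * \<bar>w j x\<bar> \<le> C * C" for x using w_abs[OF assms] C0 by (intro mult_left_mono) auto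
    show "integrable p (\<lambda>x. \<bar>w j x * w i x\<bar>)"
      by (rule integrable_bounded_pmf[where B="C*C"]) (use order_trans[OF * **] in simp)
    show "integrable p (\<lambda>x. C * \<bar>w j x\<bar>)"
      by (rule integrable_bounded_pmf[where B="C*C"]) (use ** C0 in \<open>simp add: abs_mult\<close>)
  qed
  also have "\<dots> = real (card (J \<inter> \<Gamma> j - {j})) * (C * E p (\<lambda>x. \<bar>w j x\<bar>))" by simp
  also have "\<dots> \<le> real D * (C * E p (\<lambda>x. \<bar>w j x\<bar>))"
  proof (intro mult_right_mono)
    have "card (J \<inter> \<Gamma> j - {j}) \<le> card (J \<inter> \<Gamma> j)" using finJ by (intro card_mono) auto
    then show "real (card (J \<inter> \<Gamma> j - {j})) \<le> real D" using card_\<Gamma>[OF assms] by simp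
  qed (use C0 in \<open>auto simp: integral_nonneg_AE\<close>)
  finally show ?thesis by (simp add: mult_ac)
qed

text \<open>
  One insertion multiplies \<open>F\<close> by \<open>1 + y\<close> with \<open>y\<close> close to \<open>E p (w j)\<close>. Since
  \<open>\<bar>y\<bar>\<close> is at most a constant times \<open>E \<bar>w j\<bar> \<le> e\<close>, replacing \<open>ln (1
  + y)\<close> by \<open>y\<close> costs a term of order \<open>e * E \<bar>w j\<bar>\<close>, which is of the same kind as
  the errors of the insertion itself. The logarithm turns the product of the steps into a
  sum.
\<close>

lemma log_estimate:
  assumes e: "\<And>i. i \<in> J \<Longrightarrow> E p (\<lambda>x. \<bar>w i x\<bar>) \<le> e" and e1: "e \<le> 1"
    and small: "(1 + 2 * C ^ (6 * D) * D * C) * e \<le> 1 / 2" and "S \<subseteq> J"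
  shows "\<bar>ln (F S) - (\<Sum>j\<in>S. E p (w j))\<bar> \<le>
    (C ^ (6 * D) * (D + 1) + 2 * (1 + 2 * C ^ (6 * D) * D * C)\<^sup>2) * (\<Sum>j\<in>S. e * E p (\<lambda>x. \<bar>w j x\<bar>) + pair_err j)"
    (is "_ \<le> ?K * _")
proof -
  define L where "L = C ^ (6 * D)"
  define B where "B = 1 + 2 * L * D * C"
  have L: "1 \<le> L" using C1 by (simp add: L_def)
  have B: "1 \<le> B" using L C0 by (simp add: B_def)
  have K: "?K = L * (D + 1) + 2 * B\<^sup>2" by (simp add: L_def B_def)
  have fin: "finite S" using finJ assms finite_subset by auto
  show ?thesis unfolding K using fin \<open>S \<subseteq> J\<close>
  proof (induction S)
    case empty
    then show ?case by (simp add: F_def)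
  next
    case (insert j S)
    then have j: "j \<in> J" "S \<subseteq> J" "j \<notin> S" by auto
    define a where "a = E p (\<lambda>x. \<bar>w j x\<bar>)"
    have a: "0 \<le> a" "a \<le> e" using e[OF j(1)] by (auto simp: a_def integral_nonneg_AE)
    define x where "x = F (insert j S) / F S - 1"
    define err where "err = L * (D * e * a + pair_err j)"
    have FS: "0 < F S" "0 < F (insert j S)" using F_pos[of S] F_pos[of "insert j S"] j by auto
    have "\<bar>x - E p (w j)\<bar> = \<bar>F (insert j S) - F S - E p (w j) * F S\<bar> / F S"
      using FS by (simp add: x_def field_simps abs_divide[symmetric] flip: abs_of_pos)
    also have "\<dots> \<le> err"
      using step_estimate[OF j e] FS by (simp add: field_simps err_def L_def a_def)
    finally have x1: "\<bar>x - E p (w j)\<bar> \<le> err" .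
    have "err \<le> L * (D * C * a + D * C * a)"
      unfolding err_def using L a e1 C1 pair_err_le[OF j(1)]
      by (intro mult_left_mono add_mono mult_right_mono) (auto simp: a_def)
    also have "\<dots> = (B - 1) * a" by (simp add: B_def algebra_simps)
    finally have err2: "err \<le> (B - 1) * a" .
    have "\<bar>E p (w j)\<bar> \<le> a" unfolding a_def by (rule integral_abs_bound)
    then have "\<bar>x\<bar> \<le> a + err" using x1 by linarith
    also have "\<dots> \<le> B * a" using err2 by (simp add: algebra_simps)
    finally have x2: "\<bar>x\<bar> \<le> B * a" .
    have "B * a \<le> B * e" using a B by (intro mult_left_mono) auto
    then have x3: "\<bar>x\<bar> \<le> 1 / 2" using x2 small by (simp add: B_def L_def)
    have "\<bar>ln (1 + x) - x\<bar> \<le> 2 * x\<^sup>2" by (rule abs_ln_one_plus_x_minus_x_bound[OF x3])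
    also have "x\<^sup>2 \<le> (B * a)\<^sup>2" using x2 by (metis abs_ge_zero power2_abs power_mono)
    also have "(B * a)\<^sup>2 = B\<^sup>2 * (a * a)" by (simp add: power2_eq_square)
    also have "B\<^sup>2 * (a * a) \<le> B\<^sup>2 * (e * a)" using a by (intro mult_left_mono mult_right_mono) auto
    finally have ln1: "\<bar>ln (1 + x) - x\<bar> \<le> 2 * B\<^sup>2 * (e * a)" by simp
    have ea: "0 \<le> e * a" using a by simp
    have e2: "err \<le> L * (D + 1) * (e * a) + L * (D + 1) * pair_err j"
      unfolding err_def using L ea pair_err_nonneg[of j] by (simp add: algebra_simps)
    have "ln (F (insert j S)) = ln (F S) + ln (1 + x)"
      using FS by (simp add: x_def ln_div)
    then have "\<bar>ln (F (insert j S)) - (E p (w j) + (\<Sum>j\<in>S. E p (w j)))\<bar> \<le>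
        \<bar>ln (F S) - (\<Sum>j\<in>S. E p (w j))\<bar> + err + 2 * B\<^sup>2 * (e * a)"
      using x1 ln1 by linarith
    also have "\<dots> \<le> (L * (D + 1) + 2 * B\<^sup>2) * (\<Sum>j\<in>S. e * E p (\<lambda>x. \<bar>w j x\<bar>) + pair_err j)
        + (L * (D + 1) + 2 * B\<^sup>2) * (e * a + pair_err j)"
    proof -
      have "0 \<le> 2 * B\<^sup>2 * pair_err j" using pair_err_nonneg[of j] by simp
      then have "err + 2 * B\<^sup>2 * (e * a) \<le> (L * (D + 1) + 2 * B\<^sup>2) * (e * a + pair_err j)"
        using e2 by (simp add: algebra_simps)
      then show ?thesis using insert.IH j by linarith
    qed
    finally show ?case using insert by (simp add: algebra_simps a_def)
  qed
qed

end

section \<open>Isolated points in a finite system of cells\<close>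

text \<open>
  The probability that a Poisson variable of mean \<open>x\<close> is less than \<open>m\<close>.
\<close>

definition PL :: "nat \<Rightarrow> real \<Rightarrow> real" where
  "PL m x = exp (- x) * (\<Sum>i<m. x ^ i / fact i)"

lemma prob_pois_less: "0 \<le> \<mu> \<Longrightarrow> measure (pois \<mu>) {n. n < m} = PL m \<mu>"
proof -
  assume "0 \<le> \<mu>"
  have "measure (pois \<mu>) {n. n < m} = (\<Sum>n<m. pmf (pois \<mu>) n)"
    by (subst measure_measure_pmf_finite) (auto simp: lessThan_def)
  then show ?thesis using \<open>0 \<le> \<mu>\<close> by (simp add: PL_def pmf_pois sum_distrib_left mult_ac)
qed

lemma PL_nonneg: "0 \<le> x \<Longrightarrow> 0 \<le> PL m x"
  by (simp add: PL_def sum_nonneg)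

lemma PL_le_1: "0 \<le> x \<Longrightarrow> PL m x \<le> 1"
  by (metis measure_pmf.prob_le_1 prob_pois_less)

lemma PL_antimono:
  assumes "0 \<le> x" "x \<le> y"
  shows "PL m y \<le> PL m x"
proof -
  have y: "pois y = map_pmf (\<lambda>(a, b). a + b) (pair_pmf (pois x) (pois (y - x)))"
    using pois_add[of x "y - x"] assms by simp
  have "PL m y = measure (pair_pmf (pois x) (pois (y - x))) {z. fst z + snd z < m}"
    using assms by (simp add: prob_pois_less[symmetric] y vimage_def case_prod_unfold)
  also have "\<dots> \<le> measure (pair_pmf (pois x) (pois (y - x))) {z. fst z < m}"
    by (intro measure_pmf.finite_measure_mono) auto
  also have "\<dots> = measure (map_pmf fst (pair_pmf (pois x) (pois (y - x)))) {n. n < m}"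
    by (simp add: vimage_def)
  also have "\<dots> = PL m x" using assms by (simp add: map_fst_pair_pmf prob_pois_less)
  finally show ?thesis .
qed

text \<open>
  A threshold lowered by one gains a factor of order \<open>1 / x\<close>, because \<open>x ^ i / fact i = (i +
  1) / x * (x ^ (i + 1) / fact (i + 1))\<close>. This gain pays for the number of possible
  positions of a second isolated point in the ball around the first one.
\<close>

lemma PL_pred_le:
  assumes "0 < x"
  shows "PL (k - 1) x \<le> k / x * PL k x"
proof -
  have "(\<Sum>i<k - 1. x ^ i / fact i) \<le> (\<Sum>i<k - 1. k / x * (x ^ Suc i / fact (Suc i)))"
  proof (rule sum_mono)
    fix i assume "i \<in> {..<k - 1}"
    then have "real (Suc i) \<le> k" by simp
    have "x ^ i / fact i = real (Suc i) / x * (x ^ Suc i / fact (Suc i))"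
      using assms by (simp add: field_simps del: of_nat_Suc)
    also have "\<dots> \<le> k / x * (x ^ Suc i / fact (Suc i))"
      using assms \<open>real (Suc i) \<le> k\<close> by (intro mult_right_mono divide_right_mono) auto
    finally show "x ^ i / fact i \<le> k / x * (x ^ Suc i / fact (Suc i))" .
  qed
  also have "\<dots> = k / x * (\<Sum>i\<in>Suc ` {..<k - 1}. x ^ i / fact i)"
    by (subst sum.reindex) (auto simp: sum_distrib_left)
  also have "\<dots> \<le> k / x * (\<Sum>i<k. x ^ i / fact i)"
    using assms by (intro mult_left_mono sum_mono2) auto
  finally have *: "(\<Sum>i<k - 1. x ^ i / fact i) \<le> k / x * (\<Sum>i<k. x ^ i / fact i)" .
  show ?thesis unfolding PL_def
    using mult_left_mono[OF *, of "exp (- x)"] by (simp add: mult_ac)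
qed

text \<open>
  The polynomial factor grows with its argument, so that only the exponential loses.
\<close>

lemma PL_scale_ge:
  assumes "0 \<le> x" "0 \<le> \<tau>"
  shows "exp (- (\<tau> * x)) * PL k x \<le> PL k ((1 + \<tau>) * x)"
proof -
  have "exp (- (\<tau> * x)) * PL k x = exp (- ((1 + \<tau>) * x)) * (\<Sum>i<k. x ^ i / fact i)"
    by (simp add: PL_def mult_exp_exp algebra_simps)
  also have "\<dots> \<le> PL k ((1 + \<tau>) * x)"
    unfolding PL_def using assms
    by (intro mult_left_mono sum_mono divide_right_mono power_mono) (auto simp: mult_le_cancel_right1)
  finally show ?thesis .
qed

lemma E_of_bool: "E p (\<lambda>x. of_bool (P x)) = measure p {x. P x}"
proof -
  have "(\<lambda>x. of_bool (P x) :: real) = indicator {x. P x}" by (auto simp: fun_eq_iff indicator_def)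
  then show ?thesis by simp
qed

text \<open>
  The classes that contain a cell whose neighbourhood meets the neighbourhood of a cell of
  class \<open>i\<close>. Classes that are not adjacent depend on disjoint sets of counts.
\<close>

definition adj :: "'q set \<Rightarrow> ('q \<Rightarrow> 'q set) \<Rightarrow> ('q \<Rightarrow> 'i) \<Rightarrow> 'i \<Rightarrow> 'i set" where
  "adj Q nb cl i = {cl q' | q q'. q \<in> Q \<and> q' \<in> Q \<and> cl q = i \<and> nb q \<inter> nb q' \<noteq> {}}"

text \<open>
  A discrete model of the torus. The cells \<open>q\<close> have masses \<open>\<kappa> q\<close>; \<open>nb q\<close> stands for
  the ball around a point of \<open>q\<close>, and has mass \<open>vol\<close> up to the factor \<open>1 + \<tau>\<close>. The
  classes given by \<open>cl\<close> are so small that a neighbourhood contains the whole class of its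
  centre. By \<open>close\<close>, the neighbourhood of \<open>q'\<close> sticks out of the one of \<open>q\<close> by at least the
  mass \<open>\<gamma> * vol\<close>, unless \<open>q'\<close> belongs to an exceptional set of mass at most \<open>\<sigma>
  * vol\<close>; by \<open>far\<close>, this set is part of \<open>nb q\<close>.
\<close>

locale cell_system =
  fixes Q :: "'q set" and \<kappa> :: "'q \<Rightarrow> real" and nb :: "'q \<Rightarrow> 'q set" and cl :: "'q \<Rightarrow> 'i"
    and vol :: real and D :: nat and \<sigma> \<gamma> \<tau> :: real
  assumes fin_Q: "finite Q"
    and kap_nonneg: "\<And>q. q \<in> Q \<Longrightarrow> 0 \<le> \<kappa> q"
    and kap_sum: "sum \<kappa> Q = 1"
    and nb_sub: "\<And>q. q \<in> Q \<Longrightarrow> nb q \<subseteq> Q"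
    and nb_self: "\<And>q. q \<in> Q \<Longrightarrow> q \<in> nb q"
    and nb_sym: "\<And>q q'. q \<in> Q \<Longrightarrow> q' \<in> nb q \<Longrightarrow> q \<in> nb q'"
    and vol_pos: "0 < vol"
    and nb_lower: "\<And>q. q \<in> Q \<Longrightarrow> vol \<le> sum \<kappa> (nb q)"
    and nb_upper: "\<And>q. q \<in> Q \<Longrightarrow> sum \<kappa> (nb q) \<le> (1 + \<tau>) * vol"
    and tau: "0 \<le> \<tau>" "\<tau> \<le> 1"
    and cl_nb: "\<And>q q'. q \<in> Q \<Longrightarrow> q' \<in> Q \<Longrightarrow> cl q = cl q' \<Longrightarrow> q' \<in> nb q"
    and adj_card: "\<And>i. i \<in> cl ` Q \<Longrightarrow> card (adj Q nb cl i) \<le> D"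
    and far: "\<And>q q'. q \<in> Q \<Longrightarrow> q' \<in> Q \<Longrightarrow> q' \<notin> nb q \<Longrightarrow> \<gamma> * vol \<le> sum \<kappa> (nb q' - nb q)"
    and close: "\<And>q. q \<in> Q \<Longrightarrow> sum \<kappa> {q' \<in> Q. sum \<kappa> (nb q' - nb q) < \<gamma> * vol} \<le> \<sigma> * vol"
    and sg: "0 \<le> \<sigma>" "0 < \<gamma>"
begin

abbreviation adj' where "adj' \<equiv> adj Q nb cl"

definition isol :: "nat \<Rightarrow> ('q \<Rightarrow> nat) \<Rightarrow> 'q \<Rightarrow> nat" where
  "isol k N q = of_bool (sum N (nb q) \<le> k)"

definition Tc :: "nat \<Rightarrow> ('q \<Rightarrow> nat) \<Rightarrow> nat" where
  "Tc k N = (\<Sum>q\<in>Q. N q * isol k N q)"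

definition Zc :: "nat \<Rightarrow> 'i \<Rightarrow> ('q \<Rightarrow> nat) \<Rightarrow> nat" where
  "Zc k i N = (\<Sum>q\<in>{q\<in>Q. cl q = i}. N q * isol k N q)"

definition PP :: "real \<Rightarrow> ('q \<Rightarrow> nat) pmf" where
  "PP \<rho> = Pi_pmf Q 0 (\<lambda>q. pois (\<rho> * \<kappa> q))"

text \<open>
  The cells whose counts determine which points of class \<open>i\<close> are isolated.
\<close>

definition reg :: "'i \<Rightarrow> 'q set" where
  "reg i = (\<Union>q\<in>{q\<in>Q. cl q = i}. nb q)"

lemma fin_nb: "q \<in> Q \<Longrightarrow> finite (nb q)"
  using nb_sub fin_Q finite_subset by blast

lemma fin_I: "finite (cl ` Q)" using fin_Q by simp

lemma fin_class: "finite {q \<in> Q. cl q = i}" using fin_Q by simp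

lemma kap_sum_nonneg: "U \<subseteq> Q \<Longrightarrow> 0 \<le> sum \<kappa> U"
  by (intro sum_nonneg) (auto intro: kap_nonneg)

lemma kap_sum_mono: "U \<subseteq> V \<Longrightarrow> V \<subseteq> Q \<Longrightarrow> sum \<kappa> U \<le> sum \<kappa> V"
  using fin_Q by (intro sum_mono2) (auto intro: kap_nonneg finite_subset)

lemma adj_self: "i \<in> cl ` Q \<Longrightarrow> i \<in> adj' i"
  using nb_self by (fastforce simp: adj_def)

lemma adj_sub: "adj' i \<subseteq> cl ` Q" by (auto simp: adj_def)

lemma reg_disjoint: "j \<notin> adj' i \<Longrightarrow> reg i \<inter> reg j = {}"
  by (auto simp: reg_def adj_def)

lemma depends_isol: "q \<in> Q \<Longrightarrow> depends_on (\<lambda>N. isol k N q) (nb q)"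
  unfolding depends_on_def isol_def by (metis sum.cong)

lemma depends_Zc: "depends_on (Zc k i) (reg i)"
  unfolding depends_on_def
proof (intro allI impI)
  fix N N' assume eq: "\<forall>x\<in>reg i. N x = (N' x :: nat)"
  have "N q * isol k N q = N' q * isol k N' q" if "q \<in> Q" "cl q = i" for q
  proof -
    have sub: "nb q \<subseteq> reg i" using that by (auto simp: reg_def)
    then have "isol k N q = isol k N' q"
      using depends_onD[OF depends_isol[OF that(1)], of N N' k] eq by auto
    then show ?thesis using eq sub nb_self[OF that(1)] by auto
  qed
  then show "Zc k i N = Zc k i N'" unfolding Zc_def by (intro sum.cong) auto
qed

lemma Tc_eq_sum_Zc: "Tc k N = (\<Sum>i\<in>cl ` Q. Zc k i N)"
  unfolding Tc_def Zc_def by (subst sum.image_gen[OF fin_Q, of _ cl]) (simp cong: conj_cong)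

text \<open>
  All cells of the class lie in the neighbourhood of any of them. Hence an isolated point in
  one of them leaves room for at most \<open>k\<close> points in the class.
\<close>

lemma Zc_le: "Zc k i N \<le> k"
proof (cases "\<exists>q\<in>Q. cl q = i \<and> isol k N q \<noteq> 0")
  case True
  then obtain q where q: "q \<in> Q" "cl q = i" "sum N (nb q) \<le> k" by (auto simp: isol_def split: if_splits)
  have "Zc k i N \<le> (\<Sum>q'\<in>{q\<in>Q. cl q = i}. N q')"
    unfolding Zc_def isol_def by (intro sum_mono) auto
  also have "\<dots> \<le> sum N (nb q)"
    using q fin_nb cl_nb[OF q(1)] by (intro sum_mono2) auto
  finally show ?thesis using q by simp
qed (auto simp: Zc_def)

lemma class_mass_le: "sum \<kappa> {q \<in> Q. cl q = i} \<le> 2 * vol"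
proof (cases "\<exists>q\<in>Q. cl q = i")
  case True
  then obtain q where q: "q \<in> Q" "cl q = i" by auto
  have "sum \<kappa> {q \<in> Q. cl q = i} \<le> sum \<kappa> (nb q)"
    using q cl_nb[OF q(1)] nb_sub[OF q(1)] by (intro kap_sum_mono) auto
  also have "\<dots> \<le> (1 + \<tau>) * vol" by (rule nb_upper[OF q(1)])
  also have "\<dots> \<le> 2 * vol" using tau vol_pos by (intro mult_right_mono) auto
  finally show ?thesis .
next
  case False
  then have e: "{q \<in> Q. cl q = i} = {}" by auto
  show ?thesis unfolding e using vol_pos by simp
qed

lemma local_product_cells:
  assumes dep: "\<And>i. depends_on (g i) (reg i)" and C: "1 \<le> C"
    and g: "\<And>i N. i \<in> cl ` Q \<Longrightarrow> \<bar>g i N\<bar> \<le> ln C"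
  shows "local_product (PP \<rho>) (cl ` Q) (\<lambda>i N. exp (g i N)) adj' C D"
proof
  show "finite (cl ` Q)" by (rule fin_I)
  show "1 \<le> C" by fact
  fix i N assume i: "i \<in> cl ` Q"
  have "exp (g i N) \<le> exp (ln C)" using g[OF i, of N] by (simp add: abs_le_iff)
  then show "exp (g i N) \<le> C" using C by simp
  have "exp (- ln C) \<le> exp (g i N)" using g[OF i, of N] by (simp add: abs_le_iff)
  then show "1 / C \<le> exp (g i N)" using C by (simp add: exp_minus field_simps)
  show "card (cl ` Q \<inter> adj' i) \<le> D" using adj_card[OF i] adj_sub[of i] by (simp add: Int_absorb1)
  show "i \<in> adj' i" by (rule adj_self[OF i])
next
  fix i j S B and h :: "real \<Rightarrow> real \<Rightarrow> real"
  assume S: "S \<subseteq> cl ` Q" "S \<inter> (adj' i \<union> adj' j) = {}"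
    and B: "\<And>N. \<bar>h (exp (g i N)) (exp (g j N))\<bar> \<le> B"
  have fin: "finite S" using S fin_I finite_subset by auto
  have "reg l \<inter> (reg i \<union> reg j) = {}" if "l \<in> S" for l
    using that S(2) reg_disjoint[of l i] reg_disjoint[of l j] by blast
  then have disj: "(reg i \<union> reg j) \<inter> (\<Union>l\<in>S. reg l) = {}" by blast
  have P: "\<bar>\<Prod>l\<in>S. exp (g l N)\<bar> \<le> C ^ card S" for N
  proof -
    have "exp (g l N) \<le> C" if "l \<in> S" for l
    proof -
      have "exp (g l N) \<le> exp (ln C)" using g[of l N] that S(1) by (auto simp: abs_le_iff)
      then show ?thesis using C by simp
    qed
    then have "(\<Prod>l\<in>S. exp (g l N)) \<le> (\<Prod>l\<in>S. C)" by (intro prod_mono) auto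
    moreover have "0 \<le> (\<Prod>l\<in>S. exp (g l N))" by (intro prod_nonneg) auto
    ultimately show ?thesis by simp
  qed
  show "E (PP \<rho>) (\<lambda>N. h (exp (g i N)) (exp (g j N)) * (\<Prod>l\<in>S. exp (g l N))) =
      E (PP \<rho>) (\<lambda>N. h (exp (g i N)) (exp (g j N))) * E (PP \<rho>) (\<lambda>N. \<Prod>l\<in>S. exp (g l N))"
    unfolding PP_def
  proof (rule E_Pi_indep[OF fin_Q _ _ disj B P])
    show "depends_on (\<lambda>N. h (exp (g i N)) (exp (g j N))) (reg i \<union> reg j)"
      using dep[of i] dep[of j] unfolding depends_on_def by (metis UnI1 UnI2)
    show "depends_on (\<lambda>N. \<Prod>l\<in>S. exp (g l N)) (\<Union>l\<in>S. reg l)"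
      unfolding depends_on_def
    proof (intro allI impI prod.cong refl)
      fix N N' l assume "\<forall>x\<in>\<Union> (reg ` S). N x = (N' x :: nat)" "l \<in> S"
      then have "g l N = g l N'" by (intro depends_onD[OF dep]) auto
      then show "exp (g l N) = exp (g l N')" by simp
    qed
  qed
qed

lemma E_palm:
  fixes h :: "('q \<Rightarrow> nat) \<Rightarrow> real"
  assumes q: "q \<in> Q" and \<rho>: "0 \<le> \<rho>" and h: "\<And>N. 0 \<le> h N" "\<And>N. h N \<le> B" "\<And>N. real (N q) * h N \<le> B'"
  shows "E (PP \<rho>) (\<lambda>N. real (N q) * h N) = \<rho> * \<kappa> q * E (PP \<rho>) (\<lambda>N. h (N(q := Suc (N q))))"
proof -
  have mu: "0 \<le> \<rho> * \<kappa> q" using kap_nonneg[OF q] \<rho> by simp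
  have "ennreal (E (PP \<rho>) (\<lambda>N. real (N q) * h N)) = (\<integral>\<^sup>+N. ennreal (real (N q) * h N) \<partial>PP \<rho>)"
    by (intro nn_integral_eq_integral[symmetric] integrable_bounded_pmf[where B=B'])
       (use h in \<open>auto simp: abs_of_nonneg\<close>)
  also have "\<dots> = (\<integral>\<^sup>+N. of_nat (N q) * ennreal (h N) \<partial>PP \<rho>)"
    using h by (simp add: ennreal_mult ennreal_of_nat_eq_real_of_nat)
  also have "\<dots> = ennreal (\<rho> * \<kappa> q) * (\<integral>\<^sup>+N. ennreal (h (N(q := Suc (N q)))) \<partial>PP \<rho>)"
    unfolding PP_def
    by (rule palm_Pi_pois[where \<mu>="\<lambda>q. \<rho> * \<kappa> q"]) (use fin_Q q mu in auto)
  also have "(\<integral>\<^sup>+N. ennreal (h (N(q := Suc (N q)))) \<partial>PP \<rho>) = ennreal (E (PP \<rho>) (\<lambda>N. h (N(q := Suc (N q)))))"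
    by (intro nn_integral_eq_integral integrable_bounded_pmf[where B=B])
       (use h in \<open>auto simp: abs_of_nonneg\<close>)
  also have "ennreal (\<rho> * \<kappa> q) * \<dots> = ennreal (\<rho> * \<kappa> q * E (PP \<rho>) (\<lambda>N. h (N(q := Suc (N q)))))"
    using mu h by (simp add: ennreal_mult integral_nonneg_AE)
  finally show ?thesis
    using mu h by (subst (asm) ennreal_inj) (auto intro!: integral_nonneg_AE mult_nonneg_nonneg)
qed

lemma E_count_less:
  assumes "U \<subseteq> Q" "0 \<le> \<rho>"
  shows "E (PP \<rho>) (\<lambda>N. of_bool (sum N U < m)) = PL m (\<rho> * sum \<kappa> U)"
proof -
  have "E (PP \<rho>) (\<lambda>N. of_bool (sum N U < m)) = measure (PP \<rho>) {N. sum N U < m}"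
    by (rule E_of_bool)
  also have "\<dots> = measure (map_pmf (\<lambda>N. sum N U) (PP \<rho>)) {n. n < m}"
    by (simp add: vimage_def)
  also have "map_pmf (\<lambda>N. sum N U) (PP \<rho>) = pois (\<Sum>q\<in>U. \<rho> * \<kappa> q)"
    unfolding PP_def by (intro Pi_pois_sum fin_Q assms) (use kap_nonneg assms in auto)
  finally show ?thesis
    using assms kap_sum_nonneg[OF assms(1)] by (simp add: prob_pois_less flip: sum_distrib_left)
qed

lemma sum_fun_upd_Suc:
  fixes N :: "'q \<Rightarrow> nat"
  assumes "finite U"
  shows "sum (N(q := Suc (N q))) U = sum N U + of_bool (q \<in> U)"
proof -
  have "sum (N(q := Suc (N q))) U = (\<Sum>x\<in>U. N x + of_bool (x = q))"
    by (intro sum.cong) auto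
  also have "\<dots> = sum N U + of_bool (q \<in> U)"
    using assms by (simp add: sum.distrib of_bool_def sum.delta')
  finally show ?thesis .
qed

lemma count_le: "q \<in> Q \<Longrightarrow> N q \<le> sum N (nb q)" for N :: "'q \<Rightarrow> nat"
  using fin_nb nb_self by (intro member_le_sum) auto

lemma isol_upd:
  "x \<in> Q \<Longrightarrow> isol k (N(q := Suc (N q))) x = of_bool (sum N (nb x) + of_bool (q \<in> nb x) \<le> k)"
  unfolding isol_def sum_fun_upd_Suc[OF fin_nb] ..

lemma E_isol:
  assumes q: "q \<in> Q" and \<rho>: "0 \<le> \<rho>"
  shows "E (PP \<rho>) (\<lambda>N. real (N q * isol k N q)) = \<rho> * \<kappa> q * PL k (\<rho> * sum \<kappa> (nb q))"
proof -
  have "E (PP \<rho>) (\<lambda>N. real (N q) * real (isol k N q)) =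
      \<rho> * \<kappa> q * E (PP \<rho>) (\<lambda>N. real (isol k (N(q := Suc (N q))) q))"
  proof (rule E_palm[OF q \<rho>, where B=1 and B'=k])
    fix N
    show "real (N q) * real (isol k N q) \<le> real k"
      using count_le[OF q, of N] by (auto simp: isol_def)
  qed (auto simp: isol_def)
  also have "(\<lambda>N. real (isol k (N(q := Suc (N q))) q)) = (\<lambda>N. of_bool (sum N (nb q) < k))"
    unfolding isol_upd[OF q] using nb_self[OF q] by (auto simp: fun_eq_iff)
  also have "E (PP \<rho>) (\<lambda>N. of_bool (sum N (nb q) < k)) = PL k (\<rho> * sum \<kappa> (nb q))"
    by (rule E_count_less[OF nb_sub[OF q] \<rho>])
  finally show ?thesis by simp
qed

text \<open>
  Ordered pairs of distinct isolated points, the first in \<open>q\<close> and the second in \<open>q'\<close>; on the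
  diagonal this is the factorial moment \<open>N q * (N q - 1)\<close>.
\<close>

definition pr :: "nat \<Rightarrow> 'q \<Rightarrow> 'q \<Rightarrow> ('q \<Rightarrow> nat) \<Rightarrow> real" where
  "pr k q q' N = real (N q) * (real (N q' - of_bool (q' = q)) * real (isol k N q) * real (isol k N q'))"

lemma pr_bounds:
  assumes "q \<in> Q" "q' \<in> Q"
  shows "0 \<le> pr k q q' N" "pr k q q' N \<le> real k * real k"
proof -
  have "real (N q' - of_bool (q' = q)) * real (isol k N q) * real (isol k N q') \<le> real k" if "isol k N q \<noteq> 0"
    using count_le[OF assms(2), of N] by (auto simp: isol_def)
  moreover have "real (N q) \<le> real k" if "isol k N q \<noteq> 0"
    using count_le[OF assms(1), of N] that by (auto simp: isol_def split: if_splits)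
  ultimately show "pr k q q' N \<le> real k * real k"
    unfolding pr_def by (cases "isol k N q = 0") (auto intro!: mult_mono)
qed (auto simp: pr_def)

text \<open>
  The Palm formula, applied twice, inserts both points. If \<open>q'\<close> belongs to \<open>nb q\<close>, then the
  second point takes one of the places in \<open>nb q\<close>, which lowers the threshold. The part of
  \<open>nb q'\<close> outside \<open>nb q\<close> is independent of the counts in \<open>nb q\<close> and must have fewer than \<open>k\<close>
  points as well.
\<close>

lemma E_pr_le:
  assumes q: "q \<in> Q" and q': "q' \<in> Q" and \<rho>: "0 \<le> \<rho>"
  shows "E (PP \<rho>) (pr k q q') \<le> \<rho> * \<kappa> q * (\<rho> * \<kappa> q' *
     (PL (k - of_bool (q' \<in> nb q)) (\<rho> * sum \<kappa> (nb q)) * PL k (\<rho> * sum \<kappa> (nb q' - nb q))))"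
proof -
  have fnb: "finite (nb q)" "finite (nb q')" using fin_nb q q' by auto
  define h2 where "h2 = (\<lambda>N. of_bool (sum N (nb q) < k) * of_bool (sum N (nb q') + of_bool (q \<in> nb q') \<le> k) :: real)"
  have e1: "E (PP \<rho>) (pr k q q') = \<rho> * \<kappa> q *
      E (PP \<rho>) (\<lambda>N. real ((N(q := Suc (N q))) q' - of_bool (q' = q)) * real (isol k (N(q := Suc (N q))) q) *
        real (isol k (N(q := Suc (N q))) q'))"
    unfolding pr_def[abs_def]
  proof (rule E_palm[OF q \<rho>, where B=k and B'="real k * real k"])
    fix N
    show "real (N q) * (real (N q' - of_bool (q' = q)) * real (isol k N q) * real (isol k N q')) \<le> real k * real k"
      using pr_bounds(2)[OF q q'] by (simp add: pr_def)
    show "real (N q' - of_bool (q' = q)) * real (isol k N q) * real (isol k N q') \<le> real k"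
      using count_le[OF q', of N] by (auto simp: isol_def)
  qed auto
  have e2: "(\<lambda>N. real ((N(q := Suc (N q))) q' - of_bool (q' = q)) * real (isol k (N(q := Suc (N q))) q) *
        real (isol k (N(q := Suc (N q))) q')) = (\<lambda>N. real (N q') * h2 N)"
    unfolding isol_upd[OF q] isol_upd[OF q'] using nb_self[OF q] by (auto simp: fun_eq_iff h2_def)
  have e3: "E (PP \<rho>) (\<lambda>N. real (N q') * h2 N) = \<rho> * \<kappa> q' * E (PP \<rho>) (\<lambda>N. h2 (N(q' := Suc (N q'))))"
  proof (rule E_palm[OF q' \<rho>, where B=1 and B'=k])
    fix N
    show "real (N q') * h2 N \<le> real k"
      using count_le[OF q', of N] by (auto simp: h2_def)
  qed (auto simp: h2_def)
  have "E (PP \<rho>) (\<lambda>N. h2 (N(q' := Suc (N q')))) \<le>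
     E (PP \<rho>) (\<lambda>N. of_bool (sum N (nb q) < k - of_bool (q' \<in> nb q)) * of_bool (sum N (nb q' - nb q) < k))"
  proof (rule E_mono_bounded[where B=1 and B'=1])
    fix N :: "'q \<Rightarrow> nat"
    have "sum N (nb q' - nb q) \<le> sum N (nb q')" by (rule sum_mono2[OF fnb(2)]) auto
    then show "h2 (N(q' := Suc (N q'))) \<le>
        of_bool (sum N (nb q) < k - of_bool (q' \<in> nb q)) * of_bool (sum N (nb q' - nb q) < k)"
      unfolding h2_def sum_fun_upd_Suc[OF fnb(1)] sum_fun_upd_Suc[OF fnb(2)]
      using nb_self[OF q'] by auto
  qed (auto simp: h2_def)
  also have "\<dots> = E (PP \<rho>) (\<lambda>N. of_bool (sum N (nb q) < k - of_bool (q' \<in> nb q))) *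
      E (PP \<rho>) (\<lambda>N. of_bool (sum N (nb q' - nb q) < k))"
    unfolding PP_def
  proof (rule E_Pi_indep[OF fin_Q, where A="nb q" and B="nb q' - nb q" and Bf=1 and Bg=1])
    show "depends_on (\<lambda>N. of_bool (sum N (nb q) < k - of_bool (q' \<in> nb q)) :: real) (nb q)"
      unfolding depends_on_def by (metis (no_types, lifting) sum.cong)
    show "depends_on (\<lambda>N. of_bool (sum N (nb q' - nb q) < k) :: real) (nb q' - nb q)"
      unfolding depends_on_def by (metis (no_types, lifting) sum.cong)
  qed auto
  also have "\<dots> = PL (k - of_bool (q' \<in> nb q)) (\<rho> * sum \<kappa> (nb q)) * PL k (\<rho> * sum \<kappa> (nb q' - nb q))"
    using nb_sub q q' by (subst (1 2) E_count_less) (auto simp: \<rho>)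
  finally show ?thesis
    unfolding e1 e2 e3 using \<rho> kap_nonneg[OF q] kap_nonneg[OF q'] by (intro mult_left_mono) auto
qed

end

section \<open>Exponential moments for Poisson counts\<close>

text \<open>
  On \<open>{0, 1}\<close> the function \<open>exp (t * z)\<close> is affine in \<open>z\<close>, and \<open>z * z - z\<close> vanishes there.
  So the error of the affine approximation only sees classes with at least two isolated
  points.
\<close>

lemma exp_nat_bounds:
  fixes t :: real and z k :: nat
  assumes "z \<le> k"
  shows "\<bar>exp (t * z) - 1\<bar> \<le> exp (\<bar>t\<bar> * k) * z"
    and "\<bar>exp (t * z) - 1 - (exp t - 1) * z\<bar> \<le> 2 * exp (\<bar>t\<bar> * k) * (real z * real z - real z)"
proof -
  let ?C = "exp (\<bar>t\<bar> * k)"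
  have C1: "1 \<le> ?C" by simp
  have b: "\<bar>exp (t * y) - 1\<bar> \<le> ?C" if "y \<le> k" for y :: nat
  proof -
    have "t * y \<le> \<bar>t\<bar> * y" by (intro mult_right_mono) auto
    also have "\<dots> \<le> \<bar>t\<bar> * k" using that by (intro mult_left_mono) auto
    finally have "exp (t * y) \<le> ?C" by simp
    then show ?thesis using C1 exp_gt_zero[of "t * y"] by linarith
  qed
  show "\<bar>exp (t * z) - 1\<bar> \<le> ?C * z"
  proof (cases "z = 0")
    case False
    then have "?C * 1 \<le> ?C * real z" by (intro mult_left_mono) auto
    then show ?thesis using b[OF assms] by linarith
  qed simp
  consider "z = 0" | "z = 1" | "2 \<le> z" by linarith
  then show "\<bar>exp (t * z) - 1 - (exp t - 1) * z\<bar> \<le> 2 * ?C * (real z * real z - real z)"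
  proof cases
    case 3
    then have "1 \<le> k" using assms by simp
    have "\<bar>(exp t - 1) * z\<bar> \<le> ?C * z"
      unfolding abs_mult using b[OF \<open>1 \<le> k\<close>] by (intro mult_mono) auto
    then have "\<bar>exp (t * z) - 1 - (exp t - 1) * z\<bar> \<le> ?C * 1 + ?C * z" using b[OF assms] by linarith
    also have "\<dots> = ?C * (1 + z)" by (simp add: algebra_simps)
    also have "\<dots> \<le> ?C * (2 * (real z * real z - real z))"
    proof (intro mult_left_mono)
      have lin: "1 + y \<le> 2 * (w - y)" if "2 \<le> y" "2 * y \<le> w" for y w :: real
        using that by argo
      have "2 * real z \<le> real z * real z" using 3 by (intro mult_right_mono) auto
      moreover have "2 \<le> real z" using 3 by simp
      ultimately show "real (1 + z) \<le> 2 * (real z * real z - real z)"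
        using lin[of "real z" "real z * real z"] by simp
    qed simp
    finally show ?thesis by (simp only: mult_ac)
  qed auto
qed

lemma exp_minus_one_le: "exp x - 1 \<le> x * exp x" for x :: real
proof -
  have "(1 - x) * exp x \<le> exp (- x) * exp x"
    using exp_ge_add_one_self[of "- x"] by (intro mult_right_mono) auto
  then show ?thesis by (simp add: algebra_simps mult_exp_exp)
qed

context cell_system
begin

lemma integrable_Zc: "integrable (PP \<rho>) (\<lambda>N. real (Zc k i N))"
  by (rule integrable_bounded_pmf[where B=k]) (simp add: Zc_le)

lemma term_le: "q \<in> Q \<Longrightarrow> N q * isol k N q \<le> k"
  using count_le[of q N] by (auto simp: isol_def)

lemma integrable_isol: "q \<in> Q \<Longrightarrow> integrable (PP \<rho>) (\<lambda>N. real (N q * isol k N q))"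
  by (rule integrable_bounded_pmf[where B=k]) (use term_le in \<open>auto simp del: of_nat_mult\<close>)

lemma E_Zc:
  assumes "0 \<le> \<rho>"
  shows "E (PP \<rho>) (\<lambda>N. real (Zc k i N)) = (\<Sum>q\<in>{q\<in>Q. cl q = i}. \<rho> * \<kappa> q * PL k (\<rho> * sum \<kappa> (nb q)))"
proof -
  have "E (PP \<rho>) (\<lambda>N. real (Zc k i N)) = (\<Sum>q\<in>{q\<in>Q. cl q = i}. E (PP \<rho>) (\<lambda>N. real (N q * isol k N q)))"
    unfolding Zc_def of_nat_sum by (intro Bochner_Integration.integral_sum integrable_isol) auto
  then show ?thesis using assms by (simp add: E_isol del: of_nat_mult)
qed

lemma E_Tc:
  assumes "0 \<le> \<rho>"
  shows "E (PP \<rho>) (\<lambda>N. real (Tc k N)) = (\<Sum>q\<in>Q. \<rho> * \<kappa> q * PL k (\<rho> * sum \<kappa> (nb q)))"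
proof -
  have "E (PP \<rho>) (\<lambda>N. real (Tc k N)) = (\<Sum>q\<in>Q. E (PP \<rho>) (\<lambda>N. real (N q * isol k N q)))"
    unfolding Tc_def of_nat_sum by (intro Bochner_Integration.integral_sum integrable_isol) auto
  then show ?thesis using assms by (simp add: E_isol del: of_nat_mult)
qed

lemma E_Tc_sum_Zc: "E (PP \<rho>) (\<lambda>N. real (Tc k N)) = (\<Sum>i\<in>cl ` Q. E (PP \<rho>) (\<lambda>N. real (Zc k i N)))"
  unfolding Tc_eq_sum_Zc of_nat_sum by (intro Bochner_Integration.integral_sum integrable_Zc)

lemma PL_nb_le: "q \<in> Q \<Longrightarrow> 0 \<le> \<rho> \<Longrightarrow> PL m (\<rho> * sum \<kappa> (nb q)) \<le> PL m (\<rho> * vol)"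
  using vol_pos by (intro PL_antimono mult_left_mono nb_lower) auto

lemma E_Tc_le: "0 \<le> \<rho> \<Longrightarrow> E (PP \<rho>) (\<lambda>N. real (Tc k N)) \<le> \<rho> * PL k (\<rho> * vol)"
proof -
  assume \<rho>: "0 \<le> \<rho>"
  have "E (PP \<rho>) (\<lambda>N. real (Tc k N)) \<le> (\<Sum>q\<in>Q. \<rho> * \<kappa> q * PL k (\<rho> * vol))"
    unfolding E_Tc[OF \<rho>] using \<rho> kap_nonneg by (intro sum_mono mult_left_mono PL_nb_le) auto
  then show ?thesis by (simp add: sum_distrib_right[symmetric] sum_distrib_left[symmetric] kap_sum)
qed

lemma E_Tc_ge: "0 \<le> \<rho> \<Longrightarrow> \<rho> * (exp (- (\<tau> * (\<rho> * vol))) * PL k (\<rho> * vol)) \<le> E (PP \<rho>) (\<lambda>N. real (Tc k N))"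
proof -
  assume \<rho>: "0 \<le> \<rho>"
  have "(\<Sum>q\<in>Q. \<rho> * \<kappa> q * (exp (- (\<tau> * (\<rho> * vol))) * PL k (\<rho> * vol))) \<le> E (PP \<rho>) (\<lambda>N. real (Tc k N))"
    unfolding E_Tc[OF \<rho>]
  proof (intro sum_mono mult_left_mono)
    fix q assume q: "q \<in> Q"
    have "exp (- (\<tau> * (\<rho> * vol))) * PL k (\<rho> * vol) \<le> PL k ((1 + \<tau>) * (\<rho> * vol))"
      using \<rho> vol_pos tau by (intro PL_scale_ge) auto
    also have "\<dots> \<le> PL k (\<rho> * sum \<kappa> (nb q))"
      using \<rho> nb_upper[OF q] kap_sum_nonneg[OF nb_sub[OF q]] mult_left_mono[OF nb_upper[OF q] \<rho>]
      by (intro PL_antimono) (auto simp: mult_ac)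
    finally show "exp (- (\<tau> * (\<rho> * vol))) * PL k (\<rho> * vol) \<le> PL k (\<rho> * sum \<kappa> (nb q))" .
    show "0 \<le> \<rho> * \<kappa> q" using \<rho> kap_nonneg[OF q] by simp
  qed
  then show ?thesis by (simp add: sum_distrib_right[symmetric] sum_distrib_left[symmetric] kap_sum)
qed

lemma E_Zc_le: "0 \<le> \<rho> \<Longrightarrow> E (PP \<rho>) (\<lambda>N. real (Zc k i N)) \<le> 2 * (\<rho> * vol) * PL k (\<rho> * vol)"
proof -
  assume \<rho>: "0 \<le> \<rho>"
  have "E (PP \<rho>) (\<lambda>N. real (Zc k i N)) \<le> (\<Sum>q\<in>{q\<in>Q. cl q = i}. \<rho> * \<kappa> q * PL k (\<rho> * vol))"
    unfolding E_Zc[OF \<rho>] using \<rho> kap_nonneg by (intro sum_mono mult_left_mono PL_nb_le) auto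
  also have "\<dots> = sum \<kappa> {q\<in>Q. cl q = i} * (\<rho> * PL k (\<rho> * vol))"
    by (simp add: sum_distrib_left sum_distrib_right mult_ac)
  also have "\<dots> \<le> 2 * vol * (\<rho> * PL k (\<rho> * vol))"
    using \<rho> vol_pos by (intro mult_right_mono class_mass_le) (auto simp: PL_nonneg)
  finally show ?thesis by (simp add: mult_ac)
qed

definition wide :: "'q \<Rightarrow> 'q set" where
  "wide q = {q' \<in> Q. cl q' \<in> adj' (cl q)}"

lemma wide_mass: "q \<in> Q \<Longrightarrow> sum \<kappa> (wide q) \<le> 2 * D * vol"
proof -
  assume q: "q \<in> Q"
  have fin: "finite (adj' (cl q))" using adj_sub fin_I finite_subset by blast
  have "wide q = (\<Union>i\<in>adj' (cl q). {q' \<in> Q. cl q' = i})" by (auto simp: wide_def)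
  then have "sum \<kappa> (wide q) = (\<Sum>i\<in>adj' (cl q). sum \<kappa> {q' \<in> Q. cl q' = i})"
    by (simp only:) (rule sum.UNION_disjoint; use fin_class fin in auto)
  also have "\<dots> \<le> (\<Sum>i\<in>adj' (cl q). 2 * vol)" by (intro sum_mono class_mass_le)
  also have "\<dots> = card (adj' (cl q)) * (2 * vol)" by simp
  also have "\<dots> \<le> D * (2 * vol)" using adj_card[of "cl q"] q vol_pos by (intro mult_right_mono) auto
  finally show ?thesis by (simp add: mult_ac)
qed

text \<open>
  For \<open>i = j\<close> the subtracted term removes the pairs formed by a point with itself, so that
  pairs of distinct points remain.
\<close>

definition ZZ :: "nat \<Rightarrow> 'i \<Rightarrow> 'i \<Rightarrow> ('q \<Rightarrow> nat) \<Rightarrow> real" where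
  "ZZ k i j N = real (Zc k i N) * real (Zc k j N) - of_bool (i = j) * real (Zc k i N)"

lemma ZZ_eq: "ZZ k i j N = (\<Sum>q\<in>{q\<in>Q. cl q = i}. \<Sum>q'\<in>{q\<in>Q. cl q = j}. pr k q q' N)"
proof -
  have pr: "pr k q q' N = real (N q * isol k N q) * real (N q' * isol k N q') -
      (if q' = q then real (N q * isol k N q) else 0)" for q q'
    by (cases "N q") (auto simp: pr_def isol_def algebra_simps)
  have diag: "(\<Sum>q\<in>{q\<in>Q. cl q = i}. \<Sum>q'\<in>{q\<in>Q. cl q = j}. if q' = q then real (N q * isol k N q) else 0) =
      of_bool (i = j) * real (Zc k i N)"
  proof -
    have "(\<Sum>q'\<in>{q\<in>Q. cl q = j}. if q' = q then real (N q * isol k N q) else 0) =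
        of_bool (i = j) * real (N q * isol k N q)" if "q \<in> Q" "cl q = i" for q
      using that fin_class by (auto simp: sum.delta')
    then show ?thesis unfolding Zc_def of_nat_sum sum_distrib_left by (intro sum.cong) auto
  qed
  show ?thesis
    unfolding ZZ_def pr sum_subtractf diag sum_product[symmetric] Zc_def of_nat_sum ..
qed

lemma ZZ_nonneg: "0 \<le> ZZ k i j N"
  unfolding ZZ_eq by (intro sum_nonneg) (auto intro: pr_bounds)

lemma integrable_pr: "q \<in> Q \<Longrightarrow> q' \<in> Q \<Longrightarrow> integrable (PP \<rho>) (pr k q q')"
  by (rule integrable_bounded_pmf[where B="real k * real k"]) (simp add: pr_bounds abs_of_nonneg)

lemma E_ZZ: "E (PP \<rho>) (ZZ k i j) = (\<Sum>q\<in>{q\<in>Q. cl q = i}. \<Sum>q'\<in>{q\<in>Q. cl q = j}. E (PP \<rho>) (pr k q q'))"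
  unfolding ZZ_eq[abs_def]
  by (subst Bochner_Integration.integral_sum)
     (auto intro!: Bochner_Integration.integrable_sum integrable_pr sum.cong Bochner_Integration.integral_sum)

text \<open>
  Bounds the expected number of isolated partners, in adjacent classes, of a given isolated
  point. The terms come from partners in the exceptional set around the point, from the
  other partners in its neighbourhood and from partners outside its neighbourhood.
\<close>

definition pairX :: "nat \<Rightarrow> real \<Rightarrow> real" where
  "pairX k A = \<sigma> * real k + (2 * real k + 2 * real D * A) * PL k (\<gamma> * A)"

text \<open>
  In the exceptional set only the gain of \<open>PL_pred_le\<close> is available, and the small mass of
  this set compensates. Elsewhere the second point must leave a region of mass \<open>\<gamma> *
  vol\<close> almost empty, and the factor \<open>PL k (\<gamma> * A)\<close> beats the mass \<open>2 * D * vol\<close> of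
  the adjacent classes.
\<close>

lemma E_pr_sum_le:
  assumes q: "q \<in> Q" and \<rho>: "0 < \<rho>"
  shows "(\<Sum>q'\<in>wide q. E (PP \<rho>) (pr k q q')) \<le> \<rho> * \<kappa> q * PL k (\<rho> * vol) * pairX k (\<rho> * vol)"
proof -
  define A where "A = \<rho> * vol"
  define P where "P = PL k A"
  define G where "G = PL k (\<gamma> * A)"
  define cs where "cs = {q' \<in> Q. sum \<kappa> (nb q' - nb q) < \<gamma> * vol}"
  have A: "0 < A" using \<rho> vol_pos by (simp add: A_def)
  have PG: "0 \<le> P" "0 \<le> G" "G \<le> 1" using A sg by (auto simp: P_def G_def PL_nonneg PL_le_1)
  have kAP: "PL (k - 1) A \<le> k / A * P" using PL_pred_le[OF A] by (simp add: P_def)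
  have bound: "PL (k - of_bool (q' \<in> nb q)) (\<rho> * sum \<kappa> (nb q)) * PL k (\<rho> * sum \<kappa> (nb q' - nb q)) \<le>
      of_bool (q' \<in> cs) * (k / A * P) + of_bool (q' \<in> nb q) * (k / A * P * G) + P * G" (is "?l * ?r \<le> _")
    if q': "q' \<in> Q" for q'
  proof -
    have l: "?l \<le> (if q' \<in> nb q then k / A * P else P)"
      using PL_nb_le[OF q, of \<rho> "k - 1"] PL_nb_le[OF q, of \<rho> k] \<rho> kAP by (auto simp: A_def P_def)
    have sub: "0 \<le> sum \<kappa> (nb q)" "0 \<le> sum \<kappa> (nb q' - nb q)"
      using nb_sub[OF q] nb_sub[OF q'] by (auto intro!: kap_sum_nonneg)
    have l0: "0 \<le> ?l" "0 \<le> ?r" using \<rho> sub by (auto intro!: PL_nonneg mult_nonneg_nonneg)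
    show ?thesis
    proof (cases "q' \<in> cs")
      case True
      then have "q' \<in> nb q" using far[OF q q'] by (auto simp: cs_def)
      have "?r \<le> 1" using \<rho> sub by (intro PL_le_1 mult_nonneg_nonneg) auto
      then have "?l * ?r \<le> (k / A * P) * 1" using l l0 \<open>q' \<in> nb q\<close> A PG by (intro mult_mono) auto
      moreover have "0 \<le> k / A * P * G" "0 \<le> P * G" using A PG by auto
      ultimately show ?thesis using True \<open>q' \<in> nb q\<close> by simp
    next
      case False
      then have "\<gamma> * vol \<le> sum \<kappa> (nb q' - nb q)" using q' by (auto simp: cs_def)
      then have "\<gamma> * A \<le> \<rho> * sum \<kappa> (nb q' - nb q)"
        using mult_left_mono[of "\<gamma> * vol" _ \<rho>] \<rho> by (simp add: A_def mult_ac)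
      then have r: "?r \<le> G" unfolding G_def using A sg by (intro PL_antimono) auto
      have "?l * ?r \<le> (if q' \<in> nb q then k / A * P else P) * G"
        using l l0 r A PG by (intro mult_mono) auto
      moreover have "0 \<le> P * G" using PG by simp
      ultimately show ?thesis using False by (auto split: if_splits)
    qed
  qed
  have wQ: "wide q \<subseteq> Q" by (auto simp: wide_def)
  have finw: "finite (wide q)" using wQ fin_Q finite_subset by auto
  have "(\<Sum>q'\<in>wide q. E (PP \<rho>) (pr k q q')) \<le> (\<Sum>q'\<in>wide q. \<rho> * \<kappa> q * (\<rho> * \<kappa> q' *
      (of_bool (q' \<in> cs) * (k / A * P) + of_bool (q' \<in> nb q) * (k / A * P * G) + P * G)))"
  proof (rule sum_mono)
    fix q' assume "q' \<in> wide q"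
    then have q': "q' \<in> Q" using wQ by auto
    show "E (PP \<rho>) (pr k q q') \<le> \<rho> * \<kappa> q * (\<rho> * \<kappa> q' *
      (of_bool (q' \<in> cs) * (k / A * P) + of_bool (q' \<in> nb q) * (k / A * P * G) + P * G))"
      using \<rho> kap_nonneg[OF q] kap_nonneg[OF q']
      by (intro order_trans[OF E_pr_le[OF q q']] mult_left_mono bound q') auto
  qed
  also have "\<dots> = \<rho> * \<kappa> q * (\<rho> * ((k / A * P) * (\<Sum>q'\<in>wide q. of_bool (q' \<in> cs) * \<kappa> q') +
      (k / A * P * G) * (\<Sum>q'\<in>wide q. of_bool (q' \<in> nb q) * \<kappa> q') + (P * G) * sum \<kappa> (wide q)))"
    by (simp add: sum_distrib_left sum.distrib algebra_simps)
  also have "\<dots> \<le> \<rho> * \<kappa> q * (\<rho> * ((k / A * P) * (\<sigma> * vol) + (k / A * P * G) * (2 * vol) + (P * G) * (2 * D * vol)))"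
  proof -
    have "(\<Sum>q'\<in>wide q. of_bool (q' \<in> cs) * \<kappa> q') = (\<Sum>q'\<in>wide q \<inter> cs. \<kappa> q')"
      using finw by (simp add: sum.inter_restrict of_bool_def if_distrib[where f="\<lambda>x. x * _"] cong: if_cong)
    also have "\<dots> \<le> sum \<kappa> cs" by (intro kap_sum_mono) (auto simp: cs_def)
    also have "\<dots> \<le> \<sigma> * vol" unfolding cs_def by (rule close[OF q])
    finally have 1: "(\<Sum>q'\<in>wide q. of_bool (q' \<in> cs) * \<kappa> q') \<le> \<sigma> * vol" .
    have "(\<Sum>q'\<in>wide q. of_bool (q' \<in> nb q) * \<kappa> q') = (\<Sum>q'\<in>wide q \<inter> nb q. \<kappa> q')"
      using finw by (simp add: sum.inter_restrict of_bool_def if_distrib[where f="\<lambda>x. x * _"] cong: if_cong)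
    also have "\<dots> \<le> sum \<kappa> (nb q)" using nb_sub[OF q] by (intro kap_sum_mono) auto
    also have "\<dots> \<le> (1 + \<tau>) * vol" by (rule nb_upper[OF q])
    also have "\<dots> \<le> 2 * vol" using tau vol_pos by (intro mult_right_mono) auto
    finally have 2: "(\<Sum>q'\<in>wide q. of_bool (q' \<in> nb q) * \<kappa> q') \<le> 2 * vol" .
    show ?thesis using \<rho> kap_nonneg[OF q] A PG
      by (intro mult_left_mono add_mono 1 2 wide_mass q) auto
  qed
  also have "\<rho> * ((k / A * P) * (\<sigma> * vol) + (k / A * P * G) * (2 * vol) + (P * G) * (2 * D * vol)) =
      A * ((k / A * P) * \<sigma> + (k / A * P * G) * 2 + (P * G) * (2 * D))"
    by (simp add: A_def algebra_simps)
  also have "\<dots> = P * (\<sigma> * real k + (2 * real k + 2 * real D * A) * G)"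
    using A by (simp add: field_simps)
  finally show ?thesis by (simp add: pairX_def P_def G_def A_def mult_ac)
qed

lemma ZZ_total:
  assumes \<rho>: "0 < \<rho>"
  shows "(\<Sum>i\<in>cl ` Q. \<Sum>j\<in>adj' i. E (PP \<rho>) (ZZ k i j)) \<le> \<rho> * PL k (\<rho> * vol) * pairX k (\<rho> * vol)"
proof -
  have fadj: "finite (adj' i)" for i using adj_sub fin_I finite_subset by blast
  have w: "(\<Sum>q'\<in>wide q. f q') = (\<Sum>j\<in>adj' (cl q). \<Sum>q'\<in>{q'\<in>Q. cl q' = j}. f q')" for f :: "'q \<Rightarrow> real" and q
  proof -
    have "wide q = (\<Union>i\<in>adj' (cl q). {q' \<in> Q. cl q' = i})" by (auto simp: wide_def)
    then show ?thesis by (simp only:) (rule sum.UNION_disjoint; use fin_class fadj in auto)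
  qed
  have "(\<Sum>i\<in>cl ` Q. \<Sum>j\<in>adj' i. E (PP \<rho>) (ZZ k i j)) =
      (\<Sum>i\<in>cl ` Q. \<Sum>q\<in>{q\<in>Q. cl q = i}. \<Sum>q'\<in>wide q. E (PP \<rho>) (pr k q q'))"
    unfolding E_ZZ by (subst sum.swap) (auto intro!: sum.cong simp: w)
  also have "\<dots> = (\<Sum>q\<in>Q. \<Sum>q'\<in>wide q. E (PP \<rho>) (pr k q q'))"
    by (rule sum.image_gen[OF fin_Q, symmetric])
  also have "\<dots> \<le> (\<Sum>q\<in>Q. \<rho> * \<kappa> q * PL k (\<rho> * vol) * pairX k (\<rho> * vol))"
    by (intro sum_mono E_pr_sum_le \<rho>)
  also have "\<dots> = \<rho> * PL k (\<rho> * vol) * pairX k (\<rho> * vol)"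
    by (simp add: sum_distrib_right[symmetric] sum_distrib_left[symmetric] kap_sum)
  finally show ?thesis .
qed

text \<open>
  The product expansion is applied to the factors \<open>exp (t * Zc k i)\<close>. Their first-order term
  is \<open>(exp t - 1) * E (Zc k i)\<close> up to pairs of isolated points in one class; the
  correlations of adjacent classes are bounded by pairs of isolated points as well. The last
  summand comes from the deviation of the neighbourhood masses from \<open>vol\<close>.
\<close>

theorem log_mgf_estimate:
  fixes t A e C :: real and k :: nat
  defines "C \<equiv> exp (\<bar>t\<bar> * k)"
  assumes \<rho>: "0 < \<rho>" and A: "A = \<rho> * vol" and e: "e = C * (2 * A * PL k A)" and e1: "e \<le> 1"
    and small: "(1 + 2 * C ^ (6 * D) * D * C) * e \<le> 1 / 2"
  shows "\<bar>ln (E (PP \<rho>) (\<lambda>N. exp (t * Tc k N))) - (exp t - 1) * (\<rho> * PL k A)\<bar> \<le>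
    \<rho> * PL k A * ((C ^ (6 * D) * (D + 1) + 2 * (1 + 2 * C ^ (6 * D) * D * C)\<^sup>2) * (e * C + C\<^sup>2 * pairX k A)
      + 2 * C * pairX k A + \<bar>exp t - 1\<bar> * (1 - exp (- (\<tau> * A))))"
    (is "_ \<le> ?\<beta> * (?K * _ + _ + _)")
proof -
  have C1: "1 \<le> C" by (simp add: C_def)
  have \<rho>0: "0 \<le> \<rho>" using \<rho> by simp
  interpret LP: local_product "PP \<rho>" "cl ` Q" "\<lambda>i N. exp (t * Zc k i N)" "adj'" C D
  proof (rule local_product_cells[OF _ C1])
    show "depends_on (\<lambda>N. t * real (Zc k i N)) (reg i)" for i
      using depends_Zc[of k i] unfolding depends_on_def by metis
    show "\<bar>t * real (Zc k i N)\<bar> \<le> ln C" for i N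
      using Zc_le[of k i N] by (simp add: C_def abs_mult mult_left_mono)
  qed
  have K0: "0 \<le> ?K" using C1 by simp
  have F: "LP.F (cl ` Q) = E (PP \<rho>) (\<lambda>N. exp (t * Tc k N))"
    unfolding LP.F_def Tc_eq_sum_Zc of_nat_sum sum_distrib_left using fin_I by (simp add: exp_sum)
  have iZZ: "integrable (PP \<rho>) (ZZ k i j)" for i j
  proof (rule integrable_bounded_pmf[where B="real k * real k"])
    fix N
    have "real (Zc k i N) * real (Zc k j N) \<le> real k * real k" by (intro mult_mono) (auto simp: Zc_le)
    moreover have "ZZ k i j N \<le> real (Zc k i N) * real (Zc k j N)" by (simp add: ZZ_def)
    ultimately have "ZZ k i j N \<le> real k * real k" by linarith
    then show "\<bar>ZZ k i j N\<bar> \<le> real k * real k" using ZZ_nonneg[of k i j N] by simp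
  qed
  have iw: "integrable (PP \<rho>) (LP.w i)" for i
  proof (rule integrable_bounded_pmf[where B="C * k"])
    fix N
    have "\<bar>LP.w i N\<bar> \<le> C * Zc k i N" unfolding LP.w_def C_def by (rule exp_nat_bounds[OF Zc_le])
    also have "\<dots> \<le> C * k" using C1 Zc_le[of k i N] by (intro mult_left_mono) auto
    finally show "\<bar>LP.w i N\<bar> \<le> C * k" .
  qed
  have Ew: "E (PP \<rho>) (\<lambda>N. \<bar>LP.w i N\<bar>) \<le> C * E (PP \<rho>) (\<lambda>N. real (Zc k i N))" for i
  proof -
    have "E (PP \<rho>) (\<lambda>N. \<bar>LP.w i N\<bar>) \<le> E (PP \<rho>) (\<lambda>N. C * real (Zc k i N))"
    proof (intro integral_mono integrable_abs iw Bochner_Integration.integrable_mult_right integrable_Zc)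
      show "\<bar>LP.w i N\<bar> \<le> C * Zc k i N" for N unfolding LP.w_def C_def by (rule exp_nat_bounds[OF Zc_le])
    qed
    then show ?thesis by simp
  qed
  have Ewe: "E (PP \<rho>) (\<lambda>N. \<bar>LP.w i N\<bar>) \<le> e" for i
  proof -
    have "C * E (PP \<rho>) (\<lambda>N. real (Zc k i N)) \<le> C * (2 * (\<rho> * vol) * PL k (\<rho> * vol))"
      using C1 by (intro mult_left_mono E_Zc_le \<rho>0) auto
    then show ?thesis using Ew[of i] by (simp add: e A)
  qed
  have e0: "0 \<le> e" using order_trans[OF _ Ewe] by (simp add: integral_nonneg_AE)
  have ETc: "(\<Sum>i\<in>cl ` Q. E (PP \<rho>) (\<lambda>N. real (Zc k i N))) \<le> ?\<beta>"
    using E_Tc_le[OF \<rho>0, of k] by (simp add: E_Tc_sum_Zc[symmetric] A)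
  have tot: "(\<Sum>i\<in>cl ` Q. E (PP \<rho>) (ZZ k i i)) + (\<Sum>i\<in>cl ` Q. \<Sum>j\<in>adj' i - {i}. E (PP \<rho>) (ZZ k i j)) \<le> ?\<beta> * pairX k A"
  proof -
    have "(\<Sum>j\<in>adj' i. E (PP \<rho>) (ZZ k i j)) = E (PP \<rho>) (ZZ k i i) + (\<Sum>j\<in>adj' i - {i}. E (PP \<rho>) (ZZ k i j))"
      if "i \<in> cl ` Q" for i
      using adj_self[OF that] adj_sub[of i] fin_I finite_subset by (intro sum.remove) blast+
    then show ?thesis using ZZ_total[OF \<rho>, of k] by (simp add: A sum.distrib)
  qed
  have nn: "0 \<le> (\<Sum>i\<in>cl ` Q. E (PP \<rho>) (ZZ k i i))" "0 \<le> (\<Sum>i\<in>cl ` Q. \<Sum>j\<in>adj' i - {i}. E (PP \<rho>) (ZZ k i j))"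
    by (intro sum_nonneg integral_nonneg_AE; simp add: ZZ_nonneg)+
  have perr: "LP.pair_err j \<le> C\<^sup>2 * (\<Sum>i\<in>adj' j - {j}. E (PP \<rho>) (ZZ k j i))" for j
  proof -
    have "LP.pair_err j = (\<Sum>i\<in>adj' j - {j}. E (PP \<rho>) (\<lambda>N. \<bar>LP.w j N * LP.w i N\<bar>))"
      unfolding LP.pair_err_def using adj_sub[of j] by (intro sum.cong) auto
    also have "\<dots> \<le> (\<Sum>i\<in>adj' j - {j}. E (PP \<rho>) (\<lambda>N. C\<^sup>2 * ZZ k j i N))"
    proof (intro sum_mono integral_mono Bochner_Integration.integrable_mult_right iZZ)
      fix i assume i: "i \<in> adj' j - {j}"
      have *: "\<bar>LP.w j N * LP.w i N\<bar> \<le> C\<^sup>2 * ZZ k j i N" for N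
      proof -
        have "\<bar>LP.w j N\<bar> * \<bar>LP.w i N\<bar> \<le> (C * Zc k j N) * (C * Zc k i N)"
          unfolding LP.w_def C_def by (intro mult_mono exp_nat_bounds[OF Zc_le]) auto
        moreover have "j \<noteq> i" using i by auto
        ultimately show ?thesis by (simp add: abs_mult ZZ_def power2_eq_square mult_ac)
      qed
      then show "\<bar>LP.w j N * LP.w i N\<bar> \<le> C\<^sup>2 * ZZ k j i N" for N .
      have "integrable (PP \<rho>) (\<lambda>N. LP.w j N * LP.w i N)"
        by (rule Bochner_Integration.integrable_bound[of _ "\<lambda>N. C\<^sup>2 * ZZ k j i N"])
           (use * in \<open>auto intro!: iZZ intro: order_trans[OF _ abs_ge_self]\<close>)
      then show "integrable (PP \<rho>) (\<lambda>N. \<bar>LP.w j N * LP.w i N\<bar>)" by (rule integrable_abs)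
    qed
    finally show ?thesis by (simp add: sum_distrib_left)
  qed
  have 1: "\<bar>ln (E (PP \<rho>) (\<lambda>N. exp (t * Tc k N))) - (\<Sum>j\<in>cl ` Q. E (PP \<rho>) (LP.w j))\<bar> \<le>
      ?K * (e * (C * ?\<beta>) + C\<^sup>2 * (?\<beta> * pairX k A))"
  proof -
    have "\<bar>ln (E (PP \<rho>) (\<lambda>N. exp (t * Tc k N))) - (\<Sum>j\<in>cl ` Q. E (PP \<rho>) (LP.w j))\<bar> \<le>
      ?K * (\<Sum>j\<in>cl ` Q. e * E (PP \<rho>) (\<lambda>N. \<bar>LP.w j N\<bar>) + LP.pair_err j)"
      unfolding F[symmetric] by (rule LP.log_estimate[OF Ewe e1 small order_refl])
    also have "\<dots> \<le> ?K * (\<Sum>j\<in>cl ` Q. e * (C * E (PP \<rho>) (\<lambda>N. real (Zc k j N))) +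
        C\<^sup>2 * (\<Sum>i\<in>adj' j - {j}. E (PP \<rho>) (ZZ k j i)))"
      using e0 by (intro mult_left_mono[OF _ K0] sum_mono add_mono perr mult_left_mono Ew)
    also have "\<dots> = ?K * (e * (C * (\<Sum>j\<in>cl ` Q. E (PP \<rho>) (\<lambda>N. real (Zc k j N)))) +
        C\<^sup>2 * (\<Sum>j\<in>cl ` Q. \<Sum>i\<in>adj' j - {j}. E (PP \<rho>) (ZZ k j i)))"
      by (simp add: sum.distrib sum_distrib_left)
    also have "\<dots> \<le> ?K * (e * (C * ?\<beta>) + C\<^sup>2 * (?\<beta> * pairX k A))"
      using e0 C1 ETc tot nn by (intro mult_left_mono[OF _ K0] add_mono mult_left_mono) auto
    finally show ?thesis .
  qed
  have 2: "\<bar>(\<Sum>j\<in>cl ` Q. E (PP \<rho>) (LP.w j)) - (exp t - 1) * E (PP \<rho>) (\<lambda>N. real (Tc k N))\<bar> \<le>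
      2 * C * (?\<beta> * pairX k A)"
  proof -
    have d: "\<bar>E (PP \<rho>) (LP.w j) - (exp t - 1) * E (PP \<rho>) (\<lambda>N. real (Zc k j N))\<bar> \<le> 2 * C * E (PP \<rho>) (ZZ k j j)" for j
    proof -
      have "\<bar>E (PP \<rho>) (\<lambda>N. LP.w j N - (exp t - 1) * real (Zc k j N))\<bar> \<le> E (PP \<rho>) (\<lambda>N. 2 * C * ZZ k j j N)"
      proof (rule abs_E_le)
        show "\<bar>LP.w j N - (exp t - 1) * real (Zc k j N)\<bar> \<le> 2 * C * ZZ k j j N" for N
          using exp_nat_bounds(2)[where z="Zc k j N" and k=k and t=t, OF Zc_le] by (simp add: LP.w_def ZZ_def C_def)
      qed (intro Bochner_Integration.integrable_diff iw Bochner_Integration.integrable_mult_right integrable_Zc iZZ)+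
      then show ?thesis by (simp add: iw integrable_Zc)
    qed
    have "\<bar>(\<Sum>j\<in>cl ` Q. E (PP \<rho>) (LP.w j)) - (exp t - 1) * E (PP \<rho>) (\<lambda>N. real (Tc k N))\<bar> =
        \<bar>\<Sum>j\<in>cl ` Q. E (PP \<rho>) (LP.w j) - (exp t - 1) * E (PP \<rho>) (\<lambda>N. real (Zc k j N))\<bar>"
      by (simp add: E_Tc_sum_Zc sum_subtractf sum_distrib_left)
    also have "\<dots> \<le> (\<Sum>j\<in>cl ` Q. 2 * C * E (PP \<rho>) (ZZ k j j))"
      by (intro order_trans[OF sum_abs] sum_mono d)
    also have "\<dots> = 2 * C * (\<Sum>j\<in>cl ` Q. E (PP \<rho>) (ZZ k j j))" by (simp add: sum_distrib_left)
    also have "\<dots> \<le> 2 * C * (?\<beta> * pairX k A)" using C1 tot nn by (intro mult_left_mono) auto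
    finally show ?thesis .
  qed
  have 3: "\<bar>(exp t - 1) * E (PP \<rho>) (\<lambda>N. real (Tc k N)) - (exp t - 1) * ?\<beta>\<bar> \<le>
      \<bar>exp t - 1\<bar> * (?\<beta> * (1 - exp (- (\<tau> * A))))"
  proof -
    have "\<bar>E (PP \<rho>) (\<lambda>N. real (Tc k N)) - ?\<beta>\<bar> \<le> ?\<beta> * (1 - exp (- (\<tau> * A)))"
      using E_Tc_le[OF \<rho>0, of k] E_Tc_ge[OF \<rho>0, of k] by (simp add: A algebra_simps)
    then show ?thesis
      unfolding right_diff_distrib[symmetric] abs_mult by (intro mult_left_mono) auto
  qed
  show ?thesis using 1 2 3 by (simp add: algebra_simps)
qed

text \<open>
  The probability that an additional random point would be isolated in the configuration
  \<open>N\<close>.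
\<close>

definition Vc :: "nat \<Rightarrow> ('q \<Rightarrow> nat) \<Rightarrow> real" where
  "Vc k N = (\<Sum>q\<in>Q. \<kappa> q * of_bool (sum N (nb q) < k))"

text \<open>
  This moment controls the error of the coupling below, where only the order of the exponent
  matters. The condition on \<open>t\<close> and \<open>s\<close> keeps every factor below \<open>exp 1\<close>, and then inserting
  the factors one after the other is precise enough.
\<close>

theorem crude_mgf_bound:
  fixes \<rho> t s :: real and k :: nat
  assumes \<rho>: "0 \<le> \<rho>" and ts: "0 \<le> t" "0 \<le> s" "t * (2 * (\<rho> * vol)) + s * k \<le> 1"
  shows "E (PP \<rho>) (\<lambda>N. exp (t * (\<rho> * Vc k N) + s * Tc k N)) \<le>
    exp (exp 1 ^ (4 * D) * (exp 1 * ((t + s) * (\<rho> * PL k (\<rho> * vol)))))"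
proof -
  define V where "V i N = (\<Sum>q\<in>{q\<in>Q. cl q = i}. \<kappa> q * of_bool (sum N (nb q) < k))" for i and N :: "'q \<Rightarrow> nat"
  define g where "g i N = t * (\<rho> * V i N) + s * Zc k i N" for i N
  have V0: "0 \<le> V i N" for i N unfolding V_def using kap_nonneg by (intro sum_nonneg) auto
  have V1: "V i N \<le> 2 * vol" for i N
  proof -
    have "V i N \<le> sum \<kappa> {q\<in>Q. cl q = i}" unfolding V_def using kap_nonneg by (intro sum_mono) auto
    then show ?thesis using class_mass_le[of i] by linarith
  qed
  have g0: "0 \<le> g i N" for i N using V0 ts \<rho> by (simp add: g_def)
  have g1: "g i N \<le> 1" for i N
  proof -
    have "t * (\<rho> * V i N) \<le> t * (\<rho> * (2 * vol))" using ts \<rho> V1 by (intro mult_left_mono) auto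
    moreover have "s * Zc k i N \<le> s * k" using ts Zc_le by (intro mult_left_mono) auto
    moreover have "t * (\<rho> * (2 * vol)) = t * (2 * (\<rho> * vol))" by simp
    ultimately show ?thesis using ts(3) unfolding g_def by linarith
  qed
  have depV: "depends_on (V i) (reg i)" for i
    unfolding depends_on_def V_def
  proof (intro allI impI sum.cong refl)
    fix N N' :: "'q \<Rightarrow> nat" and q assume eq: "\<forall>x\<in>reg i. N x = N' x" and "q \<in> {q \<in> Q. cl q = i}"
    then have "sum N (nb q) = sum N' (nb q)" by (intro sum.cong) (auto simp: reg_def)
    then show "\<kappa> q * of_bool (sum N (nb q) < k) = \<kappa> q * of_bool (sum N' (nb q) < k)" by simp
  qed
  interpret LP: local_product "PP \<rho>" "cl ` Q" "\<lambda>i N. exp (g i N)" "adj'" "exp 1" D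
  proof (rule local_product_cells)
    show "depends_on (g i) (reg i)" for i
      using depV[of i] depends_Zc[of k i] unfolding g_def[abs_def] depends_on_def by metis
    show "\<bar>g i N\<bar> \<le> ln (exp 1)" for i N using g0[of i N] g1[of i N] by simp
  qed simp
  have ig: "integrable (PP \<rho>) (g i)" for i
    by (rule integrable_bounded_pmf[where B=1]) (use g0 g1 in \<open>simp add: abs_of_nonneg\<close>)
  have iV: "integrable (PP \<rho>) (\<lambda>N. \<kappa> q * of_bool (sum N (nb q) < k))" for q
    by (rule integrable_bounded_pmf[where B="\<bar>\<kappa> q\<bar>"]) simp
  have Ew: "E (PP \<rho>) (\<lambda>N. \<bar>LP.w i N\<bar>) \<le> exp 1 * E (PP \<rho>) (g i)" for i
  proof -
    have b: "\<bar>LP.w i N\<bar> \<le> exp 1 * g i N" for N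
    proof -
      have "exp (g i N) - 1 \<le> g i N * exp (g i N)" by (rule exp_minus_one_le)
      also have "\<dots> \<le> g i N * exp 1" using g0[of i N] g1[of i N] by (intro mult_left_mono) auto
      finally show ?thesis using g0[of i N] by (simp add: LP.w_def mult_ac)
    qed
    have "integrable (PP \<rho>) (LP.w i)"
    proof (rule integrable_bounded_pmf)
      show "\<bar>LP.w i N\<bar> \<le> exp 1 * 1" for N
        using b[of N] g1[of i N] by (intro order_trans[OF b] mult_left_mono) auto
    qed
    then have "E (PP \<rho>) (\<lambda>N. \<bar>LP.w i N\<bar>) \<le> E (PP \<rho>) (\<lambda>N. exp 1 * g i N)"
      by (intro integral_mono integrable_abs Bochner_Integration.integrable_mult_right ig b)
    then show ?thesis by simp
  qed
  have Eg: "(\<Sum>i\<in>cl ` Q. E (PP \<rho>) (g i)) \<le> (t + s) * (\<rho> * PL k (\<rho> * vol))"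
  proof -
    have EV: "E (PP \<rho>) (V i) = (\<Sum>q\<in>{q\<in>Q. cl q = i}. \<kappa> q * PL k (\<rho> * sum \<kappa> (nb q)))" for i
      unfolding V_def[abs_def]
    proof (subst Bochner_Integration.integral_sum)
      show "(\<Sum>q\<in>{q \<in> Q. cl q = i}. E (PP \<rho>) (\<lambda>x. \<kappa> q * of_bool (sum x (nb q) < k))) =
        (\<Sum>q\<in>{q \<in> Q. cl q = i}. \<kappa> q * PL k (\<rho> * sum \<kappa> (nb q)))"
        by (intro sum.cong) (auto simp: E_count_less[OF nb_sub \<rho>])
    qed (rule iV)
    have iV': "integrable (PP \<rho>) (V i)" for i
      unfolding V_def[abs_def] by (intro Bochner_Integration.integrable_sum iV)
    have "E (PP \<rho>) (g i) = t * (\<rho> * E (PP \<rho>) (V i)) + s * E (PP \<rho>) (\<lambda>N. real (Zc k i N))" for i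
      unfolding g_def[abs_def] using iV'[of i] integrable_Zc[of \<rho> k i] by simp
    also have "t * (\<rho> * E (PP \<rho>) (V i)) + s * E (PP \<rho>) (\<lambda>N. real (Zc k i N)) = (t + s) * E (PP \<rho>) (\<lambda>N. real (Zc k i N))" for i
    proof -
      have "E (PP \<rho>) (\<lambda>N. real (Zc k i N)) = \<rho> * E (PP \<rho>) (V i)"
        unfolding EV E_Zc[OF \<rho>]
        by (simp only: sum_distrib_left[of \<rho> "\<lambda>q. \<kappa> q * PL k (\<rho> * sum \<kappa> (nb q))"] mult.assoc)
      then show ?thesis by (simp add: distrib_right)
    qed
    finally have "(\<Sum>i\<in>cl ` Q. E (PP \<rho>) (g i)) = (t + s) * E (PP \<rho>) (\<lambda>N. real (Tc k N))"
      by (simp add: E_Tc_sum_Zc sum_distrib_left)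
    also have "\<dots> \<le> (t + s) * (\<rho> * PL k (\<rho> * vol))"
      using ts by (intro mult_left_mono E_Tc_le \<rho>) auto
    finally show ?thesis .
  qed
  have "(\<lambda>N. exp (t * (\<rho> * Vc k N) + s * Tc k N)) = (\<lambda>N. \<Prod>i\<in>cl ` Q. exp (g i N))"
  proof
    fix N
    have "Vc k N = (\<Sum>i\<in>cl ` Q. V i N)"
      unfolding Vc_def V_def by (rule sum.image_gen[OF fin_Q])
    then have "t * (\<rho> * Vc k N) + s * Tc k N = (\<Sum>i\<in>cl ` Q. g i N)"
      by (simp add: g_def Tc_eq_sum_Zc sum.distrib sum_distrib_left)
    then show "exp (t * (\<rho> * Vc k N) + s * Tc k N) = (\<Prod>i\<in>cl ` Q. exp (g i N))"
      using fin_I by (simp add: exp_sum)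
  qed
  then have "E (PP \<rho>) (\<lambda>N. exp (t * (\<rho> * Vc k N) + s * Tc k N)) = LP.F (cl ` Q)"
    by (simp add: LP.F_def)
  also have "\<dots> \<le> exp (exp 1 ^ (4 * D) * (\<Sum>j\<in>cl ` Q. E (PP \<rho>) (\<lambda>N. \<bar>LP.w j N\<bar>)))"
    by (rule LP.crude_bound) simp
  also have "\<dots> \<le> exp (exp 1 ^ (4 * D) * (exp 1 * ((t + s) * (\<rho> * PL k (\<rho> * vol)))))"
  proof (subst exp_le_cancel_iff, rule mult_left_mono)
    have "(\<Sum>j\<in>cl ` Q. E (PP \<rho>) (\<lambda>N. \<bar>LP.w j N\<bar>)) \<le> (\<Sum>j\<in>cl ` Q. exp 1 * E (PP \<rho>) (g j))"
      by (intro sum_mono Ew)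
    also have "\<dots> = exp 1 * (\<Sum>j\<in>cl ` Q. E (PP \<rho>) (g j))" by (simp add: sum_distrib_left)
    also have "\<dots> \<le> exp 1 * ((t + s) * (\<rho> * PL k (\<rho> * vol)))" by (intro mult_left_mono Eg) auto
    finally show "(\<Sum>j\<in>cl ` Q. E (PP \<rho>) (\<lambda>N. \<bar>LP.w j N\<bar>)) \<le> exp 1 * ((t + s) * (\<rho> * PL k (\<rho> * vol)))" .
  qed simp
  finally show ?thesis .
qed

end

section \<open>Poisson counts as a mixture of multinomial counts\<close>

lemma nn_expectation_eq: "(\<And>x. 0 \<le> f x) \<Longrightarrow> integrable (measure_pmf p) f \<Longrightarrow> (\<integral>\<^sup>+x. ennreal (f x) \<partial>measure_pmf p) = ennreal (E p f)"
  by (intro nn_integral_eq_integral) auto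

lemma exp_quadratic:
  fixes u :: real
  assumes "\<bar>u\<bar> \<le> 1"
  shows "exp u \<le> 1 + u + u\<^sup>2"
proof (cases "0 \<le> u")
  case True
  then show ?thesis using exp_bound[of u] assms by simp
next
  case False
  define x where "x = - u"
  have x: "0 < x" "u = - x" using False by (auto simp: x_def)
  have "exp (- x) \<le> 1 / (1 + x)"
    using exp_ge_add_one_self[of x] x by (simp add: exp_minus field_simps)
  also have "\<dots> \<le> 1 - x + x\<^sup>2"
  proof -
    have "(1 - x + x\<^sup>2) * (1 + x) = 1 + x ^ 3" by (simp add: algebra_simps power2_eq_square power3_eq_cube)
    then show ?thesis using x by (simp add: field_simps)
  qed
  finally show ?thesis by (simp add: x(2))
qed

lemma pois_mgf:
  assumes "0 \<le> \<rho>"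
  shows "(\<integral>\<^sup>+j. ennreal (exp (u * real j)) \<partial>pois \<rho>) = ennreal (exp (\<rho> * (exp u - 1)))"
proof -
  have s: "(\<lambda>j. exp (- \<rho>) * ((\<rho> * exp u) ^ j /\<^sub>R fact j)) sums (exp (- \<rho>) * exp (\<rho> * exp u))"
    by (intro sums_mult exp_converges)
  have t: "pmf (pois \<rho>) j * exp (u * real j) = exp (- \<rho>) * ((\<rho> * exp u) ^ j /\<^sub>R fact j)" for j
    using assms by (simp add: pmf_pois power_mult_distrib exp_of_nat_mult[symmetric] divide_inverse mult_ac)
  have "(\<integral>\<^sup>+j. ennreal (exp (u * real j)) \<partial>pois \<rho>) = (\<Sum>j. ennreal (pmf (pois \<rho>) j * exp (u * real j)))"
    by (simp add: nn_integral_measure_pmf nn_integral_count_space_nat ennreal_mult)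
  also have "\<dots> = ennreal (\<Sum>j. pmf (pois \<rho>) j * exp (u * real j))"
  proof (rule suminf_ennreal2)
    show "summable (\<lambda>j. pmf (pois \<rho>) j * exp (u * real j))" unfolding t using s by (rule sums_summable)
  qed simp
  also have "(\<Sum>j. pmf (pois \<rho>) j * exp (u * real j)) = exp (- \<rho>) * exp (\<rho> * exp u)"
    unfolding t using s by (simp add: sums_iff)
  finally show ?thesis by (simp add: mult_exp_exp algebra_simps)
qed

lemma pois_chernoff:
  assumes "0 \<le> \<rho>"
  shows "measure (pois \<rho>) {j. 0 \<le> u * (real j - a)} \<le> exp (\<rho> * (exp u - 1) - u * a)"
proof -
  have "ennreal (measure (pois \<rho>) {j. 0 \<le> u * (real j - a)}) = (\<integral>\<^sup>+j. indicator {j. 0 \<le> u * (real j - a)} j \<partial>pois \<rho>)"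
    by (simp add: measure_pmf.emeasure_eq_measure)
  also have "\<dots> \<le> (\<integral>\<^sup>+j. ennreal (exp (- u * a)) * ennreal (exp (u * real j)) \<partial>pois \<rho>)"
    by (intro nn_integral_mono)
       (auto simp: indicator_def ennreal_mult[symmetric] mult_exp_exp algebra_simps)
  also have "\<dots> = ennreal (exp (- u * a) * exp (\<rho> * (exp u - 1)))"
    by (simp add: nn_integral_cmult pois_mgf[OF assms] ennreal_mult)
  finally show ?thesis by (simp add: mult_exp_exp algebra_simps)
qed

lemma pois_concentration:
  assumes "0 < \<rho>" "0 < \<epsilon>" "\<epsilon> \<le> 1"
  shows "measure (pois \<rho>) {j. \<not> (\<rho> * (1 - \<epsilon>) \<le> real j \<and> real j \<le> \<rho> * (1 + \<epsilon>))} \<le> 2 * exp (- (\<rho> * \<epsilon>\<^sup>2 / 4))"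
proof -
  have e: "\<rho> * (exp u - 1) - u * (\<rho> * (1 + 2 * u)) \<le> - (\<rho> * \<epsilon>\<^sup>2 / 4)" if "u = \<epsilon> / 2 \<or> u = - (\<epsilon> / 2)" for u
  proof -
    have "\<bar>u\<bar> \<le> 1" using that assms by auto
    then have "\<rho> * (exp u - 1 - u - 2 * u\<^sup>2) \<le> \<rho> * (- u\<^sup>2)"
      using exp_quadratic[of u] assms by (intro mult_left_mono) auto
    moreover have "\<rho> * (- u\<^sup>2) = - (\<rho> * \<epsilon>\<^sup>2 / 4)" using that by (auto simp: power2_eq_square)
    moreover have "\<rho> * (exp u - 1) - u * (\<rho> * (1 + 2 * u)) = \<rho> * (exp u - 1 - u - 2 * u\<^sup>2)"
      by (simp add: algebra_simps power2_eq_square)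
    ultimately show ?thesis by linarith
  qed
  have "{j. \<not> (\<rho> * (1 - \<epsilon>) \<le> real j \<and> real j \<le> \<rho> * (1 + \<epsilon>))} \<subseteq>
     {j. 0 \<le> (\<epsilon> / 2) * (real j - \<rho> * (1 + 2 * (\<epsilon> / 2)))} \<union> {j. 0 \<le> (- (\<epsilon> / 2)) * (real j - \<rho> * (1 + 2 * (- (\<epsilon> / 2))))}"
    (is "_ \<subseteq> ?S1 \<union> ?S2")
    using assms by (auto simp: mult_le_0_iff zero_le_mult_iff)
  then have "measure (pois \<rho>) {j. \<not> (\<rho> * (1 - \<epsilon>) \<le> real j \<and> real j \<le> \<rho> * (1 + \<epsilon>))} \<le> measure (pois \<rho>) (?S1 \<union> ?S2)"
    by (intro measure_pmf.finite_measure_mono) auto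
  also have "\<dots> \<le> measure (pois \<rho>) ?S1 + measure (pois \<rho>) ?S2"
    by (intro measure_Un_le) auto
  also have "\<dots> \<le> exp (- (\<rho> * \<epsilon>\<^sup>2 / 4)) + exp (- (\<rho> * \<epsilon>\<^sup>2 / 4))"
  proof (rule add_mono)
    have \<rho>: "0 \<le> \<rho>" using assms by simp
    show "measure (pois \<rho>) ?S1 \<le> exp (- (\<rho> * \<epsilon>\<^sup>2 / 4))" "measure (pois \<rho>) ?S2 \<le> exp (- (\<rho> * \<epsilon>\<^sup>2 / 4))"
      using order_trans[OF pois_chernoff[OF \<rho>] exp_le_cancel_iff[THEN iffD2, OF e]] by blast+
  qed
  finally show ?thesis by simp
qed

text \<open>
  Young's inequality with the weights \<open>\<theta>\<close> and \<open>1 - \<theta>\<close>. With \<open>c\<close> equal to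
  \<open>\<theta>\<close> times the logarithm of the expectation of \<open>exp (u / \<theta>)\<close> it yields
  Hoelder's inequality. As long as \<open>c\<close> is free, the bound is linear in the expectations, so
  that it can be averaged over the number of points.
\<close>

lemma young_exp:
  fixes \<theta> u w c :: real
  assumes "0 < \<theta>" "\<theta> < 1"
  shows "exp (u + w) \<le> exp c * (\<theta> * exp (- c / \<theta>) * exp (u / \<theta>) + (1 - \<theta>) * exp (w / (1 - \<theta>)))"
proof -
  have "exp (\<theta> * ((u - c) / \<theta>) + (1 - \<theta>) * (w / (1 - \<theta>))) \<le> \<theta> * exp ((u - c) / \<theta>) + (1 - \<theta>) * exp (w / (1 - \<theta>))"
    using assms convex_onD[OF exp_convex, where t="1 - \<theta>" and x="(u - c) / \<theta>" and y="w / (1 - \<theta>)"] by simp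
  then have "exp c * exp (u - c + w) \<le> exp c * (\<theta> * exp ((u - c) / \<theta>) + (1 - \<theta>) * exp (w / (1 - \<theta>)))"
    using assms by (intro mult_left_mono) auto
  moreover have e2: "exp ((u - c) / \<theta>) = exp (- c / \<theta>) * exp (u / \<theta>)"
    by (simp add: mult_exp_exp diff_divide_distrib)
  moreover have e1: "exp c * exp (u - c + w) = exp (u + w)" by (simp add: mult_exp_exp)
  ultimately show ?thesis unfolding e1 e2 by (simp only: mult.assoc)
qed

context cell_system
begin

definition kp :: "'q pmf" where
  "kp = embed_pmf (\<lambda>q. if q \<in> Q then \<kappa> q else 0)"

lemma pmf_kp: "pmf kp q = (if q \<in> Q then \<kappa> q else 0)"
  unfolding kp_def
proof (rule pmf_embed_pmf)
  have "(\<integral>\<^sup>+ q. ennreal (if q \<in> Q then \<kappa> q else 0) \<partial>count_space UNIV) = (\<Sum>q\<in>Q. ennreal (\<kappa> q))"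
    using fin_Q by (subst nn_integral_count_space'[of Q]) auto
  also have "\<dots> = ennreal (sum \<kappa> Q)" using kap_nonneg by (intro sum_ennreal) auto
  finally show "(\<integral>\<^sup>+ q. ennreal (if q \<in> Q then \<kappa> q else 0) \<partial>count_space UNIV) = 1" by (simp add: kap_sum)
qed (simp add: kap_nonneg)

lemma set_kp: "set_pmf kp \<subseteq> Q"
  by (auto simp: set_pmf_iff pmf_kp split: if_splits)

lemma fin_kp: "finite (set_pmf kp)" using set_kp fin_Q finite_subset by auto

lemma E_kp: "E kp f = (\<Sum>q\<in>Q. \<kappa> q * f q)"
  using set_kp by (subst integral_measure_pmf_real[OF fin_Q]) (auto simp: pmf_kp mult_ac)

abbreviation rep :: "nat \<Rightarrow> 'q list pmf" where "rep n \<equiv> replicate_pmf n kp"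

lemma fin_rep: "finite (set_pmf (rep n))"
proof -
  have "set_pmf (rep n) = {xs. set xs \<subseteq> set_pmf kp \<and> length xs = n}"
    by (auto simp: set_replicate_pmf)
  then show ?thesis using finite_lists_length_eq[OF fin_kp, of n] by simp
qed

lemma rep_sub: "xs \<in> set_pmf (rep n) \<Longrightarrow> set xs \<subseteq> Q"
  using set_kp by (auto simp: set_replicate_pmf)

lemma integrable_rep: "integrable (rep n) (f :: _ \<Rightarrow> real)"
  by (rule integrable_measure_pmf_finite[OF fin_rep])

lemma E_bind_finite:
  assumes "finite (set_pmf p)" "\<And>x. x \<in> set_pmf p \<Longrightarrow> finite (set_pmf (q x))" "\<And>x. 0 \<le> f x"
  shows "E (bind_pmf p q) f = E p (\<lambda>x. E (q x) f)"
proof -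
  have nn: "(\<integral>\<^sup>+x. ennreal (f x) \<partial>measure_pmf r) = ennreal (E r f)" if "finite (set_pmf r)" for r
    using that assms by (intro nn_expectation_eq integrable_measure_pmf_finite)
  have "ennreal (E (bind_pmf p q) f) = (\<integral>\<^sup>+x. (\<integral>\<^sup>+y. ennreal (f y) \<partial>q x) \<partial>p)"
    using assms by (subst nn[symmetric]) auto
  also have "\<dots> = (\<integral>\<^sup>+x. ennreal (E (q x) f) \<partial>p)"
    using assms by (intro nn_integral_cong_AE) (auto simp: AE_measure_pmf_iff nn)
  also have "\<dots> = ennreal (E p (\<lambda>x. E (q x) f))"
    using assms by (intro nn_expectation_eq integrable_measure_pmf_finite integral_nonneg_AE) auto
  finally show ?thesis
    using assms by (subst (asm) ennreal_inj) (auto intro!: integral_nonneg_AE)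
qed

lemma E_rep_append:
  assumes "\<And>x. 0 \<le> f x"
  shows "E (rep (m + n)) f = E (rep m) (\<lambda>xs. E (rep n) (\<lambda>ys. f (xs @ ys)))"
proof -
  have "E (rep (m + n)) f = E (rep m) (\<lambda>xs. E (bind_pmf (rep n) (\<lambda>ys. return_pmf (xs @ ys))) f)"
    unfolding replicate_pmf_distrib
    by (rule E_bind_finite) (use assms fin_rep in auto)
  also have "\<dots> = E (rep m) (\<lambda>xs. E (rep n) (\<lambda>ys. f (xs @ ys)))"
    using assms fin_rep by (simp add: E_bind_finite)
  finally show ?thesis .
qed

text \<open>
  The multinomial weights, by induction on the number of labels: if the new label is \<open>q\<close>,
  the others have the counts \<open>N\<close> with one point of \<open>q\<close> removed. This contributes the share
  \<open>N q\<close> of the weight, and these shares add up to the number of labels.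
\<close>

lemma pmf_counts:
  "pmf (map_pmf count_list (rep j)) N =
    (if (\<forall>q. q \<notin> Q \<longrightarrow> N q = 0) \<and> sum N Q = j then fact j * (\<Prod>q\<in>Q. \<kappa> q ^ N q / fact (N q)) else 0)"
proof (induction j arbitrary: N)
  case 0
  have c: "count_list [] = (\<lambda>q. 0 :: nat)" by (simp add: fun_eq_iff)
  have "(\<forall>q. q \<notin> Q \<longrightarrow> N q = 0) \<and> sum N Q = 0 \<longleftrightarrow> N = (\<lambda>_. 0)"
    using fin_Q by (auto simp: fun_eq_iff)
  then show ?case by (auto simp: c)
next
  case (Suc j)
  define up where "up q M = M(q := Suc (M q))" for q :: 'q and M :: "'q \<Rightarrow> nat"
  have cc: "count_list (x # xs) = up x (count_list xs)" for x :: 'q and xs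
    by (auto simp: up_def fun_eq_iff)
  have inj: "inj (up q)" for q
  proof (rule injI)
    fix M M' assume "up q M = up q M'"
    then have "up q M x = up q M' x" for x by simp
    then have "M x = M' x" for x unfolding up_def by (cases "x = q") (metis fun_upd_same nat.inject, metis fun_upd_other)
    then show "M = M'" by auto
  qed
  have pm: "pmf (map_pmf (up q) R) N = (if N q = 0 then 0 else pmf R (N(q := N q - 1)))" for q R
  proof (cases "N q = 0")
    case True
    then have "N \<notin> up q ` set_pmf R" by (auto simp: up_def)
    then show ?thesis using True by (simp add: pmf_map_outside)
  next
    case False
    then have "N = up q (N(q := N q - 1))" by (auto simp: up_def)
    then show ?thesis using False pmf_map_inj'[OF inj, of q R "N(q := N q - 1)"] by simp
  qed
  define pp where "pp = (\<Prod>q\<in>Q. \<kappa> q ^ N q / fact (N q))"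
  have "map_pmf count_list (rep (Suc j)) = bind_pmf kp (\<lambda>x. map_pmf (up x) (map_pmf count_list (rep j)))"
    by (simp add: map_bind_pmf pmf.map_comp o_def cc map_pmf_def bind_assoc_pmf bind_return_pmf)
  then have "pmf (map_pmf count_list (rep (Suc j))) N = E kp (\<lambda>x. pmf (map_pmf (up x) (map_pmf count_list (rep j))) N)"
    by (simp only: pmf_bind)
  also have "\<dots> = (\<Sum>q\<in>Q. \<kappa> q * (if N q = 0 then 0 else pmf (map_pmf count_list (rep j)) (N(q := N q - 1))))"
    unfolding pm E_kp ..
  also have "\<dots> = (\<Sum>q\<in>Q. if (\<forall>q. q \<notin> Q \<longrightarrow> N q = 0) \<and> sum N Q = Suc j then real (N q) * (fact j * pp) else 0)"
  proof (rule sum.cong[OF refl])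
    fix q assume q: "q \<in> Q"
    show "\<kappa> q * (if N q = 0 then 0 else pmf (map_pmf count_list (rep j)) (N(q := N q - 1))) =
      (if (\<forall>q. q \<notin> Q \<longrightarrow> N q = 0) \<and> sum N Q = Suc j then real (N q) * (fact j * pp) else 0)"
    proof (cases "N q")
      case (Suc l)
      let ?M = "N(q := l)"
      have s: "sum N Q = Suc (sum ?M Q)"
        using fin_Q q Suc by (simp add: sum.remove[of Q q])
      have "(\<Prod>x\<in>Q. \<kappa> x ^ ?M x / fact (?M x)) = \<kappa> q ^ l / fact l * (\<Prod>x\<in>Q - {q}. \<kappa> x ^ N x / fact (N x))"
        using fin_Q q by (simp add: prod.remove[of Q q])
      moreover have "pp = \<kappa> q ^ Suc l / fact (Suc l) * (\<Prod>x\<in>Q - {q}. \<kappa> x ^ N x / fact (N x))"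
        unfolding pp_def using fin_Q q Suc by (simp add: prod.remove[of Q q])
      moreover have "\<kappa> q * (\<kappa> q ^ l / fact l) = real (Suc l) * (\<kappa> q ^ Suc l / fact (Suc l))"
        by (simp add: divide_simps del: of_nat_Suc)
      ultimately have "\<kappa> q * (\<Prod>x\<in>Q. \<kappa> x ^ ?M x / fact (?M x)) = real (Suc l) * pp"
        by (metis mult.assoc)
      moreover have "(\<forall>x. x \<notin> Q \<longrightarrow> ?M x = 0) \<longleftrightarrow> (\<forall>x. x \<notin> Q \<longrightarrow> N x = 0)" using q by auto
      ultimately show ?thesis unfolding Suc.IH using Suc s by (auto simp: mult_ac simp del: fun_upd_apply)
    qed simp
  qed
  also have "\<dots> = (if (\<forall>q. q \<notin> Q \<longrightarrow> N q = 0) \<and> sum N Q = Suc j then real (sum N Q) * (fact j * pp) else 0)"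
  proof -
    have "(\<Sum>q\<in>Q. if P then real (N q) * c else 0) = (if P then real (sum N Q) * c else 0)" for P c
      by (simp add: sum_distrib_right)
    then show ?thesis .
  qed
  finally show ?case by (auto simp: pp_def)
qed

text \<open>
  The factor \<open>fact j\<close> of the multinomial weights cancels against the Poisson weight of \<open>j\<close>.
  Because the masses of the cells add up to one, the rest is a product of Poisson weights
  over the cells.
\<close>

lemma mixture_eq:
  assumes \<rho>: "0 \<le> \<rho>"
  shows "bind_pmf (pois \<rho>) (\<lambda>j. map_pmf count_list (rep j)) = PP \<rho>"
proof (rule pmf_eqI)
  fix N :: "'q \<Rightarrow> nat"
  let ?m = "sum N Q" and ?c = "\<forall>q. q \<notin> Q \<longrightarrow> N q = 0"
  have "pmf (bind_pmf (pois \<rho>) (\<lambda>j. map_pmf count_list (rep j))) N =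
      E (pois \<rho>) (\<lambda>j. if ?c \<and> ?m = j then fact ?m * (\<Prod>q\<in>Q. \<kappa> q ^ N q / fact (N q)) else 0)"
    unfolding pmf_bind pmf_counts by (intro Bochner_Integration.integral_cong) auto
  also have "\<dots> = (\<Sum>j\<in>{?m}. (if ?c \<and> ?m = j then fact ?m * (\<Prod>q\<in>Q. \<kappa> q ^ N q / fact (N q)) else 0) * pmf (pois \<rho>) j)"
    by (rule integral_measure_pmf_real) (auto split: if_splits)
  also have "\<dots> = (if ?c then (\<Prod>q\<in>Q. \<kappa> q ^ N q / fact (N q)) * (\<rho> ^ ?m * exp (- \<rho>)) else 0)"
    using \<rho> by (auto simp: pmf_pois)
  also have "\<rho> ^ ?m * exp (- \<rho>) = (\<Prod>q\<in>Q. \<rho> ^ N q * exp (- (\<rho> * \<kappa> q)))"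
  proof -
    have "- \<rho> = (\<Sum>q\<in>Q. - (\<rho> * \<kappa> q))"
      by (simp add: sum_negf kap_sum flip: sum_distrib_left)
    then show ?thesis using fin_Q by (simp add: power_sum prod.distrib exp_sum)
  qed
  also have "(if ?c then (\<Prod>q\<in>Q. \<kappa> q ^ N q / fact (N q)) * (\<Prod>q\<in>Q. \<rho> ^ N q * exp (- (\<rho> * \<kappa> q))) else 0) = pmf (PP \<rho>) N"
    unfolding PP_def pmf_Pi[OF fin_Q] prod.distrib[symmetric]
    using \<rho> kap_nonneg by (auto simp: pmf_pois power_mult_distrib mult_ac intro!: prod.cong)
  finally show "pmf (bind_pmf (pois \<rho>) (\<lambda>j. map_pmf count_list (rep j))) N = pmf (PP \<rho>) N" .
qed

lemma nn_PP_mixture: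
  assumes "0 \<le> \<rho>"
  shows "(\<integral>\<^sup>+N. h N \<partial>PP \<rho>) = (\<integral>\<^sup>+j. (\<integral>\<^sup>+xs. h (count_list xs) \<partial>rep j) \<partial>pois \<rho>)"
  unfolding mixture_eq[OF assms, symmetric] by simp

lemma mixture_partial:
  assumes \<rho>: "0 \<le> \<rho>" and h: "\<And>N. 0 \<le> h N" and ih: "integrable (PP \<rho>) h" and J: "finite J"
  shows "(\<Sum>j\<in>J. pmf (pois \<rho>) j * E (rep j) (\<lambda>xs. h (count_list xs))) \<le> E (PP \<rho>) h"
proof -
  have "ennreal (\<Sum>j\<in>J. pmf (pois \<rho>) j * E (rep j) (\<lambda>xs. h (count_list xs))) =
      (\<Sum>j\<in>J. ennreal (pmf (pois \<rho>) j) * (\<integral>\<^sup>+xs. h (count_list xs) \<partial>rep j))"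
  proof -
    have "ennreal (pmf (pois \<rho>) j * E (rep j) (\<lambda>xs. h (count_list xs))) =
       ennreal (pmf (pois \<rho>) j) * (\<integral>\<^sup>+xs. h (count_list xs) \<partial>rep j)" for j
      using h by (subst nn_expectation_eq[OF _ integrable_rep]) (auto simp: ennreal_mult integral_nonneg_AE)
    then show ?thesis
      using h by (subst sum_ennreal[symmetric]) (auto intro!: mult_nonneg_nonneg integral_nonneg_AE)
  qed
  also have "\<dots> = (\<integral>\<^sup>+j\<in>J. (\<integral>\<^sup>+xs. h (count_list xs) \<partial>rep j) \<partial>pois \<rho>)"
  proof -
    have "(\<integral>\<^sup>+j\<in>J. (\<integral>\<^sup>+xs. h (count_list xs) \<partial>rep j) \<partial>pois \<rho>) =
        (\<integral>\<^sup>+j. ennreal (pmf (pois \<rho>) j) * ((\<integral>\<^sup>+xs. h (count_list xs) \<partial>rep j) * indicator J j) \<partial>count_space UNIV)"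
      by (rule nn_integral_measure_pmf)
    also have "\<dots> = (\<Sum>j\<in>J. ennreal (pmf (pois \<rho>) j) * ((\<integral>\<^sup>+xs. h (count_list xs) \<partial>rep j) * indicator J j))"
      by (rule nn_integral_count_space'[OF J]) auto
    finally show ?thesis by simp
  qed
  also have "\<dots> \<le> (\<integral>\<^sup>+j. (\<integral>\<^sup>+xs. h (count_list xs) \<partial>rep j) \<partial>pois \<rho>)"
    by (intro nn_integral_mono) (auto simp: indicator_def)
  also have "\<dots> = ennreal (E (PP \<rho>) h)"
    using nn_PP_mixture[OF \<rho>, of "\<lambda>N. ennreal (h N)"] h ih by (simp add: nn_expectation_eq)
  finally show ?thesis using h by (subst (asm) ennreal_le_iff) (auto intro: integral_nonneg_AE)
qed

end

section \<open>Coupling Poisson and multinomial counts\<close>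

lemma sum_affine:
  fixes p x y :: "'a \<Rightarrow> real"
  shows "(\<Sum>j\<in>J. p j * (K * (a * x j + b * y j))) = K * (a * (\<Sum>j\<in>J. p j * x j) + b * (\<Sum>j\<in>J. p j * y j))"
  by (simp add: sum_distrib_left sum.distrib distrib_left mult_ac)

context cell_system
begin

text \<open>
  An upper bound for the effect of an additional point in \<open>y\<close>: the new point may be isolated
  itself, and the isolated points around it may cease to be so.
\<close>

definition fc :: "nat \<Rightarrow> ('q \<Rightarrow> nat) \<Rightarrow> 'q \<Rightarrow> nat" where
  "fc k N y = of_bool (sum N (nb y) < k) + (\<Sum>q\<in>nb y. N q * isol k N q)"

lemma sum_count_list: "set ys \<subseteq> Q \<Longrightarrow> (\<Sum>q\<in>Q. count_list ys q * f q) = (\<Sum>y\<leftarrow>ys. f y)" for f :: "'q \<Rightarrow> nat"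
proof (induction ys)
  case (Cons y ys)
  have "(\<Sum>q\<in>Q. count_list (y # ys) q * f q) = (\<Sum>q\<in>Q. count_list ys q * f q + (if q = y then f q else 0))"
    by (intro sum.cong) auto
  then show ?case using Cons fin_Q by (simp add: sum.distrib)
qed simp

text \<open>
  More points never make an old point isolated. A new isolated point sits at a place that
  had fewer than \<open>k\<close> points around it, and an isolated point that is lost has a new point in
  its neighbourhood.
\<close>

lemma Tc_add_diff:
  "real (Tc k (\<lambda>q. N q + M q)) \<le> real (Tc k N) + real (\<Sum>q\<in>Q. M q * fc k N q)" (is ?th1)
  "real (Tc k N) \<le> real (Tc k (\<lambda>q. N q + M q)) + real (\<Sum>q\<in>Q. M q * fc k N q)" (is ?th2)
proof -
  let ?NM = "\<lambda>q. N q + M q"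
  have s: "sum ?NM (nb q) = sum N (nb q) + sum M (nb q)" for q by (simp add: sum.distrib)
  have "Tc k ?NM \<le> (\<Sum>q\<in>Q. N q * isol k N q + M q * fc k N q)"
    unfolding Tc_def
  proof (rule sum_mono)
    fix q assume q: "q \<in> Q"
    have "M q \<le> sum M (nb q)" using count_le[OF q] .
    then have "M q * isol k ?NM q \<le> M q * of_bool (sum N (nb q) < k)"
      by (cases "M q = 0") (auto simp: isol_def s)
    also have "\<dots> \<le> M q * fc k N q" by (intro mult_le_mono2) (simp add: fc_def)
    finally have "M q * isol k ?NM q \<le> M q * fc k N q" .
    moreover have "N q * isol k ?NM q \<le> N q * isol k N q" by (auto simp: isol_def s)
    ultimately show "?NM q * isol k ?NM q \<le> N q * isol k N q + M q * fc k N q"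
      unfolding distrib_right by (intro add_mono)
  qed
  then show ?th1 unfolding Tc_def of_nat_add[symmetric] of_nat_le_iff by (simp add: sum.distrib)
  have "Tc k N \<le> (\<Sum>q\<in>Q. ?NM q * isol k ?NM q + N q * isol k N q * sum M (nb q))"
    unfolding Tc_def
  proof (rule sum_mono)
    fix q assume q: "q \<in> Q"
    show "N q * isol k N q \<le> ?NM q * isol k ?NM q + N q * isol k N q * sum M (nb q)"
      by (cases "sum M (nb q) = 0") (auto simp: isol_def s)
  qed
  also have "\<dots> = Tc k ?NM + (\<Sum>q\<in>Q. \<Sum>q'\<in>nb q. N q * isol k N q * M q')"
    by (simp add: Tc_def sum.distrib sum_distrib_left)
  also have "(\<Sum>q\<in>Q. \<Sum>q'\<in>nb q. N q * isol k N q * M q') = (\<Sum>q\<in>Q. \<Sum>q'\<in>{q'\<in>Q. q' \<in> nb q}. N q * isol k N q * M q')"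
    using nb_sub by (intro sum.cong refl) auto
  also have "\<dots> = (\<Sum>q'\<in>Q. \<Sum>q\<in>{q\<in>Q. q' \<in> nb q}. N q * isol k N q * M q')"
    by (rule sum.swap_restrict[OF fin_Q fin_Q])
  also have "\<dots> = (\<Sum>q'\<in>Q. M q' * (\<Sum>q\<in>nb q'. N q * isol k N q))"
  proof (intro sum.cong refl)
    fix q' assume q': "q' \<in> Q"
    have "{q\<in>Q. q' \<in> nb q} = nb q'" using q' nb_sym nb_sub by blast
    then show "(\<Sum>q\<in>{q\<in>Q. q' \<in> nb q}. N q * isol k N q * M q') = M q' * (\<Sum>q\<in>nb q'. N q * isol k N q)"
      by (simp add: sum_distrib_left mult_ac)
  qed
  also have "\<dots> \<le> (\<Sum>q\<in>Q. M q * fc k N q)" by (intro sum_mono mult_left_mono) (auto simp: fc_def)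
  finally show ?th2 unfolding of_nat_add[symmetric] of_nat_le_iff by simp
qed

text \<open>
  The isolated points in one neighbourhood lie in at most \<open>D\<close> classes, with at most \<open>k\<close> in
  each of them.
\<close>

lemma fc_le: "y \<in> Q \<Longrightarrow> fc k N y \<le> 1 + D * k"
proof -
  assume y: "y \<in> Q"
  have fin: "finite (adj' (cl y))" using adj_sub fin_I finite_subset by blast
  have w: "wide y = (\<Union>i\<in>adj' (cl y). {q' \<in> Q. cl q' = i})" by (auto simp: wide_def)
  have "q \<in> wide y" if "q \<in> nb y" for q
  proof -
    have "q \<in> Q" using that nb_sub y by auto
    moreover have "q \<in> nb q \<inter> nb y" using that nb_self[OF \<open>q \<in> Q\<close>] by auto
    ultimately show ?thesis using y by (auto simp: wide_def adj_def)
  qed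
  then have "(\<Sum>q\<in>nb y. N q * isol k N q) \<le> (\<Sum>q\<in>wide y. N q * isol k N q)"
    using fin_Q by (intro sum_mono2) (auto simp: wide_def)
  also have "\<dots> = (\<Sum>i\<in>adj' (cl y). Zc k i N)"
    unfolding w Zc_def by (rule sum.UNION_disjoint) (use fin fin_class in auto)
  also have "\<dots> \<le> (\<Sum>i\<in>adj' (cl y). k)" by (intro sum_mono Zc_le)
  also have "\<dots> \<le> D * k" using adj_card[of "cl y"] y by simp
  finally show ?thesis by (simp add: fc_def)
qed

text \<open>
  Double counting: by symmetry of the neighbourhoods, a random cell has a given point in its
  neighbourhood with probability at most \<open>2 * vol\<close>.
\<close>

lemma E_fc_le: "E kp (\<lambda>y. real (fc k N y)) \<le> Vc k N + 2 * vol * Tc k N"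
proof -
  have "E kp (\<lambda>y. real (fc k N y)) = Vc k N + (\<Sum>q\<in>Q. \<Sum>q'\<in>{q'\<in>Q. q' \<in> nb q}. \<kappa> q * real (N q' * isol k N q'))"
    unfolding E_kp fc_def Vc_def of_nat_add distrib_left sum.distrib
    using nb_sub by (auto simp: sum_distrib_left intro!: sum.cong)
  also have "(\<Sum>q\<in>Q. \<Sum>q'\<in>{q'\<in>Q. q' \<in> nb q}. \<kappa> q * real (N q' * isol k N q')) =
      (\<Sum>q'\<in>Q. \<Sum>q\<in>{q\<in>Q. q' \<in> nb q}. \<kappa> q * real (N q' * isol k N q'))"
    by (rule sum.swap_restrict[OF fin_Q fin_Q])
  also have "\<dots> \<le> (\<Sum>q'\<in>Q. 2 * vol * real (N q' * isol k N q'))"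
  proof (rule sum_mono)
    fix q' assume q': "q' \<in> Q"
    have e: "{q\<in>Q. q' \<in> nb q} = nb q'" using q' nb_sym nb_sub by blast
    have "sum \<kappa> (nb q') \<le> (1 + \<tau>) * vol" by (rule nb_upper[OF q'])
    also have "\<dots> \<le> 2 * vol" using tau vol_pos by (intro mult_right_mono) auto
    finally show "(\<Sum>q\<in>{q\<in>Q. q' \<in> nb q}. \<kappa> q * real (N q' * isol k N q')) \<le> 2 * vol * real (N q' * isol k N q')"
      unfolding e sum_distrib_right[symmetric] by (intro mult_right_mono) auto
  qed
  also have "\<dots> = 2 * vol * Tc k N" by (simp add: Tc_def sum_distrib_left)
  finally show ?thesis by simp
qed

definition Dc :: "nat \<Rightarrow> ('q \<Rightarrow> nat) \<Rightarrow> 'q list \<Rightarrow> real" where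
  "Dc k N ys = (\<Sum>y\<leftarrow>ys. real (fc k N y))"

text \<open>
  The labels are independent, so the moment is a power of the moment of one label; there
  \<open>exp x - 1 \<le> x * exp x\<close> is used together with the maximum of \<open>fc\<close>.
\<close>

lemma E_exp_Dc:
  fixes s :: real
  assumes s: "0 \<le> s"
  shows "E (rep m) (\<lambda>ys. exp (s * Dc k N ys)) \<le>
    exp (m * (s * exp (s * (1 + D * k))) * (Vc k N + 2 * vol * Tc k N))"
proof -
  define r where "r = E kp (\<lambda>y. exp (s * fc k N y))"
  define B where "B = s * exp (s * (1 + D * k))"
  have "E (rep m) (\<lambda>ys. exp (s * Dc k N ys)) = r ^ m"
  proof (induction m)
    case 0
    then show ?case by (simp add: Dc_def)
  next
    case (Suc m)
    have "E (rep (Suc m)) (\<lambda>ys. exp (s * Dc k N ys)) =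
        E kp (\<lambda>y. E (rep m) (\<lambda>ys. exp (s * fc k N y) * exp (s * Dc k N ys)))"
      unfolding replicate_pmf.simps using fin_kp fin_rep
      by (simp add: E_bind_finite Dc_def distrib_left exp_add)
    then show ?case using Suc by (simp add: r_def)
  qed
  also have "r \<le> exp (B * (Vc k N + 2 * vol * Tc k N))"
  proof -
    have "r \<le> E kp (\<lambda>y. 1 + B * fc k N y)"
      unfolding r_def
    proof (intro integral_mono_AE integrable_measure_pmf_finite fin_kp)
      show "AE y in kp. exp (s * fc k N y) \<le> 1 + B * fc k N y"
      proof (unfold AE_measure_pmf_iff, intro ballI)
        fix y assume "y \<in> set_pmf kp"
        then have f: "real (fc k N y) \<le> real (1 + D * k)" using set_kp by (intro of_nat_mono fc_le) auto
        have "exp (s * fc k N y) - 1 \<le> s * fc k N y * exp (s * fc k N y)" by (rule exp_minus_one_le)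
        also have "\<dots> \<le> s * fc k N y * exp (s * (1 + D * k))"
          using s f by (intro mult_left_mono) (auto intro: mult_left_mono)
        finally show "exp (s * fc k N y) \<le> 1 + B * fc k N y" by (simp add: B_def mult_ac)
      qed
    qed
    also have "\<dots> = 1 + B * E kp (\<lambda>y. real (fc k N y))"
      by (subst Bochner_Integration.integral_add) (auto intro!: integrable_measure_pmf_finite fin_kp)
    also have "\<dots> \<le> 1 + B * (Vc k N + 2 * vol * Tc k N)"
      using s by (intro add_mono mult_left_mono E_fc_le) (auto simp: B_def)
    also have "\<dots> \<le> exp (B * (Vc k N + 2 * vol * Tc k N))" by (rule exp_ge_add_one_self)
    finally show ?thesis .
  qed
  then have "r ^ m \<le> exp (B * (Vc k N + 2 * vol * Tc k N)) ^ m"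
    by (intro power_mono) (auto simp: r_def intro!: integral_nonneg_AE)
  finally show ?thesis by (simp add: B_def exp_of_nat_mult[symmetric] mult_ac)
qed

lemma count_append: "count_list (xs @ ys) = (\<lambda>q. count_list xs q + count_list ys q)"
  by (simp add: fun_eq_iff)

lemma Tc_append_diff:
  assumes "set ys \<subseteq> Q"
  shows "\<bar>real (Tc k (count_list (xs @ ys))) - real (Tc k (count_list xs))\<bar> \<le> Dc k (count_list xs) ys"
proof -
  have "Dc k (count_list xs) ys = real (\<Sum>q\<in>Q. count_list ys q * fc k (count_list xs) q)"
    unfolding Dc_def sum_count_list[OF assms] by (induction ys) auto
  then show ?thesis
    using Tc_add_diff[of k "count_list xs" "count_list ys"] unfolding count_append by (simp add: abs_le_iff)
qed

lemma Tc_bound: "Tc k N \<le> card (cl ` Q) * k"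
  unfolding Tc_eq_sum_Zc using sum_bounded_above[of "cl ` Q" "\<lambda>i. Zc k i N" k] Zc_le by simp

lemma integrable_exp_Tc: "integrable (PP \<rho>) (\<lambda>N. exp (t * Tc k N))" for t :: real
proof (rule integrable_bounded_pmf)
  fix N
  have "t * Tc k N \<le> \<bar>t\<bar> * (card (cl ` Q) * k)"
    using Tc_bound[of k N] by (intro mult_mono) (auto simp flip: of_nat_mult)
  then show "\<bar>exp (t * Tc k N)\<bar> \<le> exp (\<bar>t\<bar> * (card (cl ` Q) * k))" by simp
qed

lemma Vc_bounds: "0 \<le> Vc k N" "Vc k N \<le> 1"
proof -
  show "0 \<le> Vc k N" unfolding Vc_def using kap_nonneg by (intro sum_nonneg) auto
  have "Vc k N \<le> sum \<kappa> Q" unfolding Vc_def using kap_nonneg by (intro sum_mono) auto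
  then show "Vc k N \<le> 1" by (simp add: kap_sum)
qed

definition Fc :: "nat \<Rightarrow> real \<Rightarrow> real \<Rightarrow> real" where "Fc k \<rho> t = E (PP \<rho>) (\<lambda>N. exp (t * Tc k N))"
definition gc :: "nat \<Rightarrow> nat \<Rightarrow> real \<Rightarrow> real" where "gc k n t = E (rep n) (\<lambda>xs. exp (t * Tc k (count_list xs)))"
text \<open>
  Dominates the exponential moment of the effect of \<open>h * \<rho>\<close> additional points, averaged
  over the Poisson configuration to which they are added.
\<close>

definition Hc :: "nat \<Rightarrow> real \<Rightarrow> real \<Rightarrow> real \<Rightarrow> real" where
  "Hc k \<rho> h s = E (PP \<rho>) (\<lambda>N. exp (h * (s * exp (s * (1 + real D * real k))) * (\<rho> * Vc k N + 2 * (\<rho> * vol) * Tc k N)))"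

text \<open>
  The first \<open>j\<close> of \<open>n\<close> independent labels are a sample of size \<open>j\<close>. For \<open>j\<close> in \<open>J\<close> there are
  at most \<open>2 * \<epsilon> * \<rho>\<close> further labels, and they change the statistic by at most
  \<open>Dc\<close>. Young's inequality separates the sample from this change, in either direction, and
  the average over \<open>j\<close> with Poisson weights replaces samples by the Poisson system.
\<close>

lemma coupled_expectations:
  fixes \<rho> \<theta> \<epsilon> t c :: real and n k :: nat
  assumes \<rho>: "0 < \<rho>" and \<theta>: "0 < \<theta>" "\<theta> < 1" and J: "J = {j. \<rho> * (1 - \<epsilon>) \<le> real j \<and> j \<le> n}"
    and n: "real n = \<rho> * (1 + \<epsilon>)" and \<epsilon>: "0 < \<epsilon>"
  shows
    "measure (pois \<rho>) J * gc k n t \<le>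
      exp c * (\<theta> * exp (- c / \<theta>) * Fc k \<rho> (t / \<theta>) + (1 - \<theta>) * Hc k \<rho> (2 * \<epsilon>) (\<bar>t\<bar> / (1 - \<theta>)))" (is ?th1)
    "(\<Sum>j\<in>J. pmf (pois \<rho>) j * gc k j (\<theta> * t)) \<le>
      exp c * (\<theta> * exp (- c / \<theta>) * gc k n t + (1 - \<theta>) * Hc k \<rho> (2 * \<epsilon>) (\<theta> * \<bar>t\<bar> / (1 - \<theta>)))" (is ?th2)
proof -
  have \<rho>0: "0 \<le> \<rho>" using \<rho> by simp
  have finJ: "finite J" unfolding J by (rule finite_subset[of _ "{..n}"]) auto
  have split: "E (rep n) f = E (rep j) (\<lambda>xs. E (rep (n - j)) (\<lambda>ys. f (xs @ ys)))"
    if "j \<in> J" "\<And>x. 0 \<le> f x" for j f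
    using E_rep_append[of f j "n - j"] that by (simp add: J)
  define h where "h s N = exp (2 * \<epsilon> * (s * exp (s * (1 + real D * real k))) * (\<rho> * Vc k N + 2 * (\<rho> * vol) * Tc k N))" for s N
  have ED: "E (rep (n - j)) (\<lambda>ys. exp (s * Dc k N ys)) \<le> h s N" if j: "j \<in> J" and s: "0 \<le> s" for j s N
  proof -
    have "real (n - j) \<le> 2 * \<epsilon> * \<rho>" using j n by (simp add: J of_nat_diff algebra_simps)
    then have "real (n - j) * (s * exp (s * (1 + real D * real k))) * (Vc k N + 2 * vol * Tc k N) \<le>
        2 * \<epsilon> * \<rho> * (s * exp (s * (1 + real D * real k))) * (Vc k N + 2 * vol * Tc k N)"
      using s Vc_bounds[of k N] vol_pos by (intro mult_right_mono) auto
    also have "\<dots> = 2 * \<epsilon> * (s * exp (s * (1 + real D * real k))) * (\<rho> * Vc k N + 2 * (\<rho> * vol) * Tc k N)"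
      by (simp add: algebra_simps)
    finally show ?thesis
      unfolding h_def using E_exp_Dc[OF s, of "n - j" k N] by (elim order_trans) simp
  qed
  have ih: "integrable (PP \<rho>) (h s)" if "0 \<le> s" for s
  proof (rule integrable_bounded_pmf)
    fix N
    have "\<rho> * Vc k N + 2 * (\<rho> * vol) * Tc k N \<le> \<rho> * 1 + 2 * (\<rho> * vol) * (card (cl ` Q) * k)"
      using \<rho> vol_pos Vc_bounds[of k N] Tc_bound[of k N]
      by (intro add_mono mult_left_mono) (auto simp flip: of_nat_mult)
    then have "h s N \<le> exp (2 * \<epsilon> * (s * exp (s * (1 + real D * real k))) * (\<rho> * 1 + 2 * (\<rho> * vol) * (card (cl ` Q) * k)))"
      unfolding h_def exp_le_cancel_iff using that \<epsilon> by (intro mult_left_mono) auto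
    then show "\<bar>h s N\<bar> \<le> exp (2 * \<epsilon> * (s * exp (s * (1 + real D * real k))) * (\<rho> * 1 + 2 * (\<rho> * vol) * (card (cl ` Q) * k)))"
      by (simp add: h_def)
  qed
  have SH: "(\<Sum>j\<in>J. pmf (pois \<rho>) j * E (rep j) (\<lambda>xs. h s (count_list xs))) \<le> Hc k \<rho> (2 * \<epsilon>) s" if "0 \<le> s" for s
  proof -
    have "Hc k \<rho> (2 * \<epsilon>) s = E (PP \<rho>) (h s)" by (simp add: Hc_def h_def[abs_def])
    moreover have "0 \<le> h s N" for N by (simp add: h_def)
    ultimately show ?thesis using mixture_partial[OF \<rho>0 _ ih[OF that] finJ] by simp
  qed
  have SF: "(\<Sum>j\<in>J. pmf (pois \<rho>) j * gc k j s) \<le> Fc k \<rho> s" for s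
    using mixture_partial[OF \<rho>0 _ integrable_exp_Tc finJ, of s k] by (simp add: Fc_def gc_def)
  have prJ: "measure (pois \<rho>) J = (\<Sum>j\<in>J. pmf (pois \<rho>) j)" by (rule measure_measure_pmf_finite[OF finJ])
  have upper: "gc k n t \<le> exp c * (\<theta> * exp (- c / \<theta>) * gc k j (t / \<theta>) +
      (1 - \<theta>) * E (rep j) (\<lambda>xs. h (\<bar>t\<bar> / (1 - \<theta>)) (count_list xs)))" if j: "j \<in> J" for j
  proof -
    have "gc k n t = E (rep j) (\<lambda>xs. E (rep (n - j)) (\<lambda>ys. exp (t * Tc k (count_list (xs @ ys)))))"
      unfolding gc_def by (rule split[OF j]) simp
    also have "\<dots> \<le> E (rep j) (\<lambda>xs. exp c * (\<theta> * exp (- c / \<theta>) * exp (t / \<theta> * Tc k (count_list xs)) +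
        (1 - \<theta>) * h (\<bar>t\<bar> / (1 - \<theta>)) (count_list xs)))"
    proof (intro integral_mono integrable_rep)
      fix xs
      let ?T = "real (Tc k (count_list xs))"
      have "E (rep (n - j)) (\<lambda>ys. exp (t * Tc k (count_list (xs @ ys)))) \<le>
         E (rep (n - j)) (\<lambda>ys. exp c * (\<theta> * exp (- c / \<theta>) * exp (t * ?T / \<theta>) +
          (1 - \<theta>) * exp (\<bar>t\<bar> / (1 - \<theta>) * Dc k (count_list xs) ys)))"
      proof (intro integral_mono_AE integrable_rep, unfold AE_measure_pmf_iff, intro ballI)
        fix ys assume "ys \<in> set_pmf (rep (n - j))"
        then have d: "\<bar>real (Tc k (count_list (xs @ ys))) - ?T\<bar> \<le> Dc k (count_list xs) ys"
          by (intro Tc_append_diff rep_sub)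
        have "t * (real (Tc k (count_list (xs @ ys))) - ?T) \<le> \<bar>t\<bar> * Dc k (count_list xs) ys"
          using mult_left_mono[OF d, of "\<bar>t\<bar>"] abs_ge_self[of "t * (real (Tc k (count_list (xs @ ys))) - ?T)"]
          by (simp add: abs_mult)
        then have "exp (t * Tc k (count_list (xs @ ys))) \<le> exp (t * ?T + \<bar>t\<bar> * Dc k (count_list xs) ys)"
          by (simp add: algebra_simps)
        also have "\<dots> \<le> exp c * (\<theta> * exp (- c / \<theta>) * exp (t * ?T / \<theta>) +
          (1 - \<theta>) * exp (\<bar>t\<bar> * Dc k (count_list xs) ys / (1 - \<theta>)))" by (rule young_exp[OF \<theta>])
        finally show "exp (t * Tc k (count_list (xs @ ys))) \<le> exp c * (\<theta> * exp (- c / \<theta>) * exp (t * ?T / \<theta>) +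
          (1 - \<theta>) * exp (\<bar>t\<bar> / (1 - \<theta>) * Dc k (count_list xs) ys))" by simp
      qed
      also have "\<dots> = exp c * (\<theta> * exp (- c / \<theta>) * exp (t / \<theta> * ?T) +
          (1 - \<theta>) * E (rep (n - j)) (\<lambda>ys. exp (\<bar>t\<bar> / (1 - \<theta>) * Dc k (count_list xs) ys)))"
        by (simp add: integrable_rep)
      also have "\<dots> \<le> exp c * (\<theta> * exp (- c / \<theta>) * exp (t / \<theta> * ?T) +
          (1 - \<theta>) * h (\<bar>t\<bar> / (1 - \<theta>)) (count_list xs))"
        using \<theta> by (intro mult_left_mono add_mono ED[OF j]) auto
      finally show "E (rep (n - j)) (\<lambda>ys. exp (t * Tc k (count_list (xs @ ys)))) \<le> \<dots>" .
    qed
    also have "\<dots> = exp c * (\<theta> * exp (- c / \<theta>) * gc k j (t / \<theta>) +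
      (1 - \<theta>) * E (rep j) (\<lambda>xs. h (\<bar>t\<bar> / (1 - \<theta>)) (count_list xs)))"
      by (simp add: integrable_rep gc_def)
    finally show ?thesis .
  qed
  have "measure (pois \<rho>) J * gc k n t = (\<Sum>j\<in>J. pmf (pois \<rho>) j * gc k n t)"
    by (simp add: prJ sum_distrib_right)
  also have "\<dots> \<le> (\<Sum>j\<in>J. pmf (pois \<rho>) j * (exp c * (\<theta> * exp (- c / \<theta>) * gc k j (t / \<theta>) +
      (1 - \<theta>) * E (rep j) (\<lambda>xs. h (\<bar>t\<bar> / (1 - \<theta>)) (count_list xs)))))"
    by (intro sum_mono mult_left_mono upper) auto
  also have "\<dots> = exp c * (\<theta> * exp (- c / \<theta>) * (\<Sum>j\<in>J. pmf (pois \<rho>) j * gc k j (t / \<theta>)) +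
      (1 - \<theta>) * (\<Sum>j\<in>J. pmf (pois \<rho>) j * E (rep j) (\<lambda>xs. h (\<bar>t\<bar> / (1 - \<theta>)) (count_list xs))))"
    by (rule sum_affine)
  also have "\<dots> \<le> exp c * (\<theta> * exp (- c / \<theta>) * Fc k \<rho> (t / \<theta>) + (1 - \<theta>) * Hc k \<rho> (2 * \<epsilon>) (\<bar>t\<bar> / (1 - \<theta>)))"
    using \<theta> by (intro mult_left_mono add_mono SF SH) auto
  finally show ?th1 .
  have lower: "gc k j (\<theta> * t) \<le> exp c * (\<theta> * exp (- c / \<theta>) * gc k n t +
      (1 - \<theta>) * E (rep j) (\<lambda>xs. h (\<theta> * \<bar>t\<bar> / (1 - \<theta>)) (count_list xs)))" if j: "j \<in> J" for j
  proof -
    have "gc k j (\<theta> * t) = E (rep j) (\<lambda>xs. exp (\<theta> * t * Tc k (count_list xs)))"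
      by (simp add: gc_def)
    also have "\<dots> \<le> E (rep j) (\<lambda>xs. exp c * (\<theta> * exp (- c / \<theta>) * E (rep (n - j)) (\<lambda>ys. exp (t * Tc k (count_list (xs @ ys)))) +
        (1 - \<theta>) * h (\<theta> * \<bar>t\<bar> / (1 - \<theta>)) (count_list xs)))"
    proof (intro integral_mono integrable_rep)
      fix xs
      let ?T = "real (Tc k (count_list xs))"
      have "exp (\<theta> * t * ?T) = E (rep (n - j)) (\<lambda>ys. exp (\<theta> * t * ?T))" by simp
      also have "\<dots> \<le>
         E (rep (n - j)) (\<lambda>ys. exp c * (\<theta> * exp (- c / \<theta>) * exp (t * Tc k (count_list (xs @ ys))) +
          (1 - \<theta>) * exp (\<theta> * \<bar>t\<bar> / (1 - \<theta>) * Dc k (count_list xs) ys)))"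
      proof (intro integral_mono_AE integrable_rep, unfold AE_measure_pmf_iff, intro ballI)
        fix ys assume "ys \<in> set_pmf (rep (n - j))"
        then have d: "\<bar>real (Tc k (count_list (xs @ ys))) - ?T\<bar> \<le> Dc k (count_list xs) ys"
          by (intro Tc_append_diff rep_sub)
        let ?U = "real (Tc k (count_list (xs @ ys)))"
        have "t * (?T - ?U) \<le> \<bar>t\<bar> * Dc k (count_list xs) ys"
          using mult_left_mono[OF d, of "\<bar>t\<bar>"] abs_ge_self[of "t * (?T - ?U)"]
          by (simp add: abs_mult abs_minus_commute)
        then have "\<theta> * (t * ?T) \<le> \<theta> * (t * ?U + \<bar>t\<bar> * Dc k (count_list xs) ys)"
          using \<theta> by (intro mult_left_mono) (auto simp: algebra_simps)
        then have "exp (\<theta> * t * ?T) \<le> exp (\<theta> * (t * ?U) + \<theta> * \<bar>t\<bar> * Dc k (count_list xs) ys)"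
          by (simp add: algebra_simps)
        also have "\<dots> \<le> exp c * (\<theta> * exp (- c / \<theta>) * exp (\<theta> * (t * ?U) / \<theta>) +
          (1 - \<theta>) * exp (\<theta> * \<bar>t\<bar> * Dc k (count_list xs) ys / (1 - \<theta>)))" by (rule young_exp[OF \<theta>])
        finally show "exp (\<theta> * t * ?T) \<le> exp c * (\<theta> * exp (- c / \<theta>) * exp (t * ?U) +
          (1 - \<theta>) * exp (\<theta> * \<bar>t\<bar> / (1 - \<theta>) * Dc k (count_list xs) ys))" using \<theta> by simp
      qed
      also have "\<dots> = exp c * (\<theta> * exp (- c / \<theta>) * E (rep (n - j)) (\<lambda>ys. exp (t * Tc k (count_list (xs @ ys)))) +
          (1 - \<theta>) * E (rep (n - j)) (\<lambda>ys. exp (\<theta> * \<bar>t\<bar> / (1 - \<theta>) * Dc k (count_list xs) ys)))"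
        by (simp add: integrable_rep)
      also have "\<dots> \<le> exp c * (\<theta> * exp (- c / \<theta>) * E (rep (n - j)) (\<lambda>ys. exp (t * Tc k (count_list (xs @ ys)))) +
          (1 - \<theta>) * h (\<theta> * \<bar>t\<bar> / (1 - \<theta>)) (count_list xs))"
        using \<theta> by (intro mult_left_mono add_mono ED[OF j]) auto
      finally show "exp (\<theta> * t * ?T) \<le> \<dots>" .
    qed
    also have "\<dots> = exp c * (\<theta> * exp (- c / \<theta>) * gc k n t +
      (1 - \<theta>) * E (rep j) (\<lambda>xs. h (\<theta> * \<bar>t\<bar> / (1 - \<theta>)) (count_list xs)))"
      unfolding gc_def split[OF j, where f="\<lambda>xs. exp (t * Tc k (count_list xs))", OF exp_ge_zero]
      by (simp add: integrable_rep)
    finally show ?thesis .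
  qed
  have "(\<Sum>j\<in>J. pmf (pois \<rho>) j * gc k j (\<theta> * t)) \<le> (\<Sum>j\<in>J. pmf (pois \<rho>) j * (exp c * (\<theta> * exp (- c / \<theta>) * gc k n t +
      (1 - \<theta>) * E (rep j) (\<lambda>xs. h (\<theta> * \<bar>t\<bar> / (1 - \<theta>)) (count_list xs)))))"
    by (intro sum_mono mult_left_mono lower) auto
  also have "\<dots> = exp c * (\<theta> * exp (- c / \<theta>) * (measure (pois \<rho>) J * gc k n t) +
      (1 - \<theta>) * (\<Sum>j\<in>J. pmf (pois \<rho>) j * E (rep j) (\<lambda>xs. h (\<theta> * \<bar>t\<bar> / (1 - \<theta>)) (count_list xs))))"
    unfolding prJ sum_distrib_right by (rule sum_affine)
  also have "\<dots> \<le> exp c * (\<theta> * exp (- c / \<theta>) * gc k n t + (1 - \<theta>) * Hc k \<rho> (2 * \<epsilon>) (\<theta> * \<bar>t\<bar> / (1 - \<theta>)))"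
  proof -
    have "measure (pois \<rho>) J * gc k n t \<le> 1 * gc k n t"
      by (intro mult_right_mono) (auto simp: gc_def integral_nonneg_AE)
    then show ?thesis using \<theta> by (intro mult_left_mono add_mono SH) auto
  qed
  finally show ?th2 .
qed

text \<open>
  Outside \<open>J\<close> the bound \<open>a \<le> d * a\<^sup>2 + 1 / d\<close> trades the small probability against
  the exponential moment at \<open>2 * u\<close>.
\<close>

lemma good_part_large:
  fixes \<rho> d u :: real and k :: nat
  assumes \<rho>: "0 < \<rho>" and J: "finite J" and d: "0 < d"
  shows "Fc k \<rho> u \<le> (\<Sum>j\<in>J. pmf (pois \<rho>) j * gc k j u) + d * Fc k \<rho> (2 * u) + measure (pois \<rho>) (- J) / d"
proof -
  have \<rho>0: "0 \<le> \<rho>" using \<rho> by simp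
  have nng: "(\<integral>\<^sup>+xs. ennreal (exp (s * Tc k (count_list xs))) \<partial>rep j) = ennreal (gc k j s)" for j and s :: real
    unfolding gc_def by (rule nn_expectation_eq[OF _ integrable_rep]) simp
  have g0: "0 \<le> gc k j s" for j s by (simp add: gc_def integral_nonneg_AE)
  have nnF: "ennreal (Fc k \<rho> s) = (\<integral>\<^sup>+j. ennreal (gc k j s) \<partial>pois \<rho>)" for s
    unfolding Fc_def nn_expectation_eq[OF exp_ge_zero integrable_exp_Tc, symmetric] nn_PP_mixture[OF \<rho>0] nng ..
  have am: "gc k j u \<le> d * gc k j (2 * u) + 1 / d" for j
  proof -
    have "gc k j u \<le> E (rep j) (\<lambda>xs. d * exp (2 * u * Tc k (count_list xs)) + 1 / d)"
      unfolding gc_def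
    proof (intro integral_mono integrable_rep)
      fix xs
      define z where "z = exp (u * Tc k (count_list xs))"
      have z2: "exp (2 * u * Tc k (count_list xs)) = z\<^sup>2" by (simp add: z_def exp_double[symmetric] mult_ac)
      have "0 \<le> (d * z - 1)\<^sup>2 + d * z" using d by (simp add: z_def)
      then have "d * z \<le> d * (d * z\<^sup>2 + 1 / d)" using d by (simp add: power2_eq_square algebra_simps)
      then show "exp (u * Tc k (count_list xs)) \<le> d * exp (2 * u * Tc k (count_list xs)) + 1 / d"
        unfolding z2 z_def[symmetric] using d by simp
    qed
    then show ?thesis by (simp add: integrable_rep gc_def)
  qed
  have "ennreal (Fc k \<rho> u) \<le> (\<integral>\<^sup>+j. ennreal (gc k j u) * indicator J j + (ennreal (d * gc k j (2 * u)) + ennreal (1 / d) * indicator (- J) j) \<partial>pois \<rho>)"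
    unfolding nnF
  proof (intro nn_integral_mono)
    fix j
    show "ennreal (gc k j u) \<le> ennreal (gc k j u) * indicator J j + (ennreal (d * gc k j (2 * u)) + ennreal (1 / d) * indicator (- J) j)"
      using am[of j] g0 d by (cases "j \<in> J") (auto simp: ennreal_plus[symmetric] simp del: ennreal_plus)
  qed
  also have "\<dots> = (\<integral>\<^sup>+j\<in>J. ennreal (gc k j u) \<partial>pois \<rho>) + (ennreal d * ennreal (Fc k \<rho> (2 * u)) + ennreal (1 / d) * ennreal (measure (pois \<rho>) (- J)))"
    using d g0 by (simp add: nn_integral_add nnF ennreal_mult nn_integral_cmult nn_integral_cmult_indicator measure_pmf.emeasure_eq_measure)
  also have "(\<integral>\<^sup>+j\<in>J. ennreal (gc k j u) \<partial>pois \<rho>) = ennreal (\<Sum>j\<in>J. pmf (pois \<rho>) j * gc k j u)"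
  proof -
    have "(\<integral>\<^sup>+j\<in>J. ennreal (gc k j u) \<partial>pois \<rho>) =
        (\<integral>\<^sup>+j. ennreal (pmf (pois \<rho>) j) * (ennreal (gc k j u) * indicator J j) \<partial>count_space UNIV)"
      by (rule nn_integral_measure_pmf)
    also have "\<dots> = (\<Sum>j\<in>J. ennreal (pmf (pois \<rho>) j) * (ennreal (gc k j u) * indicator J j))"
      by (rule nn_integral_count_space'[OF J]) auto
    also have "\<dots> = (\<Sum>j\<in>J. ennreal (pmf (pois \<rho>) j * gc k j u))"
      by (intro sum.cong refl) (simp add: ennreal_mult g0)
    also have "\<dots> = ennreal (\<Sum>j\<in>J. pmf (pois \<rho>) j * gc k j u)"
      using g0 by (intro sum_ennreal) auto
    finally show ?thesis .
  qed
  also have "ennreal (\<Sum>j\<in>J. pmf (pois \<rho>) j * gc k j u) + (ennreal d * ennreal (Fc k \<rho> (2 * u)) + ennreal (1 / d) * ennreal (measure (pois \<rho>) (- J)))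
     = ennreal ((\<Sum>j\<in>J. pmf (pois \<rho>) j * gc k j u) + (d * Fc k \<rho> (2 * u) + 1 / d * measure (pois \<rho>) (- J)))"
    using d g0 by (simp add: ennreal_mult[symmetric] ennreal_plus[symmetric] sum_nonneg Fc_def integral_nonneg_AE del: ennreal_plus)
  finally show ?thesis
    using d g0 by (subst (asm) ennreal_le_iff) (auto simp: sum_nonneg Fc_def integral_nonneg_AE)
qed

end

section \<open>Exponential moments for multinomial counts\<close>

lemma PL_decay:
  assumes "0 < c"
  shows "((\<lambda>A. A * PL k (c * A)) \<longlongrightarrow> 0) at_top" "((\<lambda>A. PL k (c * A)) \<longlongrightarrow> 0) at_top"
proof -
  have lim: "filterlim (\<lambda>A. c * A) at_top at_top"
    using assms by (intro filterlim_tendsto_pos_mult_at_top[OF tendsto_const _ filterlim_ident])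
  have p: "((\<lambda>A. (c * A) ^ i / exp (c * A)) \<longlongrightarrow> 0) at_top" for i
    by (rule filterlim_compose[OF tendsto_power_div_exp_0 lim])
  have "((\<lambda>A. \<Sum>i<k. 1 / (c * fact i) * ((c * A) ^ Suc i / exp (c * A))) \<longlongrightarrow> (\<Sum>i<k. 1 / (c * fact i) * 0)) at_top"
    by (intro tendsto_sum tendsto_mult tendsto_const p)
  moreover have "(\<lambda>A. A * PL k (c * A)) = (\<lambda>A. \<Sum>i<k. 1 / (c * fact i) * ((c * A) ^ Suc i / exp (c * A)))"
    using assms by (auto simp: fun_eq_iff PL_def sum_distrib_left exp_minus divide_inverse mult_ac intro!: sum.cong)
  ultimately show "((\<lambda>A. A * PL k (c * A)) \<longlongrightarrow> 0) at_top" by simp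
  have "((\<lambda>A. \<Sum>i<k. 1 / fact i * ((c * A) ^ i / exp (c * A))) \<longlongrightarrow> (\<Sum>i<k. 1 / fact i * 0)) at_top"
    by (intro tendsto_sum tendsto_mult tendsto_const p)
  moreover have "(\<lambda>A. PL k (c * A)) = (\<lambda>A. \<Sum>i<k. 1 / fact i * ((c * A) ^ i / exp (c * A)))"
    by (auto simp: fun_eq_iff PL_def sum_distrib_left exp_minus divide_inverse mult_ac intro!: sum.cong)
  ultimately show "((\<lambda>A. PL k (c * A)) \<longlongrightarrow> 0) at_top" by simp
qed

text \<open>
  The smallness conditions and the relative error of \<open>log_mgf_estimate\<close>, with \<open>s\<close> in place
  of \<open>\<tau> * A\<close>.
\<close>

definition mgf_ok :: "real \<Rightarrow> real \<Rightarrow> nat \<Rightarrow> nat \<Rightarrow> real \<Rightarrow> real \<Rightarrow> real \<Rightarrow> real \<Rightarrow> bool" where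
  "mgf_ok t \<eta> k D \<sigma> \<gamma> A s \<longleftrightarrow>
    (let C = exp (\<bar>t\<bar> * real k); e = C * (2 * A * PL k A);
         X = \<sigma> * real k + (2 * real k + 2 * real D * A) * PL k (\<gamma> * A)
     in e \<le> 1 \<and> (1 + 2 * C ^ (6 * D) * real D * C) * e \<le> 1 / 2 \<and>
       (C ^ (6 * D) * real (D + 1) + 2 * (1 + 2 * C ^ (6 * D) * real D * C)\<^sup>2) * (e * C + C\<^sup>2 * X)
        + 2 * C * X + \<bar>exp t - 1\<bar> * (1 - exp (- s)) \<le> \<eta>)"

text \<open>
  The order of the quantifiers matters: the bound on \<open>\<sigma>\<close> and \<open>s\<close> comes first;
  \<open>\<gamma>\<close> depends on how small \<open>\<sigma>\<close> is; and \<open>A\<close> has to be large in terms of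
  \<open>\<gamma>\<close>, so that \<open>PL k (\<gamma> * A)\<close> is small.
\<close>

lemma mgf_ok_eventually:
  assumes \<eta>: "0 < \<eta>"
  shows "\<exists>\<xi>>0. \<forall>\<gamma>>0. \<forall>\<^sub>F A in at_top. \<forall>\<sigma> s. 0 \<le> \<sigma> \<and> \<sigma> \<le> \<xi> \<and> 0 \<le> s \<and> s \<le> \<xi> \<longrightarrow> mgf_ok t \<eta> k D \<sigma> \<gamma> A s"
proof -
  define C where "C = exp (\<bar>t\<bar> * real k)"
  define B where "B = 1 + 2 * C ^ (6 * D) * real D * C"
  define K where "K = C ^ (6 * D) * real (D + 1) + 2 * B\<^sup>2"
  define z where "z = K * (C + C\<^sup>2) + 2 * C + \<bar>exp t - 1\<bar> + 2 * B"
  have C: "1 \<le> C" by (simp add: C_def)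
  have B: "1 \<le> B" using C by (simp add: B_def)
  have K: "0 \<le> K" using C B by (simp add: K_def)
  have z: "2 * B \<le> z" using K C by (simp add: z_def)
  define \<zeta> where "\<zeta> = min \<eta> 1 / z"
  have \<zeta>: "0 < \<zeta>" "z * \<zeta> \<le> \<eta>" "z * \<zeta> \<le> 1" using \<eta> z B by (auto simp: \<zeta>_def)
  define \<xi> where "\<xi> = \<zeta> / (2 * (real k + 1))"
  have \<xi>: "0 < \<xi>" "\<xi> \<le> \<zeta>" "\<xi> * real k \<le> \<zeta> / 2"
  proof -
    have "0 < 2 * (real k + 1)" by simp
    then show "0 < \<xi>" "\<xi> \<le> \<zeta>" using \<zeta> by (auto simp: \<xi>_def field_simps)
    show "\<xi> * real k \<le> \<zeta> / 2" using \<zeta> by (simp add: \<xi>_def field_simps)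
  qed
  show ?thesis
  proof (intro exI[of _ \<xi>] conjI allI impI \<xi>(1))
    fix \<gamma> :: real assume \<gamma>: "0 < \<gamma>"
    have "((\<lambda>A. 2 * C * (A * PL k (1 * A))) \<longlongrightarrow> 2 * C * 0) at_top"
      by (intro tendsto_mult tendsto_const PL_decay) auto
    then have e1: "\<forall>\<^sub>F A in at_top. 2 * C * (A * PL k (1 * A)) < \<zeta>" using \<zeta> by (auto dest: order_tendstoD(2)[where a=\<zeta>])
    have "((\<lambda>A. 2 * real k * PL k (\<gamma> * A) + 2 * real D * (A * PL k (\<gamma> * A))) \<longlongrightarrow> 2 * real k * 0 + 2 * real D * 0) at_top"
      using \<gamma> by (intro tendsto_mult tendsto_add tendsto_const PL_decay)
    then have e2: "\<forall>\<^sub>F A in at_top. 2 * real k * PL k (\<gamma> * A) + 2 * real D * (A * PL k (\<gamma> * A)) < \<zeta> / 2"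
      using \<zeta> by (auto dest: order_tendstoD(2)[where a="\<zeta>/2"])
    show "\<forall>\<^sub>F A in at_top. \<forall>\<sigma> s. 0 \<le> \<sigma> \<and> \<sigma> \<le> \<xi> \<and> 0 \<le> s \<and> s \<le> \<xi> \<longrightarrow> mgf_ok t \<eta> k D \<sigma> \<gamma> A s"
      using e1 e2 eventually_ge_at_top[of 0]
    proof eventually_elim
      case (elim A)
      show ?case
      proof (intro allI impI)
        fix \<sigma> s assume s: "0 \<le> \<sigma> \<and> \<sigma> \<le> \<xi> \<and> 0 \<le> s \<and> s \<le> \<xi>"
        define e where "e = C * (2 * A * PL k A)"
        define X where "X = \<sigma> * real k + (2 * real k + 2 * real D * A) * PL k (\<gamma> * A)"
        have e: "e \<le> \<zeta>" "0 \<le> e" using elim C by (auto simp: e_def mult_ac PL_nonneg)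
        have "\<sigma> * real k \<le> \<xi> * real k" using s by (intro mult_right_mono) auto
        then have X: "X \<le> \<zeta>" using elim \<xi>(3) by (simp add: X_def algebra_simps)
        have Be: "B * e \<le> 1 / 2"
        proof -
          have "2 * B * e \<le> z * \<zeta>" using e z B by (intro mult_mono) auto
          then show ?thesis using \<zeta> by simp
        qed
        have "1 - exp (- s) \<le> \<zeta>" using exp_ge_add_one_self[of "- s"] s \<xi> by linarith
        then have s1: "\<bar>exp t - 1\<bar> * (1 - exp (- s)) \<le> \<bar>exp t - 1\<bar> * \<zeta>" by (intro mult_left_mono) auto
        have "K * (e * C + C\<^sup>2 * X) \<le> K * (\<zeta> * C + C\<^sup>2 * \<zeta>)"
          using K C e X by (intro mult_left_mono add_mono mult_right_mono) auto
        moreover have "2 * C * X \<le> 2 * C * \<zeta>" using C X by (intro mult_left_mono) auto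
        ultimately have "K * (e * C + C\<^sup>2 * X) + 2 * C * X + \<bar>exp t - 1\<bar> * (1 - exp (- s)) \<le>
            (K * (C + C\<^sup>2) + 2 * C + \<bar>exp t - 1\<bar>) * \<zeta>" using s1 by (simp add: algebra_simps)
        also have "\<dots> \<le> z * \<zeta>" using \<zeta> B by (intro mult_right_mono) (auto simp: z_def)
        also have "\<dots> \<le> \<eta>" by (rule \<zeta>(2))
        finally have fin: "K * (e * C + C\<^sup>2 * X) + 2 * C * X + \<bar>exp t - 1\<bar> * (1 - exp (- s)) \<le> \<eta>" .
        have "1 * e \<le> B * e" using B e by (intro mult_right_mono) auto
        then have "e \<le> 1" using Be by simp
        then show "mgf_ok t \<eta> k D \<sigma> \<gamma> A s"
          unfolding mgf_ok_def Let_def C_def[symmetric] B_def[symmetric] K_def[symmetric] e_def[symmetric] X_def[symmetric]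
          using Be fin by simp
      qed
    qed
  qed
qed

text \<open>
  The free constant of Young's inequality is chosen as in Hoelder's inequality. The
  assumption \<open>8 \<le> \<eta> * \<beta>\<close> lets \<open>exp (\<eta> * \<beta>)\<close> absorb the numerical
  constants.
\<close>

lemma coupled_moment_sandwich:
  fixes \<beta> \<eta> \<theta> F1 F2 F3 H1 H2 g S pJ pJc L1 L2 L3 :: real
  assumes \<theta>: "0 < \<theta>" "\<theta> < 1" and \<eta>: "0 < \<eta>" "8 \<le> \<eta> * \<beta>"
    and up: "\<And>c. pJ * g \<le> exp c * (\<theta> * exp (- c / \<theta>) * F1 + (1 - \<theta>) * H1)"
    and lo: "\<And>c. S \<le> exp c * (\<theta> * exp (- c / \<theta>) * g + (1 - \<theta>) * H2)"
    and sp: "\<And>d. 0 < d \<Longrightarrow> F2 \<le> S + d * F3 + pJc / d"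
    and F1: "F1 \<le> exp ((L1 + \<eta>) * \<beta>)" and F2: "exp ((L2 - \<eta>) * \<beta>) \<le> F2" and F3: "F3 \<le> exp ((L3 + \<eta>) * \<beta>)"
    and H1: "H1 \<le> exp (\<eta> * \<beta>)" and H2: "H2 \<le> exp (\<eta> * \<beta>)"
    and pJ: "1 / 2 \<le> pJ" and pJc: "pJc \<le> exp (- (2 * \<bar>L2\<bar> + \<bar>L3\<bar> + 4 * \<eta>) * \<beta>)" and g: "0 \<le> g"
  shows "g \<le> exp ((\<theta> * L1 + 3 * \<eta>) * \<beta>)" "exp ((L2 - 3 * \<eta>) / \<theta> * \<beta>) \<le> g"
proof -
  have \<beta>: "0 < \<beta>" using \<eta> by (smt (verit) mult_nonneg_nonpos)
  define u where "u = \<eta> * \<beta>"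
  have u: "8 \<le> u" "1 / 8 \<ge> exp (- u)" "8 \<le> exp u"
  proof -
    show "8 \<le> u" using \<eta> by (simp add: u_def)
    then show e: "8 \<le> exp u" using exp_ge_add_one_self[of u] by linarith
    then show "1 / 8 \<ge> exp (- u)" by (simp add: exp_minus field_simps)
  qed
  show "g \<le> exp ((\<theta> * L1 + 3 * \<eta>) * \<beta>)"
  proof -
    define c where "c = \<theta> * ((L1 + \<eta>) * \<beta>)"
    have "exp (- c / \<theta>) * F1 \<le> exp (- c / \<theta>) * exp ((L1 + \<eta>) * \<beta>)" using F1 by (intro mult_left_mono) auto
    also have "\<dots> = 1" using \<theta> by (simp add: c_def mult_exp_exp)
    finally have e: "exp (- c / \<theta>) * F1 \<le> 1" .
    have "\<theta> * (exp (- c / \<theta>) * F1) + (1 - \<theta>) * H1 \<le> \<theta> * 1 + (1 - \<theta>) * exp u"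
      using e H1 \<theta> by (intro add_mono mult_left_mono) (auto simp: u_def)
    also have "\<dots> \<le> \<theta> * exp u + (1 - \<theta>) * exp u" using \<theta> u by (intro add_mono mult_left_mono) auto
    also have "\<dots> = exp u" by (simp add: algebra_simps)
    finally have "\<theta> * exp (- c / \<theta>) * F1 + (1 - \<theta>) * H1 \<le> exp u" by (simp add: mult.assoc)
    then have "exp c * (\<theta> * exp (- c / \<theta>) * F1 + (1 - \<theta>) * H1) \<le> exp c * exp u" by (intro mult_left_mono) auto
    then have "pJ * g \<le> exp c * exp u" by (rule order_trans[OF up])
    then have "pJ * g \<le> exp (c + u)" by (simp add: exp_add)
    moreover have "1 / 2 * g \<le> pJ * g" using pJ g by (intro mult_right_mono)
    ultimately have "g \<le> 2 * exp (c + u)" by simp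
    also have "\<dots> \<le> exp u * exp (c + u)" using u by (intro mult_right_mono) auto
    also have "\<dots> = exp (c + 2 * u)" by (simp add: mult_exp_exp)
    also have "c + 2 * u \<le> (\<theta> * L1 + 3 * \<eta>) * \<beta>"
    proof -
      have "\<theta> * u \<le> 1 * u" using \<theta> u by (intro mult_right_mono) auto
      then show ?thesis by (simp add: c_def u_def algebra_simps)
    qed
    finally show ?thesis by simp
  qed
  define E2 where "E2 = exp ((L2 - \<eta>) * \<beta>)"
  have S: "E2 / 4 \<le> S"
  proof -
    \<comment> \<open>Chosen such that the term with \<open>F3\<close> takes at most half of the lower bound for \<open>F2\<close>.\<close>
    define d where "d = exp ((L2 - L3 - 2 * \<eta>) * \<beta>) / 2"
    have d: "0 < d" by (simp add: d_def)
    have "d * F3 \<le> d * exp ((L3 + \<eta>) * \<beta>)" using d F3 by (intro mult_left_mono) auto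
    also have "\<dots> = E2 / 2" by (simp add: d_def E2_def mult_exp_exp algebra_simps)
    finally have 1: "d * F3 \<le> E2 / 2" .
    have "pJc / d \<le> exp (- (2 * \<bar>L2\<bar> + \<bar>L3\<bar> + 4 * \<eta>) * \<beta>) / d" using d pJc by (intro divide_right_mono) auto
    also have "\<dots> = 2 * exp (- (2 * \<bar>L2\<bar> + \<bar>L3\<bar> + 4 * \<eta>) * \<beta> - (L2 - L3 - 2 * \<eta>) * \<beta>)"
      by (simp add: d_def exp_diff)
    also have "\<dots> \<le> 2 * exp ((L2 - \<eta>) * \<beta> - u)"
    proof -
      have "(- (2 * \<bar>L2\<bar> + \<bar>L3\<bar> + 4 * \<eta>) - (L2 - L3 - 2 * \<eta>)) * \<beta> \<le> (L2 - \<eta> - \<eta>) * \<beta>"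
        using \<beta> by (intro mult_right_mono) auto
      then show ?thesis by (simp add: u_def algebra_simps)
    qed
    also have "\<dots> = 2 * (exp (- u) * E2)" by (simp add: E2_def mult_exp_exp)
    also have "\<dots> \<le> 2 * (1 / 8 * E2)" using u by (intro mult_left_mono mult_right_mono) (auto simp: E2_def)
    finally have "pJc / d \<le> E2 / 4" by simp
    then show ?thesis using sp[OF d] 1 F2[folded E2_def] by linarith
  qed
  show "exp ((L2 - 3 * \<eta>) / \<theta> * \<beta>) \<le> g"
  proof -
    define c where "c = (L2 - 3 * \<eta>) * \<beta>"
    have "exp c * ((1 - \<theta>) * H2) \<le> exp c * (1 * exp u)"
    proof (intro mult_left_mono)
      have "(1 - \<theta>) * H2 \<le> (1 - \<theta>) * exp u" using \<theta> H2 by (intro mult_left_mono) (auto simp: u_def)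
      also have "\<dots> \<le> 1 * exp u" using \<theta> by (intro mult_right_mono) auto
      finally show "(1 - \<theta>) * H2 \<le> 1 * exp u" .
    qed simp
    also have "\<dots> = exp (- u) * E2" by (simp add: c_def u_def E2_def mult_exp_exp algebra_simps)
    also have "\<dots> \<le> 1 / 8 * E2" using u by (intro mult_right_mono) (auto simp: E2_def)
    finally have "E2 / 8 \<le> exp c * (\<theta> * exp (- c / \<theta>) * g)"
      using lo[of c] S by (simp add: distrib_left)
    also have "\<dots> = \<theta> * (exp (c - c / \<theta>) * g)" by (simp add: mult_exp_exp exp_diff exp_minus divide_inverse mult_ac)
    also have "\<dots> \<le> 1 * (exp (c - c / \<theta>) * g)" using \<theta> g by (intro mult_right_mono) auto
    finally have h: "E2 / 8 \<le> exp (c - c / \<theta>) * g" by simp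
    have "exp (- u) * E2 \<le> 1 / 8 * E2" using u by (intro mult_right_mono) (auto simp: E2_def)
    then have "exp (c / \<theta> - c) * (exp (- u) * E2) \<le> exp (c / \<theta> - c) * (exp (c - c / \<theta>) * g)"
      using h by (intro mult_left_mono) auto
    also have "\<dots> = g" unfolding mult.assoc[symmetric] mult_exp_exp by simp
    also have "exp (c / \<theta> - c) * (exp (- u) * E2) = exp (c / \<theta> + u)"
      by (simp add: E2_def mult_exp_exp c_def u_def algebra_simps)
    finally have h2: "exp (c / \<theta> + u) \<le> g" .
    have "exp (c / \<theta>) \<le> exp (c / \<theta> + u)" using u by simp
    then have "exp (c / \<theta>) \<le> g" using h2 by (rule order_trans)
    then show ?thesis by (simp add: c_def)
  qed
qed

context cell_system
begin

lemma Fc_pos: "0 < Fc k \<rho> t"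
proof -
  have "0 \<le> Fc k \<rho> t" by (simp add: Fc_def integral_nonneg_AE)
  moreover have "Fc k \<rho> t \<noteq> 0"
  proof
    assume "Fc k \<rho> t = 0"
    then have "AE N in PP \<rho>. exp (t * Tc k N) = 0"
      unfolding Fc_def by (subst (asm) integral_nonneg_eq_0_iff_AE[OF integrable_exp_Tc]) auto
    then show False by (simp add: AE_measure_pmf_iff set_pmf_not_empty)
  qed
  ultimately show ?thesis by simp
qed

lemma Fc_estimate:
  assumes "0 < \<rho>" "mgf_ok t \<eta> k D \<sigma> \<gamma> (\<rho> * vol) (\<tau> * (\<rho> * vol))"
  shows "exp ((exp t - 1 - \<eta>) * (\<rho> * PL k (\<rho> * vol))) \<le> Fc k \<rho> t"
    "Fc k \<rho> t \<le> exp ((exp t - 1 + \<eta>) * (\<rho> * PL k (\<rho> * vol)))"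
proof -
  have A: "0 \<le> \<rho> * vol" using assms vol_pos by simp
  have \<beta>: "0 \<le> \<rho> * PL k (\<rho> * vol)" using assms A by (simp add: PL_nonneg)
  have ok: "exp (\<bar>t\<bar> * real k) * (2 * (\<rho> * vol) * PL k (\<rho> * vol)) \<le> 1"
    "(1 + 2 * exp (\<bar>t\<bar> * real k) ^ (6 * D) * real D * exp (\<bar>t\<bar> * real k)) * (exp (\<bar>t\<bar> * real k) * (2 * (\<rho> * vol) * PL k (\<rho> * vol))) \<le> 1 / 2"
    using assms(2) unfolding mgf_ok_def Let_def by auto
  have "\<bar>ln (E (PP \<rho>) (\<lambda>N. exp (t * Tc k N))) - (exp t - 1) * (\<rho> * PL k (\<rho> * vol))\<bar> \<le> \<rho> * PL k (\<rho> * vol) * \<eta>"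
    using assms(2) unfolding mgf_ok_def Let_def
    by (intro order_trans[OF log_mgf_estimate[OF assms(1) refl refl ok]] mult_left_mono \<beta>) (simp add: pairX_def)
  then have "\<bar>ln (Fc k \<rho> t) - (exp t - 1) * (\<rho> * PL k (\<rho> * vol))\<bar> \<le> \<eta> * (\<rho> * PL k (\<rho> * vol))"
    by (simp add: Fc_def mult.commute)
  then have "(exp t - 1 - \<eta>) * (\<rho> * PL k (\<rho> * vol)) \<le> ln (Fc k \<rho> t)"
    "ln (Fc k \<rho> t) \<le> (exp t - 1 + \<eta>) * (\<rho> * PL k (\<rho> * vol))"
    by (auto simp: abs_le_iff algebra_simps)
  then show "exp ((exp t - 1 - \<eta>) * (\<rho> * PL k (\<rho> * vol))) \<le> Fc k \<rho> t"
    "Fc k \<rho> t \<le> exp ((exp t - 1 + \<eta>) * (\<rho> * PL k (\<rho> * vol)))"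
    using Fc_pos[of k \<rho> t] by (metis exp_le_cancel_iff exp_ln)+
qed

lemma Hc_estimate:
  assumes "0 < \<rho>" "0 \<le> h" "0 \<le> s" and w: "w = h * (s * exp (s * (1 + real D * real k)))"
    and "w * (2 * (\<rho> * vol)) * (1 + real k) \<le> 1"
    and "exp 1 ^ (4 * D) * (exp 1 * (w * (1 + 2 * (\<rho> * vol)))) \<le> \<eta>"
  shows "Hc k \<rho> h s \<le> exp (\<eta> * (\<rho> * PL k (\<rho> * vol)))"
proof -
  have w0: "0 \<le> w" using assms by simp
  have A: "0 \<le> \<rho> * vol" using assms vol_pos by simp
  have eq: "Hc k \<rho> h s = E (PP \<rho>) (\<lambda>N. exp (w * (\<rho> * Vc k N) + w * (2 * (\<rho> * vol)) * Tc k N))"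
    unfolding Hc_def w[symmetric] by (simp add: algebra_simps)
  have "Hc k \<rho> h s \<le> exp (exp 1 ^ (4 * D) * (exp 1 * ((w + w * (2 * (\<rho> * vol))) * (\<rho> * PL k (\<rho> * vol)))))"
    unfolding eq
  proof (rule crude_mgf_bound[OF _ w0])
    show "0 \<le> \<rho>" "0 \<le> w * (2 * (\<rho> * vol))" using assms(1) w0 A by auto
    show "w * (2 * (\<rho> * vol)) + w * (2 * (\<rho> * vol)) * real k \<le> 1" using assms(5) by (simp only: distrib_left mult_1_right)
  qed
  also have "\<dots> = exp (exp 1 ^ (4 * D) * (exp 1 * (w * (1 + 2 * (\<rho> * vol)))) * (\<rho> * PL k (\<rho> * vol)))"
    by (simp add: algebra_simps)
  also have "\<dots> \<le> exp (\<eta> * (\<rho> * PL k (\<rho> * vol)))"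
    unfolding exp_le_cancel_iff using assms A by (intro mult_right_mono) (auto simp: PL_nonneg)
  finally show ?thesis .
qed

text \<open>
  The coupling needs the Poisson system at \<open>t / \<theta>\<close> for the upper bound, and at
  \<open>\<theta> * t\<close> for the lower bound; the parameter \<open>2 * (\<theta> * t)\<close> enters through the
  atypical numbers of points.
\<close>

theorem gc_estimate:
  fixes \<rho> \<epsilon> t \<theta> \<eta> :: real and n k :: nat
  defines "A \<equiv> \<rho> * vol" and "\<beta> \<equiv> \<rho> * PL k (\<rho> * vol)"
  assumes \<rho>: "0 < \<rho>" and \<epsilon>: "0 < \<epsilon>" "\<epsilon> \<le> 1" and n: "real n = \<rho> * (1 + \<epsilon>)"
    and \<theta>: "0 < \<theta>" "\<theta> < 1" and \<eta>: "0 < \<eta>" "8 \<le> \<eta> * \<beta>"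
    and ok: "mgf_ok (t / \<theta>) \<eta> k D \<sigma> \<gamma> A (\<tau> * A)" "mgf_ok (\<theta> * t) \<eta> k D \<sigma> \<gamma> A (\<tau> * A)"
      "mgf_ok (2 * (\<theta> * t)) \<eta> k D \<sigma> \<gamma> A (\<tau> * A)"
    and w: "w = 2 * \<epsilon> * (\<bar>t\<bar> / (1 - \<theta>) * exp (\<bar>t\<bar> / (1 - \<theta>) * (1 + real D * real k)))"
      "w * (2 * A) * (1 + real k) \<le> 1" "exp 1 ^ (4 * D) * (exp 1 * (w * (1 + 2 * A))) \<le> \<eta>"
    and conc: "2 * exp (- (\<rho> * \<epsilon>\<^sup>2 / 4)) \<le> exp (- (2 * \<bar>exp (\<theta> * t) - 1\<bar> + \<bar>exp (2 * (\<theta> * t)) - 1\<bar> + 4 * \<eta>) * \<beta>)"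
  shows "gc k n t \<le> exp ((\<theta> * (exp (t / \<theta>) - 1) + 3 * \<eta>) * \<beta>)"
    "exp ((exp (\<theta> * t) - 1 - 3 * \<eta>) / \<theta> * \<beta>) \<le> gc k n t"
proof -
  define J where "J = {j. \<rho> * (1 - \<epsilon>) \<le> real j \<and> j \<le> n}"
  have finJ: "finite J" unfolding J_def by (rule finite_subset[of _ "{..n}"]) auto
  have A0: "0 < A" using \<rho> vol_pos by (simp add: A_def)
  have \<beta>0: "0 < \<beta>" using \<eta> by (smt (verit) mult_nonneg_nonpos)
  have "- J = {j. \<not> (\<rho> * (1 - \<epsilon>) \<le> real j \<and> real j \<le> \<rho> * (1 + \<epsilon>))}"
    by (auto simp: J_def n[symmetric])
  then have pJc: "measure (pois \<rho>) (- J) \<le> exp (- (2 * \<bar>exp (\<theta> * t) - 1\<bar> + \<bar>exp (2 * (\<theta> * t)) - 1\<bar> + 4 * \<eta>) * \<beta>)"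
    using pois_concentration[OF \<rho> \<epsilon>] conc by simp
  also have "\<dots> \<le> exp (- (\<eta> * \<beta>))"
  proof -
    have "- (2 * \<bar>exp (\<theta> * t) - 1\<bar> + \<bar>exp (2 * (\<theta> * t)) - 1\<bar> + 4 * \<eta>) * \<beta> \<le> - \<eta> * \<beta>"
    proof (rule mult_right_mono)
      show "- (2 * \<bar>exp (\<theta> * t) - 1\<bar> + \<bar>exp (2 * (\<theta> * t)) - 1\<bar> + 4 * \<eta>) \<le> - \<eta>"
      proof -
        have "- (2 * x + y + 4 * \<eta>) \<le> - \<eta>" if "0 \<le> x" "0 \<le> y" for x y :: real
          using that \<eta>(1) by linarith
        then show ?thesis using abs_ge_zero by blast
      qed
    qed (use \<beta>0 in simp)
    then show ?thesis by simp
  qed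
  also have "\<dots> \<le> 1 / 2"
  proof -
    have "2 \<le> exp (\<eta> * \<beta>)" using exp_ge_add_one_self[of "\<eta> * \<beta>"] \<eta> by linarith
    then show ?thesis by (simp add: exp_minus field_simps)
  qed
  finally have "measure (pois \<rho>) (- J) \<le> 1 / 2" .
  then have pJ: "1 / 2 \<le> measure (pois \<rho>) J"
    using measure_pmf.prob_compl[of J "pois \<rho>"] by (simp add: Compl_eq_Diff_UNIV)
  have w0: "0 \<le> w" using w(1) \<epsilon> \<theta> by simp
  have H1: "Hc k \<rho> (2 * \<epsilon>) (\<bar>t\<bar> / (1 - \<theta>)) \<le> exp (\<eta> * \<beta>)"
    unfolding \<beta>_def by (rule Hc_estimate[where w=w]) (use \<rho> \<epsilon> \<theta> w in \<open>auto simp: A_def\<close>)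
  have H2: "Hc k \<rho> (2 * \<epsilon>) (\<theta> * \<bar>t\<bar> / (1 - \<theta>)) \<le> exp (\<eta> * \<beta>)"
  proof -
    define s where "s = \<theta> * \<bar>t\<bar> / (1 - \<theta>)"
    define w' where "w' = 2 * \<epsilon> * (s * exp (s * (1 + real D * real k)))"
    have s: "0 \<le> s" "s \<le> \<bar>t\<bar> / (1 - \<theta>)"
    proof -
      show "0 \<le> s" using \<theta> by (simp add: s_def)
      have "\<theta> * \<bar>t\<bar> \<le> 1 * \<bar>t\<bar>" using \<theta> by (intro mult_right_mono) auto
      then show "s \<le> \<bar>t\<bar> / (1 - \<theta>)" using \<theta> by (simp add: s_def divide_right_mono)
    qed
    have mono: "2 * \<epsilon> * (a * exp (a * (1 + real D * real k))) \<le> 2 * \<epsilon> * (b * exp (b * (1 + real D * real k)))"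
      if "0 \<le> a" "a \<le> b" for a b
    proof -
      have "a * (1 + real D * real k) \<le> b * (1 + real D * real k)" using that by (intro mult_right_mono) auto
      then have "a * exp (a * (1 + real D * real k)) \<le> b * exp (b * (1 + real D * real k))"
        using that by (intro mult_mono) auto
      then show ?thesis using \<epsilon> by (intro mult_left_mono) auto
    qed
    have ww: "w' \<le> w" "0 \<le> w'"
      unfolding w(1) w'_def using mono[OF s] s \<epsilon> by auto
    show ?thesis
      unfolding \<beta>_def s_def[symmetric]
    proof (rule Hc_estimate[where w=w'])
      have "w' * (2 * A) * (1 + real k) \<le> w * (2 * A) * (1 + real k)" using ww A0 by (intro mult_right_mono) auto
      then show "w' * (2 * (\<rho> * vol)) * (1 + real k) \<le> 1" using w by (simp add: A_def)
      have "exp 1 ^ (4 * D) * (exp 1 * (w' * (1 + 2 * A))) \<le> exp 1 ^ (4 * D) * (exp 1 * (w * (1 + 2 * A)))"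
        using ww A0 by (intro mult_left_mono mult_right_mono) auto
      then show "exp 1 ^ (4 * D) * (exp 1 * (w' * (1 + 2 * (\<rho> * vol)))) \<le> \<eta>" using w by (simp add: A_def)
    qed (use \<rho> \<epsilon> s w'_def in auto)
  qed
  note ce = coupled_expectations[OF \<rho> \<theta> J_def n \<epsilon>(1), of k t]
  note ok' = ok[unfolded A_def]
  note F1 = Fc_estimate(2)[OF \<rho> ok'(1), folded \<beta>_def]
  note F2 = Fc_estimate(1)[OF \<rho> ok'(2), folded \<beta>_def]
  note F3 = Fc_estimate(2)[OF \<rho> ok'(3), folded \<beta>_def]
  have g0: "0 \<le> gc k n t" by (simp add: gc_def integral_nonneg_AE)
  note sw = coupled_moment_sandwich[OF \<theta> \<eta> ce(1) ce(2) good_part_large[OF \<rho> finJ] F1 F2 F3 H1 H2 pJ pJc g0]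
  show "gc k n t \<le> exp ((\<theta> * (exp (t / \<theta>) - 1) + 3 * \<eta>) * \<beta>)" by (rule sw(1))
  show "exp ((exp (\<theta> * t) - 1 - 3 * \<eta>) / \<theta> * \<beta>) \<le> gc k n t" by (rule sw(2))
qed

end

section \<open>Geometry of the torus\<close>

definition lattice :: "(real ^ 'd) set" where "lattice = {z. \<forall>i. z $ i \<in> \<int>}"

lemma lattice_simps: "0 \<in> lattice" "z \<in> lattice \<Longrightarrow> - z \<in> lattice"
  "z \<in> lattice \<Longrightarrow> w \<in> lattice \<Longrightarrow> z + w \<in> lattice" "z \<in> lattice \<Longrightarrow> w \<in> lattice \<Longrightarrow> z - w \<in> lattice"
  by (auto simp: lattice_def)

lemma torus_dist_lattice: "torus_dist x y = (INF z\<in>lattice. norm (x - y + z))"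
  by (simp add: torus_dist_def lattice_def)

lemma torus_dist_le: "z \<in> lattice \<Longrightarrow> torus_dist x y \<le> norm (x - y + z)"
  unfolding torus_dist_lattice by (rule cINF_lower) (auto intro: bdd_belowI[of _ 0])

text \<open>
  The representative of \<open>v\<close> of least norm modulo the integer lattice.
\<close>

definition frac_rep :: "real ^ 'd \<Rightarrow> real ^ 'd" where
  "frac_rep v = (\<chi> i. v $ i - of_int (round (v $ i)))"

lemma frac_rep_minimal:
  assumes "z \<in> lattice"
  shows "norm (frac_rep v) \<le> norm (v + z)"
proof (rule norm_le_componentwise_cart)
  fix i
  obtain m where m: "z $ i = of_int m" using assms by (auto simp: lattice_def elim: Ints_cases)
  have "\<bar>v $ i - of_int (round (v $ i))\<bar> \<le> \<bar>v $ i - of_int (- m)\<bar>" by (rule round_diff_minimal)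
  then show "norm (frac_rep v $ i) \<le> norm ((v + z) $ i)" by (simp add: frac_rep_def m)
qed

lemma frac_rep_in: "frac_rep v - v \<in> lattice"
  by (auto simp: frac_rep_def lattice_def)

lemma torus_dist_eq_norm: "torus_dist x y = norm (frac_rep (x - y))"
proof (rule antisym)
  show "torus_dist x y \<le> norm (frac_rep (x - y))"
    using torus_dist_le[OF frac_rep_in, of x y "x - y"] by simp
  show "norm (frac_rep (x - y)) \<le> torus_dist x y"
    unfolding torus_dist_lattice by (intro cINF_greatest frac_rep_minimal) (use lattice_simps in auto)
qed

lemma torus_dist_attained: obtains z where "z \<in> lattice" "torus_dist x y = norm (x - y + z)"
  using frac_rep_in[of "x - y"] torus_dist_eq_norm[of x y] that[of "frac_rep (x - y) - (x - y)"] by simp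

lemma torus_dist_nonneg: "0 \<le> torus_dist x y"
  by (simp add: torus_dist_eq_norm)

lemma torus_dist_le_norm: "torus_dist x y \<le> norm (x - y)"
  using torus_dist_le[OF lattice_simps(1), of x y] by simp

lemma torus_dist_self [simp]: "torus_dist x x = 0"
  using torus_dist_le_norm[of x x] torus_dist_nonneg[of x x] by simp

lemma torus_dist_sym: "torus_dist x y = torus_dist y x"
proof -
  have "torus_dist x y \<le> torus_dist y x" for x y :: "real ^ 'd"
  proof -
    obtain z where z: "z \<in> lattice" "torus_dist y x = norm (y - x + z)" by (rule torus_dist_attained)
    have "torus_dist x y \<le> norm (x - y + (- z))" using z lattice_simps by (intro torus_dist_le) auto
    also have "\<dots> = norm (- (y - x + z))" by (simp add: algebra_simps)
    finally show ?thesis using z by (simp only: norm_minus_cancel)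
  qed
  then show ?thesis by (intro antisym)
qed

lemma torus_dist_triangle: "torus_dist x y \<le> torus_dist x w + torus_dist w y"
proof -
  obtain z1 where z1: "z1 \<in> lattice" "torus_dist x w = norm (x - w + z1)" by (rule torus_dist_attained)
  obtain z2 where z2: "z2 \<in> lattice" "torus_dist w y = norm (w - y + z2)" by (rule torus_dist_attained)
  have "torus_dist x y \<le> norm (x - y + (z1 + z2))" using z1 z2 lattice_simps by (intro torus_dist_le) auto
  also have "x - y + (z1 + z2) = (x - w + z1) + (w - y + z2)" by simp
  also have "norm \<dots> \<le> norm (x - w + z1) + norm (w - y + z2)" by (rule norm_triangle_ineq)
  finally show ?thesis using z1 z2 by simp
qed

lemma torus_dist_near:
  assumes "norm (x - y) \<le> 1 / 2"
  shows "torus_dist x y = norm (x - y)"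
proof (rule antisym[OF torus_dist_le_norm])
  obtain z where z: "z \<in> lattice" "torus_dist x y = norm (x - y + z)" by (rule torus_dist_attained)
  have "norm (x - y) \<le> norm (x - y + z)"
  proof (rule norm_le_componentwise_cart)
    fix i
    have c: "\<bar>(x - y) $ i\<bar> \<le> 1 / 2" using component_le_norm_cart[of "x - y" i] assms by linarith
    obtain m where m: "z $ i = of_int m" using z by (auto simp: lattice_def elim: Ints_cases)
    have "m = 0 \<or> 1 \<le> \<bar>real_of_int m\<bar>" by (cases "m = 0") (auto simp flip: of_int_abs)
    moreover have "\<bar>a\<bar> \<le> \<bar>a + b\<bar>" if "\<bar>a\<bar> \<le> 1 / 2" "b = 0 \<or> 1 \<le> \<bar>b\<bar>" for a b :: real
      using that by linarith
    ultimately show "norm ((x - y) $ i) \<le> norm ((x - y + z) $ i)" using c m by auto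
  qed
  then show "norm (x - y) \<le> torus_dist x y" using z by simp
qed

lemma lattice_norm: "z \<in> lattice \<Longrightarrow> norm z < 1 \<Longrightarrow> z = 0"
proof -
  assume z: "z \<in> lattice" "norm z < 1"
  have "z $ i = 0" for i
  proof -
    have "\<bar>z $ i\<bar> < 1" using component_le_norm_cart[of z i] z by linarith
    moreover obtain m where "z $ i = of_int m" using z by (auto simp: lattice_def elim: Ints_cases)
    ultimately show ?thesis by (simp flip: of_int_abs)
  qed
  then show ?thesis by (simp add: vec_eq_iff)
qed

lemma countable_lattice: "countable (lattice :: (real ^ 'd) set)"
proof -
  have "lattice \<subseteq> (\<lambda>f :: 'd \<Rightarrow> int. (\<chi> i. of_int (f i)) :: real ^ 'd) ` UNIV"
  proof
    fix z :: "real ^ 'd" assume "z \<in> lattice"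
    then have "z = (\<chi> i. of_int \<lfloor>z $ i\<rfloor>)" by (auto simp: lattice_def vec_eq_iff elim!: Ints_cases)
    then show "z \<in> (\<lambda>f :: 'd \<Rightarrow> int. (\<chi> i. of_int (f i)) :: real ^ 'd) ` UNIV" by (intro image_eqI) auto
  qed
  then show ?thesis by (rule countable_subset) auto
qed

lemma torus_dist_cont: "\<bar>torus_dist x y - torus_dist x y'\<bar> \<le> norm (y - y')"
proof -
  have "torus_dist x y \<le> torus_dist x y' + norm (y - y')" for y y'
    using torus_dist_triangle[of x y y'] torus_dist_le_norm[of y' y] by (simp add: norm_minus_commute)
  from this[of y y'] this[of y' y] show ?thesis by (simp add: abs_le_iff norm_minus_commute)
qed

lemma continuous_torus_dist: "continuous_on UNIV (torus_dist x)"
proof (rule continuous_onI)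
  fix y e assume "0 < (e :: real)"
  then show "\<exists>d>0. \<forall>y'\<in>UNIV. dist y' y < d \<longrightarrow> dist (torus_dist x y') (torus_dist x y) \<le> e"
    using torus_dist_cont[of x _ y] by (intro exI[of _ e]) (auto simp: dist_norm intro: order_trans less_imp_le)
qed

lemma closed_unit_cube: "closed (unit_cube :: (real ^ 'd) set)"
  unfolding unit_cube_def
  by (intro closed_Collect_all closed_Collect_conj closed_Collect_le continuous_intros)

lemma unit_cube_cbox: "unit_cube = cbox 0 (1 :: real ^ 'd)"
  by (auto simp: unit_cube_def mem_box_cart)

lemma closed_torus_ball: "closed (torus_ball r x)"
proof -
  have "closed {y. torus_dist x y \<le> r}"
    by (intro closed_Collect_le continuous_torus_dist continuous_on_const)
  then have "closed (unit_cube \<inter> {y. torus_dist x y \<le> r})" using closed_unit_cube by (rule closed_Int[rotated])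
  then show ?thesis by (simp add: torus_ball_def Collect_conj_eq)
qed

lemma torus_ball_borel [measurable]: "torus_ball r x \<in> sets borel"
  using closed_torus_ball by (rule borel_closed)

lemma unit_cube_borel [measurable]: "unit_cube \<in> sets borel"
  using closed_unit_cube by (rule borel_closed)

lemma finite_emeasure_cube: "A \<subseteq> unit_cube \<Longrightarrow> emeasure lborel (A :: (real ^ 'd) set) \<noteq> \<infinity>"
proof -
  assume "A \<subseteq> unit_cube"
  then have "emeasure lborel A \<le> emeasure lborel (unit_cube :: (real ^ 'd) set)"
    by (intro emeasure_mono) auto
  also have "\<dots> < \<infinity>" unfolding unit_cube_cbox by (rule emeasure_lborel_cbox_finite)
  finally show ?thesis by auto
qed

lemma measure_unit_cube: "measure lborel (unit_cube :: (real ^ 'd) set) = 1"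
proof -
  have "0 \<in> cbox 0 (1 :: real ^ 'd)" by (simp add: mem_box_cart)
  then have "cbox 0 (1 :: real ^ 'd) \<noteq> {}" by blast
  from content_cbox_cart[OF this] show ?thesis by (simp add: unit_cube_cbox)
qed

lemma measure_mono_cube:
  "A \<subseteq> B \<Longrightarrow> B \<subseteq> unit_cube \<Longrightarrow> A \<in> sets borel \<Longrightarrow> B \<in> sets borel \<Longrightarrow> measure lborel (A :: (real ^ 'd) set) \<le> measure lborel B"
  using finite_emeasure_cube[of B] finite_emeasure_cube[of A]
  by (intro measure_mono_fmeasurable) (auto simp: fmeasurable_def less_top)

definition unit_vol :: "'d::finite itself \<Rightarrow> real" where
  "unit_vol _ = measure lborel (ball (0 :: real ^ 'd) 1)"

lemma unit_vol_pos: "0 < unit_vol TYPE('d::finite)"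
  unfolding unit_vol_def by (rule content_ball_pos) simp

text \<open>
  For \<open>r < 1 / 2\<close> the Euclidean ball around \<open>x\<close> does not meet its own translates by lattice
  vectors. The lattice translates of the cube cut it into pieces, which translation
  reassembles to the torus ball.
\<close>

theorem measure_torus_ball:
  fixes x :: "real ^ 'd"
  assumes r: "0 \<le> r" "r < 1 / 2"
  shows "measure lborel (torus_ball r x) = unit_vol TYPE('d) * r ^ CARD('d)"
proof -
  define Q0 where "Q0 = {y :: real ^ 'd. \<forall>i. 0 \<le> y $ i \<and> y $ i < 1}"
  have Q0m: "Q0 \<in> sets borel"
  proof -
    have "Q0 = (\<Inter>i. {y. 0 \<le> y $ i} \<inter> {y. y $ i < 1})" by (auto simp: Q0_def)
    moreover have "{y :: real ^ 'd. 0 \<le> y $ i} \<in> sets borel" "{y :: real ^ 'd. y $ i < 1} \<in> sets borel" for i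
      by (intro borel_closed closed_Collect_le borel_open open_Collect_less continuous_intros)+
    ultimately show ?thesis by (simp only:) (intro sets.finite_INT sets.Int; simp)
  qed
  define S where "S z = {y. norm (y + z - x) \<le> r}" for z :: "real ^ 'd"
  define A where "A z = Q0 \<inter> S z" for z :: "real ^ 'd"
  have Sm: "S z \<in> sets borel" for z
    unfolding S_def by (intro borel_closed closed_Collect_le continuous_intros)
  have Am: "A z \<in> sets borel" for z using Sm Q0m by (auto simp: A_def)
  have tb: "torus_ball r x \<inter> Q0 = (\<Union>z\<in>lattice. A z)"
  proof (intro set_eqI iffI)
    fix y assume y: "y \<in> torus_ball r x \<inter> Q0"
    obtain z where z: "z \<in> lattice" "torus_dist x y = norm (x - y + z)" by (rule torus_dist_attained)
    have "norm (y + (- z) - x) = norm (- (x - y + z))" by (simp add: algebra_simps)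
    then have "y \<in> A (- z)" using y z unfolding norm_minus_cancel by (auto simp: A_def S_def torus_ball_def)
    then show "y \<in> (\<Union>z\<in>lattice. A z)" using z lattice_simps by blast
  next
    fix y assume "y \<in> (\<Union>z\<in>lattice. A z)"
    then obtain z where z: "z \<in> lattice" "y \<in> Q0" "norm (y + z - x) \<le> r" by (auto simp: A_def S_def)
    have "torus_dist y x \<le> norm (y - x + z)" by (rule torus_dist_le[OF z(1)])
    also have "y - x + z = y + z - x" by simp
    finally have "torus_dist x y \<le> r" using z by (simp add: torus_dist_sym)
    moreover have "y \<in> unit_cube" using z(2) by (auto simp: Q0_def unit_cube_def intro: less_imp_le)
    ultimately show "y \<in> torus_ball r x \<inter> Q0" using z by (auto simp: torus_ball_def)
  qed
  have disjA: "disjoint_family_on A lattice"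
    unfolding disjoint_family_on_def
  proof (intro ballI impI)
    fix z w :: "real ^ 'd" assume zw: "z \<in> lattice" "w \<in> lattice" "z \<noteq> w"
    show "A z \<inter> A w = {}"
    proof (rule ccontr)
      assume "A z \<inter> A w \<noteq> {}"
      then obtain y where y: "norm (y + z - x) \<le> r" "norm (y + w - x) \<le> r" by (auto simp: A_def S_def)
      have "z - w = (y + z - x) - (y + w - x)" by simp
      then have "norm (z - w) \<le> norm (y + z - x) + norm (y + w - x)" by (metis norm_triangle_ineq4)
      then have "norm (z - w) < 1" using y r by linarith
      then have "z - w = 0" using zw lattice_simps by (intro lattice_norm) auto
      then show False using zw by simp
    qed
  qed
  define B where "B z = (\<lambda>y. y - z) -` A z" for z :: "real ^ 'd"
  have Bm: "B z \<in> sets borel" for z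
    unfolding B_def using measurable_sets[of "\<lambda>y. y - z" borel borel "A z"] Am by simp
  have eB: "emeasure lborel (B z) = emeasure lborel (A z)" for z
  proof -
    have "emeasure lborel (A z) = emeasure (distr lborel borel ((+) (- z))) (A z)"
      by (simp only: lborel_distr_plus)
    also have "\<dots> = emeasure lborel (B z)"
    proof -
      have "(+) (- z) = (\<lambda>y. y - z)" by auto
      then show ?thesis using Am by (subst emeasure_distr) (auto simp: B_def)
    qed
    finally show ?thesis ..
  qed
  have cb: "cball x r = (\<Union>z\<in>lattice. B z)"
  proof (intro set_eqI iffI)
    fix y assume y: "y \<in> cball x r"
    define z :: "real ^ 'd" where "z = (\<chi> i. of_int \<lfloor>y $ i\<rfloor>)"
    have "z \<in> lattice" by (auto simp: z_def lattice_def)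
    moreover have "y - z \<in> Q0" by (auto simp: z_def Q0_def) linarith
    ultimately show "y \<in> (\<Union>z\<in>lattice. B z)" using y by (auto simp: B_def A_def S_def dist_norm norm_minus_commute)
  next
    fix y assume "y \<in> (\<Union>z\<in>lattice. B z)"
    then show "y \<in> cball x r" by (auto simp: B_def A_def S_def dist_norm norm_minus_commute)
  qed
  have disjB: "disjoint_family_on B lattice"
    unfolding disjoint_family_on_def
  proof (intro ballI impI)
    fix z w :: "real ^ 'd" assume zw: "z \<in> lattice" "w \<in> lattice" "z \<noteq> w"
    show "B z \<inter> B w = {}"
    proof (rule ccontr)
      assume "B z \<inter> B w \<noteq> {}"
      then obtain y where y: "y - z \<in> Q0" "y - w \<in> Q0" by (auto simp: B_def A_def)
      have "z $ i = w $ i" for i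
      proof -
        obtain m l where ml: "z $ i = of_int m" "w $ i = of_int l"
          using zw by (auto simp: lattice_def elim!: Ints_cases) (metis Ints_cases)
        have "\<bar>real_of_int m - real_of_int l\<bar> < 1" using y ml by (auto simp: Q0_def) (smt (verit))
        then have "real_of_int \<bar>m - l\<bar> < 1" by simp
        then show ?thesis using ml by simp
      qed
      then show False using zw by (simp add: vec_eq_iff)
    qed
  qed
  have "emeasure lborel (torus_ball r x \<inter> Q0) = (\<integral>\<^sup>+z. emeasure lborel (A z) \<partial>count_space lattice)"
    unfolding tb by (rule emeasure_UN_countable[OF _ countable_lattice disjA]) (simp add: Am)
  also have "\<dots> = (\<integral>\<^sup>+z. emeasure lborel (B z) \<partial>count_space lattice)" by (simp add: eB)
  also have "\<dots> = emeasure lborel (cball x r)"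
    unfolding cb by (rule emeasure_UN_countable[OF _ countable_lattice disjB, symmetric]) (simp add: Bm)
  finally have 1: "emeasure lborel (torus_ball r x \<inter> Q0) = emeasure lborel (cball x r)" .
  have "torus_ball r x - Q0 \<subseteq> (\<Union>i. {y. y $ i = 1})"
    by (auto simp: torus_ball_def unit_cube_def Q0_def) (metis antisym_conv1 not_le)
  moreover have "(\<Union>i. {y :: real ^ 'd. y $ i = 1}) \<in> null_sets lborel"
  proof (rule null_sets.finite_UN)
    fix i
    have "negligible {y :: real ^ 'd. y $ i = 1}" 
      using negligible_standard_hyperplane[of "axis i 1 :: real ^ 'd" 1] by (simp add: inner_axis axis_in_Basis_iff)
    moreover have "{y :: real ^ 'd. y $ i = 1} \<in> sets borel" by (intro borel_closed closed_Collect_eq continuous_intros)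
    ultimately show "{y :: real ^ 'd. y $ i = 1} \<in> null_sets lborel"
      by (simp add: negligible_iff_null_sets null_sets_completion_iff)
  qed auto
  moreover have "torus_ball r x - Q0 \<in> sets lborel" using Q0m by simp
  ultimately have "torus_ball r x - Q0 \<in> null_sets lborel"
    by (metis null_sets_subset)
  then have "emeasure lborel (torus_ball r x) = emeasure lborel (torus_ball r x \<inter> Q0)"
    using emeasure_Un_null_set[of "torus_ball r x \<inter> Q0" lborel "torus_ball r x - Q0"] Q0m by (simp add: Int_Diff_Un)
  then have "measure lborel (torus_ball r x) = measure lborel (cball x r)" using 1 by (simp add: measure_def)
  also have "\<dots> = unit_vol TYPE('d) * r ^ CARD('d)"
    using r by (simp add: content_cball unit_vol_def content_ball)
  finally show ?thesis .
qed

lemma torus_ball_cube: "torus_ball r x \<subseteq> unit_cube" by (auto simp: torus_ball_def)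

text \<open>
  A ball of radius \<open>\<epsilon> / 4 * r\<close> fits into the difference. If \<open>x\<close> and \<open>y\<close> are close,
  its centre is found by moving from \<open>y\<close> straight away from \<open>x\<close>; if they are far apart, \<open>y\<close>
  itself will do.
\<close>

lemma measure_annulus_ge:
  fixes x y :: "real ^ 'd"
  assumes r: "0 < r" "r \<le> 1 / 8" and e: "0 < \<epsilon>" "\<epsilon> \<le> 1" and xy: "\<epsilon> * r \<le> torus_dist x y"
    and r': "r' < r + \<epsilon> * r / 2"
  shows "unit_vol TYPE('d) * (\<epsilon> / 4 * r) ^ CARD('d) \<le> measure lborel (torus_ball r y - torus_ball r' x)"
proof -
  define s where "s = \<epsilon> / 4 * r"
  define t where "t = torus_dist x y"
  have er: "0 < \<epsilon> * r" "\<epsilon> * r \<le> r" using r e by (auto simp: mult_le_cancel_right1)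
  then have s: "0 < s" "s \<le> r / 4" "4 * s = \<epsilon> * r" by (auto simp: s_def)
  have "\<exists>w. torus_dist w y \<le> r - s \<and> r' < torus_dist w x - s"
  proof (cases "t \<le> 3 * r")
    case True
    obtain z where z: "z \<in> lattice" "torus_dist y x = norm (y - x + z)" by (rule torus_dist_attained)
    define u where "u = y - x + z"
    have u: "norm u = t" using z by (simp add: u_def t_def torus_dist_sym)
    have t0: "0 < t" using xy er by (simp add: t_def)
    define w where "w = y + z + ((r - s) / t) *\<^sub>R u"
    have "w - x = (1 + (r - s) / t) *\<^sub>R u" by (simp add: w_def u_def algebra_simps)
    then have "norm (w - x) = \<bar>1 + (r - s) / t\<bar> * t" using u by simp
    also have "\<dots> = t + (r - s)" using t0 s r by (simp add: field_simps abs_of_nonneg)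
    finally have wx: "norm (w - x) = t + (r - s)" .
    have "torus_dist w x = t + (r - s)"
      using torus_dist_near[of w x] wx True r s by simp
    moreover have "torus_dist w y \<le> norm (w - y + (- z))" using z lattice_simps by (intro torus_dist_le) auto
    moreover have "norm (w - y + (- z)) = r - s" using u t0 s r by (simp add: w_def)
    ultimately show ?thesis using xy s r' by (intro exI[of _ w]) (auto simp: t_def)
  next
    case False
    have "r' < torus_dist y x - s" using False r' er s r by (simp add: t_def torus_dist_sym)
    then show ?thesis using s r by (intro exI[of _ y]) auto
  qed
  then obtain w where w: "torus_dist w y \<le> r - s" "r' < torus_dist w x - s" by auto
  have sub: "torus_ball s w \<subseteq> torus_ball r y - torus_ball r' x"
  proof
    fix v assume v: "v \<in> torus_ball s w"
    then have vw: "torus_dist w v \<le> s" "v \<in> unit_cube" by (auto simp: torus_ball_def)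
    have "torus_dist y v \<le> r" using torus_dist_triangle[of y v w] vw w by (simp add: torus_dist_sym)
    moreover have "r' < torus_dist x v" using torus_dist_triangle[of w x v] vw w by (simp add: torus_dist_sym)
    ultimately show "v \<in> torus_ball r y - torus_ball r' x" using vw by (auto simp: torus_ball_def)
  qed
  have "unit_vol TYPE('d) * s ^ CARD('d) = measure lborel (torus_ball s w)"
    using s r by (intro measure_torus_ball[symmetric]) auto
  also have "\<dots> \<le> measure lborel (torus_ball r y - torus_ball r' x)"
    using torus_ball_cube by (intro measure_mono_cube sub) auto
  finally show ?thesis by (simp add: s_def)
qed

text \<open>
  The balls of radius \<open>s\<close> around the points of \<open>F\<close> are disjoint.
\<close>

lemma packing_bound:
  fixes F :: "(real ^ 'd) set"
  assumes F: "finite F" "\<And>f g. f \<in> F \<Longrightarrow> g \<in> F \<Longrightarrow> f \<noteq> g \<Longrightarrow> 2 * s < torus_dist f g"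
    and s: "0 < s" "s < 1 / 2" and A: "A \<in> sets borel" "A \<subseteq> unit_cube" "\<And>f. f \<in> F \<Longrightarrow> torus_ball s f \<subseteq> A"
  shows "card F * (unit_vol TYPE('d) * s ^ CARD('d)) \<le> measure lborel A"
proof -
  have disj: "disjoint_family_on (torus_ball s) F"
    unfolding disjoint_family_on_def
  proof (intro ballI impI)
    fix f g assume fg: "f \<in> F" "g \<in> F" "f \<noteq> g"
    show "torus_ball s f \<inter> torus_ball s g = {}"
    proof (rule ccontr)
      assume "torus_ball s f \<inter> torus_ball s g \<noteq> {}"
      then obtain v where "torus_dist f v \<le> s" "torus_dist g v \<le> s" by (auto simp: torus_ball_def)
      then show False using torus_dist_triangle[of f g v] F(2)[OF fg] by (simp add: torus_dist_sym)
    qed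
  qed
  have "card F * (unit_vol TYPE('d) * s ^ CARD('d)) = (\<Sum>f\<in>F. measure lborel (torus_ball s f))"
    using s by (simp add: measure_torus_ball)
  also have "\<dots> = measure lborel (\<Union>f\<in>F. torus_ball s f)"
    using finite_emeasure_cube[OF torus_ball_cube]
    by (intro measure_UNION'[symmetric] F(1)) (use disj in \<open>auto simp: fmeasurable_def less_top disjoint_family_on_def pairwise_def disjnt_def\<close>)
  also have "\<dots> \<le> measure lborel A" using A F by (intro measure_mono_cube) auto
  finally show ?thesis .
qed

section \<open>Partitions of the torus into small cells\<close>

text \<open>
  A separated set of maximal size is a net, and the packing bound limits the size.
\<close>

lemma exists_net:
  assumes r: "0 < r" "r \<le> 1"
  obtains F :: "(real ^ 'd) set" where "finite F" "F \<subseteq> unit_cube"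
    "\<And>f g. f \<in> F \<Longrightarrow> g \<in> F \<Longrightarrow> f \<noteq> g \<Longrightarrow> r / 2 < torus_dist f g"
    "\<And>x. x \<in> unit_cube \<Longrightarrow> \<exists>f\<in>F. torus_dist f x \<le> r / 2"
proof -
  define P where "P F \<longleftrightarrow> finite F \<and> F \<subseteq> unit_cube \<and> (\<forall>f\<in>F. \<forall>g\<in>F. f \<noteq> g \<longrightarrow> r / 2 < torus_dist f g)"
    for F :: "(real ^ 'd) set"
  define c where "c = unit_vol TYPE('d) * (r / 4) ^ CARD('d)"
  have c: "0 < c" using r by (simp add: c_def unit_vol_pos)
  have bound: "card F \<le> nat \<lceil>1 / c\<rceil>" if "P F" for F
  proof -
    have "card F * c \<le> measure lborel (unit_cube :: (real ^ 'd) set)"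
      unfolding c_def using that r torus_ball_cube by (intro packing_bound) (auto simp: P_def)
    then have "card F \<le> 1 / c" using c by (simp add: measure_unit_cube field_simps)
    then show ?thesis by linarith
  qed
  have "P {}" by (simp add: P_def)
  then obtain F where F: "P F" "\<And>G. P G \<Longrightarrow> card G \<le> card F"
    using ex_has_greatest_nat[of P "{}" card "Suc (nat \<lceil>1 / c\<rceil>)"] bound by (metis le_imp_less_Suc)
  have "\<exists>f\<in>F. torus_dist f x \<le> r / 2" if x: "x \<in> unit_cube" for x
  proof (rule ccontr)
    assume n: "\<not> (\<exists>f\<in>F. torus_dist f x \<le> r / 2)"
    then have "x \<notin> F" using r by force
    moreover have "P (insert x F)" using F(1) n x by (auto simp: P_def torus_dist_sym not_le)
    ultimately show False using F(2)[of "insert x F"] F(1) by (simp add: P_def)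
  qed
  then show ?thesis using F(1) by (intro that[of F]) (auto simp: P_def)
qed

lemma num_points_eq_sum: "num_points N A = (\<Sum>x\<in>#N. of_bool (x \<in> A))"
  by (induction N) (auto simp: num_points_def)

text \<open>
  A partition of the cube into finitely many Borel cells of small diameter. The labels are
  pairs, since their second component will serve as the class of the cell.
\<close>

locale fine_labels =
  fixes lab :: "real ^ 'd \<Rightarrow> nat \<times> nat" and r \<delta> :: real
  assumes lab_meas: "\<And>q. {x \<in> unit_cube. lab x = q} \<in> sets borel"
    and fin_lab: "finite (lab ` unit_cube)"
    and fine: "\<And>x y. x \<in> unit_cube \<Longrightarrow> y \<in> unit_cube \<Longrightarrow> lab x = lab y \<Longrightarrow> torus_dist x y \<le> \<delta>"
begin

definition cell :: "nat \<times> nat \<Rightarrow> (real ^ 'd) set" where "cell q = {x \<in> unit_cube. lab x = q}"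
definition QQ where "QQ = lab ` unit_cube"
definition mass where "mass q = measure lborel (cell q)"
definition nbr where "nbr q = {q' \<in> QQ. \<exists>x\<in>cell q. \<exists>y\<in>cell q'. torus_dist x y \<le> r}"
definition region where "region U = {x \<in> unit_cube. lab x \<in> U}"

definition TT :: "nat \<Rightarrow> (nat \<times> nat \<Rightarrow> nat) \<Rightarrow> nat" where
  "TT k c = (\<Sum>q\<in>QQ. c q * of_bool (sum c (nbr q) \<le> k))"

lemma cell_meas [measurable]: "cell q \<in> sets borel" by (simp add: cell_def lab_meas)

lemma region_eq: "region U = (\<Union>q\<in>U. cell q)" by (auto simp: region_def cell_def)

lemma fin_QQ: "finite QQ" using fin_lab by (simp add: QQ_def)

lemma nbr_sub: "nbr q \<subseteq> QQ" by (auto simp: nbr_def)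

lemma region_meas: "U \<subseteq> QQ \<Longrightarrow> region U \<in> sets borel"
  unfolding region_eq using fin_QQ finite_subset by (intro sets.finite_UN) auto

lemma region_mass: "U \<subseteq> QQ \<Longrightarrow> sum mass U = measure lborel (region U)"
proof -
  assume "U \<subseteq> QQ"
  then have "finite U" using fin_QQ finite_subset by auto
  moreover have "cell q \<in> fmeasurable lborel" for q
  proof -
    have "cell q \<subseteq> unit_cube" by (auto simp: cell_def)
    from finite_emeasure_cube[OF this] show ?thesis by (simp add: fmeasurable_def less_top)
  qed
  moreover have "pairwise (\<lambda>q q'. disjnt (cell q) (cell q')) U"
    by (auto simp: pairwise_def disjnt_def cell_def)
  ultimately show ?thesis
    unfolding region_eq mass_def by (intro measure_UNION'[symmetric])
qed

lemma cell_nonempty: "q \<in> QQ \<Longrightarrow> \<exists>x. x \<in> cell q" by (auto simp: QQ_def cell_def)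

lemma cell_dist: "x \<in> cell q \<Longrightarrow> y \<in> cell q \<Longrightarrow> torus_dist x y \<le> \<delta>"
  by (auto simp: cell_def intro: fine)

lemma region_lower: "x \<in> cell q \<Longrightarrow> torus_ball r x \<subseteq> region (nbr q)"
proof
  fix y assume x: "x \<in> cell q" and y: "y \<in> torus_ball r x"
  then have "y \<in> cell (lab y)" "y \<in> unit_cube" "torus_dist x y \<le> r" by (auto simp: cell_def torus_ball_def)
  then show "y \<in> region (nbr q)" using x by (auto simp: region_def nbr_def QQ_def)
qed

lemma region_upper: "x \<in> cell q \<Longrightarrow> y \<in> region (nbr q) \<Longrightarrow> torus_dist x y \<le> r + 2 * \<delta>"
proof -
  assume x: "x \<in> cell q" and y: "y \<in> region (nbr q)"
  then obtain x0 y0 where z: "x0 \<in> cell q" "y0 \<in> cell (lab y)" "torus_dist x0 y0 \<le> r"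
    by (auto simp: region_def nbr_def)
  have "y \<in> cell (lab y)" using y by (auto simp: region_def cell_def)
  then have "torus_dist y0 y \<le> \<delta>" using z cell_dist by auto
  moreover have "torus_dist x x0 \<le> \<delta>" using x z cell_dist by auto
  ultimately show ?thesis using z torus_dist_triangle[of x y x0] torus_dist_triangle[of x0 y y0] by linarith
qed

lemma region_upper': "x \<in> cell q \<Longrightarrow> region (nbr q) \<subseteq> torus_ball (r + 2 * \<delta>) x"
proof
  fix y assume "x \<in> cell q" and y: "y \<in> region (nbr q)"
  then have "torus_dist x y \<le> r + 2 * \<delta>" by (rule region_upper)
  then show "y \<in> torus_ball (r + 2 * \<delta>) x" using y by (simp add: torus_ball_def region_def)
qed

lemma sum_points_label:
  fixes g :: "nat \<times> nat \<Rightarrow> nat"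
  assumes "set_mset N \<subseteq> unit_cube"
  shows "(\<Sum>q\<in>QQ. num_points N (cell q) * g q) = (\<Sum>x\<in>#N. g (lab x))"
  using assms
proof (induction N)
  case empty
  then show ?case by (simp add: num_points_def)
next
  case (add x N)
  have "num_points (add_mset x N) (cell q) * g q = num_points N (cell q) * g q + (if q = lab x then g q else 0)" for q
    using add.prems by (auto simp: num_points_def cell_def)
  then have "(\<Sum>q\<in>QQ. num_points (add_mset x N) (cell q) * g q) =
      (\<Sum>q\<in>QQ. num_points N (cell q) * g q) + (\<Sum>q\<in>QQ. if q = lab x then g q else 0)"
    by (simp only: sum.distrib)
  also have "(\<Sum>q\<in>QQ. if q = lab x then g q else 0) = g (lab x)"
    using add.prems fin_QQ by (simp add: sum.delta' QQ_def)
  finally show ?case using add by simp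
qed

text \<open>
  Cells of diameter \<open>\<delta>\<close> blur distances by at most \<open>2 * \<delta>\<close>. So the
  discretisation is exact when no two points have a distance slightly above \<open>r\<close>.
\<close>

lemma TT_eq_T_stat:
  assumes N: "set_mset N \<subseteq> unit_cube"
    and gap: "\<And>x y. x \<in># N \<Longrightarrow> y \<in># N \<Longrightarrow> torus_dist x y \<le> r + 2 * \<delta> \<Longrightarrow> torus_dist x y \<le> r"
  shows "real (TT k (\<lambda>q. num_points N (cell q))) = T_stat k r N"
proof -
  let ?c = "\<lambda>q. num_points N (cell q)"
  have nb: "sum ?c (nbr (lab x)) = num_points N (torus_ball r x)" if x: "x \<in># N" for x
  proof -
    have xc: "x \<in> cell (lab x)" "x \<in> unit_cube" using x N by (auto simp: cell_def)
    have "sum ?c (nbr (lab x)) = (\<Sum>q\<in>QQ. ?c q * of_bool (q \<in> nbr (lab x)))"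
      using fin_QQ nbr_sub[of "lab x"] by (intro sum.mono_neutral_cong_left) auto
    also have "\<dots> = (\<Sum>y\<in>#N. of_bool (lab y \<in> nbr (lab x)))" by (rule sum_points_label[OF N])
    also have "\<dots> = (\<Sum>y\<in>#N. of_bool (y \<in> torus_ball r x))"
    proof (rule arg_cong[where f=sum_mset], rule image_mset_cong)
      fix y assume y: "y \<in># N"
      then have yu: "y \<in> unit_cube" using N by auto
      have "lab y \<in> nbr (lab x) \<longleftrightarrow> y \<in> torus_ball r x"
      proof
        assume "lab y \<in> nbr (lab x)"
        then have "y \<in> region (nbr (lab x))" using yu by (auto simp: region_def)
        then have "torus_dist x y \<le> r + 2 * \<delta>" by (rule region_upper[OF xc(1)])
        then show "y \<in> torus_ball r x" using gap[OF x y] yu by (auto simp: torus_ball_def)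
      next
        assume "y \<in> torus_ball r x"
        then show "lab y \<in> nbr (lab x)" using region_lower[OF xc(1)] by (auto simp: region_def)
      qed
      then show "(of_bool (lab y \<in> nbr (lab x)) :: nat) = of_bool (y \<in> torus_ball r x)" by simp
    qed
    finally show ?thesis by (simp add: num_points_eq_sum)
  qed
  have "TT k ?c = (\<Sum>x\<in>#N. of_bool (sum ?c (nbr (lab x)) \<le> k))"
    unfolding TT_def by (rule sum_points_label[OF N])
  also have "\<dots> = (\<Sum>x\<in>#N. of_bool (num_points N (torus_ball r x) \<le> k))"
    by (rule arg_cong[where f=sum_mset], rule image_mset_cong) (simp add: nb)
  finally have e: "TT k ?c = (\<Sum>x\<in>#N. of_bool (num_points N (torus_ball r x) \<le> k))" .
  have "real (\<Sum>x\<in>#N'. of_bool (P x)) = (\<Sum>x\<in>#N'. of_bool (P x))" for P and N' :: "(real ^ 'd) multiset"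
    by (induction N') auto
  then show ?thesis unfolding e T_stat_def .
qed

end

text \<open>
  The second component of a label selects a close point of a net that is separated at scale
  \<open>r / 2\<close>. Thus the points of a class are within distance \<open>r\<close> of each other, while the
  separation bounds the number of adjacent classes.
\<close>

locale torus_labels = fine_labels lab r \<delta> for lab :: "real ^ 'd \<Rightarrow> nat \<times> nat" and r \<delta> +
  fixes net :: "nat \<Rightarrow> real ^ 'd" and \<epsilon> \<tau> :: real
  assumes net_close: "\<And>x. x \<in> unit_cube \<Longrightarrow> torus_dist (net (snd (lab x))) x \<le> r / 2"
    and net_sep: "\<And>x y. x \<in> unit_cube \<Longrightarrow> y \<in> unit_cube \<Longrightarrow> snd (lab x) \<noteq> snd (lab y) \<Longrightarrow>
      r / 2 < torus_dist (net (snd (lab x))) (net (snd (lab y)))"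
    and r: "0 < r" "r \<le> 1 / 10" and \<delta>: "0 < \<delta>" "4 * \<delta> < \<epsilon> * r" and \<epsilon>: "0 < \<epsilon>" "\<epsilon> \<le> 1"
    and \<tau>': "0 \<le> \<tau>" "\<tau> \<le> 1" "(r + 2 * \<delta>) ^ CARD('d) \<le> (1 + \<tau>) * r ^ CARD('d)"
begin

lemma small: "\<delta> \<le> r / 4" "r + 2 * \<delta> < 1 / 2"
proof -
  have "\<epsilon> * r \<le> r" using r \<epsilon> by (simp add: mult_le_cancel_right1)
  then show "\<delta> \<le> r / 4" using \<delta> by simp
  then show "r + 2 * \<delta> < 1 / 2" using r by simp
qed

lemma diff_mass_ge:
  assumes q: "x \<in> cell q" and q': "y \<in> cell q'" and d: "\<epsilon> * r \<le> torus_dist x y"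
  shows "(\<epsilon> / 4) ^ CARD('d) * (unit_vol TYPE('d) * r ^ CARD('d)) \<le> sum mass (nbr q' - nbr q)"
proof -
  have sub: "torus_ball r y - torus_ball (r + 2 * \<delta>) x \<subseteq> region (nbr q' - nbr q)"
  proof
    fix u assume u: "u \<in> torus_ball r y - torus_ball (r + 2 * \<delta>) x"
    then have "u \<in> region (nbr q')" using region_lower[OF q'] by auto
    moreover have "u \<notin> region (nbr q)" using region_upper'[OF q] u by auto
    ultimately show "u \<in> region (nbr q' - nbr q)" by (auto simp: region_def)
  qed
  have "(\<epsilon> / 4) ^ CARD('d) * (unit_vol TYPE('d) * r ^ CARD('d)) = unit_vol TYPE('d) * (\<epsilon> / 4 * r) ^ CARD('d)"
  proof -
    have "(\<epsilon> / 4 * r) ^ CARD('d) = (\<epsilon> / 4) ^ CARD('d) * r ^ CARD('d)" by (rule power_mult_distrib)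
    then show ?thesis by (simp only: mult.left_commute)
  qed
  also have "\<dots> \<le> measure lborel (torus_ball r y - torus_ball (r + 2 * \<delta>) x)"
    using r \<epsilon> \<delta> d by (intro measure_annulus_ge) auto
  also have "\<dots> \<le> measure lborel (region (nbr q' - nbr q))"
  proof (intro measure_mono_cube sub region_meas)
    show "nbr q' - nbr q \<subseteq> QQ" using nbr_sub[of q'] by blast
  qed (auto simp: region_def)
  also have "\<dots> = sum mass (nbr q' - nbr q)" using nbr_sub[of q'] by (intro region_mass[symmetric]) blast
  finally show ?thesis .
qed

text \<open>
  Net points of adjacent classes are within distance \<open>4 * r\<close>. The balls of radius \<open>r / 4\<close>
  around the net points are disjoint, and \<open>17 / 4 = 4 + 1 / 4\<close>.
\<close>

lemma adj_bound:
  assumes i: "i \<in> snd ` QQ"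
  shows "card (adj QQ nbr snd i) \<le> 17 ^ CARD('d)"
proof -
  let ?A = "adj QQ nbr snd i" and ?F = "net ` adj QQ nbr snd i"
  have A: "?A \<subseteq> snd ` QQ" by (force simp: adj_def)
  then have finA: "finite ?A" using fin_QQ finite_subset by blast
  have sep: "r / 2 < torus_dist (net l) (net l')" if ll: "l \<in> snd ` QQ" "l' \<in> snd ` QQ" "l \<noteq> l'" for l l'
  proof -
    obtain x y where "x \<in> unit_cube" "y \<in> unit_cube" "l = snd (lab x)" "l' = snd (lab y)"
      using ll(1,2) unfolding QQ_def by blast
    then show ?thesis using net_sep ll(3) by blast
  qed
  have inj: "inj_on net ?A"
  proof (rule inj_onI)
    fix l l' assume l: "l \<in> ?A" "l' \<in> ?A" "net l = net l'"
    then show "l = l'" using sep[of l l'] A r by fastforce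
  qed
  have dist4: "torus_dist (net i) (net j) \<le> 4 * r" if jA: "j \<in> ?A" for j
  proof -
    obtain q q' q'' where q: "q \<in> QQ" "q' \<in> QQ" "snd q = i" "snd q' = j" "q'' \<in> nbr q" "q'' \<in> nbr q'"
      using jA unfolding adj_def by blast
    obtain x y where xy: "x \<in> cell q" "y \<in> cell q'" using q cell_nonempty by blast
    obtain u where u: "u \<in> cell q''" using q(5) nbr_sub cell_nonempty by blast
    then have "u \<in> region (nbr q)" "u \<in> region (nbr q')" using q by (auto simp: region_def cell_def)
    then have 1: "torus_dist x u \<le> r + 2 * \<delta>" "torus_dist y u \<le> r + 2 * \<delta>" using region_upper xy by auto
    have 2: "torus_dist (net i) x \<le> r / 2" "torus_dist (net j) y \<le> r / 2"
      using net_close[of x] net_close[of y] xy q by (auto simp: cell_def)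
    have "torus_dist (net i) (net j) \<le> torus_dist (net i) x + torus_dist x u + torus_dist u y + torus_dist y (net j)"
      using torus_dist_triangle[of "net i" "net j" x] torus_dist_triangle[of x "net j" u]
        torus_dist_triangle[of u "net j" y] by linarith
    then show ?thesis using 1 2 small by (simp add: torus_dist_sym)
  qed
  have "card ?F * (unit_vol TYPE('d) * (r / 4) ^ CARD('d)) \<le> measure lborel (torus_ball (17 / 4 * r) (net i))"
  proof (rule packing_bound)
    show "torus_ball (r / 4) f \<subseteq> torus_ball (17 / 4 * r) (net i)" if "f \<in> ?F" for f
    proof
      fix u assume "u \<in> torus_ball (r / 4) f"
      then show "u \<in> torus_ball (17 / 4 * r) (net i)"
        using that dist4 torus_dist_triangle[of "net i" u f] by (force simp: torus_ball_def)
    qed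
    show "2 * (r / 4) < torus_dist f g" if "f \<in> ?F" "g \<in> ?F" "f \<noteq> g" for f g
      using that sep A by force
  qed (use finA r torus_ball_cube in auto)
  also have "\<dots> = unit_vol TYPE('d) * (17 / 4 * r) ^ CARD('d)"
    using r by (intro measure_torus_ball) auto
  also have "\<dots> = 17 ^ CARD('d) * (unit_vol TYPE('d) * (r / 4) ^ CARD('d))"
    by (simp add: power_mult_distrib power_divide)
  finally have "card ?F * (unit_vol TYPE('d) * (r / 4) ^ CARD('d)) \<le> 17 ^ CARD('d) * (unit_vol TYPE('d) * (r / 4) ^ CARD('d))" .
  moreover have "0 < unit_vol TYPE('d) * (r / 4) ^ CARD('d)" using r by (simp add: unit_vol_pos)
  ultimately have "real (card ?F) \<le> 17 ^ CARD('d)" by (rule mult_right_le_imp_le)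
  then have "real (card ?F) \<le> real (17 ^ CARD('d))" by simp
  then have "card ?F \<le> 17 ^ CARD('d)" by (simp only: of_nat_le_iff)
  then show ?thesis using card_image[OF inj] by simp
qed

sublocale cs: cell_system QQ mass nbr snd "unit_vol TYPE('d) * r ^ CARD('d)" "17 ^ CARD('d)" "\<epsilon> ^ CARD('d)" "(\<epsilon> / 4) ^ CARD('d)" \<tau>
proof
  show "finite QQ" by (rule fin_QQ)
  show "0 \<le> mass q" if "q \<in> QQ" for q by (simp add: mass_def)
  have "region QQ = unit_cube" by (auto simp: region_def QQ_def)
  then show "sum mass QQ = 1" by (subst region_mass) (auto simp: measure_unit_cube)
  show "nbr q \<subseteq> QQ" if "q \<in> QQ" for q by (rule nbr_sub)
  show "q \<in> nbr q" if "q \<in> QQ" for q using cell_nonempty[OF that] that r by (force simp: nbr_def)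
  show "q \<in> nbr q'" if qq: "q \<in> QQ" "q' \<in> nbr q" for q q'
  proof -
    obtain x y where "x \<in> cell q" "y \<in> cell q'" "torus_dist x y \<le> r" using qq(2) unfolding nbr_def by blast
    then show ?thesis using qq(1) unfolding nbr_def by (auto simp: torus_dist_sym[of x y])
  qed
  show "0 < (unit_vol TYPE('d) * r ^ CARD('d))" using r by (simp add: unit_vol_pos)
  show "(unit_vol TYPE('d) * r ^ CARD('d)) \<le> sum mass (nbr q)" if q: "q \<in> QQ" for q
  proof -
    obtain x where x: "x \<in> cell q" using cell_nonempty[OF q] by auto
    have "(unit_vol TYPE('d) * r ^ CARD('d)) = measure lborel (torus_ball r x)" using r by (intro measure_torus_ball[symmetric]) auto
    also have "\<dots> \<le> measure lborel (region (nbr q))"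
      by (intro measure_mono_cube region_lower[OF x] region_meas nbr_sub) (auto simp: region_def)
    finally show ?thesis by (simp add: region_mass[OF nbr_sub])
  qed
  show "sum mass (nbr q) \<le> (1 + \<tau>) * (unit_vol TYPE('d) * r ^ CARD('d))" if q: "q \<in> QQ" for q
  proof -
    obtain x where x: "x \<in> cell q" using cell_nonempty[OF q] by auto
    have "sum mass (nbr q) = measure lborel (region (nbr q))" by (rule region_mass[OF nbr_sub])
    also have "\<dots> \<le> measure lborel (torus_ball (r + 2 * \<delta>) x)"
      by (intro measure_mono_cube region_upper'[OF x] region_meas nbr_sub torus_ball_cube) auto
    also have "\<dots> = unit_vol TYPE('d) * (r + 2 * \<delta>) ^ CARD('d)"
      using r \<delta> small by (intro measure_torus_ball) auto
    also have "\<dots> \<le> unit_vol TYPE('d) * ((1 + \<tau>) * r ^ CARD('d))"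
      using unit_vol_pos[where 'd='d] by (intro mult_left_mono \<tau>') auto
    finally show ?thesis by (simp add: mult_ac)
  qed
  show "0 \<le> \<tau>" "\<tau> \<le> 1" by (rule \<tau>')+
  show "q' \<in> nbr q" if q: "q \<in> QQ" "q' \<in> QQ" "snd q = snd q'" for q q'
  proof -
    obtain x y where xy: "x \<in> cell q" "y \<in> cell q'" using q cell_nonempty by blast
    then have "torus_dist (net (snd q)) x \<le> r / 2" "torus_dist (net (snd q)) y \<le> r / 2"
      using net_close[of x] net_close[of y] q by (auto simp: cell_def)
    then have "torus_dist x y \<le> r"
      using torus_dist_triangle[of x y "net (snd q)"] by (simp add: torus_dist_sym)
    then show ?thesis using q xy by (auto simp: nbr_def)
  qed
  show "card (adj QQ nbr snd i) \<le> 17 ^ CARD('d)" if "i \<in> snd ` QQ" for i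
    by (rule adj_bound[OF that])
  show "(\<epsilon> / 4) ^ CARD('d) * (unit_vol TYPE('d) * r ^ CARD('d)) \<le> sum mass (nbr q' - nbr q)" if q: "q \<in> QQ" "q' \<in> QQ" "q' \<notin> nbr q" for q q'
  proof -
    obtain x y where xy: "x \<in> cell q" "y \<in> cell q'" using q cell_nonempty by blast
    then have "r < torus_dist x y" using q by (auto simp: nbr_def not_le)
    moreover have "\<epsilon> * r \<le> r" using r \<epsilon> by (simp add: mult_le_cancel_right1)
    ultimately show ?thesis by (intro diff_mass_ge[OF xy]) auto
  qed
  show "sum mass {q' \<in> QQ. sum mass (nbr q' - nbr q) < (\<epsilon> / 4) ^ CARD('d) * (unit_vol TYPE('d) * r ^ CARD('d))} \<le> \<epsilon> ^ CARD('d) * (unit_vol TYPE('d) * r ^ CARD('d))"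
    if q: "q \<in> QQ" for q
  proof -
    obtain x where x: "x \<in> cell q" using cell_nonempty[OF q] by auto
    let ?U = "{q' \<in> QQ. sum mass (nbr q' - nbr q) < (\<epsilon> / 4) ^ CARD('d) * (unit_vol TYPE('d) * r ^ CARD('d))}"
    have "region ?U \<subseteq> torus_ball (\<epsilon> * r) x"
    proof
      fix y assume y: "y \<in> region ?U"
      then have "y \<in> cell (lab y)" "\<not> (\<epsilon> / 4) ^ CARD('d) * (unit_vol TYPE('d) * r ^ CARD('d)) \<le> sum mass (nbr (lab y) - nbr q)" "y \<in> unit_cube"
        by (auto simp: region_def cell_def)
      then have "\<not> \<epsilon> * r \<le> torus_dist x y" "y \<in> unit_cube" using diff_mass_ge[OF x, of y "lab y"] by blast+
      then show "y \<in> torus_ball (\<epsilon> * r) x" by (simp add: torus_ball_def)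
    qed
    then have "measure lborel (region ?U) \<le> measure lborel (torus_ball (\<epsilon> * r) x)"
      by (intro measure_mono_cube region_meas torus_ball_cube) auto
    also have "\<dots> = unit_vol TYPE('d) * (\<epsilon> * r) ^ CARD('d)"
    proof (rule measure_torus_ball)
      have "\<epsilon> * r \<le> r" using r \<epsilon> by (simp add: mult_le_cancel_right1)
      then show "\<epsilon> * r < 1 / 2" using r by linarith
      show "0 \<le> \<epsilon> * r" using r \<epsilon> by simp
    qed
    finally show ?thesis by (subst region_mass) (auto simp: power_mult_distrib mult_ac)
  qed
  show "0 \<le> \<epsilon> ^ CARD('d)" "0 < (\<epsilon> / 4) ^ CARD('d)" using \<epsilon> by auto
qed

lemma Tc_eq_TT: "cs.Tc k c = TT k c"
  by (simp add: cs.Tc_def TT_def cs.isol_def)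

lemma card_classes_le: "card (snd ` QQ) * (unit_vol TYPE('d) * (r / 4) ^ CARD('d)) \<le> 1"
proof -
  have sep: "r / 2 < torus_dist (net l) (net l')" if ll: "l \<in> snd ` QQ" "l' \<in> snd ` QQ" "l \<noteq> l'" for l l'
  proof -
    obtain x y where "x \<in> unit_cube" "y \<in> unit_cube" "l = snd (lab x)" "l' = snd (lab y)"
      using ll(1,2) unfolding QQ_def by blast
    then show ?thesis using net_sep ll(3) by blast
  qed
  have inj: "inj_on net (snd ` QQ)"
  proof (rule inj_onI)
    fix l l' assume l: "l \<in> snd ` QQ" "l' \<in> snd ` QQ" "net l = net l'"
    then show "l = l'" using sep[of l l'] r by fastforce
  qed
  have "card (net ` snd ` QQ) * (unit_vol TYPE('d) * (r / 4) ^ CARD('d)) \<le> measure lborel (unit_cube :: (real ^ 'd) set)"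
  proof (rule packing_bound)
    fix f g assume fg: "f \<in> net ` snd ` QQ" "g \<in> net ` snd ` QQ" "f \<noteq> g"
    then obtain l l' where "f = net l" "g = net l'" "l \<in> snd ` QQ" "l' \<in> snd ` QQ" by blast
    then show "2 * (r / 4) < torus_dist f g" using sep[of l l'] fg(3) by fastforce
  qed (use fin_QQ r torus_ball_cube in auto)
  then show ?thesis using card_image[OF inj] by (simp add: measure_unit_cube)
qed

end

text \<open>
  The first component is the index of the first ball of a finite cover by balls of radius
  \<open>\<delta> / 2\<close>, the second one the index of the first net point within distance \<open>r / 2\<close>.
  Taking least indices makes both of them Borel functions.
\<close>

lemma exists_torus_labels:
  assumes r: "0 < r" "r \<le> 1 / 10" and \<delta>: "0 < \<delta>" "4 * \<delta> < \<epsilon> * r" and \<epsilon>: "0 < \<epsilon>" "\<epsilon> \<le> 1"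
    and \<tau>: "0 \<le> \<tau>" "\<tau> \<le> 1" "(r + 2 * \<delta>) ^ CARD('d) \<le> (1 + \<tau>) * r ^ CARD('d)"
  shows "\<exists>(lab :: real ^ 'd \<Rightarrow> nat \<times> nat) net. torus_labels lab r \<delta> net \<epsilon> \<tau>"
proof -
  have r1: "r \<le> 1" using r by simp
  obtain F :: "(real ^ 'd) set" where F: "finite F" "F \<subseteq> unit_cube"
    "\<And>f g. f \<in> F \<Longrightarrow> g \<in> F \<Longrightarrow> f \<noteq> g \<Longrightarrow> r / 2 < torus_dist f g"
    "\<And>x. x \<in> unit_cube \<Longrightarrow> \<exists>f\<in>F. torus_dist f x \<le> r / 2"
    by (rule exists_net[OF r(1) r1]) blast
  obtain fs where fs: "set fs = F" "distinct fs" using finite_distinct_list[OF F(1)] by auto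
  have "compact (unit_cube :: (real ^ 'd) set)" unfolding unit_cube_cbox by (rule compact_cbox)
  then obtain C where C: "finite C" "unit_cube \<subseteq> (\<Union>x\<in>C. ball x (\<delta> / 2) :: (real ^ 'd) set)"
    using half_gt_zero[OF \<delta>(1)] unfolding compact_eq_totally_bounded by blast
  obtain cs where cs: "set cs = C" using finite_list[OF C(1)] by auto
  define P where "P m x \<longleftrightarrow> m < length cs \<and> x \<in> ball (cs ! m) (\<delta> / 2)" for m x
  define R where "R l x \<longleftrightarrow> l < length fs \<and> torus_dist (fs ! l) x \<le> r / 2" for l x
  define l1 where "l1 x = (LEAST m. P m x)" for x
  define l2 where "l2 x = (LEAST l. R l x)" for x
  have Pm [measurable]: "Measurable.pred borel (P m)" for m
  proof -
    have "{x. P m x} = (if m < length cs then ball (cs ! m) (\<delta> / 2) else {})" by (auto simp: P_def)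
    then have "{x. P m x} \<in> sets borel" by simp
    then show ?thesis by (simp add: pred_def)
  qed
  have Rm [measurable]: "Measurable.pred borel (R l)" for l
  proof -
    have "closed {x. torus_dist (fs ! l) x \<le> r / 2}"
      by (intro closed_Collect_le continuous_torus_dist continuous_on_const)
    moreover have "{x. R l x} = (if l < length fs then {x. torus_dist (fs ! l) x \<le> r / 2} else {})"
      by (auto simp: R_def)
    ultimately have "{x. R l x} \<in> sets borel" by simp
    then show ?thesis by (simp add: pred_def)
  qed
  have lm [measurable]: "l1 \<in> borel \<rightarrow>\<^sub>M count_space UNIV" "l2 \<in> borel \<rightarrow>\<^sub>M count_space UNIV"
    unfolding l1_def[abs_def] l2_def[abs_def] by (intro measurable_Least Pm Rm)+
  have P: "P (l1 x) x" if xu: "x \<in> unit_cube" for x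
  proof -
    obtain c where "c \<in> set cs" "x \<in> ball c (\<delta> / 2)" using C xu cs by blast
    then have "\<exists>m. P m x" by (auto simp: P_def in_set_conv_nth)
    then show ?thesis unfolding l1_def by (rule LeastI_ex)
  qed
  have R: "R (l2 x) x" if xu: "x \<in> unit_cube" for x
  proof -
    obtain c where "c \<in> set fs" "torus_dist c x \<le> r / 2" using F(4)[OF xu] fs by blast
    then have "\<exists>m. R m x" by (auto simp: R_def in_set_conv_nth)
    then show ?thesis unfolding l2_def by (rule LeastI_ex)
  qed
  have "torus_labels (\<lambda>x. (l1 x, l2 x)) r \<delta> (\<lambda>l. fs ! l) \<epsilon> \<tau>"
  proof
    fix q :: "nat \<times> nat"
    have "{x \<in> unit_cube. (l1 x, l2 x) = q} = unit_cube \<inter> {x \<in> space borel. l1 x = fst q \<and> l2 x = snd q}"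
      by auto
    also have "\<dots> \<in> sets borel"
    proof (intro sets.Int unit_cube_borel)
      have "l1 -` {fst q} \<inter> space borel \<in> sets borel" "l2 -` {snd q} \<inter> space borel \<in> sets borel"
        by (rule measurable_sets[OF lm(1)] measurable_sets[OF lm(2)]; simp)+
      then have "(l1 -` {fst q} \<inter> space borel) \<inter> (l2 -` {snd q} \<inter> space borel) \<in> sets borel" by (rule sets.Int)
      then show "{x \<in> space borel. l1 x = fst q \<and> l2 x = snd q} \<in> sets borel"
        by (simp add: vimage_def Collect_conj_eq)
    qed
    finally show "{x \<in> unit_cube. (l1 x, l2 x) = q} \<in> sets borel" .
  next
    have "(\<lambda>x. (l1 x, l2 x)) ` unit_cube \<subseteq> {..<length cs} \<times> {..<length fs}"
      using P R by (auto simp: P_def R_def)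
    then show "finite ((\<lambda>x. (l1 x, l2 x)) ` unit_cube)" by (rule finite_subset) auto
  next
    fix x y :: "real ^ 'd" assume xy: "x \<in> unit_cube" "y \<in> unit_cube" "(l1 x, l2 x) = (l1 y, l2 y)"
    have "dist (cs ! l1 x) x < \<delta> / 2" "dist (cs ! l1 x) y < \<delta> / 2"
      using P[OF xy(1)] P[OF xy(2)] xy(3) by (auto simp: P_def)
    then have "dist x y < \<delta>" by (metis dist_commute dist_triangle_half_l)
    then show "torus_dist x y \<le> \<delta>" using torus_dist_le_norm[of x y] by (simp add: dist_norm)
  next
    fix x :: "real ^ 'd" assume "x \<in> unit_cube"
    then show "torus_dist (fs ! snd (l1 x, l2 x)) x \<le> r / 2" using R by (auto simp: R_def)
  next
    fix x y :: "real ^ 'd" assume xy: "x \<in> unit_cube" "y \<in> unit_cube" "snd (l1 x, l2 x) \<noteq> snd (l1 y, l2 y)"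
    then have "l2 x < length fs" "l2 y < length fs" "l2 x \<noteq> l2 y" using R by (auto simp: R_def)
    then have "fs ! l2 x \<noteq> fs ! l2 y" "fs ! l2 x \<in> F" "fs ! l2 y \<in> F" using fs nth_eq_iff_index_eq by auto
    then show "r / 2 < torus_dist (fs ! snd (l1 x, l2 x)) (fs ! snd (l1 y, l2 y))" using F(3) by simp
  qed (use assms in auto)
  then show ?thesis by blast
qed

section \<open>Laws of the cell counts\<close>

lemma (in prob_space) expectation_discrete_law:
  fixes C :: "'a \<Rightarrow> 'c" and h :: "'c \<Rightarrow> real"
  assumes S: "countable S" and C: "\<And>\<omega>. \<omega> \<in> space M \<Longrightarrow> C \<omega> \<in> S"
    and ev: "\<And>f. f \<in> S \<Longrightarrow> {\<omega> \<in> space M. C \<omega> = f} \<in> sets M"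
    and law: "\<And>f. f \<in> S \<Longrightarrow> measure M {\<omega> \<in> space M. C \<omega> = f} = pmf p f"
    and p: "set_pmf p \<subseteq> S"
  shows "C \<in> measurable M (count_space UNIV)" "(\<integral>\<omega>. h (C \<omega>) \<partial>M) = E p h"
proof -
  have "C \<in> measurable M (count_space S)"
    unfolding measurable_count_space_eq_countable[OF S] using C ev
    by (auto simp: vimage_def Int_def conj_commute)
  then have "(\<lambda>x. x) \<circ> C \<in> measurable M (count_space UNIV)"
    by (rule measurable_comp) simp
  then show Cm: "C \<in> measurable M (count_space UNIV)" by (simp add: o_def)
  have "distr M (count_space UNIV) C = measure_pmf p"
  proof (rule measure_eqI_countable_AE[where \<Omega>=S])
    show "AE x in distr M (count_space UNIV) C. x \<in> S"
      by (subst AE_distr_iff[OF Cm]) (auto intro: AE_I2 C)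
    show "AE x in measure_pmf p. x \<in> S" using p by (auto simp: AE_measure_pmf_iff)
    fix f assume f: "f \<in> S"
    have "C -` {f} \<inter> space M = {\<omega> \<in> space M. C \<omega> = f}" by auto
    then have "emeasure (distr M (count_space UNIV) C) {f} = ennreal (measure M {\<omega> \<in> space M. C \<omega> = f})"
      by (subst emeasure_distr[OF Cm]) (auto simp: emeasure_eq_measure)
    then show "emeasure (distr M (count_space UNIV) C) {f} = emeasure (measure_pmf p) {f}"
      using law[OF f] by (simp add: emeasure_pmf_single)
  qed (use S in auto)
  moreover have "(\<integral>\<omega>. h (C \<omega>) \<partial>M) = (\<integral>x. h x \<partial>distr M (count_space UNIV) C)"
    by (rule integral_distr[symmetric, OF Cm]) simp
  ultimately show "(\<integral>\<omega>. h (C \<omega>) \<partial>M) = E p h" by simp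
qed

context fine_labels
begin

abbreviation counts :: "(real ^ 'd) multiset \<Rightarrow> nat \<times> nat \<Rightarrow> nat" where
  "counts N q \<equiv> num_points N (cell q)"

lemma cell_sub: "cell q \<subseteq> unit_cube" by (auto simp: cell_def)

lemma cell_empty: "q \<notin> QQ \<Longrightarrow> cell q = {}" by (auto simp: cell_def QQ_def)

lemma zero_in_cube: "0 \<in> unit_cube" by (simp add: unit_cube_def)

lemma QQ_nonempty: "QQ \<noteq> {}" using zero_in_cube by (auto simp: QQ_def)

lemma disjoint_cells: "q \<noteq> q' \<Longrightarrow> cell q \<inter> cell q' = {}" by (auto simp: cell_def)

lemma TT_measurable:
  assumes "\<And>q. (\<lambda>\<omega>. counts (N \<omega>) q) \<in> M \<rightarrow>\<^sub>M count_space UNIV"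
  shows "(\<lambda>\<omega>. real (TT k (counts (N \<omega>)))) \<in> borel_measurable M"
proof -
  have [measurable]: "(\<lambda>\<omega>. real (counts (N \<omega>) q)) \<in> borel_measurable M" for q
    by (rule measurable_compose[OF assms]) simp
  have "(\<lambda>\<omega>. \<Sum>q\<in>QQ. real (counts (N \<omega>) q) * (if (\<Sum>q'\<in>nbr q. real (counts (N \<omega>) q')) \<le> real k then 1 else 0)) \<in> borel_measurable M"
    by measurable
  moreover have "real (TT k (counts (N \<omega>))) =
      (\<Sum>q\<in>QQ. real (counts (N \<omega>) q) * (if (\<Sum>q'\<in>nbr q. real (counts (N \<omega>) q')) \<le> real k then 1 else 0))" for \<omega>
    unfolding TT_def of_nat_sum by (intro sum.cong refl) (auto simp flip: of_nat_sum)
  ultimately show ?thesis by simp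
qed

text \<open>
  The independence of the counts in disjoint sets, applied to an enumeration of the cells,
  determines the joint law of the counts.
\<close>

theorem poisson_counts_law:
  fixes h :: "(nat \<times> nat \<Rightarrow> nat) \<Rightarrow> real"
  assumes "prob_space M" and pp: "poisson_process M \<rho> N" and \<rho>: "0 \<le> \<rho>"
  shows "(\<integral>\<omega>. h (counts (N \<omega>)) \<partial>M) = E (Pi_pmf QQ 0 (\<lambda>q. pois (\<rho> * mass q))) h"
proof -
  interpret prob_space M by fact
  obtain qs where qs: "set qs = QQ" "distinct qs" using finite_distinct_list[OF fin_QQ] by auto
  define m where "m = length qs"
  define A where "A i = cell (qs ! i)" for i
  have m: "0 < m" using qs QQ_nonempty by (auto simp: m_def)
  have ppc: "(\<lambda>\<omega>. num_points (N \<omega>) B) \<in> M \<rightarrow>\<^sub>M count_space UNIV"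
    "measure M {\<omega>\<in>space M. num_points (N \<omega>) B = j} = (\<rho> * measure lborel B) ^ j / fact j * exp (- (\<rho> * measure lborel B))"
    if "B \<in> sets borel" "B \<subseteq> unit_cube" for B j
    using pp that unfolding poisson_process_def by blast+
  have A: "\<forall>i<m. A i \<in> sets borel \<and> A i \<subseteq> unit_cube" by (auto simp: A_def cell_sub)
  have dj: "disjoint_family_on A {..<m}"
    using qs(2) unfolding disjoint_family_on_def A_def m_def
    by (auto intro!: disjoint_cells simp: nth_eq_iff_index_eq)
  have ind: "indep_vars (\<lambda>_. count_space UNIV) (\<lambda>i \<omega>. num_points (N \<omega>) (A i)) {..<m}"
    using pp A dj unfolding poisson_process_def by blast
  define S where "S = {f :: nat \<times> nat \<Rightarrow> nat. \<forall>q. q \<notin> QQ \<longrightarrow> f q = 0}"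
  have cS: "countable S"
  proof -
    have "S \<subseteq> (\<lambda>g q. if q \<in> QQ then g q else 0) ` (QQ \<rightarrow>\<^sub>E UNIV)"
    proof
      fix f assume "f \<in> S"
      show "f \<in> (\<lambda>g q. if q \<in> QQ then g q else 0) ` (QQ \<rightarrow>\<^sub>E UNIV)"
      proof (rule image_eqI[where x="restrict f QQ"])
        show "f = (\<lambda>q. if q \<in> QQ then restrict f QQ q else 0)"
          using \<open>f \<in> S\<close> by (auto simp: S_def fun_eq_iff)
      qed auto
    qed
    moreover have "countable (QQ \<rightarrow>\<^sub>E (UNIV :: nat set))" by (intro countable_PiE fin_QQ) auto
    ultimately show ?thesis by (blast intro: countable_subset[OF _ countable_image])
  qed
  have CS: "counts (N \<omega>) \<in> S" for \<omega> by (simp add: S_def cell_empty num_points_def)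
  have evq: "{\<omega> \<in> space M. counts (N \<omega>) = f} = (\<Inter>i\<in>{..<m}. (\<lambda>\<omega>. num_points (N \<omega>) (A i)) -` {f (qs ! i)} \<inter> space M)"
    if f: "f \<in> S" for f
  proof -
    have "counts (N \<omega>) = f \<longleftrightarrow> (\<forall>i<m. counts (N \<omega>) (qs ! i) = f (qs ! i))" for \<omega>
    proof
      assume e: "\<forall>i<m. counts (N \<omega>) (qs ! i) = f (qs ! i)"
      show "counts (N \<omega>) = f"
      proof
        fix q show "counts (N \<omega>) q = f q"
        proof (cases "q \<in> QQ")
          case True
          then obtain i where "i < m" "q = qs ! i" using qs(1) unfolding m_def by (metis in_set_conv_nth)
          then show ?thesis using e by simp
        next
          case False
          have "f q = 0" using f False unfolding S_def by blast
          moreover have "counts (N \<omega>) q = 0" using CS[of \<omega>] False unfolding S_def by blast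
          ultimately show ?thesis by simp
        qed
      qed
    next
      assume "counts (N \<omega>) = f"
      then have "counts (N \<omega>) q = f q" for q by (rule fun_cong)
      then show "\<forall>i<m. counts (N \<omega>) (qs ! i) = f (qs ! i)" by simp
    qed
    then show ?thesis using m by (auto simp: A_def)
  qed
  have ms: "(\<lambda>\<omega>. num_points (N \<omega>) (A i)) -` {j} \<inter> space M \<in> sets M" if "i < m" for i j
    by (rule measurable_sets[OF ppc(1)]) (use A that in auto)
  show ?thesis
  proof (rule expectation_discrete_law(2)[OF cS CS])
    fix f assume f: "f \<in> S"
    show "{\<omega> \<in> space M. counts (N \<omega>) = f} \<in> sets M"
      unfolding evq[OF f] using m by (intro sets.finite_INT ms) auto
    have "measure M {\<omega> \<in> space M. counts (N \<omega>) = f} =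
        (\<Prod>i<m. measure M ((\<lambda>\<omega>. num_points (N \<omega>) (A i)) -` {f (qs ! i)} \<inter> space M))"
      unfolding evq[OF f] using m by (intro indep_varsD[OF ind]) auto
    also have "\<dots> = (\<Prod>i<m. pmf (pois (\<rho> * mass (qs ! i))) (f (qs ! i)))"
    proof (rule prod.cong[OF refl])
      fix i assume i: "i \<in> {..<m}"
      have "(\<lambda>\<omega>. num_points (N \<omega>) (A i)) -` {f (qs ! i)} \<inter> space M = {\<omega>\<in>space M. num_points (N \<omega>) (A i) = f (qs ! i)}"
        by auto
      then show "measure M ((\<lambda>\<omega>. num_points (N \<omega>) (A i)) -` {f (qs ! i)} \<inter> space M) = pmf (pois (\<rho> * mass (qs ! i))) (f (qs ! i))"
        using ppc(2)[of "A i"] A i \<rho> by (simp add: pmf_pois mass_def A_def)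
    qed
    also have "\<dots> = (\<Prod>q\<in>QQ. pmf (pois (\<rho> * mass q)) (f q))"
      by (rule prod.reindex_bij_betw) (use bij_betw_nth[OF qs(2), of "{..<m}" QQ] qs(1) in \<open>simp add: m_def\<close>)
    also have "\<dots> = pmf (Pi_pmf QQ 0 (\<lambda>q. pois (\<rho> * mass q))) f"
      using f by (simp add: pmf_Pi[OF fin_QQ] S_def)
    finally show "measure M {\<omega> \<in> space M. counts (N \<omega>) = f} = pmf (Pi_pmf QQ 0 (\<lambda>q. pois (\<rho> * mass q))) f" .
  next
    show "set_pmf (Pi_pmf QQ 0 (\<lambda>q. pois (\<rho> * mass q))) \<subseteq> S"
      unfolding S_def by (rule set_Pi_pmf_subset[OF fin_QQ])
  qed
qed

end

lemma pmf_replicate_pmf: "pmf (replicate_pmf (length qs) p) qs = (\<Prod>i<length qs. pmf p (qs ! i))"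
proof (induction qs)
  case (Cons q qs)
  have "replicate_pmf (length (q # qs)) p = map_pmf (\<lambda>(x, xs). x # xs) (pair_pmf p (replicate_pmf (length qs) p))"
    by (simp add: pair_pmf_def map_bind_pmf)
  then have "pmf (replicate_pmf (length (q # qs)) p) (q # qs) = pmf (map_pmf (\<lambda>(x, xs). x # xs) (pair_pmf p (replicate_pmf (length qs) p))) ((\<lambda>(x, xs). x # xs) (q, qs))"
    by simp
  also have "\<dots> = pmf (pair_pmf p (replicate_pmf (length qs) p)) (q, qs)"
    by (rule pmf_map_inj') (auto simp: inj_on_def)
  finally show ?case using Cons by (simp add: pmf_pair lessThan_Suc_eq_insert_0 prod.reindex)
qed simp

context torus_labels
begin

lemma iid_uniform_facts:
  fixes X :: "nat \<Rightarrow> 'w \<Rightarrow> real ^ 'd"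
  assumes "prob_space M" and iid: "iid_uniform M X" and i: "1 \<le> i"
  shows "X i \<in> borel_measurable M"
    "\<And>B. B \<in> sets borel \<Longrightarrow> B \<subseteq> unit_cube \<Longrightarrow> measure M (X i -` B \<inter> space M) = measure lborel B"
    "AE \<omega> in M. X i \<omega> \<in> unit_cube"
proof -
  interpret prob_space M by fact
  have "indep_vars (\<lambda>_. borel) X {1..}" using iid by (simp add: iid_uniform_def)
  then show Xm: "X i \<in> borel_measurable M" using i unfolding indep_vars_def by auto
  have d: "distr M borel (X i) = uniform_measure lborel unit_cube" using iid i by (simp add: iid_uniform_def)
  have e1: "emeasure lborel (unit_cube :: (real ^ 'd) set) = 1"
    using measure_unit_cube[where 'd='d] finite_emeasure_cube[of "unit_cube :: (real ^ 'd) set"]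
    by (simp add: emeasure_eq_ennreal_measure)
  show B: "measure M (X i -` B \<inter> space M) = measure lborel B" if B: "B \<in> sets borel" "B \<subseteq> unit_cube" for B
  proof -
    have "measure M (X i -` B \<inter> space M) = measure (distr M borel (X i)) B"
      using Xm B by (simp add: measure_distr)
    also have "\<dots> = measure lborel (unit_cube \<inter> B)"
    proof -
      have "emeasure (uniform_measure lborel unit_cube) B = emeasure lborel (unit_cube \<inter> B) / emeasure lborel (unit_cube :: (real ^ 'd) set)"
        by (rule emeasure_uniform_measure) (use B in auto)
      also have "\<dots> = emeasure lborel (unit_cube \<inter> B)"
        unfolding e1 by (metis divide_ennreal_def ennreal_inverse_1 mult.right_neutral)
      finally show ?thesis unfolding d measure_def by simp
    qed
    also have "unit_cube \<inter> B = B" using B by auto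
    finally show ?thesis .
  qed
  have "prob (X i -` unit_cube \<inter> space M) = 1" using B[of unit_cube] by (simp add: measure_unit_cube)
  then have "AE \<omega> in M. \<omega> \<in> X i -` unit_cube \<inter> space M" by (rule AE_prob_1)
  then show "AE \<omega> in M. X i \<omega> \<in> unit_cube" by eventually_elim auto
qed

definition labels :: "(nat \<Rightarrow> 'w \<Rightarrow> real ^ 'd) \<Rightarrow> nat \<Rightarrow> 'w \<Rightarrow> (nat \<times> nat) list" where
  "labels X n \<omega> = map (\<lambda>i. lab (X (Suc i) \<omega>)) [0..<n]"

lemma counts_binomial:
  assumes "\<And>i. i \<in> {1..n} \<Longrightarrow> X i \<omega> \<in> unit_cube"
  shows "counts (binomial_process X n \<omega>) = count_list (labels X n \<omega>)"
proof
  fix q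
  have "count_list (labels X n \<omega>) q = (\<Sum>i<n. of_bool (lab (X (Suc i) \<omega>) = q))"
    unfolding labels_def by (induction n) auto
  also have "\<dots> = (\<Sum>i\<in>{1..n}. of_bool (X i \<omega> \<in> cell q))"
    using assms by (intro sum.reindex_bij_witness[of _ "\<lambda>i. i - 1" Suc]) (auto simp: cell_def)
  also have "\<dots> = counts (binomial_process X n \<omega>) q"
    unfolding num_points_eq_sum binomial_process_def
    by (simp add: image_mset.compositionality o_def sum_unfold_sum_mset)
  finally show "counts (binomial_process X n \<omega>) q = count_list (labels X n \<omega>) q" by simp
qed

text \<open>
  The random points belong to the cube only almost surely, and therefore the statistic is a
  function of the labels only almost surely.
\<close>

theorem binomial_labels_law:
  fixes h :: "(nat \<times> nat) list \<Rightarrow> real"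
  assumes "prob_space M" and iid: "iid_uniform M X" and n: "1 \<le> n"
    and g: "g \<in> borel_measurable M" "AE \<omega> in M. g \<omega> = h (labels X n \<omega>)"
  shows "(\<integral>\<omega>. g \<omega> \<partial>M) = E (cs.rep n) h"
proof -
  interpret prob_space M by fact
  note fc = iid_uniform_facts[OF assms(1) iid]
  define LS where "LS = {qs. set qs \<subseteq> QQ \<and> length qs = n}"
  have finLS: "finite LS" unfolding LS_def by (rule finite_lists_length_eq[OF fin_QQ])
  define B where "B qs = (\<Inter>i\<in>{1..n}. X i -` cell (qs ! (i - 1)) \<inter> space M)" for qs
  have Xs: "X i -` cell q \<inter> space M \<in> sets M" if "1 \<le> i" for i q
    by (rule measurable_sets[OF fc(1)[OF that] cell_meas])
  have Bm: "B qs \<in> sets M" for qs unfolding B_def using n by (intro sets.finite_INT Xs) auto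
  have ind: "indep_vars (\<lambda>_. borel) X {1..}" using iid by (simp add: iid_uniform_def)
  have pB: "prob (B qs) = pmf (cs.rep n) qs" if qs: "qs \<in> LS" for qs
  proof -
    have len: "length qs = n" using qs by (simp add: LS_def)
    have "prob (B qs) = (\<Prod>i\<in>{1..n}. prob (X i -` cell (qs ! (i - 1)) \<inter> space M))"
      unfolding B_def using n by (intro indep_varsD[OF ind]) auto
    also have "\<dots> = (\<Prod>i\<in>{1..n}. pmf cs.kp (qs ! (i - 1)))"
    proof (rule prod.cong[OF refl])
      fix i assume i: "i \<in> {1..n}"
      then have "qs ! (i - 1) \<in> QQ" using qs nth_mem[of "i - 1" qs] by (auto simp: LS_def)
      then show "prob (X i -` cell (qs ! (i - 1)) \<inter> space M) = pmf cs.kp (qs ! (i - 1))"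
        using fc(2)[of i "cell (qs ! (i - 1))"] i cell_sub by (simp add: cs.pmf_kp mass_def)
    qed
    also have "\<dots> = (\<Prod>i<n. pmf cs.kp (qs ! i))"
      by (rule prod.reindex_bij_witness[of _ Suc "\<lambda>i. i - 1"]) auto
    also have "\<dots> = pmf (cs.rep n) qs" using pmf_replicate_pmf[of qs cs.kp] len by simp
    finally show ?thesis .
  qed
  have AEall: "AE \<omega> in M. \<forall>i\<in>{1..n}. X i \<omega> \<in> unit_cube"
    by (intro AE_finite_allI fc(3)) auto
  have "AE \<omega> in M. g \<omega> = (\<Sum>qs\<in>LS. h qs * indicator (B qs) \<omega>)"
    using AEall AE_space g(2)
  proof eventually_elim
    case (elim \<omega>)
    have inB: "\<omega> \<in> B qs \<longleftrightarrow> qs = labels X n \<omega>" if "qs \<in> LS" for qs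
    proof -
      have len: "length qs = n" using that by (simp add: LS_def)
      have "\<omega> \<in> B qs \<longleftrightarrow> (\<forall>i\<in>{1..n}. lab (X i \<omega>) = qs ! (i - 1))"
        using elim n by (auto simp: B_def cell_def)
      also have "\<dots> \<longleftrightarrow> (\<forall>i<n. lab (X (Suc i) \<omega>) = qs ! i)"
      proof (intro iffI allI impI ballI)
        fix i assume "\<forall>i\<in>{1..n}. lab (X i \<omega>) = qs ! (i - 1)" "i < n"
        then show "lab (X (Suc i) \<omega>) = qs ! i" by (auto dest: bspec[of _ _ "Suc i"])
      next
        fix i assume "\<forall>i<n. lab (X (Suc i) \<omega>) = qs ! i" "i \<in> {1..n}"
        then show "lab (X i \<omega>) = qs ! (i - 1)" by (cases i) auto
      qed
      also have "\<dots> \<longleftrightarrow> qs = labels X n \<omega>"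
        using len by (auto simp: labels_def list_eq_iff_nth_eq)
      finally show ?thesis .
    qed
    have "labels X n \<omega> \<in> LS" using elim by (auto simp: LS_def labels_def QQ_def)
    have "(\<Sum>qs\<in>LS. h qs * indicator (B qs) \<omega>) = (\<Sum>qs\<in>LS. if qs = labels X n \<omega> then h qs else 0)"
      by (intro sum.cong refl) (auto simp: inB indicator_def)
    also have "\<dots> = h (labels X n \<omega>)" using finLS \<open>labels X n \<omega> \<in> LS\<close> by simp
    finally show ?case using elim by simp
  qed
  moreover have "(\<lambda>\<omega>. \<Sum>qs\<in>LS. h qs * indicator (B qs) \<omega>) \<in> borel_measurable M"
    using Bm by measurable
  ultimately have "(\<integral>\<omega>. g \<omega> \<partial>M) = (\<integral>\<omega>. (\<Sum>qs\<in>LS. h qs * indicator (B qs) \<omega>) \<partial>M)"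
    using g(1) by (intro integral_cong_AE)
  moreover have iB: "integrable M (indicator (B qs) :: _ \<Rightarrow> real)" for qs
    using integrable_real_mult_indicator[OF Bm, of "\<lambda>_. 1"] by simp
  moreover have "(\<integral>\<omega>. (\<Sum>qs\<in>LS. h qs * indicator (B qs) \<omega>) \<partial>M) = (\<Sum>qs\<in>LS. h qs * prob (B qs))"
    using Bm iB by (subst Bochner_Integration.integral_sum) auto
  moreover have "(\<Sum>qs\<in>LS. h qs * prob (B qs)) = E (cs.rep n) h"
    using pB cs.rep_sub
    by (subst integral_measure_pmf_real[OF finLS]) (auto simp: LS_def set_replicate_pmf)
  ultimately show ?thesis by simp
qed

end

section \<open>From exponential moments to large deviations\<close>

text \<open>
  The Legendre transform of \<open>\<lambda>t. \<alpha> * (exp t - 1)\<close>.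
\<close>

definition rate :: "real \<Rightarrow> real \<Rightarrow> real" where
  "rate \<alpha> x = x * ln (x / \<alpha>) - x + \<alpha>"

lemma ereal_le_uminus_reorder: "a \<le> - b \<longleftrightarrow> b \<le> - a" for a b :: ereal
  by (metis ereal_minus_le_minus ereal_uminus_uminus)

lemma rate_nonneg:
  assumes "0 < \<alpha>" "0 \<le> x"
  shows "0 \<le> rate \<alpha> x"
proof (cases "x = 0")
  case False
  then have x: "0 < x" using assms by simp
  have "ln (\<alpha> / x) \<le> \<alpha> / x - 1" using x assms by (intro ln_le_minus_one) simp
  then have "1 - \<alpha> / x \<le> ln (x / \<alpha>)" using x assms by (simp add: ln_div)
  then have "x * (1 - \<alpha> / x) \<le> x * ln (x / \<alpha>)" using x by (intro mult_left_mono) auto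
  then show ?thesis using x by (simp add: rate_def algebra_simps)
qed (use assms in \<open>simp add: rate_def\<close>)

lemma continuous_rate:
  assumes "0 < \<alpha>"
  shows "continuous_on {0..} (rate \<alpha>)"
  unfolding continuous_on_def
proof
  fix x :: real assume "x \<in> {0..}"
  show "(rate \<alpha> \<longlongrightarrow> rate \<alpha> x) (at x within {0..})"
  proof (cases "x = 0")
    case True
    have "((\<lambda>x. x * ln (x / \<alpha>) - x + \<alpha>) \<longlongrightarrow> \<alpha>) (at_right 0)"
      using assms by real_asymp
    moreover have "at x within {0..} = at_right 0"
      unfolding True by (metis at_within_Ici_at_right)
    ultimately show ?thesis using True by (simp add: rate_def[abs_def])
  next
    case False
    then have "isCont (rate \<alpha>) x" unfolding rate_def[abs_def] using assms by (intro continuous_intros) auto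
    then show ?thesis by (simp add: isCont_def Lim_at_imp_Lim_at_within)
  qed
qed

text \<open>
  Chernoff's inequality for the unnormalised law with density \<open>exp (t * T)\<close>.
\<close>

lemma (in prob_space) tilted_tail:
  fixes T :: "'a \<Rightarrow> real"
  assumes T: "T \<in> borel_measurable M" and int: "integrable M (\<lambda>\<omega>. exp ((t + s) * T \<omega>))" "integrable M (\<lambda>\<omega>. exp (t * T \<omega>))"
  shows "(\<integral>\<omega>. exp (t * T \<omega>) * indicator {\<omega>. 0 \<le> s * (T \<omega> - a)} \<omega> \<partial>M) \<le> exp (- s * a) * (\<integral>\<omega>. exp ((t + s) * T \<omega>) \<partial>M)"
proof -
  have "(\<integral>\<omega>. exp (t * T \<omega>) * indicator {\<omega>. 0 \<le> s * (T \<omega> - a)} \<omega> \<partial>M) \<le> (\<integral>\<omega>. exp (- s * a) * exp ((t + s) * T \<omega>) \<partial>M)"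
  proof (rule integral_mono)
    have "{\<omega> \<in> space M. 0 \<le> s * (T \<omega> - a)} \<in> sets M" using T by measurable
    then have "integrable M (\<lambda>\<omega>. exp (t * T \<omega>) * indicator {\<omega> \<in> space M. 0 \<le> s * (T \<omega> - a)} \<omega>)"
      using int(2) by (rule integrable_real_mult_indicator)
    then show "integrable M (\<lambda>\<omega>. exp (t * T \<omega>) * indicator {\<omega>. 0 \<le> s * (T \<omega> - a)} \<omega>)"
      by (rule Bochner_Integration.integrable_cong[THEN iffD1, rotated 2]) (auto simp: indicator_def)
    show "integrable M (\<lambda>\<omega>. exp (- s * a) * exp ((t + s) * T \<omega>))" using int(1) by simp
    fix \<omega>
    have "exp (t * T \<omega>) \<le> exp (- s * a) * exp ((t + s) * T \<omega>)" if "0 \<le> s * (T \<omega> - a)"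
      using that by (simp add: mult_exp_exp algebra_simps)
    then show "exp (t * T \<omega>) * indicator {\<omega>. 0 \<le> s * (T \<omega> - a)} \<omega> \<le> exp (- s * a) * exp ((t + s) * T \<omega>)"
      by (auto simp: indicator_def)
  qed
  then show ?thesis by simp
qed

locale mgf_limit = prob_space M for M :: "'w measure" +
  fixes T :: "nat \<Rightarrow> 'w \<Rightarrow> real" and b :: "nat \<Rightarrow> real" and \<alpha> :: real
  assumes T_meas: "\<And>n. 1 \<le> n \<Longrightarrow> T n \<in> borel_measurable M"
    and T_nonneg: "\<And>n \<omega>. \<omega> \<in> space M \<Longrightarrow> 0 \<le> T n \<omega>"
    and b_top: "filterlim b at_top sequentially"
    and \<alpha>_pos: "0 < \<alpha>"
    and T_int: "\<And>t. \<forall>\<^sub>F n in sequentially. integrable M (\<lambda>\<omega>. exp (t * T n \<omega>))"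
    and mgf: "\<And>t. (\<lambda>n. ln (\<integral>\<omega>. exp (t * T n \<omega>) \<partial>M) / b n) \<longlonglongrightarrow> \<alpha> * (exp t - 1)"
begin

definition Y :: "nat \<Rightarrow> 'w \<Rightarrow> real" where "Y n \<omega> = T n \<omega> / b n"
definition m :: "nat \<Rightarrow> real \<Rightarrow> real" where "m n t = (\<integral>\<omega>. exp (t * T n \<omega>) \<partial>M)"

lemma Y_meas: "1 \<le> n \<Longrightarrow> Y n \<in> borel_measurable M"
  unfolding Y_def[abs_def] using T_meas by measurable

lemma ev_b: "\<forall>\<^sub>F n in sequentially. B < b n \<and> 1 \<le> n"
  using b_top eventually_ge_at_top[of "1 :: nat"] by (auto simp: filterlim_at_top_dense intro: eventually_conj)

lemma m_pos: "integrable M (\<lambda>\<omega>. exp (t * T n \<omega>)) \<Longrightarrow> 0 < m n t"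
  unfolding m_def
proof (rule ccontr)
  assume i: "integrable M (\<lambda>\<omega>. exp (t * T n \<omega>))" and "\<not> 0 < (\<integral>\<omega>. exp (t * T n \<omega>) \<partial>M)"
  then have "(\<integral>\<omega>. exp (t * T n \<omega>) \<partial>M) = 0" by (simp add: antisym integral_nonneg_AE not_less)
  then have "AE \<omega> in M. exp (t * T n \<omega>) = 0" using i by (subst (asm) integral_nonneg_eq_0_iff_AE) auto
  then show False by simp
qed

lemma m_bounds:
  assumes "0 < e"
  shows "\<forall>\<^sub>F n in sequentially. exp ((\<alpha> * (exp t - 1) - e) * b n) \<le> m n t \<and> m n t \<le> exp ((\<alpha> * (exp t - 1) + e) * b n)"
proof -
  have "\<forall>\<^sub>F n in sequentially. \<bar>ln (m n t) / b n - \<alpha> * (exp t - 1)\<bar> < e"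
    using tendstoD[OF mgf assms, of t] by (simp add: dist_real_def m_def)
  then show ?thesis using ev_b[of 0] T_int[of t]
  proof eventually_elim
    case (elim n)
    then have b: "0 < b n" and m: "0 < m n t" using m_pos by auto
    have "(\<alpha> * (exp t - 1) - e) * b n \<le> ln (m n t)" "ln (m n t) \<le> (\<alpha> * (exp t - 1) + e) * b n"
      using elim(1) b by (auto simp: abs_less_iff field_simps)
    then show ?case using m by (simp add: ln_ge_iff) (metis exp_le_cancel_iff exp_ln)
  qed
qed

lemma chernoff:
  assumes c: "c < t * x - \<alpha> * (exp t - 1)"
  shows "\<forall>\<^sub>F n in sequentially. measure M {\<omega>\<in>space M. 0 \<le> t * (Y n \<omega> - x)} \<le> exp (- c * b n)"
proof -
  define e where "e = t * x - \<alpha> * (exp t - 1) - c"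
  have "0 < e" using c by (simp add: e_def)
  from m_bounds[OF this, of t] show ?thesis using ev_b[of 0] T_int[of t]
  proof eventually_elim
    case (elim n)
    then have b: "0 < b n" "1 \<le> n" by auto
    have eq: "0 \<le> t * (Y n \<omega> - x) \<longleftrightarrow> 0 \<le> t * (T n \<omega> - x * b n)" for \<omega>
    proof -
      have "t * (T n \<omega> - x * b n) = b n * (t * (Y n \<omega> - x))" using b by (simp add: Y_def field_simps)
      moreover have "0 \<le> b n * z \<longleftrightarrow> 0 \<le> z" for z using b by (simp add: zero_le_mult_iff)
      ultimately show ?thesis by presburger
    qed
    have ms: "{\<omega>\<in>space M. 0 \<le> t * (T n \<omega> - x * b n)} \<in> sets M" using T_meas[OF b(2)] by measurable
    have "measure M {\<omega>\<in>space M. 0 \<le> t * (T n \<omega> - x * b n)} = (\<integral>\<omega>. exp (0 * T n \<omega>) * indicator {\<omega>. 0 \<le> t * (T n \<omega> - x * b n)} \<omega> \<partial>M)"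
      using ms by (subst Bochner_Integration.integral_cong[OF refl, where g="indicator {\<omega>\<in>space M. 0 \<le> t * (T n \<omega> - x * b n)}"])
        (auto simp: indicator_def)
    also have "\<dots> \<le> exp (- t * (x * b n)) * m n t"
      using tilted_tail[OF T_meas[OF b(2)], of 0 t "x * b n"] elim by (simp add: m_def)
    also have "\<dots> \<le> exp (- t * (x * b n)) * exp ((\<alpha> * (exp t - 1) + e) * b n)"
      using elim by (intro mult_left_mono) auto
    also have "\<dots> = exp (- c * b n)" by (simp add: mult_exp_exp e_def algebra_simps)
    finally show ?case by (simp add: eq)
  qed
qed

lemma rate_opt: "0 < x \<Longrightarrow> ln (x / \<alpha>) * x - \<alpha> * (exp (ln (x / \<alpha>)) - 1) = rate \<alpha> x"
  using \<alpha>_pos by (simp add: rate_def field_simps)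

text \<open>
  The optimal exponent in Chernoff's inequality is \<open>ln (x / \<alpha>)\<close>, which is nonnegative
  to the right of the mean \<open>\<alpha>\<close>.
\<close>

lemma upper_right:
  assumes x: "\<alpha> \<le> x" and c: "c < rate \<alpha> x"
  shows "\<forall>\<^sub>F n in sequentially. measure M {\<omega>\<in>space M. x \<le> Y n \<omega>} \<le> exp (- c * b n)"
proof -
  have x0: "0 < x" using x \<alpha>_pos by simp
  have t: "0 \<le> ln (x / \<alpha>)" using x \<alpha>_pos by simp
  have "\<forall>\<^sub>F n in sequentially. measure M {\<omega>\<in>space M. 0 \<le> ln (x / \<alpha>) * (Y n \<omega> - x)} \<le> exp (- c * b n)"
    using c by (intro chernoff) (simp add: rate_opt[OF x0])
  then show ?thesis using ev_b[of 0]
  proof eventually_elim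
    case (elim n)
    have "measure M {\<omega>\<in>space M. x \<le> Y n \<omega>} \<le> measure M {\<omega>\<in>space M. 0 \<le> ln (x / \<alpha>) * (Y n \<omega> - x)}"
    proof (rule finite_measure_mono)
      show "{\<omega>\<in>space M. 0 \<le> ln (x / \<alpha>) * (Y n \<omega> - x)} \<in> sets M"
      proof -
        have "Y n \<in> borel_measurable M" using Y_meas[of n] elim by auto
        then show ?thesis by measurable
      qed
    qed (use t in auto)
    then show ?case using elim by linarith
  qed
qed

lemma upper_left:
  assumes x: "0 \<le> x" "x \<le> \<alpha>" and c: "c < rate \<alpha> x"
  shows "\<forall>\<^sub>F n in sequentially. measure M {\<omega>\<in>space M. Y n \<omega> \<le> x} \<le> exp (- c * b n)"
proof -
  obtain t where t: "t \<le> 0" "c < t * x - \<alpha> * (exp t - 1)"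
  proof (cases "x = 0")
    case True
    have "((\<lambda>t. - \<alpha> * (exp t - 1)) \<longlongrightarrow> - \<alpha> * (0 - 1)) at_bot"
      by (intro tendsto_intros exp_at_bot)
    moreover have "c < - \<alpha> * (0 - 1)" using c True by (simp add: rate_def)
    ultimately have "\<forall>\<^sub>F t in at_bot. c < - \<alpha> * (exp t - 1)" by (rule order_tendstoD)
    then have "\<forall>\<^sub>F t in at_bot. c < - \<alpha> * (exp t - 1) \<and> t \<le> 0"
      using eventually_le_at_bot[of "0 :: real"] by eventually_elim auto
    then obtain t where "c < - \<alpha> * (exp t - 1)" "t \<le> 0" using eventually_happens'[OF trivial_limit_at_bot_linorder] by blast
    then show ?thesis using that[of t] True by simp
  next
    case False
    then have x0: "0 < x" using x by simp
    show ?thesis using that[of "ln (x / \<alpha>)"] rate_opt[OF x0] c x x0 \<alpha>_pos by simp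
  qed
  from chernoff[OF t(2)] show ?thesis using ev_b[of 0]
  proof eventually_elim
    case (elim n)
    have "measure M {\<omega>\<in>space M. Y n \<omega> \<le> x} \<le> measure M {\<omega>\<in>space M. 0 \<le> t * (Y n \<omega> - x)}"
    proof (rule finite_measure_mono)
      show "{\<omega>\<in>space M. 0 \<le> t * (Y n \<omega> - x)} \<in> sets M"
      proof -
        have "Y n \<in> borel_measurable M" using Y_meas[of n] elim by auto
        then show ?thesis by measurable
      qed
    qed (use t in \<open>auto intro: mult_nonpos_nonpos\<close>)
    then show ?case using elim by linarith
  qed
qed

text \<open>
  Under the density \<open>exp (t * T)\<close> with \<open>t = ln (x / \<alpha>)\<close> the quotient \<open>Y\<close> concentrates
  at \<open>x\<close>: by strict convexity of the limit, the part with \<open>\<bar>Y - x\<bar>\<close> not small has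
  exponentially smaller mass than the total \<open>m n t\<close>. On the remaining part the density is
  close to \<open>exp (t * x * b n)\<close>.
\<close>

lemma lower_local:
  assumes x: "0 < x" and \<delta>: "0 < \<delta>" and c: "rate \<alpha> x < c"
  shows "\<forall>\<^sub>F n in sequentially. exp (- c * b n) \<le> measure M {\<omega>\<in>space M. \<bar>Y n \<omega> - x\<bar> < \<delta>}"
proof -
  \<comment> \<open>The exponent at which the derivative \<open>\<alpha> * exp t\<close> of the limit equals \<open>x\<close>.\<close>
  define t where "t = ln (x / \<alpha>)"
  have et: "\<alpha> * exp t = x" using x \<alpha>_pos by (simp add: t_def)
  define d where "d = min \<delta> ((c - rate \<alpha> x) / (2 * (\<bar>t\<bar> + 1)))"
  have d: "0 < d" "d \<le> \<delta>" using \<delta> c by (auto simp: d_def)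
  have d2: "(\<bar>t\<bar> + 1) * d \<le> (c - rate \<alpha> x) / 2"
  proof -
    have "(\<bar>t\<bar> + 1) * d \<le> (\<bar>t\<bar> + 1) * ((c - rate \<alpha> x) / (2 * (\<bar>t\<bar> + 1)))"
      by (intro mult_left_mono) (auto simp: d_def)
    also have "\<dots> = (c - rate \<alpha> x) / 2" by (simp add: field_simps)
    finally show ?thesis .
  qed
  define s where "s = min 1 (d / (2 * x))"
  have s: "0 < s" "s \<le> 1" using d x by (auto simp: s_def)
  have "s * x \<le> d / (2 * x) * x" using x by (intro mult_right_mono) (auto simp: s_def)
  then have sx: "s * x \<le> d / 2" using x by simp
  define \<kappa> where "\<kappa> = s * d / 2"
  have \<kappa>: "0 < \<kappa>" "\<kappa> \<le> d" using s d mult_right_mono[OF s(2), of d] by (auto simp: \<kappa>_def)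
  have "s * (x * s) \<le> s * (d / 2)" using s sx by (intro mult_left_mono) (auto simp: mult.commute)
  then have xs2: "x * s\<^sup>2 - s * d \<le> - \<kappa>" by (simp add: \<kappa>_def power2_eq_square algebra_simps)
  have es: "exp u \<le> 1 + u + s\<^sup>2" if "u = s \<or> u = - s" for u
  proof (cases "u = s")
    case True
    then show ?thesis using exp_bound[of s] s by simp
  next
    case False
    then have u: "u = - s" using that by simp
    have "exp (- s) \<le> 1 / (1 + s)" using exp_ge_add_one_self[of s] s by (simp add: exp_minus field_simps)
    also have "\<dots> \<le> 1 - s + s\<^sup>2"
    proof -
      have "(1 - s + s\<^sup>2) * (1 + s) = 1 + s ^ 3" by (simp add: algebra_simps power2_eq_square power3_eq_cube)
      then show ?thesis using s by (simp add: field_simps)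
    qed
    finally show ?thesis by (simp add: u)
  qed
  have tails: "\<alpha> * (exp (t + u) - 1) - u * (x + (if u = s then d else - d)) \<le> \<alpha> * (exp t - 1) - \<kappa>" if u: "u = s \<or> u = - s" for u
  proof -
    have "\<alpha> * (exp (t + u) - 1) = x * exp u - \<alpha>" by (simp add: exp_add et[symmetric] algebra_simps)
    also have "\<dots> \<le> x * (1 + u + s\<^sup>2) - \<alpha>" using x es[OF u] by simp
    finally have "\<alpha> * (exp (t + u) - 1) - u * (x + (if u = s then d else - d)) \<le> x - \<alpha> + (x * s\<^sup>2 - s * d)"
      using u s by (auto simp: algebra_simps)
    also have "\<dots> \<le> x - \<alpha> - \<kappa>" using xs2 by simp
    also have "x - \<alpha> = \<alpha> * (exp t - 1)" by (simp add: et algebra_simps)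
    finally show ?thesis .
  qed
  define \<Lambda> where "\<Lambda> = \<alpha> * (exp t - 1)"
  have \<kappa>4: "0 < \<kappa> / 4" using \<kappa> by simp
  have ev1: "\<forall>\<^sub>F n in sequentially. 16 < \<kappa> * b n"
    using ev_b[of "16 / \<kappa>"] by eventually_elim (use \<kappa> in \<open>simp add: field_simps\<close>)
  have cc: "t * x + \<bar>t\<bar> * d - \<Lambda> + \<kappa> / 2 \<le> c"
  proof -
    have "t * x - \<Lambda> = rate \<alpha> x" using rate_opt[OF x] by (simp add: t_def \<Lambda>_def)
    moreover have "\<bar>t\<bar> * d + d \<le> (c - rate \<alpha> x) / 2" using d2 by (simp add: algebra_simps)
    moreover have "p + q - L + \<kappa> / 2 \<le> c" if "p - L = R" "q + d \<le> (c - R) / 2" "R < c" for p q L R :: real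
    proof -
      have "\<kappa> / 2 \<le> d" using \<kappa> by simp
      moreover have "R + (c - R) / 2 \<le> c" using that(3) by (simp add: field_simps)
      ultimately show ?thesis using that by argo
    qed
    ultimately show ?thesis using c by blast
  qed
  from m_bounds[OF \<kappa>4, of t] m_bounds[OF \<kappa>4, of "t + s"] m_bounds[OF \<kappa>4, of "t + (- s)"]
    T_int[of t] T_int[of "t + s"] T_int[of "t + (- s)"] ev_b[of 0] ev1
  show ?thesis
  proof eventually_elim
    case (elim n)
    then have b: "0 < b n" "1 \<le> n" by auto
    note Tm = T_meas[OF b(2)]
    define B where "B = {\<omega>\<in>space M. \<bar>Y n \<omega> - x\<bar> < d}"
    define S1 where "S1 = {\<omega>. 0 \<le> s * (T n \<omega> - (x + d) * b n)}"
    define S2 where "S2 = {\<omega>. 0 \<le> (- s) * (T n \<omega> - (x - d) * b n)}"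
    have Bm: "B \<in> sets M" unfolding B_def using Y_meas[OF b(2)] by measurable
    have small: "exp (- u * a) * m n (t + u) \<le> exp ((\<Lambda> - 3 * \<kappa> / 4) * b n)"
      if u: "u = s \<or> u = - s" and a: "a = (x + (if u = s then d else - d)) * b n" for u a
    proof -
      have "m n (t + u) \<le> exp ((\<alpha> * (exp (t + u) - 1) + \<kappa> / 4) * b n)" using elim u by auto
      then have "exp (- u * a) * m n (t + u) \<le> exp (- u * a) * exp ((\<alpha> * (exp (t + u) - 1) + \<kappa> / 4) * b n)"
        by (intro mult_left_mono) auto
      also have "\<dots> = exp ((\<alpha> * (exp (t + u) - 1) - u * (x + (if u = s then d else - d)) + \<kappa> / 4) * b n)"
        by (simp add: mult_exp_exp a algebra_simps)
      also have "\<dots> \<le> exp ((\<Lambda> - 3 * \<kappa> / 4) * b n)"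
        using tails[OF u] b by (simp add: \<Lambda>_def)
      finally show ?thesis .
    qed
    have t1: "(\<integral>\<omega>. exp (t * T n \<omega>) * indicator S1 \<omega> \<partial>M) \<le> exp ((\<Lambda> - 3 * \<kappa> / 4) * b n)"
    proof -
      have "(\<integral>\<omega>. exp (t * T n \<omega>) * indicator S1 \<omega> \<partial>M) \<le> exp (- s * ((x + d) * b n)) * m n (t + s)"
        unfolding S1_def m_def by (rule tilted_tail[OF Tm elim(5) elim(4)])
      also have "\<dots> \<le> exp ((\<Lambda> - 3 * \<kappa> / 4) * b n)" by (rule small) auto
      finally show ?thesis .
    qed
    have t2: "(\<integral>\<omega>. exp (t * T n \<omega>) * indicator S2 \<omega> \<partial>M) \<le> exp ((\<Lambda> - 3 * \<kappa> / 4) * b n)"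
    proof -
      have "(\<integral>\<omega>. exp (t * T n \<omega>) * indicator S2 \<omega> \<partial>M) \<le> exp (- (- s) * ((x - d) * b n)) * m n (t + (- s))"
        unfolding S2_def m_def by (rule tilted_tail[OF Tm elim(6) elim(4)])
      also have "\<dots> \<le> exp ((\<Lambda> - 3 * \<kappa> / 4) * b n)" by (rule small) (use s in auto)
      finally show ?thesis .
    qed
    have S12: "S1 \<inter> space M \<in> sets M" "S2 \<inter> space M \<in> sets M"
    proof -
      have "{\<omega> \<in> space M. 0 \<le> s * (T n \<omega> - (x + d) * b n)} \<in> sets M"
        "{\<omega> \<in> space M. 0 \<le> (- s) * (T n \<omega> - (x - d) * b n)} \<in> sets M" using Tm by measurable
      then show "S1 \<inter> space M \<in> sets M" "S2 \<inter> space M \<in> sets M"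
        by (simp_all add: S1_def S2_def Collect_conj_eq Int_commute)
    qed
    have iS: "integrable M (\<lambda>\<omega>. exp (t * T n \<omega>) * indicator S \<omega>)" if "S \<inter> space M \<in> sets M" for S
    proof -
      have "integrable M (\<lambda>\<omega>. exp (t * T n \<omega>) * indicator (S \<inter> space M) \<omega>)"
        using that elim(4) by (rule integrable_real_mult_indicator)
      then show ?thesis by (rule Bochner_Integration.integrable_cong[THEN iffD1, rotated 2]) (auto simp: indicator_def)
    qed
    have iB: "integrable M (indicator B :: _ \<Rightarrow> real)"
      using integrable_real_mult_indicator[OF Bm, of "\<lambda>_. 1"] by simp
    have "m n t \<le> (\<integral>\<omega>. exp (t * T n \<omega>) * indicator S1 \<omega> + exp (t * T n \<omega>) * indicator S2 \<omega> +
        exp ((t * x + \<bar>t\<bar> * d) * b n) * indicator B \<omega> \<partial>M)"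
      unfolding m_def
    proof (rule integral_mono)
      fix \<omega> assume \<omega>: "\<omega> \<in> space M"
      have TY: "T n \<omega> = Y n \<omega> * b n" using b by (simp add: Y_def)
      consider "\<omega> \<in> B" | "x + d \<le> Y n \<omega>" | "Y n \<omega> \<le> x - d" using \<omega> unfolding B_def by fastforce
      then show "exp (t * T n \<omega>) \<le> exp (t * T n \<omega>) * indicator S1 \<omega> + exp (t * T n \<omega>) * indicator S2 \<omega> +
          exp ((t * x + \<bar>t\<bar> * d) * b n) * indicator B \<omega>"
      proof cases
        case 1
        then have "\<bar>t * (Y n \<omega> - x)\<bar> \<le> \<bar>t\<bar> * d" unfolding abs_mult B_def by (intro mult_left_mono) auto
        then have "t * Y n \<omega> \<le> t * x + \<bar>t\<bar> * d" by (simp add: abs_le_iff algebra_simps)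
        then have "t * Y n \<omega> * b n \<le> (t * x + \<bar>t\<bar> * d) * b n" using b by (intro mult_right_mono) auto
        then have "exp (t * T n \<omega>) \<le> exp ((t * x + \<bar>t\<bar> * d) * b n)" by (simp add: TY mult.assoc)
        then show ?thesis using 1 by (simp add: add_increasing)
      next
        case 2
        then have "(x + d) * b n \<le> T n \<omega>" unfolding TY using b by (intro mult_right_mono) auto
        then have "\<omega> \<in> S1" using s by (simp add: S1_def)
        then show ?thesis by simp
      next
        case 3
        then have "T n \<omega> \<le> (x - d) * b n" unfolding TY using b by (intro mult_right_mono) auto
        then have "\<omega> \<in> S2" using s by (auto simp: S2_def intro: mult_nonneg_nonpos)
        then show ?thesis by simp
      qed
    qed (use elim(4) iS S12 iB in auto)
    also have "\<dots> = (\<integral>\<omega>. exp (t * T n \<omega>) * indicator S1 \<omega> \<partial>M) + (\<integral>\<omega>. exp (t * T n \<omega>) * indicator S2 \<omega> \<partial>M) +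
        exp ((t * x + \<bar>t\<bar> * d) * b n) * measure M B"
      using iS S12 iB Bm by (simp add: Bochner_Integration.integral_add)
    finally have "exp ((\<Lambda> - \<kappa> / 4) * b n) \<le> 2 * exp ((\<Lambda> - 3 * \<kappa> / 4) * b n) + exp ((t * x + \<bar>t\<bar> * d) * b n) * measure M B"
      using elim(1) t1 t2 by (simp add: \<Lambda>_def)
    moreover have "4 * exp ((\<Lambda> - 3 * \<kappa> / 4) * b n) \<le> exp ((\<Lambda> - \<kappa> / 4) * b n)"
    proof -
      have "(4 :: real) \<le> exp (\<kappa> * b n / 2)" using exp_ge_add_one_self[of "\<kappa> * b n / 2"] elim by linarith
      then have "4 * exp ((\<Lambda> - 3 * \<kappa> / 4) * b n) \<le> exp (\<kappa> * b n / 2) * exp ((\<Lambda> - 3 * \<kappa> / 4) * b n)"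
        by (intro mult_right_mono) auto
      also have "\<dots> = exp ((\<Lambda> - \<kappa> / 4) * b n)" by (simp add: mult_exp_exp algebra_simps)
      finally show ?thesis .
    qed
    ultimately have "exp ((\<Lambda> - \<kappa> / 4) * b n) / 2 \<le> exp ((t * x + \<bar>t\<bar> * d) * b n) * measure M B" by linarith
    moreover have "exp (- (\<kappa> / 4) * b n) \<le> 1 / 2"
    proof -
      have "2 \<le> exp (\<kappa> / 4 * b n)" using exp_ge_add_one_self[of "\<kappa> / 4 * b n"] elim by linarith
      then show ?thesis by (simp add: exp_minus field_simps)
    qed
    ultimately have "exp (- (\<kappa> / 4) * b n) * exp ((\<Lambda> - \<kappa> / 4) * b n) \<le> exp ((t * x + \<bar>t\<bar> * d) * b n) * measure M B"
    proof -
      assume h1: "exp ((\<Lambda> - \<kappa> / 4) * b n) / 2 \<le> exp ((t * x + \<bar>t\<bar> * d) * b n) * measure M B"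
        and h2: "exp (- (\<kappa> / 4) * b n) \<le> 1 / 2"
      have "exp (- (\<kappa> / 4) * b n) * exp ((\<Lambda> - \<kappa> / 4) * b n) \<le> 1 / 2 * exp ((\<Lambda> - \<kappa> / 4) * b n)"
        by (rule mult_right_mono[OF h2]) simp
      also have "\<dots> = exp ((\<Lambda> - \<kappa> / 4) * b n) / 2" by simp
      also note h1
      finally show ?thesis .
    qed
    then have "exp (- ((t * x + \<bar>t\<bar> * d) * b n)) * (exp (- (\<kappa> / 4) * b n) * exp ((\<Lambda> - \<kappa> / 4) * b n)) \<le>
        exp (- ((t * x + \<bar>t\<bar> * d) * b n)) * (exp ((t * x + \<bar>t\<bar> * d) * b n) * measure M B)"
      by (rule mult_left_mono) simp
    also have "\<dots> = measure M B" unfolding mult.assoc[symmetric] mult_exp_exp by simp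
    finally have "exp (- ((t * x + \<bar>t\<bar> * d) * b n)) * (exp (- (\<kappa> / 4) * b n) * exp ((\<Lambda> - \<kappa> / 4) * b n)) \<le> measure M B" .
    moreover have "exp (- c * b n) \<le> exp (- ((t * x + \<bar>t\<bar> * d) * b n)) * (exp (- (\<kappa> / 4) * b n) * exp ((\<Lambda> - \<kappa> / 4) * b n))"
      using mult_right_mono[OF cc, of "b n"] b by (simp add: mult_exp_exp algebra_simps)
    moreover have "measure M B \<le> measure M {\<omega>\<in>space M. \<bar>Y n \<omega> - x\<bar> < \<delta>}"
    proof (rule finite_measure_mono)
      show "{\<omega>\<in>space M. \<bar>Y n \<omega> - x\<bar> < \<delta>} \<in> sets M" using Y_meas[OF b(2)] by measurable
    qed (use d in \<open>auto simp: B_def\<close>)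
    ultimately show ?case by linarith
  qed
qed

definition J :: "real \<Rightarrow> ereal" where "J x = (if 0 \<le> x then ereal (rate \<alpha> x) else \<infinity>)"

lemma lower_semicont_J: "lower_semicont J"
  unfolding lower_semicont_def
proof
  fix c :: ereal
  show "closed {x. J x \<le> c}"
  proof (cases c)
    case (real r)
    have "{x. J x \<le> c} = {0..} \<inter> rate \<alpha> -` {..r}" by (auto simp: J_def real split: if_splits)
    also have "closed \<dots>"
      by (intro continuous_closed_preimage continuous_rate \<alpha>_pos) auto
    finally show ?thesis .
  next
    case PInf
    then show ?thesis by simp
  next
    case MInf
    then have "{x. J x \<le> c} = {}" by (auto simp: J_def)
    then show ?thesis by simp
  qed
qed

lemma Y_nonneg: "\<omega> \<in> space M \<Longrightarrow> 0 < b n \<Longrightarrow> 0 \<le> Y n \<omega>"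
  using T_nonneg by (simp add: Y_def)

text \<open>
  The rate function decreases up to \<open>\<alpha>\<close> and increases afterwards. Hence a set is
  covered by two half-lines that start at the points of its closure next to \<open>\<alpha>\<close> on
  either side, and the rate on each half-line is smallest at its end point.
\<close>

lemma limsup_bound:
  assumes A: "A \<in> sets borel"
  shows "limsup (\<lambda>n. ereal (1 / b n) * log_ereal (measure M {\<omega>\<in>space M. Y n \<omega> \<in> A})) \<le> - (INF x\<in>closure A. J x)"
    (is "limsup ?f \<le> _")
proof -
  define C where "C = closure A"
  have clC: "closed C" by (simp add: C_def)
  have key: "limsup ?f \<le> ereal (- c)" if c: "ereal c < (INF x\<in>C. J x)" for c
  proof -
    have cJ: "c < rate \<alpha> x" if "x \<in> C" "0 \<le> x" for x
      using less_le_trans[OF c INF_lower[OF that(1)]] that(2) by (simp add: J_def)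
    have R: "\<forall>\<^sub>F n in sequentially. measure M {\<omega>\<in>space M. Y n \<omega> \<in> C \<inter> {\<alpha>..}} \<le> exp (- c * b n)"
    proof (cases "C \<inter> {\<alpha>..} = {}")
      case False
      define x where "x = Inf (C \<inter> {\<alpha>..})"
      have bd: "bdd_below (C \<inter> {\<alpha>..})" by (rule bdd_belowI[of _ \<alpha>]) auto
      have x: "x \<in> C \<inter> {\<alpha>..}"
        unfolding x_def using False bd clC by (intro closed_contains_Inf closed_Int) auto
      have "\<forall>\<^sub>F n in sequentially. measure M {\<omega>\<in>space M. x \<le> Y n \<omega>} \<le> exp (- c * b n)"
        using x \<alpha>_pos by (intro upper_right cJ) auto
      then show ?thesis using ev_b[of 0]
      proof eventually_elim
        case (elim n)
        have Yn: "Y n \<in> borel_measurable M" using Y_meas elim by auto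
        have "measure M {\<omega>\<in>space M. Y n \<omega> \<in> C \<inter> {\<alpha>..}} \<le> measure M {\<omega>\<in>space M. x \<le> Y n \<omega>}"
        proof (rule finite_measure_mono)
          show "{\<omega>\<in>space M. x \<le> Y n \<omega>} \<in> sets M" using Yn by measurable
          show "{\<omega>\<in>space M. Y n \<omega> \<in> C \<inter> {\<alpha>..}} \<subseteq> {\<omega>\<in>space M. x \<le> Y n \<omega>}"
            using bd by (auto simp: x_def intro: cInf_lower)
        qed
        then show ?case using elim by linarith
      qed
    qed simp
    have L: "\<forall>\<^sub>F n in sequentially. measure M {\<omega>\<in>space M. Y n \<omega> \<in> C \<inter> {0..\<alpha>}} \<le> exp (- c * b n)"
    proof (cases "C \<inter> {0..\<alpha>} = {}")
      case False
      define x where "x = Sup (C \<inter> {0..\<alpha>})"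
      have bd: "bdd_above (C \<inter> {0..\<alpha>})" by (rule bdd_aboveI[of _ \<alpha>]) auto
      have x: "x \<in> C \<inter> {0..\<alpha>}"
        unfolding x_def using False bd clC by (intro closed_contains_Sup closed_Int) auto
      have "\<forall>\<^sub>F n in sequentially. measure M {\<omega>\<in>space M. Y n \<omega> \<le> x} \<le> exp (- c * b n)"
        using x by (intro upper_left cJ) auto
      then show ?thesis using ev_b[of 0]
      proof eventually_elim
        case (elim n)
        have Yn: "Y n \<in> borel_measurable M" using Y_meas elim by auto
        have "measure M {\<omega>\<in>space M. Y n \<omega> \<in> C \<inter> {0..\<alpha>}} \<le> measure M {\<omega>\<in>space M. Y n \<omega> \<le> x}"
        proof (rule finite_measure_mono)
          show "{\<omega>\<in>space M. Y n \<omega> \<le> x} \<in> sets M" using Yn by measurable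
          show "{\<omega>\<in>space M. Y n \<omega> \<in> C \<inter> {0..\<alpha>}} \<subseteq> {\<omega>\<in>space M. Y n \<omega> \<le> x}"
            using bd by (auto simp: x_def intro: cSup_upper)
        qed
        then show ?case using elim by linarith
      qed
    qed simp
    have "\<forall>\<^sub>F n in sequentially. ?f n \<le> ereal (ln 2 / b n - c)"
      using R L ev_b[of 0]
    proof eventually_elim
      case (elim n)
      then have b: "0 < b n" by auto
      have Yn: "Y n \<in> borel_measurable M" using Y_meas elim by auto
      have ms: "{\<omega>\<in>space M. Y n \<omega> \<in> S} \<in> sets M" if "S \<in> sets borel" for S using Yn that by measurable
      let ?p = "measure M {\<omega>\<in>space M. Y n \<omega> \<in> A}"
      have "?p \<le> measure M ({\<omega>\<in>space M. Y n \<omega> \<in> C \<inter> {\<alpha>..}} \<union> {\<omega>\<in>space M. Y n \<omega> \<in> C \<inter> {0..\<alpha>}})"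
        using Y_nonneg[OF _ b] clC closure_subset[of A] \<alpha>_pos
        by (intro finite_measure_mono sets.Un ms) (auto simp: C_def)
      also have "\<dots> \<le> measure M {\<omega>\<in>space M. Y n \<omega> \<in> C \<inter> {\<alpha>..}} + measure M {\<omega>\<in>space M. Y n \<omega> \<in> C \<inter> {0..\<alpha>}}"
        using clC by (intro measure_Un_le ms) auto
      also have "\<dots> \<le> 2 * exp (- c * b n)" using elim by simp
      finally have p: "?p \<le> 2 * exp (- c * b n)" .
      show ?case
      proof (cases "?p = 0")
        case True
        then show ?thesis using b by (simp add: log_ereal_def)
      next
        case False
        then have p0: "0 < ?p" by (simp add: zero_less_measure_iff)
        have "ln ?p \<le> ln (2 * exp (- c * b n))" using p p0 by simp
        also have "\<dots> = ln 2 - c * b n" by (simp add: ln_mult)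
        finally have "1 / b n * ln ?p \<le> ln 2 / b n - c" using b by (simp add: field_simps)
        then show ?thesis using False by (simp add: log_ereal_def)
      qed
    qed
    then have "limsup ?f \<le> limsup (\<lambda>n. ereal (ln 2 / b n - c))" by (rule Limsup_mono)
    also have "(\<lambda>n. ereal (ln 2 / b n - c)) \<longlonglongrightarrow> ereal (0 - c)"
      by (intro tendsto_intros tendsto_ereal tendsto_diff tendsto_divide_0[OF tendsto_const]
          filterlim_at_top_imp_at_infinity b_top)
    then have "limsup (\<lambda>n. ereal (ln 2 / b n - c)) = ereal (- c)"
      by (subst lim_imp_Limsup) auto
    finally show ?thesis .
  qed
  have "(INF x\<in>C. J x) \<le> - limsup ?f"
  proof (rule dense_le)
    fix y assume y: "y < (INF x\<in>C. J x)"
    show "y \<le> - limsup ?f"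
    proof (cases y)
      case (real r)
      then have "limsup ?f \<le> ereal (- r)" using key y by simp
      then show ?thesis unfolding real by (subst ereal_le_uminus_reorder) simp
    qed (use y in auto)
  qed
  then show ?thesis unfolding C_def by (subst (asm) ereal_le_uminus_reorder)
qed

text \<open>
  Interior points \<open>x > 0\<close> are handled by the tilted law. The boundary point \<open>x = 0\<close> of the
  domain is a limit of such points, and the rate function is continuous there.
\<close>

lemma liminf_bound:
  assumes A: "A \<in> sets borel"
  shows "- (INF x\<in>interior A. J x) \<le> liminf (\<lambda>n. ereal (1 / b n) * log_ereal (measure M {\<omega>\<in>space M. Y n \<omega> \<in> A}))"
    (is "_ \<le> liminf ?f")
proof -
  have key: "ereal (- c) \<le> liminf ?f" if x: "x \<in> interior A" "0 < x" and c: "rate \<alpha> x < c" for x c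
  proof -
    obtain d where d: "0 < d" "ball x d \<subseteq> A" using x(1) by (auto simp: mem_interior)
    have "\<forall>\<^sub>F n in sequentially. ereal (- c) \<le> ?f n"
      using lower_local[OF x(2) d(1) c] ev_b[of 0]
    proof eventually_elim
      case (elim n)
      then have b: "0 < b n" by auto
      have Yn: "Y n \<in> borel_measurable M" using Y_meas elim by auto
      let ?p = "measure M {\<omega>\<in>space M. Y n \<omega> \<in> A}"
      have "measure M {\<omega>\<in>space M. \<bar>Y n \<omega> - x\<bar> < d} \<le> ?p"
      proof (rule finite_measure_mono)
        show "{\<omega>\<in>space M. Y n \<omega> \<in> A} \<in> sets M" using Yn A by measurable
        show "{\<omega>\<in>space M. \<bar>Y n \<omega> - x\<bar> < d} \<subseteq> {\<omega>\<in>space M. Y n \<omega> \<in> A}"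
          using d(2) by (auto simp: dist_real_def abs_minus_commute subset_eq)
      qed
      then have p: "exp (- c * b n) \<le> ?p" using elim by linarith
      have p0: "0 < ?p" by (rule less_le_trans[OF exp_gt_zero p])
      then have "- c * b n \<le> ln ?p" using p by (simp add: ln_ge_iff)
      then have "- c \<le> 1 / b n * ln ?p" using b by (simp add: field_simps)
      then show ?case using p0 by (simp add: log_ereal_def)
    qed
    then show ?thesis by (rule Liminf_bounded)
  qed
  have pos: "- ereal (rate \<alpha> x) \<le> liminf ?f" if x: "x \<in> interior A" "0 < x" for x
  proof -
    have "- liminf ?f \<le> ereal (rate \<alpha> x)"
    proof (rule dense_ge)
      fix y assume y: "ereal (rate \<alpha> x) < y"
      show "- liminf ?f \<le> y"
      proof (cases y)
        case (real r)
        then have "ereal (- r) \<le> liminf ?f" using key[OF x] y by simp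
        then show ?thesis unfolding real by (subst ereal_uminus_le_reorder) simp
      qed (use y in auto)
    qed
    then show ?thesis by (subst (asm) ereal_uminus_le_reorder)
  qed
  have all: "- liminf ?f \<le> J x" if x: "x \<in> interior A" for x
  proof -
    consider "0 < x" | "x = 0" | "x < 0" by linarith
    then show ?thesis
    proof cases
      case 1
      have "J x = ereal (rate \<alpha> x)" using 1 by (simp add: J_def)
      then show ?thesis using pos[OF x 1] by (subst ereal_uminus_le_reorder) simp
    next
      case 2
      obtain d where d: "0 < d" "ball x d \<subseteq> interior A" using x open_contains_ball[of "interior A"] by auto
      have "(rate \<alpha> \<longlongrightarrow> rate \<alpha> 0) (at 0 within {0..})"
        using continuous_rate[OF \<alpha>_pos] by (simp add: continuous_on_def)
      then have "(rate \<alpha> \<longlongrightarrow> rate \<alpha> 0) (at_right 0)"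
        by (rule tendsto_within_subset) auto
      then have "((\<lambda>y. ereal (rate \<alpha> y)) \<longlongrightarrow> ereal (rate \<alpha> 0)) (at_right 0)" by (rule tendsto_ereal)
      moreover have "\<forall>\<^sub>F y in at_right 0. - liminf ?f \<le> ereal (rate \<alpha> y)"
      proof (rule eventually_at_rightI[of 0 d])
        fix y :: real assume y: "y \<in> {0<..<d}"
        then have "y \<in> interior A" using d(2) 2 by (auto simp: dist_real_def subset_eq)
        then show "- liminf ?f \<le> ereal (rate \<alpha> y)"
          using pos[of y] y by (subst ereal_uminus_le_reorder) simp
      qed (use d in auto)
      ultimately have "- liminf ?f \<le> ereal (rate \<alpha> 0)" by (intro tendsto_lowerbound) auto
      then show ?thesis using 2 by (simp add: J_def)
    next
      case 3
      then show ?thesis by (simp add: J_def)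
    qed
  qed
  have "- liminf ?f \<le> (INF x\<in>interior A. J x)" by (rule INF_greatest) (rule all)
  then show ?thesis by (subst (asm) ereal_uminus_le_reorder)
qed

theorem satisfies_LDP_J: "satisfies_LDP M (\<lambda>n \<omega>. T n \<omega> / b n) b J"
proof -
  have eq: "(\<lambda>n \<omega>. T n \<omega> / b n) = Y" by (simp add: Y_def fun_eq_iff)
  have "0 \<le> J x" for x using rate_nonneg[OF \<alpha>_pos, of x] by (simp add: J_def)
  then show ?thesis
    unfolding eq satisfies_LDP_def
    using Y_meas b_top lower_semicont_J limsup_bound liminf_bound by blast
qed

end

section \<open>Vanishing cell diameter\<close>

lemma T_stat_nonneg: "0 \<le> T_stat k r (N :: (real ^ 'd) multiset)"
proof -
  have "0 \<le> (\<Sum>x\<in>#N'. of_bool (Q x) :: real)" for N' and Q :: "real ^ 'd \<Rightarrow> bool" by (induction N') auto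
  then show ?thesis unfolding T_stat_def .
qed

text \<open>
  Finitely many distances occur, so none of them lies in the interval from \<open>r\<close> to \<open>r + 2 *
  \<delta> m\<close> eventually.
\<close>

lemma gap_eventually:
  assumes "\<delta> \<longlonglongrightarrow> 0"
  shows "\<forall>\<^sub>F m in sequentially. \<forall>x\<in>set_mset N. \<forall>y\<in>set_mset N. torus_dist x y \<le> r + 2 * \<delta> m \<longrightarrow> torus_dist x y \<le> r"
proof (intro eventually_ball_finite ballI finite_set_mset)
  fix x y
  show "\<forall>\<^sub>F m in sequentially. torus_dist x y \<le> r + 2 * \<delta> m \<longrightarrow> torus_dist x y \<le> r"
  proof (cases "torus_dist x y \<le> r")
    case False
    have "(\<lambda>m. r + 2 * \<delta> m) \<longlonglongrightarrow> r + 2 * 0" by (intro tendsto_intros assms)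
    then have "\<forall>\<^sub>F m in sequentially. r + 2 * \<delta> m < torus_dist x y" using False by (intro order_tendstoD(2)) auto
    then show ?thesis by eventually_elim auto
  qed simp
qed

lemma TT_tendsto_T_stat:
  assumes lab: "\<And>m. fine_labels (lab m) (\<delta> m)" and \<delta>: "\<delta> \<longlonglongrightarrow> 0" and N: "set_mset N \<subseteq> unit_cube"
  shows "(\<lambda>m. real (fine_labels.TT (lab m) r k (\<lambda>q. num_points N (fine_labels.cell (lab m) q)))) \<longlonglongrightarrow> T_stat k r N"
proof (rule tendsto_eventually)
  show "\<forall>\<^sub>F m in sequentially. real (fine_labels.TT (lab m) r k (\<lambda>q. num_points N (fine_labels.cell (lab m) q))) = T_stat k r N"
    using gap_eventually[OF \<delta>, of N r]
    by eventually_elim (intro fine_labels.TT_eq_T_stat[OF lab N], auto)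
qed

lemma labels_sequence:
  assumes r: "0 < r" "r \<le> 1 / 10" and \<epsilon>: "0 < \<epsilon>" "\<epsilon> \<le> 1" and \<tau>: "0 < \<tau>" "\<tau> \<le> 1"
  shows "\<exists>(lab :: nat \<Rightarrow> real ^ 'd \<Rightarrow> nat \<times> nat) net \<delta>. (\<forall>m. torus_labels (lab m) r (\<delta> m) (net m) \<epsilon> \<tau>) \<and> \<delta> \<longlonglongrightarrow> 0"
proof -
  have "((\<lambda>d. (r + 2 * d) ^ CARD('d)) \<longlongrightarrow> (r + 2 * 0) ^ CARD('d)) (at_right 0)" by (intro tendsto_intros)
  moreover have "(r + 2 * 0) ^ CARD('d) < (1 + \<tau>) * r ^ CARD('d)" using r \<tau> by simp
  ultimately have "\<forall>\<^sub>F d in at_right 0. (r + 2 * d) ^ CARD('d) < (1 + \<tau>) * r ^ CARD('d)" by (rule order_tendstoD)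
  then obtain b where b: "0 < b" "\<And>d. 0 < d \<Longrightarrow> d < b \<Longrightarrow> (r + 2 * d) ^ CARD('d) < (1 + \<tau>) * r ^ CARD('d)"
    unfolding eventually_at_right_field by auto
  define d0 where "d0 = min (b / 2) (\<epsilon> * r / 8)"
  define \<delta> where "\<delta> m = d0 * (1 / real (Suc m))" for m
  have d0: "0 < d0" "d0 < b" "8 * d0 \<le> \<epsilon> * r" using b r \<epsilon> by (auto simp: d0_def min_def)
  have \<delta>: "0 < \<delta> m" "\<delta> m \<le> d0" for m
    using d0 by (auto simp: \<delta>_def field_simps)
  have "\<exists>(lab :: real ^ 'd \<Rightarrow> nat \<times> nat) net. torus_labels lab r (\<delta> m) net \<epsilon> \<tau>" for m
    using r \<epsilon> \<tau> b(2)[of "\<delta> m"] \<delta>[of m] d0 by (intro exists_torus_labels) auto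
  then obtain lab :: "nat \<Rightarrow> real ^ 'd \<Rightarrow> nat \<times> nat" and net where "\<forall>m. torus_labels (lab m) r (\<delta> m) (net m) \<epsilon> \<tau>"
    by metis
  moreover have "\<delta> \<longlonglongrightarrow> d0 * 0"
    unfolding \<delta>_def[abs_def] by (intro tendsto_mult tendsto_const LIMSEQ_Suc[OF lim_1_over_n])
  ultimately show ?thesis by auto
qed

lemma poisson_count_measurable:
  assumes "poisson_process M \<rho> N" "A \<in> sets borel" "A \<subseteq> unit_cube"
  shows "(\<lambda>\<omega>. num_points (N \<omega>) A) \<in> M \<rightarrow>\<^sub>M count_space UNIV"
  using assms unfolding poisson_process_def by blast

lemma T_stat_poisson_measurable:
  fixes N :: "'w \<Rightarrow> (real ^ 'd) multiset"
  assumes pp: "poisson_process M \<rho> N"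
  shows "(\<lambda>\<omega>. T_stat k r (N \<omega>)) \<in> borel_measurable M"
proof -
  obtain lab :: "nat \<Rightarrow> real ^ 'd \<Rightarrow> nat \<times> nat" and net \<delta> where
    lab: "\<And>m. torus_labels (lab m) (1 / 10) (\<delta> m) (net m) 1 1" and \<delta>: "\<delta> \<longlonglongrightarrow> 0"
    using labels_sequence[of "1 / 10" 1 1, where 'd='d] by auto
  have fl: "fine_labels (lab m) (\<delta> m)" for m using lab by (rule torus_labels.axioms(1))
  show ?thesis
  proof (rule borel_measurable_LIMSEQ_real)
    fix m
    show "(\<lambda>\<omega>. real (fine_labels.TT (lab m) r k (\<lambda>q. num_points (N \<omega>) (fine_labels.cell (lab m) q)))) \<in> borel_measurable M"
    proof (rule fine_labels.TT_measurable[OF fl])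
      fix q
      show "(\<lambda>\<omega>. num_points (N \<omega>) (fine_labels.cell (lab m) q)) \<in> M \<rightarrow>\<^sub>M count_space UNIV"
        by (rule poisson_count_measurable[OF pp fine_labels.cell_meas[OF fl] fine_labels.cell_sub[OF fl]])
    qed
  next
    fix \<omega> assume "\<omega> \<in> space M"
    then have "set_mset (N \<omega>) \<subseteq> unit_cube" using pp unfolding poisson_process_def by blast
    then show "(\<lambda>m. real (fine_labels.TT (lab m) r k (\<lambda>q. num_points (N \<omega>) (fine_labels.cell (lab m) q)))) \<longlonglongrightarrow> T_stat k r (N \<omega>)"
      by (rule TT_tendsto_T_stat[OF fl \<delta>])
  qed
qed

lemma num_points_binomial: "num_points (binomial_process X n \<omega>) A = (\<Sum>i\<in>{1..n}. of_bool (X i \<omega> \<in> A))"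
  unfolding num_points_eq_sum binomial_process_def
  by (simp add: image_mset.compositionality o_def sum_unfold_sum_mset)

lemma binomial_count_measurable:
  assumes X: "\<And>i. 1 \<le> i \<Longrightarrow> X i \<in> borel_measurable M" and A: "A \<in> sets borel"
  shows "(\<lambda>\<omega>. num_points (binomial_process X n \<omega>) A) \<in> M \<rightarrow>\<^sub>M count_space UNIV"
proof -
  have "(\<lambda>\<omega>. of_bool (X i \<omega> \<in> A) :: nat) \<in> M \<rightarrow>\<^sub>M count_space UNIV" if "i \<in> {1..n}" for i
  proof -
    have [measurable]: "X i \<in> borel_measurable M" "A \<in> sets borel" using X A that by auto
    show ?thesis unfolding of_bool_def by measurable
  qed
  then have "(\<lambda>\<omega>. \<Sum>i\<in>{1..n}. of_bool (X i \<omega> \<in> A) :: nat) \<in> M \<rightarrow>\<^sub>M count_space UNIV"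
    by (rule measurable_sum_nat)
  then show ?thesis by (simp add: num_points_binomial)
qed

lemma closed_torus_ball_pairs: "closed {z :: (real ^ 'd) \<times> (real ^ 'd). snd z \<in> unit_cube \<and> torus_dist (fst z) (snd z) \<le> r}"
proof -
  have c: "continuous_on UNIV (\<lambda>z :: (real ^ 'd) \<times> (real ^ 'd). torus_dist (fst z) (snd z))"
  proof (rule continuous_onI)
    fix z :: "(real ^ 'd) \<times> (real ^ 'd)" and e :: real assume e: "0 < e"
    show "\<exists>d>0. \<forall>z'\<in>UNIV. dist z' z < d \<longrightarrow> dist (torus_dist (fst z') (snd z')) (torus_dist (fst z) (snd z)) \<le> e"
    proof (intro exI[of _ "e / 2"] conjI ballI impI)
      fix z' assume d: "dist z' z < e / 2"
      have "\<bar>torus_dist (fst z') (snd z') - torus_dist (fst z') (snd z)\<bar> \<le> norm (snd z' - snd z)" by (rule torus_dist_cont)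
      moreover have "\<bar>torus_dist (snd z) (fst z') - torus_dist (snd z) (fst z)\<bar> \<le> norm (fst z' - fst z)" by (rule torus_dist_cont)
      moreover have "norm (snd z' - snd z) < e / 2" "norm (fst z' - fst z) < e / 2"
        using d dist_snd_le[of z' z] dist_fst_le[of z' z] by (auto simp: dist_norm)
      ultimately show "dist (torus_dist (fst z') (snd z')) (torus_dist (fst z) (snd z)) \<le> e"
        by (simp add: dist_real_def torus_dist_sym)
    qed (use e in simp)
  qed
  have "closed {z :: (real ^ 'd) \<times> (real ^ 'd). torus_dist (fst z) (snd z) \<le> r}"
    by (intro closed_Collect_le c continuous_on_const)
  moreover have "closed {z :: (real ^ 'd) \<times> (real ^ 'd). snd z \<in> unit_cube}"
    using closed_vimage[OF closed_unit_cube continuous_on_snd[OF continuous_on_id]] by (simp add: vimage_def)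
  ultimately show ?thesis by (simp add: Collect_conj_eq closed_Int)
qed

lemma T_stat_binomial_measurable:
  fixes X :: "nat \<Rightarrow> 'w \<Rightarrow> real ^ 'd"
  assumes X: "\<And>i. 1 \<le> i \<Longrightarrow> X i \<in> borel_measurable M"
  shows "(\<lambda>\<omega>. T_stat k r (binomial_process X n \<omega>)) \<in> borel_measurable M"
proof -
  let ?P = "{z :: (real ^ 'd) \<times> (real ^ 'd). snd z \<in> unit_cube \<and> torus_dist (fst z) (snd z) \<le> r}"
  have P: "?P \<in> sets borel" by (rule borel_closed[OF closed_torus_ball_pairs])
  have pm: "(\<lambda>\<omega>. of_bool (X j \<omega> \<in> torus_ball r (X i \<omega>)) :: real) \<in> borel_measurable M" if "1 \<le> i" "1 \<le> j" for i j
  proof -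
    have "(\<lambda>\<omega>. (X i \<omega>, X j \<omega>)) \<in> borel_measurable M" using X that by (intro borel_measurable_Pair) auto
    then have "(\<lambda>\<omega>. indicator ?P (X i \<omega>, X j \<omega>) :: real) \<in> borel_measurable M"
      by (rule measurable_compose) (use P in simp)
    moreover have "(of_bool (X j \<omega> \<in> torus_ball r (X i \<omega>)) :: real) = indicator ?P (X i \<omega>, X j \<omega>)" for \<omega>
      by (simp add: torus_ball_def indicator_def)
    ultimately show ?thesis by simp
  qed
  have im: "(\<lambda>\<omega>. \<Sum>j\<in>{1..n}. of_bool (X j \<omega> \<in> torus_ball r (X i \<omega>)) :: real) \<in> borel_measurable M" if "1 \<le> i" for i
    using that by (intro borel_measurable_sum pm) auto
  have "(\<lambda>\<omega>. \<Sum>i\<in>{1..n}. if (\<Sum>j\<in>{1..n}. of_bool (X j \<omega> \<in> torus_ball r (X i \<omega>)) :: real) \<le> real k then 1 else 0 :: real) \<in> borel_measurable M"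
  proof (rule borel_measurable_sum)
    fix i assume "i \<in> {1..n}"
    then have [measurable]: "(\<lambda>\<omega>. \<Sum>j\<in>{1..n}. of_bool (X j \<omega> \<in> torus_ball r (X i \<omega>)) :: real) \<in> borel_measurable M"
      using im by auto
    show "(\<lambda>\<omega>. if (\<Sum>j\<in>{1..n}. of_bool (X j \<omega> \<in> torus_ball r (X i \<omega>)) :: real) \<le> real k then 1 else 0 :: real) \<in> borel_measurable M"
      by measurable
  qed
  moreover have "T_stat k r (binomial_process X n \<omega>) =
     (\<Sum>i\<in>{1..n}. if (\<Sum>j\<in>{1..n}. of_bool (X j \<omega> \<in> torus_ball r (X i \<omega>)) :: real) \<le> real k then 1 else 0)" for \<omega>
  proof -
    have e: "real (num_points (binomial_process X n \<omega>) A) = (\<Sum>j\<in>{1..n}. of_bool (X j \<omega> \<in> A))" for A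
      unfolding num_points_binomial by simp
    have "T_stat k r (binomial_process X n \<omega>) =
        (\<Sum>i\<in>{1..n}. of_bool (num_points (binomial_process X n \<omega>) (torus_ball r (X i \<omega>)) \<le> k))"
      unfolding T_stat_def by (subst binomial_process_def) (simp add: image_mset.compositionality o_def sum_unfold_sum_mset)
    also have "\<dots> = (\<Sum>i\<in>{1..n}. if (\<Sum>j\<in>{1..n}. of_bool (X j \<omega> \<in> torus_ball r (X i \<omega>)) :: real) \<le> real k then 1 else 0)"
      unfolding e[symmetric] by (intro sum.cong refl) auto
    finally show ?thesis .
  qed
  ultimately show ?thesis by simp
qed

context torus_labels
begin

text \<open>
  There are at most \<open>k\<close> isolated points per class, and the number of classes is bounded
  independently of \<open>\<delta>\<close>.
\<close>

lemma TT_bound: "real (TT k c) \<le> real k / (unit_vol TYPE('d) * (r / 4) ^ CARD('d))"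
proof -
  have p: "0 < unit_vol TYPE('d) * (r / 4) ^ CARD('d)" using r by (simp add: unit_vol_pos)
  have "TT k c \<le> card (snd ` QQ) * k" using cs.Tc_bound[of k c] by (simp add: Tc_eq_TT)
  then have "real (TT k c) \<le> real (card (snd ` QQ)) * real k" by (simp flip: of_nat_mult)
  then have "real (TT k c) * (unit_vol TYPE('d) * (r / 4) ^ CARD('d)) \<le>
      real (card (snd ` QQ)) * real k * (unit_vol TYPE('d) * (r / 4) ^ CARD('d))"
    using p by (intro mult_right_mono) auto
  also have "\<dots> = real (card (snd ` QQ)) * (unit_vol TYPE('d) * (r / 4) ^ CARD('d)) * real k" by simp
  also have "\<dots> \<le> 1 * real k" by (intro mult_right_mono card_classes_le) auto
  finally show ?thesis using p by (simp add: field_simps)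
qed

lemma poisson_mgf_cells:
  assumes "prob_space M" "poisson_process M \<rho> N" "0 \<le> \<rho>"
  shows "(\<integral>\<omega>. exp (t * real (TT k (counts (N \<omega>)))) \<partial>M) = cs.Fc k \<rho> t"
  using poisson_counts_law[OF assms, of "\<lambda>c. exp (t * real (TT k c))"]
  by (simp add: cs.Fc_def cs.PP_def Tc_eq_TT)

lemma binomial_mgf_cells:
  assumes "prob_space M" and iid: "iid_uniform M X" and n: "1 \<le> n"
  shows "(\<integral>\<omega>. exp (t * real (TT k (counts (binomial_process X n \<omega>)))) \<partial>M) = cs.gc k n t"
proof -
  note fc = iid_uniform_facts[OF assms(1) iid]
  have "(\<lambda>\<omega>. real (TT k (counts (binomial_process X n \<omega>)))) \<in> borel_measurable M"
    by (intro TT_measurable binomial_count_measurable fc(1) cell_meas)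
  then have m: "(\<lambda>\<omega>. exp (t * real (TT k (counts (binomial_process X n \<omega>))))) \<in> borel_measurable M" by measurable
  have "AE \<omega> in M. \<forall>i\<in>{1..n}. X i \<omega> \<in> unit_cube" by (intro AE_finite_allI fc(3)) auto
  then have "AE \<omega> in M. exp (t * real (TT k (counts (binomial_process X n \<omega>)))) = exp (t * real (TT k (count_list (labels X n \<omega>))))"
    by eventually_elim (simp only: counts_binomial)
  from binomial_labels_law[OF assms m, of "\<lambda>xs. exp (t * real (TT k (count_list xs)))", OF this]
  show ?thesis by (simp add: cs.gc_def Tc_eq_TT)
qed

end

text \<open>
  For every configuration the discretised statistic is eventually equal to the original one,
  and it is bounded uniformly in the diameter of the cells; so the convergence is dominated.
\<close>

lemma expectation_limit:
  fixes N :: "'w \<Rightarrow> (real ^ 'd) multiset" and t :: real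
  assumes "prob_space M" and lab: "\<And>m. torus_labels (lab m) r (\<delta> m) (net m) \<epsilon> \<tau>" and \<delta>: "\<delta> \<longlonglongrightarrow> 0"
    and N: "AE \<omega> in M. set_mset (N \<omega>) \<subseteq> unit_cube"
    and cm: "\<And>A. A \<in> sets borel \<Longrightarrow> A \<subseteq> unit_cube \<Longrightarrow> (\<lambda>\<omega>. num_points (N \<omega>) A) \<in> M \<rightarrow>\<^sub>M count_space UNIV"
    and Tm: "(\<lambda>\<omega>. T_stat k r (N \<omega>)) \<in> borel_measurable M"
  shows "integrable M (\<lambda>\<omega>. exp (t * T_stat k r (N \<omega>)))"
    "(\<lambda>m. \<integral>\<omega>. exp (t * real (fine_labels.TT (lab m) r k (\<lambda>q. num_points (N \<omega>) (fine_labels.cell (lab m) q)))) \<partial>M)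
      \<longlonglongrightarrow> (\<integral>\<omega>. exp (t * T_stat k r (N \<omega>)) \<partial>M)"
proof -
  interpret prob_space M by fact
  have fl: "fine_labels (lab m) (\<delta> m)" for m using lab by (rule torus_labels.axioms(1))
  define K where "K = real k / (unit_vol TYPE('d) * (r / 4) ^ CARD('d))"
  define S where "S m \<omega> = exp (t * real (fine_labels.TT (lab m) r k (\<lambda>q. num_points (N \<omega>) (fine_labels.cell (lab m) q))))" for m \<omega>
  have Sm: "S m \<in> borel_measurable M" for m
  proof -
    have [measurable]: "(\<lambda>\<omega>. real (fine_labels.TT (lab m) r k (\<lambda>q. num_points (N \<omega>) (fine_labels.cell (lab m) q)))) \<in> borel_measurable M"
      by (intro fine_labels.TT_measurable[OF fl] cm fine_labels.cell_meas[OF fl] fine_labels.cell_sub[OF fl])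
    show ?thesis unfolding S_def[abs_def] by measurable
  qed
  have Lm: "(\<lambda>\<omega>. exp (t * T_stat k r (N \<omega>))) \<in> borel_measurable M" using Tm by measurable
  have b: "AE \<omega> in M. norm (S m \<omega>) \<le> exp (\<bar>t\<bar> * K)" for m
  proof (rule AE_I2)
    fix \<omega>
    have "real (fine_labels.TT (lab m) r k (\<lambda>q. num_points (N \<omega>) (fine_labels.cell (lab m) q))) \<le> K"
      unfolding K_def by (rule torus_labels.TT_bound[OF lab])
    then have "t * real (fine_labels.TT (lab m) r k (\<lambda>q. num_points (N \<omega>) (fine_labels.cell (lab m) q))) \<le> \<bar>t\<bar> * K"
      by (intro mult_mono) auto
    then show "norm (S m \<omega>) \<le> exp (\<bar>t\<bar> * K)" by (simp add: S_def)
  qed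
  have lim: "AE \<omega> in M. (\<lambda>m. S m \<omega>) \<longlonglongrightarrow> exp (t * T_stat k r (N \<omega>))"
    using N
  proof eventually_elim
    case (elim \<omega>)
    show ?case unfolding S_def by (intro tendsto_intros TT_tendsto_T_stat[OF fl \<delta> elim])
  qed
  have ib: "integrable M (\<lambda>_. exp (\<bar>t\<bar> * K))" by simp
  show "integrable M (\<lambda>\<omega>. exp (t * T_stat k r (N \<omega>)))"
    by (rule integrable_dominated_convergence[OF Lm Sm ib lim b])
  show "(\<lambda>m. \<integral>\<omega>. exp (t * real (fine_labels.TT (lab m) r k (\<lambda>q. num_points (N \<omega>) (fine_labels.cell (lab m) q)))) \<partial>M)
      \<longlonglongrightarrow> (\<integral>\<omega>. exp (t * T_stat k r (N \<omega>)) \<partial>M)"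
    using integral_dominated_convergence[OF Lm Sm ib lim b] by (simp add: S_def)
qed

section \<open>Exponential moments of the statistic on the torus\<close>

text \<open>
  The estimates for cell systems are uniform in the diameter of the cells and survive the
  limit.
\<close>

lemma poisson_bounds:
  fixes N :: "'w \<Rightarrow> (real ^ 'd) multiset" and \<rho> r t \<eta> \<epsilon> \<tau> :: real and k :: nat
  defines "V \<equiv> unit_vol TYPE('d) * r ^ CARD('d)"
  assumes M: "prob_space M" and pp: "poisson_process M \<rho> N" and \<rho>: "0 < \<rho>"
    and r: "0 < r" "r \<le> 1 / 10" and \<epsilon>: "0 < \<epsilon>" "\<epsilon> \<le> 1" and \<tau>: "0 < \<tau>" "\<tau> \<le> 1"
    and ok: "mgf_ok t \<eta> k (17 ^ CARD('d)) (\<epsilon> ^ CARD('d)) ((\<epsilon> / 4) ^ CARD('d)) (\<rho> * V) (\<tau> * (\<rho> * V))"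
  shows "integrable M (\<lambda>\<omega>. exp (t * T_stat k r (N \<omega>)))"
    "exp ((exp t - 1 - \<eta>) * (\<rho> * PL k (\<rho> * V))) \<le> (\<integral>\<omega>. exp (t * T_stat k r (N \<omega>)) \<partial>M)"
    "(\<integral>\<omega>. exp (t * T_stat k r (N \<omega>)) \<partial>M) \<le> exp ((exp t - 1 + \<eta>) * (\<rho> * PL k (\<rho> * V)))"
proof -
  obtain lab :: "nat \<Rightarrow> real ^ 'd \<Rightarrow> nat \<times> nat" and net \<delta> where
    lab: "\<And>m. torus_labels (lab m) r (\<delta> m) (net m) \<epsilon> \<tau>" and \<delta>: "\<delta> \<longlonglongrightarrow> 0"
    using labels_sequence[OF r \<epsilon> \<tau>, where 'd='d] by auto
  define Z where "Z m = (\<integral>\<omega>. exp (t * real (fine_labels.TT (lab m) r k (\<lambda>q. num_points (N \<omega>) (fine_labels.cell (lab m) q)))) \<partial>M)" for m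
  have N: "AE \<omega> in M. set_mset (N \<omega>) \<subseteq> unit_cube"
    using pp unfolding poisson_process_def by (intro AE_I2) blast
  note el = expectation_limit[OF M lab \<delta> N poisson_count_measurable[OF pp] T_stat_poisson_measurable[OF pp]]
  show "integrable M (\<lambda>\<omega>. exp (t * T_stat k r (N \<omega>)))" by (rule el(1))
  have Zb: "exp ((exp t - 1 - \<eta>) * (\<rho> * PL k (\<rho> * V))) \<le> Z m" "Z m \<le> exp ((exp t - 1 + \<eta>) * (\<rho> * PL k (\<rho> * V)))" for m
  proof -
    interpret torus_labels "lab m" r "\<delta> m" "net m" \<epsilon> \<tau> by (rule lab)
    have "Z m = cs.Fc k \<rho> t" unfolding Z_def using \<rho> by (intro poisson_mgf_cells M pp) auto
    then show "exp ((exp t - 1 - \<eta>) * (\<rho> * PL k (\<rho> * V))) \<le> Z m" "Z m \<le> exp ((exp t - 1 + \<eta>) * (\<rho> * PL k (\<rho> * V)))"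
      using cs.Fc_estimate[OF \<rho> ok[unfolded V_def]] by (simp_all add: V_def)
  qed
  have Zl: "Z \<longlonglongrightarrow> (\<integral>\<omega>. exp (t * T_stat k r (N \<omega>)) \<partial>M)" unfolding Z_def[abs_def] by (rule el(2))
  show "exp ((exp t - 1 - \<eta>) * (\<rho> * PL k (\<rho> * V))) \<le> (\<integral>\<omega>. exp (t * T_stat k r (N \<omega>)) \<partial>M)"
    by (rule LIMSEQ_le_const[OF Zl]) (use Zb in auto)
  show "(\<integral>\<omega>. exp (t * T_stat k r (N \<omega>)) \<partial>M) \<le> exp ((exp t - 1 + \<eta>) * (\<rho> * PL k (\<rho> * V)))"
    by (rule LIMSEQ_le_const2[OF Zl]) (use Zb in auto)
qed

lemma binomial_bounds:
  fixes X :: "nat \<Rightarrow> 'w \<Rightarrow> real ^ 'd" and \<rho> r t \<theta> \<eta> e w \<epsilon> \<tau> :: real and k n :: nat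
  defines "A \<equiv> \<rho> * (unit_vol TYPE('d) * r ^ CARD('d))"
  defines "\<beta> \<equiv> \<rho> * PL k A" and "D \<equiv> 17 ^ CARD('d) :: nat"
  defines "ok s \<equiv> mgf_ok s \<eta> k D (\<epsilon> ^ CARD('d)) ((\<epsilon> / 4) ^ CARD('d)) A (\<tau> * A)"
  assumes M: "prob_space M" and iid: "iid_uniform M X" and n1: "1 \<le> n"
    and r: "0 < r" "r \<le> 1 / 10" and \<epsilon>: "0 < \<epsilon>" "\<epsilon> \<le> 1" and \<tau>: "0 < \<tau>" "\<tau> \<le> 1"
    and \<rho>: "0 < \<rho>" and e: "0 < e" "e \<le> 1" and n: "real n = \<rho> * (1 + e)"
    and \<theta>: "0 < \<theta>" "\<theta> < 1" and \<eta>: "0 < \<eta>" "8 \<le> \<eta> * \<beta>"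
    and ok: "ok (t / \<theta>)" "ok (\<theta> * t)" "ok (2 * (\<theta> * t))"
    and w: "w = 2 * e * (\<bar>t\<bar> / (1 - \<theta>) * exp (\<bar>t\<bar> / (1 - \<theta>) * (1 + real D * real k)))"
      "w * (2 * A) * (1 + real k) \<le> 1" "exp 1 ^ (4 * D) * (exp 1 * (w * (1 + 2 * A))) \<le> \<eta>"
    and conc: "2 * exp (- (\<rho> * e\<^sup>2 / 4)) \<le> exp (- (2 * \<bar>exp (\<theta> * t) - 1\<bar> + \<bar>exp (2 * (\<theta> * t)) - 1\<bar> + 4 * \<eta>) * \<beta>)"
  shows "integrable M (\<lambda>\<omega>. exp (t * T_stat k r (binomial_process X n \<omega>)))"
    "exp ((exp (\<theta> * t) - 1 - 3 * \<eta>) / \<theta> * \<beta>) \<le> (\<integral>\<omega>. exp (t * T_stat k r (binomial_process X n \<omega>)) \<partial>M)"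
    "(\<integral>\<omega>. exp (t * T_stat k r (binomial_process X n \<omega>)) \<partial>M) \<le> exp ((\<theta> * (exp (t / \<theta>) - 1) + 3 * \<eta>) * \<beta>)"
proof -
  obtain lab :: "nat \<Rightarrow> real ^ 'd \<Rightarrow> nat \<times> nat" and net \<delta> where
    lab: "\<And>m. torus_labels (lab m) r (\<delta> m) (net m) \<epsilon> \<tau>" and \<delta>: "\<delta> \<longlonglongrightarrow> 0"
    using labels_sequence[OF r \<epsilon> \<tau>, where 'd='d] by auto
  note fc = torus_labels.iid_uniform_facts[OF lab M iid]
  define Z where "Z m = (\<integral>\<omega>. exp (t * real (fine_labels.TT (lab m) r k (\<lambda>q. num_points (binomial_process X n \<omega>) (fine_labels.cell (lab m) q)))) \<partial>M)" for m
  have "AE \<omega> in M. \<forall>i\<in>{1..n}. X i \<omega> \<in> unit_cube" by (intro AE_finite_allI fc(3)) auto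
  then have N: "AE \<omega> in M. set_mset (binomial_process X n \<omega>) \<subseteq> unit_cube"
    by eventually_elim (auto simp: binomial_process_def)
  note el = expectation_limit[OF M lab \<delta> N binomial_count_measurable[OF fc(1)] T_stat_binomial_measurable[OF fc(1)]]
  show "integrable M (\<lambda>\<omega>. exp (t * T_stat k r (binomial_process X n \<omega>)))" by (rule el(1))
  have Zb: "exp ((exp (\<theta> * t) - 1 - 3 * \<eta>) / \<theta> * \<beta>) \<le> Z m" "Z m \<le> exp ((\<theta> * (exp (t / \<theta>) - 1) + 3 * \<eta>) * \<beta>)" for m
  proof -
    interpret torus_labels "lab m" r "\<delta> m" "net m" \<epsilon> \<tau> by (rule lab)
    have "Z m = cs.gc k n t" unfolding Z_def by (intro binomial_mgf_cells M iid n1)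
    then show "exp ((exp (\<theta> * t) - 1 - 3 * \<eta>) / \<theta> * \<beta>) \<le> Z m" "Z m \<le> exp ((\<theta> * (exp (t / \<theta>) - 1) + 3 * \<eta>) * \<beta>)"
      using cs.gc_estimate[OF \<rho> e n \<theta> \<eta>(1) \<eta>(2)[unfolded \<beta>_def A_def]
          ok[unfolded ok_def A_def D_def] w[unfolded A_def D_def] conc[unfolded \<beta>_def A_def]]
      by (simp_all add: \<beta>_def A_def)
  qed
  have Zl: "Z \<longlonglongrightarrow> (\<integral>\<omega>. exp (t * T_stat k r (binomial_process X n \<omega>)) \<partial>M)" unfolding Z_def[abs_def] by (rule el(2))
  show "exp ((exp (\<theta> * t) - 1 - 3 * \<eta>) / \<theta> * \<beta>) \<le> (\<integral>\<omega>. exp (t * T_stat k r (binomial_process X n \<omega>)) \<partial>M)"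
    by (rule LIMSEQ_le_const[OF Zl]) (use Zb in auto)
  show "(\<integral>\<omega>. exp (t * T_stat k r (binomial_process X n \<omega>)) \<partial>M) \<le> exp ((\<theta> * (exp (t / \<theta>) - 1) + 3 * \<eta>) * \<beta>)"
    by (rule LIMSEQ_le_const2[OF Zl]) (use Zb in auto)
qed

section \<open>Asymptotics at the critical radius\<close>

lemma log_limit:
  fixes m b \<beta> :: "nat \<Rightarrow> real" and \<alpha> c :: real
  assumes b: "filterlim b at_top sequentially" and q: "(\<lambda>n. \<beta> n / b n) \<longlonglongrightarrow> \<alpha>" and \<alpha>: "0 < \<alpha>"
    and bounds: "\<And>\<eta>. 0 < \<eta> \<Longrightarrow> \<forall>\<^sub>F n in sequentially. exp ((c - \<eta>) * \<beta> n) \<le> m n \<and> m n \<le> exp ((c + \<eta>) * \<beta> n)"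
  shows "(\<lambda>n. ln (m n) / b n) \<longlonglongrightarrow> \<alpha> * c"
proof (rule tendstoI)
  fix e :: real assume e: "0 < e"
  define \<eta> where "\<eta> = e / (2 * (\<alpha> + 1))"
  have \<eta>: "0 < \<eta>" "\<eta> * (\<alpha> + 1) = e / 2" using e \<alpha> by (auto simp: \<eta>_def field_simps)
  have "(\<lambda>n. \<beta> n / b n * c) \<longlonglongrightarrow> \<alpha> * c" by (intro tendsto_mult q tendsto_const)
  then have "\<forall>\<^sub>F n in sequentially. dist (\<beta> n / b n * c) (\<alpha> * c) < e / 2" using e by (intro tendstoD) auto
  moreover have "\<forall>\<^sub>F n in sequentially. \<beta> n / b n < \<alpha> + 1" using q by (rule order_tendstoD) simp
  moreover have "\<forall>\<^sub>F n in sequentially. 0 < b n" using b by (simp add: filterlim_at_top_dense)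
  ultimately show "\<forall>\<^sub>F n in sequentially. dist (ln (m n) / b n) (\<alpha> * c) < e"
    using bounds[OF \<eta>(1)]
  proof eventually_elim
    case (elim n)
    have mp: "0 < m n" using elim(4) exp_gt_zero[of "(c - \<eta>) * \<beta> n"] by linarith
    have u: "ln (m n) \<le> (c + \<eta>) * \<beta> n" using elim(4) mp by (metis exp_gt_zero ln_exp ln_le_cancel_iff)
    have l: "(c - \<eta>) * \<beta> n \<le> ln (m n)" using elim(4) mp by (metis exp_gt_zero ln_exp ln_le_cancel_iff)
    have "ln (m n) / b n \<le> (c + \<eta>) * \<beta> n / b n" using u elim(3) by (intro divide_right_mono) auto
    then have u2: "ln (m n) / b n - \<beta> n / b n * c \<le> \<eta> * (\<beta> n / b n)" by (simp add: algebra_simps add_divide_distrib)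
    have "(c - \<eta>) * \<beta> n / b n \<le> ln (m n) / b n" using l elim(3) by (intro divide_right_mono) auto
    then have l2: "\<beta> n / b n * c - ln (m n) / b n \<le> \<eta> * (\<beta> n / b n)" by (simp add: algebra_simps diff_divide_distrib)
    have "\<eta> * (\<beta> n / b n) \<le> \<eta> * (\<alpha> + 1)" using elim(2) \<eta> by (intro mult_left_mono) auto
    then have q2: "\<eta> * (\<beta> n / b n) \<le> e / 2" using \<eta>(2) by simp
    have "ln (m n) / b n - \<beta> n / b n * c \<le> e / 2" "\<beta> n / b n * c - ln (m n) / b n \<le> e / 2"
      using order_trans[OF u2 q2] order_trans[OF l2 q2] .
    moreover have "\<bar>\<beta> n / b n * c - \<alpha> * c\<bar> < e / 2" using elim(1) by (simp add: dist_real_def)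
    ultimately have "\<bar>ln (m n) / b n - \<alpha> * c\<bar> < e"
      unfolding abs_less_iff abs_le_iff minus_diff_eq by linarith
    then show ?case by (simp add: dist_real_def)
  qed
qed

text \<open>
  After division by \<open>a n ^ (k - 1)\<close> only the leading term \<open>i = k - 1\<close> of the polynomial in
  \<open>PL k (A n)\<close> survives, and \<open>exp (a n - A n)\<close> tends to \<open>exp (- s)\<close>.
\<close>

lemma ratio_limit:
  fixes a A \<rho> b :: "nat \<Rightarrow> real"
  assumes a: "filterlim a at_top sequentially" and As: "(\<lambda>n. A n - a n) \<longlonglongrightarrow> s"
    and \<rho>: "(\<lambda>n. \<rho> n / real n) \<longlonglongrightarrow> 1" and k: "1 \<le> k"
    and b: "\<And>n. b n = real n * a n ^ (k - 1) * exp (- a n)"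
  shows "(\<lambda>n. \<rho> n * PL k (A n) / b n) \<longlonglongrightarrow> alpha k s"
proof -
  obtain j where j: "k = Suc j" using k by (cases k) auto
  have ai: "(\<lambda>n. 1 / a n) \<longlonglongrightarrow> 0"
    using tendsto_inverse_0_at_top[OF a] by (simp add: inverse_eq_divide)
  have ap: "\<forall>\<^sub>F n in sequentially. 0 < a n" using a by (simp add: filterlim_at_top_dense)
  have "(\<lambda>n. 1 + (A n - a n) * (1 / a n)) \<longlonglongrightarrow> 1 + s * 0" by (intro tendsto_intros As ai)
  moreover have "\<forall>\<^sub>F n in sequentially. 1 + (A n - a n) * (1 / a n) = A n / a n"
    using ap by eventually_elim (simp add: field_simps)
  ultimately have Aa: "(\<lambda>n. A n / a n) \<longlonglongrightarrow> 1"
    by (simp add: Lim_transform_eventually)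
  have "(\<lambda>n. \<rho> n / real n * exp (- (A n - a n)) * (\<Sum>i<k. (A n / a n) ^ i * (1 / a n) ^ (j - i) / fact i))
      \<longlonglongrightarrow> 1 * exp (- s) * (\<Sum>i<k. 1 ^ i * 0 ^ (j - i) / fact i)"
    by (intro tendsto_intros \<rho> As Aa ai) simp_all
  also have "(\<Sum>i<k. 1 ^ i * 0 ^ (j - i) / fact i :: real) = (\<Sum>i<k. if i = j then 1 / fact j else 0)"
    by (intro sum.cong) (auto simp: j)
  also have "\<dots> = 1 / fact j" by (simp add: j)
  finally have lim: "(\<lambda>n. \<rho> n / real n * exp (- (A n - a n)) * (\<Sum>i<k. (A n / a n) ^ i * (1 / a n) ^ (j - i) / fact i)) \<longlonglongrightarrow> alpha k s"
    by (simp add: alpha_def j)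
  show ?thesis
  proof (rule Lim_transform_eventually[OF lim])
    show "\<forall>\<^sub>F n in sequentially. \<rho> n / real n * exp (- (A n - a n)) * (\<Sum>i<k. (A n / a n) ^ i * (1 / a n) ^ (j - i) / fact i) = \<rho> n * PL k (A n) / b n"
      using ap eventually_gt_at_top[of 0]
    proof eventually_elim
      case (elim n)
      have "(\<Sum>i<k. (A n / a n) ^ i * (1 / a n) ^ (j - i) / fact i) = (\<Sum>i<k. A n ^ i / fact i) / a n ^ j"
        unfolding sum_divide_distrib
      proof (intro sum.cong refl)
        fix i assume "i \<in> {..<k}"
        then have "j = i + (j - i)" by (simp add: j)
        then have "a n ^ j = a n ^ i * a n ^ (j - i)" by (metis power_add)
        then show "(A n / a n) ^ i * (1 / a n) ^ (j - i) / fact i = A n ^ i / fact i / a n ^ j"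
          by (simp add: power_divide field_simps)
      qed
      then show ?case using elim by (simp add: PL_def b j exp_diff exp_minus field_simps)
    qed
  qed
qed

lemma PL_power_decay: "((\<lambda>A. A ^ j * PL k A) \<longlongrightarrow> 0) at_top"
proof -
  have "((\<lambda>A. \<Sum>i<k. A ^ (j + i) / exp A / fact i) \<longlongrightarrow> (\<Sum>i<k. 0 / fact i)) (at_top :: real filter)"
    by (intro tendsto_sum tendsto_divide tendsto_power_div_exp_0 tendsto_const) simp
  moreover have "(\<Sum>i<k. A ^ (j + i) / exp A / fact i) = A ^ j * PL k A" for A :: real
    unfolding PL_def sum_distrib_left by (intro sum.cong) (auto simp: power_add exp_minus field_simps)
  ultimately show ?thesis by simp
qed

text \<open>
  Young's inequality loses in both directions, and both losses vanish as its exponent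
  \<open>\<theta>\<close> tends to one.
\<close>

lemma split_exponent:
  fixes t e :: real
  assumes e: "0 < e"
  shows "\<exists>\<theta>>0. \<theta> < 1 \<and> \<bar>\<theta> * (exp (t / \<theta>) - 1) - (exp t - 1)\<bar> < e \<and> \<bar>(exp (\<theta> * t) - 1) / \<theta> - (exp t - 1)\<bar> < e"
proof -
  have "((\<lambda>\<theta>. \<theta> * (exp (t / \<theta>) - 1)) \<longlongrightarrow> 1 * (exp (t / 1) - 1)) (at_left (1::real))"
    by (intro tendsto_intros) auto
  then have 1: "\<forall>\<^sub>F \<theta> in at_left 1. dist (\<theta> * (exp (t / \<theta>) - 1)) (1 * (exp (t / 1) - 1)) < e"
    using e by (rule tendstoD)
  have "((\<lambda>\<theta>. (exp (\<theta> * t) - 1) / \<theta>) \<longlongrightarrow> (exp (1 * t) - 1) / 1) (at_left (1::real))"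
    by (intro tendsto_intros) auto
  then have 2: "\<forall>\<^sub>F \<theta> in at_left 1. dist ((exp (\<theta> * t) - 1) / \<theta>) ((exp (1 * t) - 1) / 1) < e"
    using e by (rule tendstoD)
  have 3: "\<forall>\<^sub>F \<theta> in at_left (1::real). \<theta> \<in> {0<..<1}" by (rule eventually_at_left_real) simp
  have "\<exists>\<theta>::real. (dist (\<theta> * (exp (t / \<theta>) - 1)) (1 * (exp (t / 1) - 1)) < e \<and> dist ((exp (\<theta> * t) - 1) / \<theta>) ((exp (1 * t) - 1) / 1) < e) \<and> \<theta> \<in> {0<..<1}"
    by (rule eventually_happens'[OF _ eventually_conj[OF eventually_conj[OF 1 2] 3]]) simp
  then show ?thesis by (auto simp: dist_real_def)
qed

locale critical_scaling =
  fixes k :: nat and s :: real and a b :: "nat \<Rightarrow> real"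
  assumes k1: "1 \<le> k"
    and a_top: "filterlim a at_top sequentially"
    and gap: "filterlim (\<lambda>n. a n - ln (real n) - (real k - 1) * ln (ln (real n))) at_bot sequentially"
    and b_eq: "\<And>n. b n = real n * a n ^ (k - 1) * exp (- a n)"
begin

lemma a_ge: "\<forall>\<^sub>F n in sequentially. C \<le> a n"
  using a_top by (simp add: filterlim_at_top)

lemma ln_nat_ge: "\<forall>\<^sub>F n in sequentially. C \<le> ln (real n)"
  using filterlim_compose[OF ln_at_top filterlim_real_sequentially] by (simp add: filterlim_at_top)

text \<open>
  If \<open>a n\<close> is at least \<open>ln n / 2\<close>, then \<open>ln (b n)\<close> is bounded below by minus the quantity in
  \<open>gap\<close>, up to an additive constant. If \<open>a n\<close> is smaller, already the factor \<open>real n * exp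
  (- a n)\<close> diverges.
\<close>

lemma b_at_top: "filterlim b at_top sequentially"
proof -
  have "filterlim (\<lambda>n. ln (b n)) at_top sequentially"
    unfolding filterlim_at_top
  proof
    fix Z :: real
    have "\<forall>\<^sub>F n in sequentially. a n - ln (real n) - (real k - 1) * ln (ln (real n)) \<le> - Z - (real k - 1) * ln 2"
      using gap by (simp add: filterlim_at_bot)
    then show "\<forall>\<^sub>F n in sequentially. Z \<le> ln (b n)"
      using a_ge[of 1] ln_nat_ge[of 1] ln_nat_ge[of "2 * Z"] eventually_gt_at_top[of 0]
    proof eventually_elim
      case (elim n)
      have lb: "ln (b n) = ln (real n) + (real k - 1) * ln (a n) - a n"
        using elim k1 by (simp add: b_eq ln_mult ln_realpow of_nat_diff)
      show ?case
      proof (cases "ln (real n) / 2 \<le> a n")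
        case True
        have "n \<noteq> Suc 0" using elim(3) by auto
        then have "ln (ln (real n)) - ln 2 = ln (ln (real n) / 2)" using elim by (simp add: ln_div)
        also have "\<dots> \<le> ln (a n)"
          by (rule iffD2[OF ln_le_cancel_iff _]) (use True elim(2,3) in linarith)+
        finally have "(real k - 1) * (ln (ln (real n)) - ln 2) \<le> (real k - 1) * ln (a n)"
          using k1 by (intro mult_left_mono) auto
        then show ?thesis using elim(1) unfolding lb by (simp only: right_diff_distrib)
      next
        case False
        have "0 \<le> (real k - 1) * ln (a n)" using k1 elim by simp
        then show ?thesis using False elim unfolding lb by linarith
      qed
    qed
  qed
  then have "filterlim (\<lambda>n. exp (ln (b n))) at_top sequentially" by (rule filterlim_compose[OF exp_at_top])
  moreover have "\<forall>\<^sub>F n in sequentially. exp (ln (b n)) = b n"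
    using a_ge[of 1] eventually_gt_at_top[of 0] by eventually_elim (simp add: b_eq)
  ultimately show ?thesis using filterlim_cong[OF refl refl, of "\<lambda>n. exp (ln (b n))" b] by simp
qed

lemma a_over_n: "(\<lambda>n. a n / real n) \<longlonglongrightarrow> 0"
proof (rule tendsto_sandwich[OF _ _ tendsto_const])
  show "\<forall>\<^sub>F n in sequentially. 0 \<le> a n / real n" using a_ge[of 0] by eventually_elim simp
  have "\<forall>\<^sub>F n in sequentially. a n - ln (real n) - (real k - 1) * ln (ln (real n)) \<le> 0"
    using gap unfolding filterlim_at_bot by blast
  then show "\<forall>\<^sub>F n in sequentially. a n / real n \<le> (ln (real n) + (real k - 1) * ln (ln (real n))) / real n"
    by eventually_elim (intro divide_right_mono, auto)
  have 1: "(\<lambda>n. ln (real n) / real n) \<longlonglongrightarrow> 0" by real_asymp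
  have 2: "(\<lambda>n. ln (ln (real n)) / real n) \<longlonglongrightarrow> 0" by real_asymp
  have "(\<lambda>n. ln (real n) / real n + (real k - 1) * (ln (ln (real n)) / real n)) \<longlonglongrightarrow> 0 + (real k - 1) * 0"
    by (intro tendsto_intros 1 2)
  then show "(\<lambda>n. (ln (real n) + (real k - 1) * ln (ln (real n))) / real n) \<longlonglongrightarrow> 0"
    by (simp add: add_divide_distrib)
qed

lemma A_top: "filterlim (\<lambda>n. a n + s) at_top sequentially"
  using filterlim_tendsto_add_at_top[OF tendsto_const[of s] a_top] by (simp add: add.commute)

lemma crit_radius_eventually:
  "\<forall>\<^sub>F n in sequentially. 0 < a n + s \<and> 0 < crit_radius TYPE('d::finite) a s n \<and> crit_radius TYPE('d) a s n \<le> 1 / 10 \<and>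
     real n * (unit_vol TYPE('d) * crit_radius TYPE('d) a s n ^ CARD('d)) = a n + s"
proof -
  have "(\<lambda>n. (a n / real n + s * (1 / real n)) / unit_vol TYPE('d)) \<longlonglongrightarrow> (0 + s * 0) / unit_vol TYPE('d)"
    using unit_vol_pos[where 'd='d] by (intro tendsto_intros a_over_n lim_1_over_n) auto
  then have "(\<lambda>n. (a n / real n + s * (1 / real n)) / unit_vol TYPE('d)) \<longlonglongrightarrow> 0" by simp
  then have "\<forall>\<^sub>F n in sequentially. (a n / real n + s * (1 / real n)) / unit_vol TYPE('d) < (1 / 10) ^ CARD('d)"
    by (rule order_tendstoD) simp
  then show ?thesis using a_ge[of "1 - s"] eventually_gt_at_top[of 0]
  proof eventually_elim
    case (elim n)
    let ?r = "crit_radius TYPE('d) a s n"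
    have A: "0 < a n + s" using elim by linarith
    have v: "0 < unit_vol TYPE('d)" by (rule unit_vol_pos)
    have q: "0 < (a n + s) / (real n * unit_vol TYPE('d))" using A v elim by simp
    have r: "?r = ((a n + s) / (real n * unit_vol TYPE('d))) powr (1 / real CARD('d))"
      by (simp add: crit_radius_def unit_vol_def)
    have rp: "0 < ?r" unfolding r using A v elim(3) by simp
    have rd: "?r ^ CARD('d) = (a n + s) / (real n * unit_vol TYPE('d))"
      unfolding r using A v elim(3) by (simp add: powr_power)
    have "?r ^ CARD('d) < (1 / 10) ^ CARD('d)" using elim(1) unfolding rd by (simp add: add_divide_distrib)
    then have "?r < 1 / 10" by (rule power_less_imp_less_base) simp
    then show ?case using A rp rd v elim by simp
  qed
qed

end

section \<open>The large deviation principles\<close>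

context critical_scaling
begin

text \<open>
  The parameters \<open>\<epsilon>\<close> and \<open>\<tau>\<close> of the partitions are free, and
  \<open>mgf_ok_eventually\<close> tells how small they have to be for a given relative error \<open>\<eta>\<close>.
\<close>

lemma poisson_log_mgf:
  fixes M :: "'w measure" and P :: "nat \<Rightarrow> 'w \<Rightarrow> (real ^ 'd) multiset" and t :: real
  assumes M: "prob_space M" and pp: "\<And>n. 1 \<le> n \<Longrightarrow> poisson_process M (real n) (P n)"
  defines "T \<equiv> \<lambda>n \<omega>. T_stat k (crit_radius TYPE('d) a s n) (P n \<omega>)"
  shows "\<forall>\<^sub>F n in sequentially. integrable M (\<lambda>\<omega>. exp (t * T n \<omega>))"
    "(\<lambda>n. ln (\<integral>\<omega>. exp (t * T n \<omega>) \<partial>M) / b n) \<longlonglongrightarrow> alpha k s * (exp t - 1)"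
proof -
  have main: "\<forall>\<^sub>F n in sequentially. integrable M (\<lambda>\<omega>. exp (t * T n \<omega>)) \<and>
      exp ((exp t - 1 - \<eta>) * (real n * PL k (a n + s))) \<le> (\<integral>\<omega>. exp (t * T n \<omega>) \<partial>M) \<and>
      (\<integral>\<omega>. exp (t * T n \<omega>) \<partial>M) \<le> exp ((exp t - 1 + \<eta>) * (real n * PL k (a n + s)))" if \<eta>: "0 < \<eta>" for \<eta>
  proof -
    obtain \<xi> where \<xi>: "0 < \<xi>" and ok: "\<And>\<gamma>. 0 < \<gamma> \<Longrightarrow> \<forall>\<^sub>F A in at_top. \<forall>\<sigma> s. 0 \<le> \<sigma> \<and> \<sigma> \<le> \<xi> \<and> 0 \<le> s \<and> s \<le> \<xi> \<longrightarrow>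
        mgf_ok t \<eta> k (17 ^ CARD('d)) \<sigma> \<gamma> A s"
      using mgf_ok_eventually[OF \<eta>, of t k "17 ^ CARD('d)"] by blast
    define \<epsilon> where "\<epsilon> = min 1 \<xi>"
    have \<epsilon>: "0 < \<epsilon>" "\<epsilon> \<le> 1" "\<epsilon> \<le> \<xi>" using \<xi> by (auto simp: \<epsilon>_def)
    have "\<epsilon> ^ CARD('d) \<le> \<epsilon> ^ 1" using \<epsilon> by (intro power_decreasing) (auto simp: Suc_le_eq)
    then have \<sigma>: "0 \<le> \<epsilon> ^ CARD('d)" "\<epsilon> ^ CARD('d) \<le> \<xi>" using \<epsilon> by auto
    have "\<forall>\<^sub>F n in sequentially. \<forall>\<sigma> s'. 0 \<le> \<sigma> \<and> \<sigma> \<le> \<xi> \<and> 0 \<le> s' \<and> s' \<le> \<xi> \<longrightarrow>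
        mgf_ok t \<eta> k (17 ^ CARD('d)) \<sigma> ((\<epsilon> / 4) ^ CARD('d)) (a n + s) s'"
      using \<epsilon> by (intro eventually_compose_filterlim[OF ok A_top]) auto
    then show ?thesis using crit_radius_eventually[where 'd='d] eventually_ge_at_top[of 1]
    proof eventually_elim
      case (elim n)
      let ?r = "crit_radius TYPE('d) a s n" and ?A = "a n + s"
      have A: "0 < ?A" and r: "0 < ?r" "?r \<le> 1 / 10" and V: "real n * (unit_vol TYPE('d) * ?r ^ CARD('d)) = ?A"
        using elim(2) by auto
      define \<tau> where "\<tau> = min 1 (\<xi> / ?A)"
      have \<tau>: "0 < \<tau>" "\<tau> \<le> 1" using \<xi> A by (auto simp: \<tau>_def)
      have "\<tau> * ?A \<le> \<xi> / ?A * ?A" using A by (intro mult_right_mono) (auto simp: \<tau>_def)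
      then have \<tau>A: "0 \<le> \<tau> * ?A" "\<tau> * ?A \<le> \<xi>" using A \<tau> by auto
      have ok': "mgf_ok t \<eta> k (17 ^ CARD('d)) (\<epsilon> ^ CARD('d)) ((\<epsilon> / 4) ^ CARD('d)) (real n * (unit_vol TYPE('d) * ?r ^ CARD('d)))
          (\<tau> * (real n * (unit_vol TYPE('d) * ?r ^ CARD('d))))"
        unfolding V using elim(1) \<sigma> \<tau>A by blast
      have n: "0 < real n" using elim(3) by simp
      show ?case using poisson_bounds[OF M pp[OF elim(3)] n r \<epsilon>(1,2) \<tau> ok'] unfolding T_def V by blast
    qed
  qed
  show "\<forall>\<^sub>F n in sequentially. integrable M (\<lambda>\<omega>. exp (t * T n \<omega>))"
    by (rule eventually_mono[OF main[OF zero_less_one]]) blast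
  have one: "(\<lambda>n. real n / real n) \<longlonglongrightarrow> 1"
    by (rule tendsto_eventually) (use eventually_gt_at_top[of 0] in eventually_elim, auto)
  have "(\<lambda>n. a n + s - a n) \<longlonglongrightarrow> s" by simp
  note q = ratio_limit[OF a_top this one k1 b_eq]
  show "(\<lambda>n. ln (\<integral>\<omega>. exp (t * T n \<omega>) \<partial>M) / b n) \<longlonglongrightarrow> alpha k s * (exp t - 1)"
  proof (rule log_limit[OF b_at_top q])
    show "0 < alpha k s" by (simp add: alpha_def)
  next
    fix \<eta> :: real assume "0 < \<eta>"
    show "\<forall>\<^sub>F n in sequentially. exp ((exp t - 1 - \<eta>) * (real n * PL k (a n + s))) \<le> (\<integral>\<omega>. exp (t * T n \<omega>) \<partial>M) \<and>
      (\<integral>\<omega>. exp (t * T n \<omega>) \<partial>M) \<le> exp ((exp t - 1 + \<eta>) * (real n * PL k (a n + s)))"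
      by (rule eventually_mono[OF main[OF \<open>0 < \<eta>\<close>]]) blast
  qed
qed

text \<open>
  The binomial process is compared with a Poisson process of intensity \<open>\<rho> n\<close>, where
  \<open>real n = \<rho> n * (1 + e n)\<close>. The choice of \<open>e\<close> meets two demands. As \<open>e n * A n\<close> tends
  to zero, neither the additional points nor the change of intensity matter. On the other
  hand \<open>(e n)\<^sup>2\<close> exceeds every multiple of \<open>PL k (A n)\<close>, which decays faster than any
  power of \<open>A n\<close>; hence a Poisson number of points that deviates by the proportion \<open>e n\<close> is
  too unlikely to matter at the scale of the large deviations.
\<close>

lemma inflation_limits:
  defines "e \<equiv> \<lambda>n. 1 / (a n + s)\<^sup>2"
  defines "\<rho> \<equiv> \<lambda>n. real n / (1 + e n)" and "A \<equiv> \<lambda>n. (a n + s) / (1 + e n)"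
  shows "e \<longlonglongrightarrow> 0" "(\<lambda>n. e n * A n) \<longlonglongrightarrow> 0" "filterlim A at_top sequentially"
    "(\<lambda>n. \<rho> n * PL k (A n) / b n) \<longlonglongrightarrow> alpha k s"
    "filterlim (\<lambda>n. \<rho> n * PL k (A n)) at_top sequentially"
    "\<forall>\<^sub>F n in sequentially. C * (\<rho> n * PL k (A n)) + ln 2 \<le> \<rho> n * (e n)\<^sup>2 / 4"
proof -
  have Ai: "(\<lambda>n. 1 / (a n + s)) \<longlonglongrightarrow> 0"
    using tendsto_inverse_0_at_top[OF A_top] by (simp add: inverse_eq_divide)
  have "(\<lambda>n. (1 / (a n + s)) ^ 2) \<longlonglongrightarrow> 0 ^ 2" by (intro tendsto_intros Ai)
  then show e0: "e \<longlonglongrightarrow> 0" by (simp add: e_def power_divide)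
  have Ap: "\<forall>\<^sub>F n in sequentially. 1 \<le> a n + s" using a_ge[of "1 - s"] by eventually_elim simp
  have eA: "\<forall>\<^sub>F n in sequentially. e n * A n = 1 / (a n + s) / (1 + e n)"
    using Ap by eventually_elim (simp add: e_def A_def power2_eq_square)
  have "(\<lambda>n. 1 / (a n + s) / (1 + e n)) \<longlonglongrightarrow> 0 / (1 + 0)" by (intro tendsto_intros Ai e0) simp
  then show eA0: "(\<lambda>n. e n * A n) \<longlonglongrightarrow> 0" using eA by (simp add: tendsto_cong)
  have e_pos: "0 \<le> e n" for n by (simp add: e_def)
  have e_le: "\<forall>\<^sub>F n in sequentially. e n \<le> 1"
    using Ap by eventually_elim (simp add: e_def)
  have AA: "A n - a n = s - e n * A n" for n
  proof -
    have "A n * (1 + e n) = a n + s" using e_pos[of n] by (simp add: A_def)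
    then show ?thesis by (simp add: algebra_simps)
  qed
  have "(\<lambda>n. s - e n * A n) \<longlonglongrightarrow> s - 0" by (intro tendsto_intros eA0)
  then have As: "(\<lambda>n. A n - a n) \<longlonglongrightarrow> s" by (simp add: AA)
  have "filterlim (\<lambda>n. (A n - a n) + a n) at_top sequentially"
    by (rule filterlim_tendsto_add_at_top[OF As a_top])
  then show At: "filterlim A at_top sequentially" by simp
  have "(\<lambda>n. 1 / (1 + e n)) \<longlonglongrightarrow> 1 / (1 + 0)" by (intro tendsto_intros e0) simp
  moreover have "\<forall>\<^sub>F n in sequentially. 1 / (1 + e n) = \<rho> n / real n"
    using eventually_gt_at_top[of 0] by eventually_elim (simp add: \<rho>_def)
  ultimately have \<rho>1: "(\<lambda>n. \<rho> n / real n) \<longlonglongrightarrow> 1" by (simp add: Lim_transform_eventually)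
  show q: "(\<lambda>n. \<rho> n * PL k (A n) / b n) \<longlonglongrightarrow> alpha k s" by (rule ratio_limit[OF a_top As \<rho>1 k1 b_eq])
  have al: "0 < alpha k s" by (simp add: alpha_def)
  have bp: "\<forall>\<^sub>F n in sequentially. 0 < b n" using b_at_top by (simp add: filterlim_at_top_dense)
  have f1: "filterlim (\<lambda>n. \<rho> n * PL k (A n) / b n * b n) at_top sequentially"
    by (rule filterlim_tendsto_pos_mult_at_top[OF q al b_at_top])
  have f2: "\<forall>\<^sub>F n in sequentially. \<rho> n * PL k (A n) / b n * b n = \<rho> n * PL k (A n)"
    using bp by eventually_elim simp
  show \<beta>_top: "filterlim (\<lambda>n. \<rho> n * PL k (A n)) at_top sequentially"
    by (rule iffD1[OF filterlim_cong[OF refl refl f2] f1])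
  then have "\<forall>\<^sub>F n in sequentially. 1 \<le> \<rho> n * PL k (A n)" unfolding filterlim_at_top by blast
  moreover have "(\<lambda>n. 64 * (C + 1) * (A n ^ 4 * PL k (A n))) \<longlonglongrightarrow> 64 * (C + 1) * 0"
    by (intro tendsto_mult tendsto_const filterlim_compose[OF PL_power_decay At])
  then have "\<forall>\<^sub>F n in sequentially. 64 * (C + 1) * (A n ^ 4 * PL k (A n)) < 1" by (intro order_tendstoD) auto
  ultimately show "\<forall>\<^sub>F n in sequentially. C * (\<rho> n * PL k (A n)) + ln 2 \<le> \<rho> n * (e n)\<^sup>2 / 4"
    using Ap e_le
  proof eventually_elim
    case (elim n)
    let ?x = "a n + s"
    have \<beta>1: "1 \<le> \<rho> n * PL k (A n)" by (rule elim(1))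
    have ln2: "ln 2 \<le> (1 :: real)" using ln_le_minus_one[of 2] by simp
    have \<rho>0: "0 \<le> \<rho> n" using e_pos[of n] by (simp add: \<rho>_def)
    have "?x / 2 \<le> A n" unfolding A_def using elim e_pos[of n] by (intro divide_left_mono) auto
    \<comment> \<open>With \<open>e n = 1 / ?x\<^sup>2\<close> the square \<open>(e n)\<^sup>2\<close> is the fourth power of \<open>1 / ?x\<close>, which is comparable to \<open>1 / A n\<close>.\<close>
    then have x4: "?x ^ 4 \<le> 16 * A n ^ 4"
      using power_mono[of "?x / 2" "A n" 4] elim by (simp add: power_divide)
    have x0: "0 < ?x ^ 4" using elim by simp
    have e2: "(e n)\<^sup>2 * ?x ^ 4 = 1" using elim by (simp add: e_def power_divide flip: power_mult)
    have "(C + 1) * PL k (A n) \<le> (e n)\<^sup>2 / 4"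
    proof (cases "0 \<le> C + 1")
      case True
      have "?x ^ 4 * ((C + 1) * PL k (A n)) \<le> 16 * A n ^ 4 * ((C + 1) * PL k (A n))"
        using x4 True elim \<open>?x / 2 \<le> A n\<close> by (intro mult_right_mono mult_nonneg_nonneg PL_nonneg) auto
      also have "\<dots> = (64 * (C + 1) * (A n ^ 4 * PL k (A n))) / 4" by simp
      also have "\<dots> \<le> 1 / 4" using elim by (intro divide_right_mono) auto
      also have "\<dots> = ?x ^ 4 * ((e n)\<^sup>2 / 4)" using e2 by (simp add: mult.commute)
      finally show ?thesis using x0 by (simp add: mult_le_cancel_left)
    next
      case False
      have "0 \<le> PL k (A n)" using elim \<open>?x / 2 \<le> A n\<close> by (intro PL_nonneg) auto
      then have "(C + 1) * PL k (A n) \<le> 0" using False by (simp add: mult_nonpos_nonneg)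
      then show ?thesis by (rule order_trans) simp
    qed
    then have "\<rho> n * ((C + 1) * PL k (A n)) \<le> \<rho> n * ((e n)\<^sup>2 / 4)" using \<rho>0 by (rule mult_left_mono)
    then have "(C + 1) * (\<rho> n * PL k (A n)) \<le> \<rho> n * (e n)\<^sup>2 / 4" by (simp add: mult.left_commute)
    then show ?case using \<beta>1 ln2 by (simp add: distrib_right)
  qed
qed

text \<open>
  The exponent \<open>\<theta>\<close> is fixed first, according to the admissible relative error
  \<open>\<zeta>\<close>. This determines the three arguments at which the Poisson moments are needed,
  and then the parameters of the partitions.
\<close>

lemma binomial_log_mgf:
  fixes M :: "'w measure" and X :: "nat \<Rightarrow> 'w \<Rightarrow> real ^ 'd" and t :: real
  assumes M: "prob_space M" and iid: "iid_uniform M X"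
  defines "T \<equiv> \<lambda>n \<omega>. T_stat k (crit_radius TYPE('d) a s n) (binomial_process X n \<omega>)"
  shows "\<forall>\<^sub>F n in sequentially. integrable M (\<lambda>\<omega>. exp (t * T n \<omega>))"
    "(\<lambda>n. ln (\<integral>\<omega>. exp (t * T n \<omega>) \<partial>M) / b n) \<longlonglongrightarrow> alpha k s * (exp t - 1)"
proof -
  define e where "e n = 1 / (a n + s)\<^sup>2" for n
  define \<rho> where "\<rho> n = real n / (1 + e n)" for n
  define A where "A n = (a n + s) / (1 + e n)" for n
  let ?D = "17 ^ CARD('d) :: nat"
  note il = inflation_limits[folded e_def, folded \<rho>_def A_def]
  have main: "\<forall>\<^sub>F n in sequentially. integrable M (\<lambda>\<omega>. exp (t * T n \<omega>)) \<and>
      exp ((exp t - 1 - \<zeta>) * (\<rho> n * PL k (A n))) \<le> (\<integral>\<omega>. exp (t * T n \<omega>) \<partial>M) \<and>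
      (\<integral>\<omega>. exp (t * T n \<omega>) \<partial>M) \<le> exp ((exp t - 1 + \<zeta>) * (\<rho> n * PL k (A n)))" if \<zeta>: "0 < \<zeta>" for \<zeta>
  proof -
    obtain \<theta> where \<theta>: "0 < \<theta>" "\<theta> < 1" and \<theta>1: "\<bar>\<theta> * (exp (t / \<theta>) - 1) - (exp t - 1)\<bar> < \<zeta> / 2"
      and \<theta>2: "\<bar>(exp (\<theta> * t) - 1) / \<theta> - (exp t - 1)\<bar> < \<zeta> / 2"
      using split_exponent[of "\<zeta> / 2" t] \<zeta> by auto
    define \<eta> where "\<eta> = \<zeta> * \<theta> / 6"
    have \<eta>: "0 < \<eta>" using \<zeta> \<theta> by (simp add: \<eta>_def)
    have "\<zeta> * \<theta> \<le> \<zeta> * 1" using \<zeta> \<theta> by (intro mult_left_mono) auto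
    then have \<eta>3: "3 * \<eta> \<le> \<zeta> / 2" "3 * \<eta> / \<theta> = \<zeta> / 2" using \<theta> by (auto simp: \<eta>_def mult.commute)
    have up: "\<theta> * (exp (t / \<theta>) - 1) + 3 * \<eta> \<le> exp t - 1 + \<zeta>" using \<theta>1 \<eta>3 unfolding abs_less_iff by linarith
    have lo: "exp t - 1 - \<zeta> \<le> (exp (\<theta> * t) - 1 - 3 * \<eta>) / \<theta>"
      using \<theta>2 \<eta>3 unfolding diff_divide_distrib abs_less_iff by linarith
    have ex: "\<exists>\<xi>>0. \<forall>\<gamma>>0. \<forall>\<^sub>F n in sequentially. \<forall>\<sigma> s'. 0 \<le> \<sigma> \<and> \<sigma> \<le> \<xi> \<and> 0 \<le> s' \<and> s' \<le> \<xi> \<longrightarrow>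
        mgf_ok u \<eta> k ?D \<sigma> \<gamma> (A n) s'" for u
    proof -
      obtain \<xi> where \<xi>: "0 < \<xi>" and ok: "\<And>\<gamma>. 0 < \<gamma> \<Longrightarrow> \<forall>\<^sub>F A in at_top. \<forall>\<sigma> s. 0 \<le> \<sigma> \<and> \<sigma> \<le> \<xi> \<and> 0 \<le> s \<and> s \<le> \<xi> \<longrightarrow>
          mgf_ok u \<eta> k ?D \<sigma> \<gamma> A s"
        using mgf_ok_eventually[OF \<eta>, of u k ?D] by blast
      show ?thesis
      proof (intro exI[of _ \<xi>] conjI \<xi> allI impI)
        fix \<gamma> :: real assume "0 < \<gamma>"
        show "\<forall>\<^sub>F n in sequentially. \<forall>\<sigma> s'. 0 \<le> \<sigma> \<and> \<sigma> \<le> \<xi> \<and> 0 \<le> s' \<and> s' \<le> \<xi> \<longrightarrow>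
            mgf_ok u \<eta> k ?D \<sigma> \<gamma> (A n) s'"
          by (rule eventually_compose_filterlim[OF ok[OF \<open>0 < \<gamma>\<close>] il(3)])
      qed
    qed
    obtain \<xi>1 where \<xi>1: "0 < \<xi>1" and ok1: "\<And>\<gamma>. 0 < \<gamma> \<Longrightarrow> \<forall>\<^sub>F n in sequentially. \<forall>\<sigma> s'. 0 \<le> \<sigma> \<and> \<sigma> \<le> \<xi>1 \<and> 0 \<le> s' \<and> s' \<le> \<xi>1 \<longrightarrow>
        mgf_ok (t / \<theta>) \<eta> k ?D \<sigma> \<gamma> (A n) s'" using ex[of "t / \<theta>"] by blast
    obtain \<xi>2 where \<xi>2: "0 < \<xi>2" and ok2: "\<And>\<gamma>. 0 < \<gamma> \<Longrightarrow> \<forall>\<^sub>F n in sequentially. \<forall>\<sigma> s'. 0 \<le> \<sigma> \<and> \<sigma> \<le> \<xi>2 \<and> 0 \<le> s' \<and> s' \<le> \<xi>2 \<longrightarrow>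
        mgf_ok (\<theta> * t) \<eta> k ?D \<sigma> \<gamma> (A n) s'" using ex[of "\<theta> * t"] by blast
    obtain \<xi>3 where \<xi>3: "0 < \<xi>3" and ok3: "\<And>\<gamma>. 0 < \<gamma> \<Longrightarrow> \<forall>\<^sub>F n in sequentially. \<forall>\<sigma> s'. 0 \<le> \<sigma> \<and> \<sigma> \<le> \<xi>3 \<and> 0 \<le> s' \<and> s' \<le> \<xi>3 \<longrightarrow>
        mgf_ok (2 * (\<theta> * t)) \<eta> k ?D \<sigma> \<gamma> (A n) s'" using ex[of "2 * (\<theta> * t)"] by blast
    define \<xi> where "\<xi> = min \<xi>1 (min \<xi>2 \<xi>3)"
    have \<xi>: "0 < \<xi>" "\<xi> \<le> \<xi>1" "\<xi> \<le> \<xi>2" "\<xi> \<le> \<xi>3" using \<xi>1 \<xi>2 \<xi>3 by (auto simp: \<xi>_def)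
    define \<epsilon> where "\<epsilon> = min 1 \<xi>"
    have \<epsilon>: "0 < \<epsilon>" "\<epsilon> \<le> 1" "\<epsilon> \<le> \<xi>" using \<xi> by (auto simp: \<epsilon>_def)
    have "\<epsilon> ^ CARD('d) \<le> \<epsilon> ^ 1" using \<epsilon> by (intro power_decreasing) (auto simp: Suc_le_eq)
    then have \<sigma>: "0 \<le> \<epsilon> ^ CARD('d)" "\<epsilon> ^ CARD('d) \<le> \<xi>" using \<epsilon> by auto
    define \<gamma> where "\<gamma> = (\<epsilon> / 4) ^ CARD('d)"
    have \<gamma>: "0 < \<gamma>" using \<epsilon> by (simp add: \<gamma>_def)
    define W where "W = \<bar>t\<bar> / (1 - \<theta>) * exp (\<bar>t\<bar> / (1 - \<theta>) * (1 + real ?D * real k))"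
    define w where "w n = 2 * e n * W" for n
    define C where "C = 2 * \<bar>exp (\<theta> * t) - 1\<bar> + \<bar>exp (2 * (\<theta> * t)) - 1\<bar> + 4 * \<eta>"
    have "(\<lambda>n. 4 * W * (1 + real k) * (e n * A n)) \<longlonglongrightarrow> 4 * W * (1 + real k) * 0" by (intro tendsto_intros il)
    then have "\<forall>\<^sub>F n in sequentially. 4 * W * (1 + real k) * (e n * A n) < 1" by (rule order_tendstoD) simp
    then have w1: "\<forall>\<^sub>F n in sequentially. w n * (2 * A n) * (1 + real k) \<le> 1"
      by eventually_elim (simp add: w_def algebra_simps)
    have "(\<lambda>n. exp 1 ^ (4 * ?D) * (exp 1 * (2 * W * (e n + 2 * (e n * A n))))) \<longlonglongrightarrow> exp 1 ^ (4 * ?D) * (exp 1 * (2 * W * (0 + 2 * 0)))"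
      by (intro tendsto_mult tendsto_add tendsto_const il)
    then have "\<forall>\<^sub>F n in sequentially. exp 1 ^ (4 * ?D) * (exp 1 * (2 * W * (e n + 2 * (e n * A n)))) < \<eta>"
      by (rule order_tendstoD) (use \<eta> in simp)
    moreover have "2 * W * (e n + 2 * (e n * A n)) = w n * (1 + 2 * A n)" for n by (simp add: w_def algebra_simps)
    ultimately have w2: "\<forall>\<^sub>F n in sequentially. exp 1 ^ (4 * ?D) * (exp 1 * (w n * (1 + 2 * A n))) < \<eta>" by simp
    have b8: "\<forall>\<^sub>F n in sequentially. 8 / \<eta> \<le> \<rho> n * PL k (A n)" using il(5) unfolding filterlim_at_top by blast
    have e1: "\<forall>\<^sub>F n in sequentially. e n < 1" using il(1) by (rule order_tendstoD) simp
    show ?thesis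
      using ok1[OF \<gamma>] ok2[OF \<gamma>] ok3[OF \<gamma>] w1 w2 b8 e1 il(6)[of C] crit_radius_eventually[where 'd='d] eventually_ge_at_top[of 1]
    proof eventually_elim
      case (elim n)
      let ?r = "crit_radius TYPE('d) a s n"
      have A0: "0 < a n + s" and r: "0 < ?r" "?r \<le> 1 / 10" and V: "real n * (unit_vol TYPE('d) * ?r ^ CARD('d)) = a n + s"
        using elim(9) by auto
      have e: "0 < e n" "e n \<le> 1" using A0 elim(7) by (auto simp: e_def)
      have \<rho>: "0 < \<rho> n" "real n = \<rho> n * (1 + e n)" using e elim(10) by (auto simp: \<rho>_def)
      have VA: "\<rho> n * (unit_vol TYPE('d) * ?r ^ CARD('d)) = A n" by (simp add: \<rho>_def A_def flip: V)
      have Ap: "0 < A n" using A0 e by (simp add: A_def)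
      define \<tau> where "\<tau> = min 1 (\<xi> / A n)"
      have \<tau>: "0 < \<tau>" "\<tau> \<le> 1" using \<xi> Ap by (auto simp: \<tau>_def)
      have "\<tau> * A n \<le> \<xi> / A n * A n" using Ap by (intro mult_right_mono) (auto simp: \<tau>_def)
      then have \<tau>A: "0 \<le> \<tau> * A n" "\<tau> * A n \<le> \<xi>" using Ap \<tau> by auto
      have ok: "mgf_ok (t / \<theta>) \<eta> k ?D (\<epsilon> ^ CARD('d)) \<gamma> (A n) (\<tau> * A n)"
          "mgf_ok (\<theta> * t) \<eta> k ?D (\<epsilon> ^ CARD('d)) \<gamma> (A n) (\<tau> * A n)"
          "mgf_ok (2 * (\<theta> * t)) \<eta> k ?D (\<epsilon> ^ CARD('d)) \<gamma> (A n) (\<tau> * A n)"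
        using elim(1-3)[rule_format, OF conjI[OF \<sigma>(1) conjI[OF order_trans[OF \<sigma>(2)] conjI[OF \<tau>A(1) order_trans[OF \<tau>A(2)]]]]] \<xi> by auto
      have b8': "8 \<le> \<eta> * (\<rho> n * PL k (A n))" using elim(6) \<eta> by (simp add: field_simps)
      have "2 * exp (- x) = exp (ln 2 - x)" for x :: real by (simp add: exp_diff exp_minus divide_inverse)
      then have "2 * exp (- (\<rho> n * (e n)\<^sup>2 / 4)) = exp (ln 2 - \<rho> n * (e n)\<^sup>2 / 4)" .
      also have "\<dots> \<le> exp (- C * (\<rho> n * PL k (A n)))" using elim(8) by simp
      finally have conc: "2 * exp (- (\<rho> n * (e n)\<^sup>2 / 4)) \<le> exp (- C * (\<rho> n * PL k (A n)))" .
      note bb = binomial_bounds[OF M iid elim(10) r \<epsilon>(1,2) \<tau> \<rho>(1) e \<rho>(2) \<theta> \<eta>, where t=t and k=k and w="w n",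
          unfolded VA, folded \<gamma>_def, folded C_def W_def, OF b8' ok w_def elim(4) less_imp_le[OF elim(5)] conc]
      have \<beta>0: "0 \<le> \<rho> n * PL k (A n)" using \<rho> Ap by (intro mult_nonneg_nonneg PL_nonneg) auto
      have lo': "exp ((exp t - 1 - \<zeta>) * (\<rho> n * PL k (A n))) \<le> exp ((exp (\<theta> * t) - 1 - 3 * \<eta>) / \<theta> * (\<rho> n * PL k (A n)))"
        using mult_right_mono[OF lo \<beta>0] by (simp only: exp_le_cancel_iff)
      have up': "exp ((\<theta> * (exp (t / \<theta>) - 1) + 3 * \<eta>) * (\<rho> n * PL k (A n))) \<le> exp ((exp t - 1 + \<zeta>) * (\<rho> n * PL k (A n)))"
        using mult_right_mono[OF up \<beta>0] by (simp only: exp_le_cancel_iff)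
      show ?case
        unfolding T_def using bb(1) order_trans[OF lo' bb(2)] order_trans[OF bb(3) up'] by blast
    qed
  qed
  show "\<forall>\<^sub>F n in sequentially. integrable M (\<lambda>\<omega>. exp (t * T n \<omega>))"
    by (rule eventually_mono[OF main[OF zero_less_one]]) blast
  show "(\<lambda>n. ln (\<integral>\<omega>. exp (t * T n \<omega>) \<partial>M) / b n) \<longlonglongrightarrow> alpha k s * (exp t - 1)"
  proof (rule log_limit[OF b_at_top il(4)])
    show "0 < alpha k s" by (simp add: alpha_def)
  next
    fix \<zeta> :: real assume "0 < \<zeta>"
    show "\<forall>\<^sub>F n in sequentially. exp ((exp t - 1 - \<zeta>) * (\<rho> n * PL k (A n))) \<le> (\<integral>\<omega>. exp (t * T n \<omega>) \<partial>M) \<and>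
      (\<integral>\<omega>. exp (t * T n \<omega>) \<partial>M) \<le> exp ((exp t - 1 + \<zeta>) * (\<rho> n * PL k (A n)))"
      by (rule eventually_mono[OF main[OF \<open>0 < \<zeta>\<close>]]) blast
  qed
qed

end

theorem corollary2p3:
  fixes M :: "'w measure"
    and P :: "nat \<Rightarrow> 'w \<Rightarrow> (real ^ 'd) multiset"
    and X :: "nat \<Rightarrow> 'w \<Rightarrow> real ^ 'd"
    and k :: nat
    and s\<^sub>0 :: real
    and a b :: "nat \<Rightarrow> real"
  assumes "prob_space M"
    and "\<And>n. n \<ge> 1 \<Longrightarrow> poisson_process M (real n) (P n)"
    and "iid_uniform M X"
    and "k \<ge> 1"
    and "filterlim a at_top sequentially"
    and "filterlim (\<lambda>n. a n - ln (real n) - (real k - 1) * ln (ln (real n))) at_bot sequentially"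
    and "\<And>n. b n = real n * a n ^ (k - 1) * exp (- a n)"
  shows
    "satisfies_LDP M
       (\<lambda>n \<omega>. T_stat k (crit_radius TYPE('d) a s\<^sub>0 n) (P n \<omega>) / b n) b (rate_fun k s\<^sub>0) \<and>
     satisfies_LDP M
       (\<lambda>n \<omega>. T_stat k (crit_radius TYPE('d) a s\<^sub>0 n) (binomial_process X n \<omega>) / b n) b (rate_fun k s\<^sub>0)"
proof
  interpret prob_space M by fact
  interpret critical_scaling k s\<^sub>0 a b by unfold_locales (use assms in auto)
  have \<alpha>: "0 < alpha k s\<^sub>0" by (simp add: alpha_def)
  have X: "X i \<in> borel_measurable M" if "1 \<le> i" for i
    using \<open>iid_uniform M X\<close> that unfolding iid_uniform_def indep_vars_def by auto
  interpret pois: mgf_limit M "\<lambda>n \<omega>. T_stat k (crit_radius TYPE('d) a s\<^sub>0 n) (P n \<omega>)" b "alpha k s\<^sub>0"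
  proof
    show "\<And>n. 1 \<le> n \<Longrightarrow> (\<lambda>\<omega>. T_stat k (crit_radius TYPE('d) a s\<^sub>0 n) (P n \<omega>)) \<in> borel_measurable M"
      by (rule T_stat_poisson_measurable[OF assms(2)])
  qed (rule T_stat_nonneg b_at_top \<alpha> poisson_log_mgf[OF assms(1,2)], assumption?)+
  interpret bin: mgf_limit M "\<lambda>n \<omega>. T_stat k (crit_radius TYPE('d) a s\<^sub>0 n) (binomial_process X n \<omega>)" b "alpha k s\<^sub>0"
  proof
    show "\<And>n. 1 \<le> n \<Longrightarrow> (\<lambda>\<omega>. T_stat k (crit_radius TYPE('d) a s\<^sub>0 n) (binomial_process X n \<omega>)) \<in> borel_measurable M"
      by (rule T_stat_binomial_measurable[OF X])
  qed (rule T_stat_nonneg b_at_top \<alpha> binomial_log_mgf[OF assms(1,3)])+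
  have J: "mgf_limit.J (alpha k s\<^sub>0) = rate_fun k s\<^sub>0"
    by (rule ext) (simp add: pois.J_def rate_fun_def rate_def)
  show "satisfies_LDP M (\<lambda>n \<omega>. T_stat k (crit_radius TYPE('d) a s\<^sub>0 n) (P n \<omega>) / b n) b (rate_fun k s\<^sub>0)"
    using pois.satisfies_LDP_J unfolding J .
  show "satisfies_LDP M (\<lambda>n \<omega>. T_stat k (crit_radius TYPE('d) a s\<^sub>0 n) (binomial_process X n \<omega>) / b n) b (rate_fun k s\<^sub>0)"
    using bin.satisfies_LDP_J unfolding J .
qed

end
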